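(* Let $\Phi$ be a root system of type $\mathsf{E}_\ell$, $\ell=6,7,8$, and let $R$ be an arbitrary commutative ring with $1$. Then $\mathrm{K}_2(\Phi,R)$ is contained in the center of the Steinberg group $\mathrm{St}(\Phi,R)$.
   Context: All rings are commutative with $1$; $[x,y]=xyx^{-1}y^{-1}$. For simply laced $\Phi$ of rank $\ge 2$, fix a Chevalley base $\{e_\alpha\}$ of the simple complex Lie algebra of type $\Phi$ and let $N_{\alpha,\beta}=\pm1$ be its structure constants, $[e_\alpha,e_\beta]=N_{\alpha,\beta}e_{\alpha+\beta}$ for $\alpha,\beta,\alpha+\beta\in\Phi$. The Steinberg group $\mathrm{St}(\Phi,R)$ is the group with generators $x_\alpha(\xi)$ ($\alpha\in\Phi$, $\xi\in R$) and relations $x_\alpha(\xi)x_\alpha(\eta)=x_\alpha(\xi+\eta)$; $[x_\alpha(\xi),x_\beta(\eta)]=1$ if $\alpha+\beta\notin\Phi\cup\{0\}$; $[x_\alpha(\xi),x_\beta(\eta)]=x_{\alpha+\beta}(N_{\alpha,\beta}\xi\eta)$ if $\alpha+\beta\in\Phi$. $\mathrm{G}(\Phi,R)$ is the simply connected Chevalley group of type $\Phi$ over $R$, with elementary root unipotents $t_\alpha(\xi)$ (corresponding to the same Chevalley base). $\phi\colon\mathrm{St}(\Phi,R)\to\mathrm{G}(\Phi,R)$ is the homomorphism $x_\alpha(\xi)\mapsto t_\alpha(\xi)$, and $\mathrm{K}_2(\Phi,R)=\operatorname{Ker}(\phi)$. *)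

theory Defs
  imports
    "HOL-Analysis.Analysis"
    "HOL-Algebra.Generated_Groups"
    "HOL-Algebra.Ring"
    "HOL-Library.Poly_Mapping"
    "HOL-Computational_Algebra.Group_Closure"
begin

text \<open>\<open>pairing \<beta> \<alpha>\<close> is $\langle\beta,\alpha^\vee\rangle$: the second argument is the one turned
  into a coroot.\<close>

definition pairing :: "'a::real_inner \<Rightarrow> 'a \<Rightarrow> real" where
  "pairing \<beta> \<alpha> = 2 * (\<beta> \<bullet> \<alpha>) / (\<alpha> \<bullet> \<alpha>)"

definition root_system :: "'a::euclidean_space set \<Rightarrow> bool" where
  "root_system \<Phi> \<longleftrightarrow>
     finite \<Phi> \<and> span \<Phi> = UNIV \<and> 0 \<notin> \<Phi> \<and>
     (\<forall>\<alpha>\<in>\<Phi>. \<forall>c. c *\<^sub>R \<alpha> \<in> \<Phi> \<longrightarrow> c = 1 \<or> c = -1) \<and>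
     (\<forall>\<alpha>\<in>\<Phi>. \<forall>\<beta>\<in>\<Phi>. \<beta> - pairing \<beta> \<alpha> *\<^sub>R \<alpha> \<in> \<Phi> \<and> pairing \<beta> \<alpha> \<in> \<int>)"

definition root_base :: "'a::euclidean_space set \<Rightarrow> 'a set \<Rightarrow> bool" where
  "root_base \<Phi> \<Delta> \<longleftrightarrow>
     \<Delta> \<subseteq> \<Phi> \<and> independent \<Delta> \<and>
     (\<forall>\<beta>\<in>\<Phi>. \<exists>c :: 'a \<Rightarrow> int.
        \<beta> = (\<Sum>\<delta>\<in>\<Delta>. of_int (c \<delta>) *\<^sub>R \<delta>) \<and>
        ((\<forall>\<delta>\<in>\<Delta>. c \<delta> \<ge> 0) \<or> (\<forall>\<delta>\<in>\<Delta>. c \<delta> \<le> 0)))"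

text \<open>Cartan matrix of $E_8$ in Bourbaki's labelling; those of $E_6$ and $E_7$ are its leading
  principal submatrices.\<close>

definition cartan_matrix_E :: "nat \<Rightarrow> nat \<Rightarrow> int" where
  "cartan_matrix_E i j =
     (if i = j then 2
      else if {i, j} \<in> {{1,3}, {3,4}, {4,5}, {5,6}, {6,7}, {7,8}, {2,4}} then -1
      else 0)"

definition root_system_type_E :: "nat \<Rightarrow> 'a::euclidean_space set \<Rightarrow> bool" where
  "root_system_type_E l \<Phi> \<longleftrightarrow>
     root_system \<Phi> \<and>
     (\<exists>\<Delta> s. root_base \<Phi> \<Delta> \<and> bij_betw s {1..l} \<Delta> \<and>
        (\<forall>i\<in>{1..l}. \<forall>j\<in>{1..l}. pairing (s i) (s j) = of_int (cartan_matrix_E i j)))"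

definition weight_lattice :: "'a::euclidean_space set \<Rightarrow> 'a set" where
  "weight_lattice \<Phi> = {\<mu>. \<forall>\<alpha>\<in>\<Phi>. pairing \<mu> \<alpha> \<in> \<int>}"

locale complex_lie_algebra = vector_space smul
  for smul :: "complex \<Rightarrow> 'g::ab_group_add \<Rightarrow> 'g" +
  fixes br :: "'g \<Rightarrow> 'g \<Rightarrow> 'g"
  assumes br_linear_left: "Vector_Spaces.linear smul smul (\<lambda>x. br x y)"
    and br_linear_right: "Vector_Spaces.linear smul smul (br x)"
    and br_self: "br x x = 0"
    and jacobi: "br x (br y z) + br y (br z x) + br z (br x y) = 0"

locale simple_complex_lie_algebra = complex_lie_algebra +
  assumes nonabelian: "\<exists>x y. br x y \<noteq> 0"
    and ideal_trivial: "\<lbrakk>subspace I; \<And>x y. y \<in> I \<Longrightarrow> br x y \<in> I\<rbrakk> \<Longrightarrow> I = {0} \<or> I = UNIV"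

definition coroot_vector :: "('g \<Rightarrow> 'g \<Rightarrow> 'g) \<Rightarrow> ('a::uminus \<Rightarrow> 'g) \<Rightarrow> 'a \<Rightarrow> 'g" where
  "coroot_vector br e \<alpha> = br (e \<alpha>) (e (- \<alpha>))"

text \<open>The axioms \<open>cartan_abelian\<close> and \<open>root_vector\<close>, together with the basis property, say that the
  coroot vectors span a Cartan subalgebra with root system \<open>\<Phi>\<close> and that \<open>e \<alpha>\<close> spans the root space
  of \<open>\<alpha>\<close>.\<close>

locale chevalley_base = simple_complex_lie_algebra smul br
  for smul :: "complex \<Rightarrow> 'g::ab_group_add \<Rightarrow> 'g" and br :: "'g \<Rightarrow> 'g \<Rightarrow> 'g" +
  fixes \<Phi> :: "'a::euclidean_space set" and \<Delta> :: "'a set" and e :: "'a \<Rightarrow> 'g"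
  assumes roots: "root_system \<Phi>"
    and base: "root_base \<Phi> \<Delta>"
    and basis_inj: "inj_on e \<Phi>" "inj_on (coroot_vector br e) \<Delta>"
      "e ` \<Phi> \<inter> coroot_vector br e ` \<Delta> = {}"
    and basis_independent: "independent (e ` \<Phi> \<union> coroot_vector br e ` \<Delta>)"
    and basis_span: "span (e ` \<Phi> \<union> coroot_vector br e ` \<Delta>) = UNIV"
    and cartan_abelian:
      "\<lbrakk>\<alpha> \<in> \<Phi>; \<beta> \<in> \<Phi>\<rbrakk> \<Longrightarrow> br (coroot_vector br e \<alpha>) (coroot_vector br e \<beta>) = 0"
    and root_vector:
      "\<lbrakk>\<alpha> \<in> \<Phi>; \<beta> \<in> \<Phi>\<rbrakk> \<Longrightarrow>
         br (coroot_vector br e \<alpha>) (e \<beta>) = smul (of_real (pairing \<beta> \<alpha>)) (e \<beta>)"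
    and br_nonroot:
      "\<lbrakk>\<alpha> \<in> \<Phi>; \<beta> \<in> \<Phi>; \<alpha> + \<beta> \<notin> \<Phi>; \<alpha> + \<beta> \<noteq> 0\<rbrakk> \<Longrightarrow> br (e \<alpha>) (e \<beta>) = 0"
    and br_root:
      "\<lbrakk>\<alpha> \<in> \<Phi>; \<beta> \<in> \<Phi>; \<alpha> + \<beta> \<in> \<Phi>\<rbrakk> \<Longrightarrow>
         \<exists>c. br (e \<alpha>) (e \<beta>) = smul c (e (\<alpha> + \<beta>)) \<and>
             br (e (- \<alpha>)) (e (- \<beta>)) = smul (- c) (e (- (\<alpha> + \<beta>)))"

text \<open>By Chevalley's theorem the constant \<open>c\<close> in \<open>br_root\<close> is an integer, equal to $\pm 1$ in the
  simply laced case; the value is junk unless \<open>\<alpha>\<close>, \<open>\<beta>\<close>, \<open>\<alpha> + \<beta>\<close> are roots.\<close>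

definition structure_constant ::
  "(complex \<Rightarrow> 'g \<Rightarrow> 'g) \<Rightarrow> ('g \<Rightarrow> 'g \<Rightarrow> 'g) \<Rightarrow> ('a::plus \<Rightarrow> 'g) \<Rightarrow> 'a \<Rightarrow> 'a \<Rightarrow> int" where
  "structure_constant smul br e \<alpha> \<beta> = (THE n. br (e \<alpha>) (e \<beta>) = smul (of_int n) (e (\<alpha> + \<beta>)))"

text \<open>\<open>(True, x)\<close> stands for the generator \<open>x\<close> and \<open>(False, x)\<close> for its formal inverse.\<close>

type_synonym 'x group_word = "(bool \<times> 'x) list"

inductive_set word_equiv :: "'x set \<Rightarrow> 'x group_word set \<Rightarrow> ('x group_word \<times> 'x group_word) set"
  for S :: "'x set" and Rel :: "'x group_word set" where
  refl: "w \<in> lists (UNIV \<times> S) \<Longrightarrow> (w, w) \<in> word_equiv S Rel"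
| sym: "(v, w) \<in> word_equiv S Rel \<Longrightarrow> (w, v) \<in> word_equiv S Rel"
| trans: "(u, v) \<in> word_equiv S Rel \<Longrightarrow> (v, w) \<in> word_equiv S Rel \<Longrightarrow> (u, w) \<in> word_equiv S Rel"
| append: "(u, u') \<in> word_equiv S Rel \<Longrightarrow> (v, v') \<in> word_equiv S Rel \<Longrightarrow>
    (u @ v, u' @ v') \<in> word_equiv S Rel"
| cancel: "x \<in> S \<Longrightarrow> ([(b, x), (\<not> b, x)], []) \<in> word_equiv S Rel"
| relator: "r \<in> Rel \<Longrightarrow> (r, []) \<in> word_equiv S Rel"

definition presented_group :: "'x set \<Rightarrow> 'x group_word set \<Rightarrow> 'x group_word set monoid" where
  "presented_group S Rel =
     \<lparr>carrier = lists (UNIV \<times> S) // word_equiv S Rel,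
      mult = (\<lambda>A B. \<Union>u\<in>A. \<Union>v\<in>B. word_equiv S Rel `` {u @ v}),
      one = word_equiv S Rel `` {[]}\<rparr>"

primrec eval_word :: "('h, 'm) monoid_scheme \<Rightarrow> ('x \<Rightarrow> 'h) \<Rightarrow> 'x group_word \<Rightarrow> 'h" where
  "eval_word H f [] = \<one>\<^bsub>H\<^esub>"
| "eval_word H f (p # w) =
     (if fst p then f (snd p) else inv\<^bsub>H\<^esub> f (snd p)) \<otimes>\<^bsub>H\<^esub> eval_word H f w"

text \<open>The homomorphism out of a presented group induced by a map of the generators. As a group
  element is a set of equivalent words, \<open>the_elem\<close> picks their common value in \<open>H\<close>.\<close>

definition induced_hom :: "('h, 'm) monoid_scheme \<Rightarrow> ('x \<Rightarrow> 'h) \<Rightarrow> 'x group_word set \<Rightarrow> 'h" where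
  "induced_hom H f A = the_elem (eval_word H f ` A)"

definition center :: "('h, 'm) monoid_scheme \<Rightarrow> 'h set" where
  "center H = {z \<in> carrier H. \<forall>x\<in>carrier H. z \<otimes>\<^bsub>H\<^esub> x = x \<otimes>\<^bsub>H\<^esub> z}"

definition commutator_word :: "'x \<Rightarrow> 'x \<Rightarrow> 'x group_word" where
  "commutator_word x y = [(True, x), (True, y), (False, x), (False, y)]"

definition steinberg_relators ::
  "'a::ab_group_add set \<Rightarrow> ('a \<Rightarrow> 'a \<Rightarrow> int) \<Rightarrow> ('r, 'm) ring_scheme \<Rightarrow> ('a \<times> 'r) group_word set" where
  "steinberg_relators \<Phi> N R =
     {[(True, (\<alpha>, \<xi>)), (True, (\<alpha>, \<eta>)), (False, (\<alpha>, \<xi> \<oplus>\<^bsub>R\<^esub> \<eta>))] | \<alpha> \<xi> \<eta>.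
        \<alpha> \<in> \<Phi> \<and> \<xi> \<in> carrier R \<and> \<eta> \<in> carrier R} \<union>
     {commutator_word (\<alpha>, \<xi>) (\<beta>, \<eta>) | \<alpha> \<beta> \<xi> \<eta>.
        \<alpha> \<in> \<Phi> \<and> \<beta> \<in> \<Phi> \<and> \<alpha> + \<beta> \<notin> \<Phi> \<union> {0} \<and> \<xi> \<in> carrier R \<and> \<eta> \<in> carrier R} \<union>
     {commutator_word (\<alpha>, \<xi>) (\<beta>, \<eta>) @ [(False, (\<alpha> + \<beta>, [N \<alpha> \<beta>] \<cdot>\<^bsub>R\<^esub> (\<xi> \<otimes>\<^bsub>R\<^esub> \<eta>)))] | \<alpha> \<beta> \<xi> \<eta>.
        \<alpha> \<in> \<Phi> \<and> \<beta> \<in> \<Phi> \<and> \<alpha> + \<beta> \<in> \<Phi> \<and> \<xi> \<in> carrier R \<and> \<eta> \<in> carrier R}"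

definition steinberg_group ::
  "'a::ab_group_add set \<Rightarrow> ('a \<Rightarrow> 'a \<Rightarrow> int) \<Rightarrow> ('r, 'm) ring_scheme \<Rightarrow> ('a \<times> 'r) group_word set monoid"
  where
  "steinberg_group \<Phi> N R = presented_group (\<Phi> \<times> carrier R) (steinberg_relators \<Phi> N R)"

text \<open>A finite-dimensional representation \<open>\<pi>\<close> of the Lie algebra on $\mathbb{C}^n$ for which
  $\mathbb{Z}^n$ is an admissible lattice (stable under all divided powers $\pi(e_\alpha)^k/k!$) and
  whose weights generate the whole weight lattice. The latter condition is what makes the
  associated Chevalley group scheme simply connected. A weight is the vector \<open>\<mu>\<close> of the ambient
  Euclidean space through which the coroot vectors act.\<close>

definition weights ::
  "('g \<Rightarrow> 'g \<Rightarrow> 'g) \<Rightarrow> 'a::euclidean_space set \<Rightarrow> ('a \<Rightarrow> 'g) \<Rightarrow>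
     ('g \<Rightarrow> complex ^ 'n \<Rightarrow> complex ^ 'n) \<Rightarrow> 'a set" where
  "weights br \<Phi> e \<pi> =
     {\<mu>. \<exists>v. v \<noteq> 0 \<and> (\<forall>\<alpha>\<in>\<Phi>. \<pi> (coroot_vector br e \<alpha>) v = of_real (pairing \<mu> \<alpha>) *s v)}"

definition divided_power_entry ::
  "('a \<Rightarrow> 'g) \<Rightarrow> ('g \<Rightarrow> complex ^ 'n \<Rightarrow> complex ^ 'n) \<Rightarrow> 'a \<Rightarrow> nat \<Rightarrow> 'n \<Rightarrow> 'n \<Rightarrow> complex" where
  "divided_power_entry e \<pi> \<alpha> k i j = (\<pi> (e \<alpha>) ^^ k) (axis j 1) $ i / fact k"

locale simply_connected_representation = chevalley_base smul br \<Phi> \<Delta> e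
  for smul :: "complex \<Rightarrow> 'g::ab_group_add \<Rightarrow> 'g" and br :: "'g \<Rightarrow> 'g \<Rightarrow> 'g"
    and \<Phi> :: "'a::euclidean_space set" and \<Delta> :: "'a set" and e :: "'a \<Rightarrow> 'g" +
  fixes \<pi> :: "'g \<Rightarrow> complex ^ 'n \<Rightarrow> complex ^ 'n"
  assumes rep_linear: "Vector_Spaces.linear (*s) (*s) (\<pi> x)"
    and rep_linear_left: "Vector_Spaces.linear smul (*s) (\<lambda>x. \<pi> x v)"
    and rep_br: "\<pi> (br x y) v = \<pi> x (\<pi> y v) - \<pi> y (\<pi> x v)"
    and admissible: "\<alpha> \<in> \<Phi> \<Longrightarrow> divided_power_entry e \<pi> \<alpha> k i j \<in> \<int>"
    and weights_generate: "group_closure (weights br \<Phi> e \<pi>) = weight_lattice \<Phi>"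

definition matrix_monoid :: "('r, 'm) ring_scheme \<Rightarrow> ('r ^ 'n ^ 'n) monoid" where
  "matrix_monoid R =
     \<lparr>carrier = {a. \<forall>i j. a $ i $ j \<in> carrier R},
      mult = (\<lambda>a b. \<chi> i j. \<Oplus>\<^bsub>R\<^esub>k\<in>UNIV. a $ i $ k \<otimes>\<^bsub>R\<^esub> b $ k $ j),
      one = (\<chi> i j. if i = j then \<one>\<^bsub>R\<^esub> else \<zero>\<^bsub>R\<^esub>)\<rparr>"

definition GL :: "('r, 'm) ring_scheme \<Rightarrow> ('r ^ 'n ^ 'n) monoid" where
  "GL R = units_of (matrix_monoid R)"

text \<open>$t_\alpha(\xi)=\sum_k \xi^k\,\pi(e_\alpha)^k/k!$, acting on $R^n=\mathbb{Z}^n\otimes R$. The sum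
  stops before $n$ because $\pi(e_\alpha)$ is a nilpotent operator on $\mathbb{C}^n$; the floor
  converts entries that are integers by admissibility.\<close>

definition root_unipotent ::
  "('a \<Rightarrow> 'g) \<Rightarrow> ('g \<Rightarrow> complex ^ 'n \<Rightarrow> complex ^ 'n) \<Rightarrow> ('r, 'm) ring_scheme \<Rightarrow>
     'a \<Rightarrow> 'r \<Rightarrow> 'r ^ 'n ^ 'n" where
  "root_unipotent e \<pi> R \<alpha> \<xi> =
     (\<chi> i j. \<Oplus>\<^bsub>R\<^esub>k\<in>{..<CARD('n)}.
        [\<lfloor>Re (divided_power_entry e \<pi> \<alpha> k i j)\<rfloor>] \<cdot>\<^bsub>R\<^esub> (\<xi> [^]\<^bsub>R\<^esub> k))"

definition complex_ring :: "complex ring" where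
  "complex_ring = \<lparr>carrier = UNIV, mult = (*), one = 1, zero = 0, add = (+)\<rparr>"

text \<open>Evaluation at a matrix over \<open>R\<close> of a polynomial with integer coefficients in the matrix
  entries: the variables are the pairs of indices, \<open>m\<close> runs over the monomials of \<open>p\<close>.\<close>

definition eval_poly ::
  "('r, 'm) ring_scheme \<Rightarrow> ((('n \<times> 'n) \<Rightarrow>\<^sub>0 nat) \<Rightarrow>\<^sub>0 int) \<Rightarrow> 'r ^ 'n ^ 'n \<Rightarrow> 'r" where
  "eval_poly R p a =
     (\<Oplus>\<^bsub>R\<^esub>m\<in>Poly_Mapping.keys p. [Poly_Mapping.lookup p m] \<cdot>\<^bsub>R\<^esub>
        (\<Otimes>\<^bsub>R\<^esub>x\<in>Poly_Mapping.keys m. (a $ fst x $ snd x) [^]\<^bsub>R\<^esub> Poly_Mapping.lookup m x))"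

text \<open>Chevalley's construction: the complex group is generated by the root unipotents, its
  coordinate ring $\mathbb{Z}[G]$ over the integers is the quotient of
  $\mathbb{Z}[x_{ij}]$ by the ideal of polynomials vanishing on the complex group, and
  $G(R)=\mathrm{Hom}(\mathbb{Z}[G],R)$ is the set of matrices over \<open>R\<close> satisfying these
  polynomial equations. (One of them is $\det = 1$.)\<close>

definition complex_chevalley_group ::
  "'a set \<Rightarrow> ('a \<Rightarrow> 'g) \<Rightarrow> ('g \<Rightarrow> complex ^ 'n \<Rightarrow> complex ^ 'n) \<Rightarrow> (complex ^ 'n ^ 'n) set" where
  "complex_chevalley_group \<Phi> e \<pi> =
     generate (GL complex_ring) {root_unipotent e \<pi> complex_ring \<alpha> \<xi> | \<alpha> \<xi>. \<alpha> \<in> \<Phi>}"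

definition chevalley_ideal ::
  "'a set \<Rightarrow> ('a \<Rightarrow> 'g) \<Rightarrow> ('g \<Rightarrow> complex ^ 'n \<Rightarrow> complex ^ 'n) \<Rightarrow>
     ((('n \<times> 'n) \<Rightarrow>\<^sub>0 nat) \<Rightarrow>\<^sub>0 int) set" where
  "chevalley_ideal \<Phi> e \<pi> =
     {p. \<forall>a\<in>complex_chevalley_group \<Phi> e \<pi>. eval_poly complex_ring p a = 0}"

definition chevalley_group ::
  "'a set \<Rightarrow> ('a \<Rightarrow> 'g) \<Rightarrow> ('g \<Rightarrow> complex ^ 'n \<Rightarrow> complex ^ 'n) \<Rightarrow> ('r, 'm) ring_scheme \<Rightarrow>
     ('r ^ 'n ^ 'n) monoid" where
  "chevalley_group \<Phi> e \<pi> R =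
     (GL R)\<lparr>carrier :=
       {a \<in> carrier (GL R). \<forall>p\<in>chevalley_ideal \<Phi> e \<pi>. eval_poly R p a = \<zero>\<^bsub>R\<^esub>}\<rparr>"

definition steinberg_map ::
  "'a set \<Rightarrow> ('a \<Rightarrow> 'g) \<Rightarrow> ('g \<Rightarrow> complex ^ 'n \<Rightarrow> complex ^ 'n) \<Rightarrow> ('r, 'm) ring_scheme \<Rightarrow>
     ('a \<times> 'r) group_word set \<Rightarrow> 'r ^ 'n ^ 'n" where
  "steinberg_map \<Phi> e \<pi> R =
     induced_hom (chevalley_group \<Phi> e \<pi> R) (\<lambda>(\<alpha>, \<xi>). root_unipotent e \<pi> R \<alpha> \<xi>)"

definition K2 ::
  "(complex \<Rightarrow> 'g \<Rightarrow> 'g) \<Rightarrow> ('g \<Rightarrow> 'g \<Rightarrow> 'g) \<Rightarrow> 'a::ab_group_add set \<Rightarrow> ('a \<Rightarrow> 'g) \<Rightarrow>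
     ('g \<Rightarrow> complex ^ 'n \<Rightarrow> complex ^ 'n) \<Rightarrow> ('r, 'm) ring_scheme \<Rightarrow> ('a \<times> 'r) group_word set set" where
  "K2 smul br \<Phi> e \<pi> R =
     kernel (steinberg_group \<Phi> (structure_constant smul br e) R) (chevalley_group \<Phi> e \<pi> R)
       (steinberg_map \<Phi> e \<pi> R)"

end

theory Submission
  imports Defs "HOL-Library.Function_Algebras" "HOL-Number_Theory.Cong" "HOL-Computational_Algebra.Fraction_Field"
begin

text \<open>
  Lift the letters of a word representing an element \<open>g\<close> of \<open>K\<^sub>2\<close> to a polynomial ring \<open>P\<close> over the
  integers, and let \<open>J\<close> be the kernel of \<open>P \<rightarrow> R\<close>; the matrix of the lifted word is congruent to \<open>1\<close> modulo
  \<open>J\<close>. The elements \<open>s\<close> of \<open>P\<close> such that \<open>g\<close> commutes with all \<open>x\<^sub>\<beta>(sp)\<close> form an ideal. If it is proper,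
  it lies in a maximal ideal; let \<open>S\<close> be the complement and \<open>A\<close> the localization of \<open>P\<close> at \<open>S\<close>.

  The pro-ring of the ideals generated by powers of elements of \<open>S\<close> is replaced by an honest nonunital
  ring \<open>I\<close>: functions \<open>f(s, k)\<close> whose values, for \<open>s\<close> highly divisible and \<open>k\<close> large, are divisible by
  $s^{2^{k-j}}$ for some fixed \<open>j\<close>. The ring \<open>A\<close> acts on \<open>I\<close>, and \<open>I\<close> is firm: finitely many elements
  have a common factor, compatibly with relations \<open>bc = b'c'\<close>. Hence \<open>x\<^sub>\<alpha>(r)\<close> with \<open>r\<close> in \<open>A\<close> acts on the
  Steinberg group of \<open>I\<close>: the image of \<open>x\<^sub>-\<^sub>\<alpha>(bc)\<close> is forced, being a commutator of two elements with
  known images, and for roots inside a system of type \<open>A\<^sub>3\<close> the Hall--Witt identity shows that it is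
  independent of the factorization \<open>bc\<close> and that the Steinberg relations hold.

  As \<open>A\<close> is local, a Gauss decomposition in the product of this action with the matrix group shows
  that a word whose matrix is congruent to \<open>1\<close> acts trivially on the Steinberg group of \<open>I\<close>. Evaluating
  at a single pair \<open>(s, k)\<close> gives that \<open>g\<close> commutes with all $x_\beta(s^{2^k}p)$ for some \<open>s\<close> in \<open>S\<close>, a
  contradiction.
\<close>

section \<open>Groups as types\<close>

text \<open>Denominators of \<open>A\<close> are absorbed only by high powers of s, and the
  pro-object that records this has no elements to compute with. Exponents of the form 2^(k-j) are
  halved when j grows by one: one half stays as a certificate of divisibility while the other
  cancels a denominator or serves as a factor. This yields both the action of \<open>A\<close> on
  \<open>I\<close> and the firmness of \<open>I\<close>. The ideal \<open>J\<close> is carried along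
  instead of passing to a quotient: over a subring of a field of characteristic 0 root elements are
  exponentials, and their identities can be checked with factorials inverted. Triviality modulo
  \<open>J\<close> is then read off the adjoint action on the matrices \<open>E \<alpha>\<close>.
  Reading off a coefficient without dividing by integers requires these matrices to be nonzero
  modulo every prime, and this is where simple connectedness enters. Groups are additive types, so
  that computing in them is type-class reasoning; a group given by a presentation enters as a group
  of permutations.\<close>

typedef 'w sym = "{f :: 'w => 'w. bij f}" morphisms ap Sym by (rule exI[of _ id]) simp

setup_lifting type_definition_sym

instantiation sym :: (type) group_add
begin
lift_definition zero_sym :: "'a sym" is id by simp
lift_definition plus_sym :: "'a sym => 'a sym => 'a sym" is "\<lambda>f g. f \<circ> g" by (rule bij_comp)
lift_definition uminus_sym :: "'a sym => 'a sym" is "inv_into UNIV" by (rule bij_imp_bij_inv)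
definition minus_sym :: "'a sym => 'a sym => 'a sym" where "minus_sym f g = f + - g"
instance
proof
  fix a b c :: "'a sym"
  show "a + b + c = a + (b + c)" by transfer (simp add: comp_assoc)
  show "0 + a = a" by transfer simp
  show "a + 0 = a" by transfer simp
  show "- a + a = 0" by transfer (simp add: bij_is_inj)
  show "a + - b = a - b" by (simp add: minus_sym_def)
qed
end

lemma ap_zero [simp]: "ap 0 x = x" by transfer simp
lemma ap_plus [simp]: "ap (f + g) x = ap f (ap g x)" by transfer simp
lemma sym_eqI: "(\<And>x. ap f x = ap g x) ==> f = g" by transfer auto
lemma ap_Sym: "bij f ==> ap (Sym f) = f" by (simp add: Sym_inverse)

text \<open>The inverse is stored along with the element, so that negation is a swap of the pair.
  Units are written additively because the local argument pairs them with permutations in one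
  product group.\<close>

typedef (overloaded) 'm inv_elt = "{(a :: 'm::ring_1, b). a * b = 1 \<and> b * a = 1}"
  by (rule exI[of _ "(1, 1)"]) simp

setup_lifting type_definition_inv_elt

lift_definition val :: "'m::ring_1 inv_elt => 'm" is fst .

instantiation inv_elt :: (ring_1) group_add
begin
lift_definition zero_inv_elt :: "'a inv_elt" is "(1, 1)" by simp
lift_definition plus_inv_elt :: "'a inv_elt => 'a inv_elt => 'a inv_elt"
  is "\<lambda>x y. (fst x * fst y, snd y * snd x)"
  by clarsimp (metis (no_types, lifting) mult.assoc mult_1_left)
lift_definition uminus_inv_elt :: "'a inv_elt => 'a inv_elt" is "\<lambda>x. (snd x, fst x)" by auto
definition minus_inv_elt :: "'a inv_elt => 'a inv_elt => 'a inv_elt" where "minus_inv_elt f g = f + - g"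
instance
proof
  fix a b c :: "'a inv_elt"
  show "a + b + c = a + (b + c)" by transfer (simp add: mult.assoc)
  show "0 + a = a" by transfer simp
  show "a + 0 = a" by transfer simp
  show "- a + a = 0" by transfer auto
  show "a + - b = a - b" by (simp add: minus_inv_elt_def)
qed
end

lemma val_zero [simp]: "val 0 = 1" by transfer simp
lemma val_plus [simp]: "val (f + g) = val f * val g" by transfer simp
lemma val_uminus_mult [simp]: "val (- f) * val f = 1" by transfer auto
lemma val_mult_uminus [simp]: "val f * val (- f) = 1" by transfer auto
lemma inv_elt_eqI:
  assumes "val f = val g" shows "f = g"
proof -
  have "val (- f) = val (- f) * (val g * val (- g))" by simp
  also have "... = (val (- f) * val f) * val (- g)" by (simp only: assms mult.assoc)
  finally have "val (- f) = val (- g)" by simp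
  moreover have "val (- h) = snd (Rep_inv_elt h)" for h :: "'a inv_elt" by (transfer) simp
  ultimately show ?thesis using assms by (metis Rep_inv_elt_inject prod.expand val.rep_eq)
qed

lemma ex_inv_elt: "a * b = 1 ==> b * a = 1 ==> \<exists>f. val f = a \<and> val (- f) = (b :: 'm::ring_1)"
  by (rule exI[of _ "Abs_inv_elt (a, b)"])
    (simp add: val.rep_eq uminus_inv_elt.rep_eq Abs_inv_elt_inverse)

section \<open>Generated subgroups and commutators\<close>

inductive_set subgrp :: "'g::group_add set => 'g set" for X where
  zero: "0 \<in> subgrp X"
| gen: "x \<in> X ==> x \<in> subgrp X"
| add: "x \<in> subgrp X ==> y \<in> subgrp X ==> x + y \<in> subgrp X"
| uminus: "x \<in> subgrp X ==> - x \<in> subgrp X"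

lemma subgrp_minus: "x \<in> subgrp X ==> y \<in> subgrp X ==> x - y \<in> subgrp X"
  by (metis diff_conv_add_uminus subgrp.add subgrp.uminus)

lemma subgrp_mono:
  assumes "\<And>x. x \<in> X ==> x \<in> subgrp Y" and "x \<in> subgrp X"
  shows "x \<in> subgrp Y" using assms(2) by (induction) (auto intro: subgrp.intros assms(1))

definition comm :: "'g::group_add => 'g => 'g" where
  "comm a b = a + b - a - b"

abbreviation commutes :: "'g::group_add => 'g => bool" where
  "commutes a b \<equiv> a + b = b + a"

lemma commutes_add_right: "commutes a b ==> commutes a c ==> commutes a (b + c)" by (metis add.assoc)

lemma commutes_add_left: "commutes a c ==> commutes b c ==> commutes (a + b) c" by (metis add.assoc)

lemma commutes_minus_right: "commutes a b ==> commutes a (- b)"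
  for a b :: "'g::group_add"
  by (metis add.assoc add.right_neutral add_minus_cancel minus_add_cancel right_minus)

lemma commutes_minus_left: "commutes a b ==> commutes (- a) b"
  for a b :: "'g::group_add" by (metis commutes_minus_right)

lemma commutes_diff_right: "commutes a b ==> commutes a c ==> commutes a (b - c)"
  for a b :: "'g::group_add" by (metis commutes_add_right commutes_minus_right diff_conv_add_uminus)

lemma commutes_comm: "commutes a b ==> commutes a c ==> commutes a (comm b c)"
  by (simp add: comm_def commutes_diff_right commutes_add_right)

lemma comm_flip: "comm b a = - comm a b"
  by (simp add: comm_def add.assoc diff_conv_add_uminus minus_add del: add_uminus_conv_diff)

lemma comm_iff: "comm a b = c \<longleftrightarrow> a + b = c + b + a"
  by (auto simp: comm_def diff_eq_eq eq_diff_eq add.assoc)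

lemma commI: "a + b = c + b + a ==> comm a b = c" by (simp add: comm_iff)

lemma comm_zero_iff: "comm a b = 0 \<longleftrightarrow> commutes a b" by (simp add: comm_iff)

text \<open>The Hall-Witt identity when \<open>X\<close> and \<open>Z\<close> commute: with
  \<open>U\<close> = [\<open>X\<close>, \<open>Y\<close>] and \<open>W\<close> =
  [\<open>Y\<close>, \<open>Z\<close>] its third factor disappears. It moves a bracket from the left
  argument to the right, which is how a scalar will travel between the two arguments of a
  commutator.\<close>

lemma hall_witt_hop:
  fixes X Y Z U W :: "'g::group_add"
  assumes XY: "X + Y = U + Y + X" and YZ: "Y + Z = W + Z + Y"
    and "commutes X Z" and YW: "commutes Y W" and UW: "commutes U W"
  shows "comm U Z = - comm X (- W)"
proof -
  have U: "U = X + Y - X - Y" using XY by (simp add: diff_eq_eq eq_diff_eq add.assoc)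
  have 1: "Y + X - Y = - U + X" using XY by (simp add: diff_eq_eq add.assoc)
  have 2: "Y + Z - Y = W + Z" using YZ by (simp add: diff_eq_eq add.assoc)
  have 3: "- Y + Z + Y = - W + Z"
  proof -
    have "Z + Y = - W + Y + Z" using YZ by (simp add: add.assoc)
    also have "... = Y + (- W + Z)" using commutes_minus_right[OF YW] by (simp add: add.assoc[symmetric])
    finally show ?thesis by (simp add: add.assoc)
  qed
  have "comm U Z = U + (Z - U - Z)" by (simp add: comm_def add.assoc diff_conv_add_uminus del: add_uminus_conv_diff)
  \<comment> \<open>The conjugate of \<open>Z\<close> by \<open>U\<close> is evaluated from the
    inside: \<open>Y\<close> turns \<open>Z\<close> into \<open>- W + Z\<close>, and
    \<open>X\<close> commutes with \<open>Z\<close>.\<close>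
  have "U + Z - U = X + (Y - X - Y + Z + Y + X) - Y - X"
    by (simp add: U add.assoc diff_conv_add_uminus minus_add del: add_uminus_conv_diff)
  also have "Y - X - Y + Z + Y + X = Y - X + (- Y + Z + Y) + X"
    by (simp add: add.assoc diff_conv_add_uminus del: add_uminus_conv_diff)
  also have "... = Y - X - W + (Z + X)"
    unfolding 3 by (simp add: add.assoc diff_conv_add_uminus del: add_uminus_conv_diff)
  also have "Z + X = X + Z" using assms by simp
  also have "X + (Y - X - W + (X + Z)) - Y - X
     = X + (Y - X - Y) + (Y - W - Y) + (Y + X - Y) + (Y + Z - Y) - X"
    by (simp add: add.assoc diff_conv_add_uminus del: add_uminus_conv_diff)
  also have "Y - W - Y = - W"
    using commutes_minus_right[OF YW] by (simp add: diff_conv_add_uminus add.assoc del: add_uminus_conv_diff)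
  also have "X + (Y - X - Y) = U"
    by (simp add: U add.assoc diff_conv_add_uminus del: add_uminus_conv_diff)
  also have "U + - W + (Y + X - Y) + (Y + Z - Y) - X = (U - W - U) + X + W + Z - X"
    unfolding 1 2 by (simp add: add.assoc diff_conv_add_uminus del: add_uminus_conv_diff)
  also have "U - W - U = - W"
    using commutes_minus_right[OF UW] by (simp add: diff_conv_add_uminus add.assoc del: add_uminus_conv_diff)
  finally have "comm U Z = - W + X + W + (Z - X - Z)"
    by (simp add: comm_def add.assoc diff_conv_add_uminus del: add_uminus_conv_diff)
  also have "Z - X - Z = - X" using commutes_minus_left[OF \<open>commutes X Z\<close>] by (simp add: diff_eq_eq)
  finally show ?thesis
    by (simp add: comm_def add.assoc diff_conv_add_uminus minus_add del: add_uminus_conv_diff)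
qed

section \<open>Simply laced root systems of rank at least three\<close>

text \<open>\<open>ip\<close> is normalized so that roots have square 2, hence it equals the pairing
  with the coroot. \<open>nonisolated\<close> puts every root into a subsystem of type A2. In
  \<open>A2_extends\<close> the roots \<gamma> - \<beta>, \<beta>, \<alpha> form a base of type A3,
  which is how rank at least three enters. The conditions on \<open>N\<close> are those of a
  Chevalley base; \<open>N_jacobi\<close> is the Jacobi identity along a chain of type A3.\<close>

locale simply_laced =
  fixes \<Phi> :: "'a::ab_group_add set" and ip :: "'a => 'a => real" and N :: "'a => 'a => int"
  assumes finite_roots: "finite \<Phi>"
    and ip_add_left: "ip (x + x') z = ip x z + ip x' z"
    and ip_sym: "ip x z = ip z x"
    and ip_vals: "\<alpha> \<in> \<Phi> ==> \<beta> \<in> \<Phi> ==> ip \<alpha> \<beta> \<in> {-2, -1, 0, 1, 2}"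
    and ip_self: "\<alpha> \<in> \<Phi> ==> ip \<alpha> \<alpha> = 2"
    and ip_2: "\<alpha> \<in> \<Phi> ==> \<beta> \<in> \<Phi> ==> ip \<alpha> \<beta> = 2 ==> \<alpha> = \<beta>"
    and uminus_root: "\<alpha> \<in> \<Phi> ==> - \<alpha> \<in> \<Phi>"
    and add_root: "\<alpha> \<in> \<Phi> ==> \<beta> \<in> \<Phi> ==> ip \<alpha> \<beta> = -1 ==> \<alpha> + \<beta> \<in> \<Phi>"
    and nonisolated: "\<alpha> \<in> \<Phi> ==> \<exists>\<beta>\<in>\<Phi>. ip \<beta> \<alpha> = -1"
    and A2_extends: "\<alpha> \<in> \<Phi> ==> \<gamma> \<in> \<Phi> ==> ip \<gamma> \<alpha> = -1 ==> \<exists>\<beta>\<in>\<Phi>. ip \<beta> \<alpha> = -1 \<and> ip \<beta> \<gamma> = 1"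
    and N_sq: "\<alpha> \<in> \<Phi> ==> \<beta> \<in> \<Phi> ==> ip \<alpha> \<beta> = -1 ==> N \<alpha> \<beta> * N \<alpha> \<beta> = 1"
    and N_anti: "\<alpha> \<in> \<Phi> ==> \<beta> \<in> \<Phi> ==> ip \<alpha> \<beta> = -1 ==> N \<beta> \<alpha> = - N \<alpha> \<beta>"
    and N_jacobi: "\<alpha> \<in> \<Phi> ==> \<beta> \<in> \<Phi> ==> \<gamma> \<in> \<Phi> ==> ip \<alpha> \<beta> = -1 ==> ip \<beta> \<gamma> = -1 ==> ip \<alpha> \<gamma> = 0 ==>
       N \<alpha> \<beta> * N (\<alpha> + \<beta>) \<gamma> = N \<beta> \<gamma> * N \<alpha> (\<beta> + \<gamma>)"
    and N_string: "\<alpha> \<in> \<Phi> ==> \<beta> \<in> \<Phi> ==> ip \<alpha> \<beta> = -1 ==> N (- \<alpha>) (\<alpha> + \<beta>) = N \<alpha> \<beta>"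
begin

lemma ip_add_right: "ip z (x + x') = ip z x + ip z x'" by (metis ip_add_left ip_sym)

lemma ip_minus_left: "ip (- x) z = - ip x z"
  using ip_add_left[of x "- x" z] ip_add_left[of 0 0 z] by simp

lemma ip_minus_right: "ip z (- x) = - ip z x" by (metis ip_minus_left ip_sym)

lemma ip_diff_left: "ip (x - x') z = ip x z - ip x' z"
  using ip_add_left[of x "- x'" z] by (simp add: ip_minus_left)

lemma ip_diff_right: "ip z (x - x') = ip z x - ip z x'" by (metis ip_diff_left ip_sym)

lemmas ip_lin = ip_add_left ip_add_right ip_minus_left ip_minus_right ip_diff_left ip_diff_right

lemma ip_neg2: "\<alpha> \<in> \<Phi> ==> \<beta> \<in> \<Phi> ==> ip \<alpha> \<beta> = -2 ==> \<beta> = - \<alpha>"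
  using ip_2[of \<alpha> "- \<beta>"] uminus_root[of \<beta>] by (auto simp: ip_lin)

lemma diff_root: "\<alpha> \<in> \<Phi> ==> \<beta> \<in> \<Phi> ==> ip \<alpha> \<beta> = 1 ==> \<alpha> - \<beta> \<in> \<Phi>"
  using add_root[of \<alpha> "- \<beta>"] uminus_root[of \<beta>] by (simp add: ip_lin)

end

text \<open>\<open>I\<close> is a nonunital ring acted on by \<open>A\<close>; the ring of interest
  is \<open>I\<close> modulo \<open>J\<close>, kept as a congruence. In \<open>firm\<close> the four
  elements receive a common factor d, and the congruence between the products, which contain d
  twice, stays valid after one division by d. This is an elementwise substitute for injectivity of
  the multiplication map on the tensor square over \<open>I\<close>.\<close>

locale firm_ideal =
  fixes A I J :: "'c::comm_ring_1 set"
  assumes A_1: "1 \<in> A" and A_add: "a \<in> A ==> b \<in> A ==> a + b \<in> A"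
    and A_mult: "a \<in> A ==> b \<in> A ==> a * b \<in> A" and A_uminus: "a \<in> A ==> - a \<in> A"
    and I_add: "i \<in> I ==> j \<in> I ==> i + j \<in> I"
    and I_mult: "i \<in> I ==> j \<in> I ==> i * j \<in> I" and AI: "a \<in> A ==> i \<in> I ==> a * i \<in> I"
    and J_I: "j \<in> J ==> j \<in> I"
    and J_add: "i \<in> J ==> j \<in> J ==> i + j \<in> J"
    and IJ: "i \<in> I ==> j \<in> J ==> i * j \<in> J" and AJ: "a \<in> A ==> j \<in> J ==> a * j \<in> J"
    and J_0: "0 \<in> J"
    and factor: "i \<in> I ==> j \<in> I ==> \<exists>d\<in>I. \<exists>i'\<in>I. \<exists>j'\<in>I. i = d * i' \<and> j = d * j'"
    and firm: "b \<in> I ==> c \<in> I ==> b' \<in> I ==> c' \<in> I ==> b * c - b' * c' \<in> J ==>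
      \<exists>d\<in>I. \<exists>b1\<in>I. \<exists>c1\<in>I. \<exists>b1'\<in>I. \<exists>c1'\<in>I. b = d * b1 \<and> c = d * c1 \<and> b' = d * b1' \<and> c' = d * c1' \<and>
        d * b1 * c1 - d * b1' * c1' \<in> J"
begin

lemma A_0: "0 \<in> A" using A_add[OF A_1 A_uminus[OF A_1]] by simp
lemma I_0: "0 \<in> I" using J_0 J_I by blast
lemma I_uminus: "i \<in> I ==> - i \<in> I" using AI[OF A_uminus[OF A_1]] by simp
lemma A_nat: "of_nat k \<in> A" by (induction k) (auto intro: A_0 A_add A_1)
lemma A_int: "of_int k \<in> A" by (cases k) (auto intro: A_nat A_uminus simp flip: of_nat_Suc)

lemmas closed = A_1 A_0 A_add A_mult A_uminus A_int I_0 I_add I_mult I_uminus AI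

end

section \<open>Conjugation by a root element over a firm ideal\<close>

definition cjg :: "'g::group_add => 'g => 'g" where
  "cjg g h = g + h - g"

context simply_laced
begin

text \<open>A predicate on families in an arbitrary group rather than a construction, so that
  candidate images can be tested against the relations. The set \<open>C\<close> of coefficients may
  be a ring without unit.\<close>

definition steinberg :: "'c::comm_ring_1 set => ('a => 'c => 'g::group_add) => bool" where
  "steinberg C x \<longleftrightarrow>
     (\<forall>\<alpha>\<in>\<Phi>. \<forall>a\<in>C. \<forall>b\<in>C. x \<alpha> (a + b) = x \<alpha> a + x \<alpha> b) \<and>
     (\<forall>\<alpha>\<in>\<Phi>. \<forall>\<beta>\<in>\<Phi>. \<forall>a\<in>C. \<forall>b\<in>C. ip \<alpha> \<beta> \<ge> 0 --> commutes (x \<alpha> a) (x \<beta> b)) \<and>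
     (\<forall>\<alpha>\<in>\<Phi>. \<forall>\<beta>\<in>\<Phi>. \<forall>a\<in>C. \<forall>b\<in>C. ip \<alpha> \<beta> = -1 -->
        x \<alpha> a + x \<beta> b = x (\<alpha> + \<beta>) (of_int (N \<alpha> \<beta>) * a * b) + x \<beta> b + x \<alpha> a)"

lemma of_int_N_sq:
  "\<alpha> \<in> \<Phi> ==> \<beta> \<in> \<Phi> ==> ip \<alpha> \<beta> = -1 ==> of_int (N \<alpha> \<beta>) * (of_int (N \<alpha> \<beta>) * c) = (c::'c::comm_ring_1)"
  using N_sq[of \<alpha> \<beta>] by (metis mult.assoc mult_1 of_int_1 of_int_mult)

lemma of_int_jacobi:
  assumes "\<alpha> \<in> \<Phi>" "\<beta> \<in> \<Phi>" "\<gamma> \<in> \<Phi>" "ip \<alpha> \<beta> = -1" "ip \<beta> \<gamma> = -1" "ip \<alpha> \<gamma> = 0"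
  shows "of_int (N \<alpha> \<beta>) * of_int (N (\<alpha> + \<beta>) \<gamma>) = (of_int (N \<beta> \<gamma>) * of_int (N \<alpha> (\<beta> + \<gamma>)) :: 'c::comm_ring_1)"
  using N_jacobi[OF assms] by (metis of_int_mult)

lemma of_int_anti:
  "\<alpha> \<in> \<Phi> ==> \<beta> \<in> \<Phi> ==> ip \<alpha> \<beta> = -1 ==> of_int (N \<beta> \<alpha>) = (- of_int (N \<alpha> \<beta>) :: 'c::comm_ring_1)"
  using N_anti[of \<alpha> \<beta>] by simp

end

text \<open>The two cross terms, [b1, a2] and [a1, b2], are inverse to each other and cancel when
  the products are reordered.\<close>

lemma commutes_quadruple:
  fixes a1 b1 a2 b2 s :: "'g::group_add"
  assumes "b1 + a2 = s + a2 + b1" "a1 + b2 = - s + b2 + a1" "commutes s a1" "commutes s a2"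
    "commutes a1 a2" "commutes b1 b2"
  shows "commutes (a1 + b1) (a2 + b2)"
proof -
  have "(a1 + b1) + (a2 + b2) = a1 + (b1 + a2) + b2" by (simp only: add.assoc)
  also have "... = (a1 + s) + a2 + (b1 + b2)" by (simp only: assms(1) add.assoc)
  also have "... = (s + a1) + a2 + (b2 + b1)" by (simp only: assms(3,6))
  also have "... = s + (a1 + a2) + b2 + b1" by (simp only: add.assoc)
  also have "... = (s + a2) + (a1 + b2) + b1" unfolding assms(5) by (simp only: add.assoc)
  also have "... = a2 + (s + - s) + b2 + a1 + b1" unfolding assms(2,4) by (simp only: add.assoc)
  finally show ?thesis by (simp add: add.assoc)
qed

lemma conj_uminus_swap:
  fixes g y z :: "'g::group_add"
  assumes "y + - z = g + - z + y" "commutes z g"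
  shows "z + y = g + y + z"
proof -
  have "y = y + - z + z" by (simp add: add.assoc)
  then have "y = g + (- z + y + z)" unfolding assms(1) by (simp only: add.assoc)
  then have "z + y = (z + g) + (- z + y + z)" by (simp only: add.assoc)
  then have "z + y = g + (z + (- z + (y + z)))" unfolding assms(2) by (simp only: add.assoc)
  then show ?thesis by (simp add: add.assoc)
qed

locale firm_steinberg = simply_laced \<Phi> ip N + firm_ideal A I J
  for \<Phi> :: "'a::ab_group_add set" and ip N and A I J :: "'c::comm_ring_1 set" +
  fixes y :: "'a => 'c => 'g::group_add"
  assumes y_steinberg: "steinberg I y"
    and y_J: "\<beta> \<in> \<Phi> ==> j \<in> J ==> y \<beta> j = 0"
begin

lemma y_add: "\<beta> \<in> \<Phi> ==> i \<in> I ==> j \<in> I ==> y \<beta> (i + j) = y \<beta> i + y \<beta> j"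
  using y_steinberg by (simp add: steinberg_def)

lemma y_commutes:
  "\<beta> \<in> \<Phi> ==> \<gamma> \<in> \<Phi> ==> ip \<beta> \<gamma> \<ge> 0 ==> i \<in> I ==> j \<in> I ==> commutes (y \<beta> i) (y \<gamma> j)"
  using y_steinberg unfolding steinberg_def by blast

lemma y_rel:
  "\<beta> \<in> \<Phi> ==> \<gamma> \<in> \<Phi> ==> ip \<beta> \<gamma> = -1 ==> i \<in> I ==> j \<in> I ==>
     y \<beta> i + y \<gamma> j = y (\<beta> + \<gamma>) (of_int (N \<beta> \<gamma>) * i * j) + y \<gamma> j + y \<beta> i"
  using y_steinberg unfolding steinberg_def by blast

lemma y_0 [simp]: "\<beta> \<in> \<Phi> ==> y \<beta> 0 = 0"
  using y_add[of \<beta> 0 0] I_0 by (metis add.right_neutral add_left_imp_eq)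

lemma y_uminus: "\<beta> \<in> \<Phi> ==> i \<in> I ==> y \<beta> (- i) = - y \<beta> i"
  using y_add[of \<beta> "- i" i] I_uminus[of i] by (simp add: eq_neg_iff_add_eq_0)

end

text \<open>The aim is a family \<open>yc\<close> that behaves like the conjugate of
  \<open>y\<close> by a root element of \<alpha> with coefficient r. No such element need exist in
  the group, since r lies in \<open>A\<close> and not necessarily in \<open>I\<close>.\<close>

locale firm_conj = firm_steinberg \<Phi> ip N A I J y
  for \<Phi> :: "'a::ab_group_add set" and ip N and A I J :: "'c::comm_ring_1 set"
    and y :: "'a => 'c => 'g::group_add" +
  fixes \<alpha> :: 'a and r :: 'c
  assumes \<alpha>: "\<alpha> \<in> \<Phi>" and r: "r \<in> A"
begin

text \<open>The value that the commutator relation forces at roots \<beta> with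
  \<open>ip \<alpha> \<beta> = -1\<close>.\<close>

definition Z :: "'a => 'c => 'g" where
  "Z \<beta> i = y (\<alpha> + \<beta>) (of_int (N \<alpha> \<beta>) * r * i) + y \<beta> i"

abbreviation low :: "'a => bool" where
  "low \<beta> \<equiv> \<beta> \<in> \<Phi> \<and> ip \<alpha> \<beta> = -1"

text \<open>\<beta> and \<open>op \<beta>\<close> are the two summands in a decomposition of
  -\<alpha>; the image of the root subgroup of -\<alpha> is accessible only through such
  pairs.\<close>

abbreviation op :: "'a => 'a" where
  "op \<beta> \<equiv> - \<alpha> - \<beta>"

lemma low_root: "low \<beta> ==> \<alpha> + \<beta> \<in> \<Phi>" by (simp add: \<alpha> add_root)

lemma low_op: "low \<beta> ==> low (op \<beta>)"
  using low_root[of \<beta>] uminus_root[of "\<alpha> + \<beta>"] by (auto simp: ip_lin ip_self \<alpha>)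

lemma op_op [simp]: "op (op \<beta>) = \<beta>" by simp

lemma ip_op: "low \<beta> ==> ip \<beta> (op \<beta>) = -1" by (simp add: ip_lin ip_self ip_sym[of \<beta> \<alpha>])

text \<open>A value -1 would make \<gamma> pair to 2 with the root -(\<alpha> + \<beta>), hence
  equal to it, which is \<open>op \<beta>\<close>.\<close>

lemma ip_low_cases:
  assumes "low \<beta>" "low \<gamma>" "\<gamma> \<noteq> op \<beta>"
  shows "ip \<beta> \<gamma> \<in> {0, 1, 2}"
proof -
  have "ip \<beta> \<gamma> \<noteq> -2"
  proof
    assume "ip \<beta> \<gamma> = -2"
    then have "\<gamma> = - \<beta>" using assms ip_neg2 by blast
    with assms show False by (simp add: ip_lin)
  qed
  moreover have "ip \<beta> \<gamma> \<noteq> -1"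
  proof
    assume *: "ip \<beta> \<gamma> = -1"
    then have "ip (- (\<alpha> + \<beta>)) \<gamma> = 2" using assms by (simp add: ip_lin)
    then have "\<gamma> = - (\<alpha> + \<beta>)" using ip_2[of "- (\<alpha> + \<beta>)" \<gamma>] low_root[OF assms(1)] assms(2) uminus_root by metis
    with assms(3) show False by simp
  qed
  ultimately show ?thesis using ip_vals[of \<beta> \<gamma>] assms by auto
qed

lemma Z_add:
  assumes "low \<beta>" "i \<in> I" "j \<in> I"
  shows "Z \<beta> (i + j) = Z \<beta> i + Z \<beta> j"
proof -
  have c: "commutes (y (\<alpha> + \<beta>) (of_int (N \<alpha> \<beta>) * r * j)) (y \<beta> i)"
    using assms low_root r by (intro y_commutes) (auto simp: ip_lin ip_self intro: closed)
  have "Z \<beta> (i + j) = y (\<alpha> + \<beta>) (of_int (N \<alpha> \<beta>) * r * i) + (y (\<alpha> + \<beta>) (of_int (N \<alpha> \<beta>) * r * j)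
    + y \<beta> i) + y \<beta> j" using assms low_root r by (simp add: Z_def distrib_left y_add closed add.assoc)
  then show ?thesis unfolding c by (simp add: Z_def add.assoc)
qed

lemma Z_0 [simp]: "low \<beta> ==> Z \<beta> 0 = 0"
  using Z_add[of \<beta> 0 0] I_0 by (metis add.right_neutral add_left_imp_eq)

lemma Z_uminus: "low \<beta> ==> i \<in> I ==> Z \<beta> (- i) = - Z \<beta> i"
  using Z_add[of \<beta> "- i" i] I_uminus[of i] by (simp add: eq_neg_iff_add_eq_0)

lemma Z_J:
  assumes "low \<beta>" "j \<in> J" shows "Z \<beta> j = 0"
proof -
  have "of_int (N \<alpha> \<beta>) * r * j \<in> J" using assms r by (auto intro!: AJ closed)
  then show ?thesis using assms low_root by (simp add: Z_def y_J)
qed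

lemma Z_cong: "low \<beta> ==> i \<in> I ==> j \<in> I ==> i - j \<in> J ==> Z \<beta> i = Z \<beta> j"
  using Z_add[of \<beta> "i - j" j] J_I[of "i - j"] Z_J[of \<beta> "i - j"] by simp

text \<open>If \<beta> and \<gamma> are orthogonal, \<alpha> + \<beta> + \<gamma> is a root and both
  cross commutators lie in its root subgroup; the Jacobi identity gives them opposite coefficients.
  If their product is positive there are no cross terms.\<close>

lemma Z_commutes:
  assumes "low \<beta>" "low \<gamma>" "\<gamma> \<noteq> op \<beta>" "i \<in> I" "j \<in> I"
  shows "commutes (Z \<beta> i) (Z \<gamma> j)"
proof -
  note [simp] = ip_lin ip_self \<alpha> ip_sym[of \<beta> \<alpha>] ip_sym[of \<gamma> \<alpha>] ip_sym[of \<gamma> \<beta>]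
  have mem: "of_int (N \<alpha> \<beta>) * r * i \<in> I" "of_int (N \<alpha> \<gamma>) * r * j \<in> I"
    using assms r by (auto intro: closed)
  have rts: "\<alpha> + \<beta> \<in> \<Phi>" "\<alpha> + \<gamma> \<in> \<Phi>" "\<beta> \<in> \<Phi>" "\<gamma> \<in> \<Phi>" using assms low_root by auto
  consider "ip \<beta> \<gamma> = 0" | "ip \<beta> \<gamma> \<ge> 1" using ip_low_cases[OF assms(1-3)] by auto
  then show ?thesis
  proof cases
    case 1
    define s where "s = of_int (N \<beta> (\<alpha> + \<gamma>)) * i * (of_int (N \<alpha> \<gamma>) * r * j)"
    have sI: "s \<in> I" using assms mem unfolding s_def by (auto intro: closed)
    have S: "\<alpha> + \<beta> + \<gamma> \<in> \<Phi>" using add_root[of "\<alpha> + \<beta>" \<gamma>] rts 1 assms by simp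
    have e1: "y \<beta> i + y (\<alpha> + \<gamma>) (of_int (N \<alpha> \<gamma>) * r * j)
        = y (\<alpha> + \<beta> + \<gamma>) s + y (\<alpha> + \<gamma>) (of_int (N \<alpha> \<gamma>) * r * j) + y \<beta> i"
      using y_rel[of \<beta> "\<alpha> + \<gamma>" i "of_int (N \<alpha> \<gamma>) * r * j"] rts mem assms 1 by (simp add: s_def add_ac)
    have "of_int (N \<beta> \<alpha>) * of_int (N (\<beta> + \<alpha>) \<gamma>) = (of_int (N \<alpha> \<gamma>) * of_int (N \<beta> (\<alpha> + \<gamma>)) :: 'c)"
      using assms 1 by (intro of_int_jacobi) auto
    moreover have "of_int (N \<beta> \<alpha>) = (- of_int (N \<alpha> \<beta>) :: 'c)" using assms by (intro of_int_anti) auto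
    ultimately have J: "of_int (N \<alpha> \<beta>) * of_int (N (\<alpha> + \<beta>) \<gamma>) = (- of_int (N \<alpha> \<gamma>) * of_int (N \<beta> (\<alpha> + \<gamma>)) :: 'c)"
      by (metis add.commute minus_equation_iff mult_minus_left)
    have "of_int (N (\<alpha> + \<beta>) \<gamma>) * (of_int (N \<alpha> \<beta>) * r * i) * j
       = (of_int (N \<alpha> \<beta>) * of_int (N (\<alpha> + \<beta>) \<gamma>)) * (r * i * j)" by (simp only: mult_ac)
    also have "... = - s" unfolding J by (simp add: s_def mult_ac)
    finally have e2: "y (\<alpha> + \<beta>) (of_int (N \<alpha> \<beta>) * r * i) + y \<gamma> j
        = - y (\<alpha> + \<beta> + \<gamma>) s + y \<gamma> j + y (\<alpha> + \<beta>) (of_int (N \<alpha> \<beta>) * r * i)"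
      using y_rel[of "\<alpha> + \<beta>" \<gamma> "of_int (N \<alpha> \<beta>) * r * i" j] rts mem assms 1 S sI by (simp add: y_uminus)
    show ?thesis unfolding Z_def
      by (rule commutes_quadruple[OF e1 e2]; rule y_commutes) (use rts S sI mem assms 1 in auto)
  next
    case 2
    show ?thesis unfolding Z_def
      by (intro commutes_add_left commutes_add_right y_commutes) (use rts mem assms 2 in auto)
  qed
qed

lemma y_Z_commutes:
  assumes "\<delta> \<in> \<Phi>" "ip \<delta> \<beta> \<ge> 0" "ip \<delta> (\<alpha> + \<beta>) \<ge> 0" "low \<beta>" "d \<in> I" "i \<in> I"
  shows "commutes (y \<delta> d) (Z \<beta> i)" unfolding Z_def using assms low_root r
  by (intro commutes_add_right y_commutes) (auto intro: closed)

text \<open>As \<delta> is orthogonal to \<alpha>, it can be added both to \<beta> and to \<alpha> +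
  \<beta>, and each factor of \<open>Z\<close> contributes one commutator. The Jacobi identity makes
  the two contributions fit into one \<open>Z\<close>.\<close>

lemma y_Z_rel:
  assumes "\<delta> \<in> \<Phi>" "ip \<alpha> \<delta> = 0" "ip \<delta> \<beta> = -1" "low \<beta>" "d \<in> I" "i \<in> I"
  shows "y \<delta> d + Z \<beta> i = Z (\<delta> + \<beta>) (of_int (N \<delta> \<beta>) * d * i) + Z \<beta> i + y \<delta> d"
proof -
  note [simp] = ip_lin ip_self \<alpha> ip_sym[of \<beta> \<alpha>] ip_sym[of \<delta> \<alpha>] ip_sym[of \<beta> \<delta>]
  have mem: "of_int (N \<alpha> \<beta>) * r * i \<in> I" "of_int (N \<delta> \<beta>) * d * i \<in> I"
     "of_int (N \<alpha> (\<delta> + \<beta>)) * r * (of_int (N \<delta> \<beta>) * d * i) \<in> I" using assms r by (auto intro: closed)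
  have rts: "\<alpha> + \<beta> \<in> \<Phi>" "\<beta> \<in> \<Phi>" "\<delta> \<in> \<Phi>" "\<delta> + \<beta> \<in> \<Phi>" using assms low_root add_root by auto
  have rts2: "\<alpha> + (\<delta> + \<beta>) \<in> \<Phi>" using add_root[of \<alpha> "\<delta> + \<beta>"] rts assms by simp
  have "of_int (N \<delta> \<beta>) * of_int (N (\<delta> + \<beta>) \<alpha>) = (of_int (N \<beta> \<alpha>) * of_int (N \<delta> (\<beta> + \<alpha>)) :: 'c)"
    using assms by (intro of_int_jacobi) auto
  moreover have "of_int (N \<beta> \<alpha>) = (- of_int (N \<alpha> \<beta>) :: 'c)" using assms by (intro of_int_anti) auto
  moreover have "of_int (N (\<delta> + \<beta>) \<alpha>) = (- of_int (N \<alpha> (\<delta> + \<beta>)) :: 'c)"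
    using assms rts by (intro of_int_anti) auto
  ultimately have J: "of_int (N \<delta> (\<alpha> + \<beta>)) * of_int (N \<alpha> \<beta>) = (of_int (N \<alpha> (\<delta> + \<beta>)) * of_int (N \<delta> \<beta>) :: 'c)"
    by (simp add: mult_ac add_ac)
  have eq: "of_int (N \<delta> (\<alpha> + \<beta>)) * d * (of_int (N \<alpha> \<beta>) * r * i) = of_int (N \<alpha> (\<delta> + \<beta>)) * r * (of_int (N \<delta> \<beta>) * d * i)"
    (is "?l = ?r")
  proof -
    have "?l = (of_int (N \<delta> (\<alpha> + \<beta>)) * of_int (N \<alpha> \<beta>)) * (d * r * i)" by (simp only: mult_ac)
    also have "... = ?r" unfolding J by (simp only: mult_ac)
    finally show ?thesis .
  qed
  let ?a = "y (\<alpha> + \<beta>) (of_int (N \<alpha> \<beta>) * r * i)"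
  let ?c = "y (\<delta> + \<beta>) (of_int (N \<delta> \<beta>) * d * i)"
  let ?s = "y (\<alpha> + (\<delta> + \<beta>)) (of_int (N \<alpha> (\<delta> + \<beta>)) * r * (of_int (N \<delta> \<beta>) * d * i))"
  have e1: "y \<delta> d + ?a = ?s + ?a + y \<delta> d"
    using y_rel[of \<delta> "\<alpha> + \<beta>" d "of_int (N \<alpha> \<beta>) * r * i"] rts mem assms unfolding eq by (simp add: add_ac)
  have e2: "y \<delta> d + y \<beta> i = ?c + y \<beta> i + y \<delta> d" using y_rel[of \<delta> \<beta> d i] rts mem assms by simp
  have e3: "commutes ?a ?c" by (intro y_commutes) (use rts rts2 mem assms in auto)
  have "y \<delta> d + Z \<beta> i = (y \<delta> d + ?a) + y \<beta> i" by (simp add: Z_def add.assoc)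
  also have "... = ?s + ?a + (y \<delta> d + y \<beta> i)" unfolding e1 by (simp only: add.assoc)
  also have "... = ?s + (?a + ?c) + y \<beta> i + y \<delta> d" unfolding e2 by (simp only: add.assoc)
  also have "... = (?s + ?c) + (?a + y \<beta> i) + y \<delta> d" unfolding e3 by (simp only: add.assoc)
  finally show ?thesis by (simp only: Z_def add.assoc)
qed

text \<open>The forced image of the element at -\<alpha> = \<beta> + \<open>op \<beta>\<close> with
  coefficient bc. The sign in the second argument cancels the structure constant of the
  commutator.\<close>

definition G :: "'a => 'c => 'c => 'g" where
  "G \<beta> b c = comm (Z \<beta> b) (Z (op \<beta>) (of_int (N \<beta> (op \<beta>)) * c))"

text \<open>The root \<delta> = \<gamma> - \<beta> is orthogonal to \<alpha>, and \<beta>, \<delta>,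
  \<open>op \<gamma>\<close> form a chain of type A3 with sum -\<alpha>. The Hall-Witt identity for
  elements at these three roots carries d from one argument to the other and replaces \<beta> by
  \<gamma>.\<close>

lemma G_hop:
  assumes "low \<beta>" "low \<gamma>" "ip \<beta> \<gamma> = 1" "b \<in> I" "c \<in> I" "d \<in> I"
  shows "G \<gamma> (b * d) c = - G \<beta> b (- (d * c))"
proof -
  note [simp] = ip_lin ip_self \<alpha> ip_sym[of \<beta> \<alpha>] ip_sym[of \<gamma> \<alpha>] ip_sym[of \<gamma> \<beta>]
  define \<delta> where "\<delta> = \<gamma> - \<beta>"
  have \<delta>: "\<delta> \<in> \<Phi>" "ip \<alpha> \<delta> = 0" "ip \<delta> \<beta> = -1" "ip \<beta> \<delta> = -1" "ip \<delta> (op \<gamma>) = -1"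
    unfolding \<delta>_def using assms diff_root[of \<gamma> \<beta>] by auto
  have sums: "\<delta> + \<beta> = \<gamma>" "\<beta> + \<delta> = \<gamma>" "\<delta> + op \<gamma> = op \<beta>" by (auto simp: \<delta>_def algebra_simps)
  have low': "low (op \<beta>)" "low (op \<gamma>)" using assms low_op by blast+
  let ?n = "\<lambda>x y. of_int (N x y) :: 'c"
  \<comment> \<open>The sign in u makes the commutator of \<open>Z \<beta> b\<close> with
    \<open>y \<delta> u\<close> come out as \<open>Z \<gamma> (b * d)\<close>; the sign in e is the
    one in \<open>G\<close>.\<close>
  define u where "u = ?n \<beta> \<delta> * d"
  define e where "e = ?n \<gamma> (op \<gamma>) * c"
  have I: "u \<in> I" "e \<in> I" "b * d \<in> I" using assms by (auto simp: u_def e_def intro: closed)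
  have "?n \<delta> \<beta> = - ?n \<beta> \<delta>" using of_int_anti[of \<beta> \<delta>] \<delta> assms by blast
  then have "y \<delta> u + Z \<beta> (- b) = Z \<gamma> (?n \<beta> \<delta> * (?n \<beta> \<delta> * (b * d))) + Z \<beta> (- b) + y \<delta> u"
    using y_Z_rel[of \<delta> \<beta> u "- b"] \<delta> assms I by (simp add: sums closed u_def mult_ac)
  also have "?n \<beta> \<delta> * (?n \<beta> \<delta> * (b * d)) = b * d" using \<delta> assms by (intro of_int_N_sq) auto
  finally have "y \<delta> u + - Z \<beta> b = Z \<gamma> (b * d) + - Z \<beta> b + y \<delta> u" using assms by (simp add: Z_uminus)
  moreover have "commutes (Z \<beta> b) (Z \<gamma> (b * d))" using assms I ip_op[of \<beta>] by (intro Z_commutes) auto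
  ultimately have XY: "Z \<beta> b + y \<delta> u = Z \<gamma> (b * d) + y \<delta> u + Z \<beta> b" by (rule conj_uminus_swap)
  have YZ: "y \<delta> u + Z (op \<gamma>) e = Z (op \<beta>) (?n \<delta> (op \<gamma>) * u * e) + Z (op \<gamma>) e + y \<delta> u"
    using y_Z_rel[of \<delta> "op \<gamma>" u e] \<delta> assms I low' sums(3) by simp
  have XZ: "commutes (Z \<beta> b) (Z (op \<gamma>) e)" using assms I low' by (intro Z_commutes) auto
  have wI: "?n \<delta> (op \<gamma>) * u * e \<in> I" using assms I by (auto intro: closed)
  have YW: "commutes (y \<delta> u) (Z (op \<beta>) (?n \<delta> (op \<gamma>) * u * e))"
    using assms \<delta> low' wI I by (intro y_Z_commutes) (auto simp: \<delta>_def)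
  have UW: "commutes (Z \<gamma> (b * d)) (Z (op \<beta>) (?n \<delta> (op \<gamma>) * u * e))"
    using assms I low' wI by (intro Z_commutes) auto
  have J: "?n \<beta> \<delta> * ?n \<gamma> (op \<gamma>) = ?n \<delta> (op \<gamma>) * ?n \<beta> (op \<beta>)"
    using of_int_jacobi[of \<beta> \<delta> "op \<gamma>"] \<delta> assms low' unfolding sums by simp
  have "?n \<delta> (op \<gamma>) * u * e = ?n \<delta> (op \<gamma>) * (?n \<beta> \<delta> * ?n \<gamma> (op \<gamma>)) * (d * c)"
    by (simp add: u_def e_def mult_ac)
  also have "... = ?n \<delta> (op \<gamma>) * (?n \<delta> (op \<gamma>) * (?n \<beta> (op \<beta>) * (d * c)))"
    unfolding J by (simp only: mult_ac)
  also have "... = ?n \<beta> (op \<beta>) * (d * c)" using \<delta> low' by (intro of_int_N_sq) auto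
  finally have w: "- (?n \<delta> (op \<gamma>) * u * e) = ?n \<beta> (op \<beta>) * - (d * c)" by simp
  have "G \<gamma> (b * d) c = - comm (Z \<beta> b) (- Z (op \<beta>) (?n \<delta> (op \<gamma>) * u * e))"
    unfolding G_def e_def[symmetric] by (rule hall_witt_hop[OF XY YZ XZ YW UW])
  also have "- Z (op \<beta>) (?n \<delta> (op \<gamma>) * u * e) = Z (op \<beta>) (- (?n \<delta> (op \<gamma>) * u * e))"
    using low' wI by (simp add: Z_uminus)
  also have "comm (Z \<beta> b) (Z (op \<beta>) (- (?n \<delta> (op \<gamma>) * u * e))) = G \<beta> b (- (d * c))"
    unfolding w by (simp add: G_def)
  finally show ?thesis .
qed

end

section \<open>Well-definedness of the image at the root opposite to \<alpha>\<close>

lemma comm_add_right: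
  fixes a b c :: "'g::group_add"
  assumes "commutes b (comm a c)"
  shows "comm a (b + c) = comm a b + comm a c"
proof -
  have "comm a (b + c) = comm a b + (b + comm a c + - b)"
    by (simp only: comm_def add.assoc diff_conv_add_uminus minus_add add_minus_cancel minus_add_cancel minus_minus)
  then show ?thesis unfolding assms by (simp add: add.assoc)
qed

text \<open>Conjugation by b takes y to dy and conjugation by a takes d to ed. Since all other pairs
  commute, conjugation by the commutator of a and b changes y by e alone.\<close>

lemma comm_conj_rel:
  fixes a b d e y :: "'g::group_add"
  assumes rel: "b + y = d + y + b" and ad: "a + d = e + d + a" and ay: "commutes a y"
    and db: "commutes d b" and dy: "commutes d y"
    and ea: "commutes e a" and eb: "commutes e b" and ey: "commutes e y" and ed: "commutes e d"
  shows "comm a b + y = e + y + comm a b"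
proof -
  have 1: "- b + y = - d + y + - b"
  proof -
    have "b + (- d + y + - b) = (b + - d) + y + - b" by (simp only: add.assoc)
    also have "b + - d = - d + b" by (rule commutes_minus_left[OF db, symmetric])
    also have "- d + b + y + - b = - d + (b + y) + - b" by (simp only: add.assoc)
    also have "... = y" unfolding rel by (simp add: add.assoc)
    finally show ?thesis by (metis minus_add_cancel)
  qed
  have 2: "- a + - d = - d + e + - a"
  proof -
    have "(- d + - e + a) + d = - d + - e + (e + d + a)" unfolding ad[symmetric] by (simp only: add.assoc)
    also have "... = a" by (simp only: add.assoc minus_add_cancel)
    finally have "- d + - e + a = a - d" by (simp only: eq_diff_eq)
    then have *: "a + - d = - d + - e + a" by simp
    have "a + (- d + e + - a) = (a + - d) + e + - a" by (simp only: add.assoc)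
    also have "... = - d + - e + (a + e) + - a" unfolding * by (simp only: add.assoc)
    also have "... = - d" unfolding ea[symmetric]
      by (simp only: add.assoc minus_add_cancel right_minus add.right_neutral)
    finally show ?thesis by (metis minus_add_cancel)
  qed
  have "comm a b + y = a + b + - a + (- b + y)" by (simp only: comm_def add.assoc diff_conv_add_uminus)
  also have "... = a + b + (- a + - d) + y + - b" unfolding 1 by (simp only: add.assoc)
  also have "... = a + b + - d + e + (- a + y) + - b" unfolding 2 by (simp only: add.assoc)
  also have "- a + y = y + - a" by (rule commutes_minus_left[OF ay])
  also have "a + b + - d + e + (y + - a) + - b = a + (b + (- d + (e + y))) + - a + - b"
    by (simp only: add.assoc)
  also have "b + (- d + (e + y)) = (- d + e) + (b + y)"
    using commutes_minus_left[OF db] eb by (metis add.assoc)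
  also have "... = (- d + (e + d)) + y + b" unfolding rel by (simp only: add.assoc)
  also have "... = e + y + b" unfolding ed by (simp add: add.assoc)
  also have "a + (e + y + b) = e + (a + y) + b" using ea by (metis add.assoc)
  also have "... = e + y + a + b" unfolding ay by (simp only: add.assoc)
  finally show ?thesis by (simp only: comm_def add.assoc diff_conv_add_uminus)
qed

context firm_conj
begin

lemma ex_low: "\<exists>\<beta>. low \<beta>" using nonisolated[OF \<alpha>] by (metis ip_sym)

lemma ex_adjacent: "low \<gamma> ==> \<exists>\<beta>. low \<beta> \<and> ip \<beta> \<gamma> = 1" using A2_extends[OF \<alpha>, of \<gamma>] by (metis ip_sym)

lemma factor1: "i \<in> I ==> \<exists>b\<in>I. \<exists>c\<in>I. i = b * c" using factor[of i i] by blast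

text \<open>One hop to a neighbouring root and one hop back. Each hop carries a single factor
  across, so e is first split in two; the signs cancel.\<close>

lemma G_balanced:
  assumes "low \<beta>" "b \<in> I" "c \<in> I" "e \<in> I"
  shows "G \<beta> (b * e) c = G \<beta> b (e * c)"
proof -
  obtain \<gamma> where \<gamma>: "low \<gamma>" "ip \<gamma> \<beta> = 1" using ex_adjacent assms by blast
  obtain d d' where d: "d \<in> I" "d' \<in> I" "e = d * d'" using factor1 assms by blast
  have "G \<beta> ((b * d) * d') c = - G \<gamma> (b * d) (- (d' * c))"
    using G_hop[of \<gamma> \<beta> "b * d" c d'] \<gamma> assms d by (simp add: closed)
  also have "... = G \<beta> b (d * (d' * c))"
    using G_hop[of \<beta> \<gamma> b "- (d' * c)" d] \<gamma> assms d by (simp add: closed ip_sym)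
  finally show ?thesis by (simp add: d mult_ac)
qed

text \<open>Once the common factor d is extracted, balancing gives both commutators the same first
  argument d, and their second arguments agree modulo \<open>J\<close> by firmness.\<close>

lemma G_firm:
  assumes "low \<beta>" "b \<in> I" "c \<in> I" "b' \<in> I" "c' \<in> I" "b * c - b' * c' \<in> J"
  shows "G \<beta> b c = G \<beta> b' c'"
proof -
  obtain d b1 c1 b1' c1' where d: "d \<in> I" "b1 \<in> I" "c1 \<in> I" "b1' \<in> I" "c1' \<in> I"
    and eqs: "b = d * b1" "c = d * c1" "b' = d * b1'" "c' = d * c1'"
    and J: "d * b1 * c1 - d * b1' * c1' \<in> J" using firm[OF assms(2-6)] by blast
  let ?n = "of_int (N \<beta> (op \<beta>)) :: 'c"
  have "?n * (d * b1 * c1 - d * b1' * c1') \<in> J" using J by (intro AJ closed)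
  then have "?n * (b1 * (d * c1)) - ?n * (b1' * (d * c1')) \<in> J" by (simp add: algebra_simps)
  then have "G \<beta> d (b1 * (d * c1)) = G \<beta> d (b1' * (d * c1'))"
    unfolding G_def using assms d low_op[OF assms(1)]
    by (intro arg_cong[where f = "comm _"] Z_cong) (auto intro: closed)
  then show ?thesis using assms d by (simp add: eqs G_balanced closed)
qed

text \<open>The choice ranges over all factorizations of i, which yield the same value by
  \<open>G_firm\<close>.\<close>

definition Tb :: "'a => 'c => 'g" where
  "Tb \<beta> i = (SOME g. \<exists>b\<in>I. \<exists>c\<in>I. i = b * c \<and> g = G \<beta> b c)"

lemma Tb_G:
  assumes "low \<beta>" "b \<in> I" "c \<in> I" shows "Tb \<beta> (b * c) = G \<beta> b c" unfolding Tb_def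
proof (rule some1_equality[OF ex1I])
  show "\<exists>b'\<in>I. \<exists>c'\<in>I. b * c = b' * c' \<and> G \<beta> b c = G \<beta> b' c'" using assms by blast
  then show "\<exists>b'\<in>I. \<exists>c'\<in>I. b * c = b' * c' \<and> G \<beta> b c = G \<beta> b' c'" .
next
  fix g assume "\<exists>b'\<in>I. \<exists>c'\<in>I. b * c = b' * c' \<and> g = G \<beta> b' c'"
  then show "g = G \<beta> b c" using G_firm[of \<beta>] assms J_0 by (metis diff_self)
qed

lemma Tb_hop:
  assumes "low \<beta>" "low \<gamma>" "ip \<beta> \<gamma> = 1" "i \<in> I"
  shows "Tb \<gamma> i = - Tb \<beta> (- i)"
proof -
  obtain e c where e: "e \<in> I" "c \<in> I" "i = e * c" using factor1 assms by blast
  obtain b d where b: "b \<in> I" "d \<in> I" "e = b * d" using factor1 e by blast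
  have eq: "- i = b * (- (d * c))" by (simp add: e b mult_ac)
  have "Tb \<beta> (- i) = G \<beta> b (- (d * c))" unfolding eq using assms e b by (intro Tb_G closed)
  moreover have "Tb \<gamma> i = G \<gamma> (b * d) c" using Tb_G[of \<gamma> e c] assms e b by simp
  ultimately show ?thesis using G_hop[OF assms(1-3)] b e by simp
qed

lemma Z_Tb_commutes0:
  assumes "low \<beta>" "low \<gamma>" "\<gamma> \<noteq> \<beta>" "\<gamma> \<noteq> op \<beta>" "i \<in> I" "j \<in> I"
  shows "commutes (Z \<gamma> j) (Tb \<beta> i)"
proof -
  obtain b c where e: "b \<in> I" "c \<in> I" "i = b * c" using factor1 assms by blast
  show ?thesis unfolding e Tb_G[OF assms(1) e(1,2)] G_def
    using assms e low_op[OF assms(1)] by (intro commutes_comm Z_commutes) (auto intro: closed)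
qed

text \<open>The commutator behind \<open>Tb \<beta>\<close> involves \<beta> and
  \<open>op \<beta>\<close>. If \<gamma> is one of these, the element is rewritten through a
  neighbour \<epsilon> of \<beta>, whose own pair avoids both.\<close>

lemma Z_Tb_commutes:
  assumes "low \<beta>" "low \<gamma>" "i \<in> I" "j \<in> I"
  shows "commutes (Z \<gamma> j) (Tb \<beta> i)"
proof (cases "\<gamma> \<noteq> \<beta> \<and> \<gamma> \<noteq> op \<beta>")
  case False
  obtain \<epsilon> where \<epsilon>: "low \<epsilon>" "ip \<epsilon> \<beta> = 1" using ex_adjacent assms by blast
  have ne: "\<epsilon> \<noteq> \<beta>" using \<epsilon> ip_self[of \<beta>] assms by auto
  have ne': "\<epsilon> \<noteq> op \<beta>" using \<epsilon> ip_op[of \<beta>] assms by (auto simp: ip_sym)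
  have "op \<epsilon> \<noteq> \<beta>" using ne' op_op by metis
  then have "commutes (Z \<gamma> j) (Tb \<epsilon> (- i))"
    using False \<epsilon> ne ne' assms by (intro Z_Tb_commutes0) (auto intro: closed)
  then show ?thesis unfolding Tb_hop[OF \<epsilon>(1) assms(1) \<epsilon>(2) assms(3)] by (rule commutes_minus_right)
qed (use assms Z_Tb_commutes0 in blast)

lemma Tb_add:
  assumes "low \<beta>" "i \<in> I" "j \<in> I"
  shows "Tb \<beta> (i + j) = Tb \<beta> i + Tb \<beta> j"
proof -
  \<comment> \<open>A common first argument d reduces the claim to additivity of a commutator in its
    second argument.\<close>
  obtain d i' j' where d: "d \<in> I" "i' \<in> I" "j' \<in> I" "i = d * i'" "j = d * j'" using factor assms by blast
  let ?n = "of_int (N \<beta> (op \<beta>)) :: 'c"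
  have "Tb \<beta> (i + j) = G \<beta> d (i' + j')"
    using Tb_G[of \<beta> d "i' + j'"] d assms by (simp add: distrib_left closed)
  also have "... = comm (Z \<beta> d) (Z (op \<beta>) (?n * i') + Z (op \<beta>) (?n * j'))"
    unfolding G_def distrib_left using low_op[OF assms(1)] d by (subst Z_add) (auto intro: closed)
  also have "... = G \<beta> d i' + G \<beta> d j'" unfolding G_def
  proof (rule comm_add_right)
    have "commutes (Z (op \<beta>) (?n * i')) (Tb \<beta> j)"
      using assms low_op[OF assms(1)] d by (intro Z_Tb_commutes) (auto intro: closed)
    then show "commutes (Z (op \<beta>) (?n * i')) (comm (Z \<beta> d) (Z (op \<beta>) (?n * j')))"
      using Tb_G[of \<beta> d j'] assms d by (simp add: G_def)
  qed
  also have "... = Tb \<beta> i + Tb \<beta> j" using assms d by (simp add: Tb_G)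
  finally show ?thesis .
qed

lemma Tb_uminus:
  assumes "low \<beta>" "i \<in> I" shows "Tb \<beta> (- i) = - Tb \<beta> i"
proof -
  have "Tb \<beta> 0 = 0" using Tb_add[of \<beta> 0 0] assms I_0 by (metis add.right_neutral add_left_imp_eq)
  then show ?thesis using Tb_add[of \<beta> "- i" i] assms by (simp add: closed eq_neg_iff_add_eq_0)
qed

lemma Tb_op:
  assumes "low \<beta>" "i \<in> I" shows "Tb (op \<beta>) i = Tb \<beta> i"
proof -
  obtain b c where e: "b \<in> I" "c \<in> I" "i = b * c" using factor1 assms by blast
  let ?n = "of_int (N \<beta> (op \<beta>)) :: 'c" and ?m = "of_int (N (op \<beta>) \<beta>) :: 'c"
  have low': "low (op \<beta>)" using assms low_op by blast
  have m: "?m = - ?n" using of_int_anti[of \<beta> "op \<beta>"] assms low' ip_op by blast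
  have nn: "?n * (?n * b) = b" using assms low' ip_op by (intro of_int_N_sq) auto
  have "Tb (op \<beta>) i = comm (Z (op \<beta>) b) (Z \<beta> (?m * c))" using Tb_G[OF low' e(1,2)] by (simp add: G_def e)
  also have "... = - G \<beta> (?m * c) (?n * b)" by (simp add: G_def nn comm_flip[of "Z (op \<beta>) b"])
  also have "... = - Tb \<beta> (?m * c * (?n * b))" using e assms by (subst Tb_G) (auto intro: closed)
  also have "?m * c * (?n * b) = - (?n * (?n * b) * c)" by (simp add: m mult_ac)
  also have "... = - i" by (simp add: nn e)
  finally show ?thesis using assms Tb_uminus[of \<beta>] by simp
qed

text \<open>Low roots with product 1 are joined by a hop. For orthogonal \<beta> and \<gamma> the
  roots \<beta> and \<open>op \<gamma>\<close> have product 1, so a hop followed by an exchange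
  suffices.\<close>

lemma Tb_indep:
  assumes "low \<beta>" "low \<gamma>" "i \<in> I" shows "Tb \<gamma> i = Tb \<beta> i"
proof -
  have adj: "Tb \<gamma>' i = Tb \<beta> i" if "low \<gamma>'" "ip \<beta> \<gamma>' = 1" for \<gamma>'
    using Tb_hop[OF assms(1) that assms(3)] Tb_uminus[OF assms(1,3)] by simp
  consider "\<gamma> = op \<beta>" | "ip \<beta> \<gamma> = 2" | "ip \<beta> \<gamma> = 1" | "ip \<beta> \<gamma> = 0"
    using ip_low_cases[OF assms(1,2)] by auto
  then show ?thesis
  proof cases
    case 1 then show ?thesis using Tb_op assms by simp
  next
    case 2 then show ?thesis using ip_2[of \<beta> \<gamma>] assms by simp
  next
    case 3 then show ?thesis using adj assms by simp
  next
    case 4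
    have "ip \<beta> (op \<gamma>) = 1" using 4 assms by (simp add: ip_lin ip_sym[of \<beta> \<alpha>])
    then have "Tb (op \<gamma>) i = Tb \<beta> i" using adj low_op assms by blast
    then show ?thesis using Tb_op assms by simp
  qed
qed

definition T :: "'c => 'g" where
  "T = Tb (SOME \<beta>. low \<beta>)"

lemma T_Tb: "low \<beta> ==> i \<in> I ==> T i = Tb \<beta> i"
  unfolding T_def by (rule Tb_indep) (use someI_ex[OF ex_low] in auto)

lemma T_G: "low \<beta> ==> b \<in> I ==> c \<in> I ==> T (b * c) = G \<beta> b c" by (simp add: T_Tb Tb_G closed)

lemma T_comm:
  assumes "low \<beta>" "low \<gamma>" "\<gamma> = op \<beta>" "b \<in> I" "c \<in> I"
  shows "comm (Z \<beta> b) (Z \<gamma> c) = T (of_int (N \<beta> \<gamma>) * b * c)"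
proof -
  let ?n = "of_int (N \<beta> (op \<beta>)) :: 'c"
  have nn: "?n * (?n * c) = c" using assms ip_op by (intro of_int_N_sq) auto
  have "T (b * (?n * c)) = comm (Z \<beta> b) (Z \<gamma> c)"
    using T_G[of \<beta> b "?n * c"] assms by (simp add: G_def nn closed)
  then show ?thesis using assms by (simp add: mult_ac)
qed

lemma T_add: "i \<in> I ==> j \<in> I ==> T (i + j) = T i + T j" using ex_low Tb_add by (metis T_Tb I_add)

lemma T_J: assumes "j \<in> J" shows "T j = 0"
proof -
  obtain \<beta> where \<beta>: "low \<beta>" using ex_low by blast
  obtain b c where e: "b \<in> I" "c \<in> I" "j = b * c" using factor1 J_I assms by blast
  \<comment> \<open>An element of \<open>J\<close> is congruent to zero, whose factorization by
    zeros gives the trivial commutator.\<close>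
  have "G \<beta> b c = G \<beta> 0 0" using \<beta> e assms by (intro G_firm) (auto intro: closed)
  then show ?thesis using \<beta> e low_op[OF \<beta>] by (simp add: T_G G_def comm_def closed)
qed

lemma Z_T_commutes: "low \<gamma> ==> i \<in> I ==> j \<in> I ==> commutes (Z \<gamma> j) (T i)"
  by (simp add: T_Tb Z_Tb_commutes)

lemma T_commutes: assumes "i \<in> I" "j \<in> I" shows "commutes (T i) (T j)"
proof -
  obtain \<beta> where \<beta>: "low \<beta>" using ex_low by blast
  obtain b c where e: "b \<in> I" "c \<in> I" "j = b * c" using factor1 assms by blast
  show ?thesis unfolding e T_G[OF \<beta> e(1,2)] G_def using \<beta> low_op[OF \<beta>] e assms
    by (intro commutes_comm Z_T_commutes[symmetric] closed)
qed

text \<open>Passing from \<beta> to \<open>op \<beta>\<close> flips the sign of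
  \<open>ip \<delta> \<beta>\<close>, so this may be taken nonpositive. If it is -1, conjugation by
  \<open>y \<delta> d\<close> multiplies the first argument of the commutator by an element
  \<open>Z (\<delta> + \<beta>)\<close> that commutes with the second argument and with the
  commutator itself.\<close>

lemma y_T_commutes:
  assumes "\<delta> \<in> \<Phi>" "ip \<alpha> \<delta> = 0" "d \<in> I" "i \<in> I"
  shows "commutes (y \<delta> d) (T i)"
proof -
  obtain \<beta>0 where \<beta>0: "low \<beta>0" using ex_low by blast
  have "ip \<delta> (op \<beta>0) = - ip \<delta> \<beta>0" using assms by (simp add: ip_lin ip_sym[of \<delta> \<alpha>])
  then obtain \<beta> where \<beta>: "low \<beta>" "ip \<delta> \<beta> \<le> 0" using \<beta>0 low_op[OF \<beta>0] by (cases "ip \<delta> \<beta>0 \<le> 0") auto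
  have low': "low (op \<beta>)" using \<beta> low_op by blast
  have ip': "ip \<delta> (op \<beta>) = - ip \<delta> \<beta>" using assms by (simp add: ip_lin ip_sym[of \<delta> \<alpha>])
  have ne2: "ip \<delta> \<beta> \<noteq> -2" using ip_neg2[of \<delta> \<beta>] assms \<beta> by (auto simp: ip_lin)
  obtain b c where e: "b \<in> I" "c \<in> I" "i = b * c" using factor1 assms by blast
  let ?n = "of_int (N \<beta> (op \<beta>)) :: 'c"
  have nc: "?n * c \<in> I" using e by (auto intro: closed)
  note [simp] = ip_lin ip_sym[of \<delta> \<alpha>]
  have c': "commutes (y \<delta> d) (Z (op \<beta>) (?n * c))" using assms \<beta> low' nc ip' by (intro y_Z_commutes) auto
  consider "ip \<delta> \<beta> = 0" | "ip \<delta> \<beta> = -1" using ip_vals[of \<delta> \<beta>] assms \<beta> ne2 by auto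
  then show ?thesis
  proof cases
    case 1
    then have "commutes (y \<delta> d) (Z \<beta> b)" using assms \<beta> e by (intro y_Z_commutes) auto
    then show ?thesis unfolding e T_G[OF \<beta>(1) e(1,2)] G_def using c' by (intro commutes_comm)
  next
    case 2
    have db: "low (\<delta> + \<beta>)" using 2 assms \<beta> add_root by auto
    let ?u = "of_int (N \<delta> \<beta>) * d * b"
    have u: "?u \<in> I" using assms e by (auto intro: closed)
    have rel: "y \<delta> d + Z \<beta> b = Z (\<delta> + \<beta>) ?u + Z \<beta> b + y \<delta> d" using assms \<beta> e 2 by (intro y_Z_rel) auto
    have "\<delta> \<noteq> 0" using assms ip_self[of \<delta>] ip_add_left[of 0 0 0] by auto
    then have c1: "commutes (Z (\<delta> + \<beta>) ?u) (Z (op \<beta>) (?n * c))"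
      using db low' u nc by (intro Z_commutes) auto
    have c2: "commutes (Z (\<delta> + \<beta>) ?u) (T i)" using db u assms by (intro Z_T_commutes) auto
    have "commutes (y \<delta> d) (comm (Z \<beta> b) (Z (op \<beta>) (?n * c)))"
    proof -
      let ?y = "y \<delta> d" and ?A = "Z \<beta> b" and ?B = "Z (op \<beta>) (?n * c)" and ?U = "Z (\<delta> + \<beta>) ?u"
      have y1: "?y + ?A = (?U + ?A) + ?y" using rel by (simp only: add.assoc)
      have y2: "?y + - ?A = - (?U + ?A) + ?y"
      proof -
        have "- (?U + ?A) + (?y + ?A) + - ?A = - (?U + ?A) + ((?U + ?A) + ?y) + - ?A" unfolding y1 ..
        moreover have "- (?U + ?A) + (?y + ?A) + - ?A = - (?U + ?A) + ?y" by (simp only: add.assoc right_minus add.right_neutral)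
        moreover have "- (?U + ?A) + ((?U + ?A) + ?y) + - ?A = ?y + - ?A"
          by (simp only: minus_add_cancel)
        ultimately show ?thesis by simp
      qed
      have y3: "?y + - ?B = - ?B + ?y" by (rule commutes_minus_right[OF c'])
      have "?y + comm ?A ?B = (?y + ?A) + ?B + - ?A + - ?B"
        by (simp only: comm_def add.assoc diff_conv_add_uminus)
      also have "... = (?U + ?A) + (?y + ?B) + - ?A + - ?B" unfolding y1 by (simp only: add.assoc)
      also have "... = (?U + ?A) + ?B + (?y + - ?A) + - ?B" unfolding c' by (simp only: add.assoc)
      also have "... = (?U + ?A) + ?B + - (?U + ?A) + (?y + - ?B)" unfolding y2 by (simp only: add.assoc)
      also have "... = comm (?U + ?A) ?B + ?y" unfolding y3
        by (simp only: comm_def add.assoc diff_conv_add_uminus)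
      also have "comm (?U + ?A) ?B = ?U + comm ?A ?B + (?B + - ?U + - ?B)"
        by (simp only: comm_def add.assoc diff_conv_add_uminus minus_add add_minus_cancel minus_add_cancel minus_minus)
      also have "?B + - ?U + - ?B = - ?U"
        unfolding commutes_minus_left[OF c1, symmetric] by (simp only: add.assoc right_minus add.right_neutral)
      also have "?U + comm ?A ?B + - ?U = comm ?A ?B" unfolding c2[unfolded e T_G[OF \<beta>(1) e(1,2)] G_def]
        by (simp only: add.assoc right_minus add.right_neutral)
      finally show ?thesis .
    qed
    then show ?thesis unfolding e T_G[OF \<beta>(1) e(1,2)] G_def .
  qed
qed

text \<open>With \<epsilon> = \<gamma> - \<alpha>, the A3 condition supplies \<beta> orthogonal to
  \<gamma>. In -\<alpha> = \<beta> + \<open>op \<beta>\<close> only \<open>op \<beta>\<close>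
  interacts with \<gamma>, producing \<delta>; then \<beta> interacts with \<delta>, producing
  \<epsilon>. Conjugation by the commutator leaves just this last term.\<close>

lemma T_y_rel:
  assumes "\<gamma> \<in> \<Phi>" "ip \<alpha> \<gamma> = 1" "j \<in> I" "i \<in> I"
  shows "T i + y \<gamma> j = Z (\<gamma> - \<alpha>) (of_int (N (- \<alpha>) \<gamma>) * i * j) + y \<gamma> j + T i"
proof -
  define \<epsilon> where "\<epsilon> = \<gamma> - \<alpha>"
  have \<epsilon>: "low \<epsilon>" using assms diff_root[of \<gamma> \<alpha>] \<alpha> by (simp add: \<epsilon>_def ip_lin ip_self ip_sym[of \<gamma> \<alpha>])
  obtain \<beta> where \<beta>: "low \<beta>" "ip \<beta> \<epsilon> = 1" using ex_adjacent[OF \<epsilon>] by blast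
  have g: "ip \<beta> \<gamma> = 0" using \<beta> by (simp add: \<epsilon>_def ip_lin ip_sym[of \<beta> \<alpha>])
  define \<delta> where "\<delta> = \<epsilon> - \<beta>"
  have \<delta>: "\<delta> \<in> \<Phi>" unfolding \<delta>_def using diff_root[of \<epsilon> \<beta>] \<epsilon> \<beta> by (simp add: ip_sym)
  have low': "low (op \<beta>)" using \<beta> low_op by blast
  note [simp] = ip_lin ip_self \<alpha> ip_sym[of \<beta> \<alpha>] ip_sym[of \<gamma> \<alpha>] ip_sym[of \<gamma> \<beta>]
  obtain b c where e: "b \<in> I" "c \<in> I" "i = b * c" using factor1 assms by blast
  let ?n = "\<lambda>x y. of_int (N x y) :: 'c"
  define c' where "c' = ?n \<beta> (op \<beta>) * c"
  have cI: "c' \<in> I" using e by (auto simp: c'_def intro: closed)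
  have sums: "op \<beta> + \<gamma> = \<delta>" "\<delta> + \<beta> = \<epsilon>" "\<beta> + \<delta> = \<epsilon>" "\<beta> + op \<beta> = - \<alpha>" by (auto simp: \<delta>_def \<epsilon>_def)
  define d where "d = ?n (op \<beta>) \<gamma> * c' * j"
  have dI: "d \<in> I" using assms cI by (auto simp: d_def intro: closed)
  have yB: "Z (op \<beta>) c' + y \<gamma> j = y \<delta> d + y \<gamma> j + Z (op \<beta>) c'"
  proof -
    let ?p = "?n \<alpha> (op \<beta>) * r * c'"
    have pI: "?p \<in> I" using cI r by (auto intro: closed)
    have rt: "\<alpha> + op \<beta> \<in> \<Phi>" using low_root[OF low'] .
    have 1: "y (op \<beta>) c' + y \<gamma> j = y \<delta> d + y \<gamma> j + y (op \<beta>) c'"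
      using y_rel[of "op \<beta>" \<gamma> c' j] low' assms cI g unfolding sums d_def by simp
    have 2: "commutes (y (\<alpha> + op \<beta>) ?p) (y \<delta> d)" and 3: "commutes (y (\<alpha> + op \<beta>) ?p) (y \<gamma> j)"
      using pI rt \<delta> dI assms g \<beta> by (auto intro!: y_commutes simp: \<delta>_def \<epsilon>_def)
    have "Z (op \<beta>) c' + y \<gamma> j = y (\<alpha> + op \<beta>) ?p + (y \<delta> d + y \<gamma> j) + y (op \<beta>) c'"
      unfolding Z_def by (simp only: 1 add.assoc)
    also have "y (\<alpha> + op \<beta>) ?p + (y \<delta> d + y \<gamma> j) = (y \<delta> d + y \<gamma> j) + y (\<alpha> + op \<beta>) ?p"
      by (rule commutes_add_right[OF 2 3])
    finally show ?thesis unfolding Z_def by (simp only: add.assoc)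
  qed
  define f where "f = ?n \<delta> \<beta> * d * b"
  have fI: "- f \<in> I" using dI e by (auto simp: f_def intro: closed)
  have "y \<delta> d + Z \<beta> b = Z \<epsilon> f + Z \<beta> b + y \<delta> d"
    unfolding f_def using y_Z_rel[of \<delta> \<beta> d b] \<delta> \<beta> \<epsilon> dI e sums by (simp add: \<delta>_def ip_sym[of \<epsilon> \<beta>])
  then have yA: "Z \<beta> b + y \<delta> d = Z \<epsilon> (- f) + y \<delta> d + Z \<beta> b" using \<epsilon> fI I_uminus[OF fI] Z_uminus[of \<epsilon> f]
    by (simp add: add.assoc)
  have "?n \<beta> (op \<beta>) * ?n (- \<alpha>) \<gamma> = ?n (op \<beta>) \<gamma> * ?n \<beta> \<delta>"
    using of_int_jacobi[of \<beta> "op \<beta>" \<gamma>] \<beta> low' assms g unfolding sums by simp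
  then have J: "?n \<beta> (op \<beta>) * (?n \<beta> (op \<beta>) * (?n (- \<alpha>) \<gamma> * x)) = ?n \<beta> (op \<beta>) * ?n (op \<beta>) \<gamma> * ?n \<beta> \<delta> * x" for x
    by (metis mult.assoc)
  have "?n \<beta> (op \<beta>) * (?n \<beta> (op \<beta>) * (?n (- \<alpha>) \<gamma> * (i * j))) = ?n (- \<alpha>) \<gamma> * (i * j)"
    using \<beta> low' ip_op[of \<beta>] by (intro of_int_N_sq) auto
  moreover have "?n \<delta> \<beta> = - ?n \<beta> \<delta>" using \<beta> \<delta> by (intro of_int_anti) (auto simp: \<delta>_def)
  ultimately have f: "- f = ?n (- \<alpha>) \<gamma> * i * j" unfolding J by (simp add: f_def d_def c'_def e mult_ac)
  have ay: "commutes (y \<gamma> j) (Z \<beta> b)" using assms \<beta> g e by (intro y_Z_commutes) auto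
  have db: "commutes (y \<delta> d) (Z (op \<beta>) c')"
    using \<delta> dI low' cI \<beta> \<epsilon> by (intro y_Z_commutes) (auto simp: \<delta>_def ip_sym[of \<epsilon> \<beta>] ip_sym[of \<epsilon> \<alpha>])
  have dy: "commutes (y \<delta> d) (y \<gamma> j)" using \<delta> dI assms g \<beta> by (intro y_commutes) (auto simp: \<delta>_def \<epsilon>_def)
  have "\<beta> \<noteq> op \<epsilon>" using \<beta> ip_op[of \<epsilon>] \<epsilon> ip_sym[of \<beta> \<epsilon>] by auto
  then have ea: "commutes (Z \<epsilon> (- f)) (Z \<beta> b)" using Z_commutes[of \<epsilon> \<beta> "- f" b] \<epsilon> \<beta> fI e by simp
  have "\<epsilon> \<noteq> \<beta>" using \<beta> \<epsilon> by auto
  then have eb: "commutes (Z \<epsilon> (- f)) (Z (op \<beta>) c')" using \<epsilon> low' fI cI by (intro Z_commutes) auto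
  have ey: "commutes (y \<gamma> j) (Z \<epsilon> (- f))" using assms \<epsilon> fI by (intro y_Z_commutes) (auto simp: \<epsilon>_def)
  have ed: "commutes (y \<delta> d) (Z \<epsilon> (- f))"
    using \<delta> dI \<epsilon> fI \<beta> by (intro y_Z_commutes) (auto simp: \<delta>_def ip_sym[of \<epsilon> \<alpha>])
  have "comm (Z \<beta> b) (Z (op \<beta>) c') + y \<gamma> j = Z \<epsilon> (- f) + y \<gamma> j + comm (Z \<beta> b) (Z (op \<beta>) c')"
    by (rule comm_conj_rel[OF yB yA ay[symmetric] db dy ea eb ey[symmetric] ed[symmetric]])
  then show ?thesis unfolding f \<epsilon>_def using T_G[OF \<beta>(1) e(1,2)] by (simp add: G_def c'_def e)
qed

text \<open>On roots the final branch means \<open>ip \<alpha> \<beta> \<ge> 0\<close>, where root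
  elements commute with those of \<alpha>.\<close>

definition yc :: "'a => 'c => 'g" where
  "yc \<beta> i = (if \<beta> = - \<alpha> then T i else if ip \<alpha> \<beta> = -1 then Z \<beta> i else y \<beta> i)"

end

lemma commutes_left_commute: "commutes a b ==> a + (b + c) = b + (a + c)" for a b c :: "'g::group_add"
  by (simp only: add.assoc[symmetric])

lemma subgrp_subset: "(\<And>x. x \<in> X ==> x \<in> subgrp X') ==> subgrp X \<subseteq> subgrp X'" using subgrp_mono by blast

lemma rel_flip: "a + b = s + b + a ==> b + a = - s + a + b" for a b s :: "'g::group_add"
  by (simp add: add.assoc)

section \<open>Steinberg relations for the conjugated family\<close>

context firm_conj
begin

lemma root_cases:
  assumes "\<beta> \<in> \<Phi>"
  obtains "\<beta> = - \<alpha>" | "low \<beta>" | "ip \<alpha> \<beta> \<ge> 0"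
proof -
  have "ip \<alpha> \<beta> \<in> {-2, -1} \<or> ip \<alpha> \<beta> \<ge> 0" using ip_vals[OF \<alpha> assms] by auto
  then show thesis using that assms ip_neg2[OF \<alpha> assms] by blast
qed

lemma yc_T: "yc (- \<alpha>) i = T i"
  and yc_Z: "low \<beta> ==> yc \<beta> i = Z \<beta> i"
  and yc_y: "ip \<alpha> \<beta> \<ge> 0 ==> yc \<beta> i = y \<beta> i" by (auto simp: yc_def ip_minus_right ip_self \<alpha>)

lemma yc_commutes1:
  assumes "\<gamma> \<in> \<Phi>" "i \<in> I" "j \<in> I" "ip \<alpha> \<gamma> \<le> 0"
  shows "commutes (T i) (yc \<gamma> j)" using assms(1)
proof (cases rule: root_cases)
  case 1 then show ?thesis using assms T_commutes by (simp add: yc_T)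
next
  case 2 then show ?thesis using assms Z_T_commutes by (simp add: yc_Z)
next
  case 3 then show ?thesis using assms y_T_commutes[of \<gamma> j i] by (simp add: yc_y)
qed

lemma yc_commutes2:
  assumes "\<beta> \<in> \<Phi>" "\<gamma> \<in> \<Phi>" "i \<in> I" "j \<in> I" "ip \<beta> \<gamma> \<ge> 0" "ip \<alpha> \<beta> \<ge> 0"
  shows "commutes (y \<beta> i) (yc \<gamma> j)" using assms(2)
proof (cases rule: root_cases)
  case 1 then show ?thesis using assms y_T_commutes[of \<beta> i j]
    by (simp add: yc_T ip_minus_right ip_sym[of \<beta> \<alpha>])
next
  case 2 then show ?thesis using assms
    by (simp add: yc_Z) (intro y_Z_commutes, auto simp: ip_lin ip_sym[of \<beta> \<alpha>])
next
  case 3 then show ?thesis using assms y_commutes by (simp add: yc_y)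
qed

lemma yc_commutes:
  assumes "\<beta> \<in> \<Phi>" "\<gamma> \<in> \<Phi>" "i \<in> I" "j \<in> I" "ip \<beta> \<gamma> \<ge> 0"
  shows "commutes (yc \<beta> i) (yc \<gamma> j)" using assms(1)
proof (cases rule: root_cases)
  case 1 then show ?thesis using assms yc_commutes1 by (simp add: yc_T ip_minus_left)
next
  case 3 then show ?thesis using assms yc_commutes2 by (simp add: yc_y)
next
  case 2
  show ?thesis using assms(2)
  proof (cases rule: root_cases)
    assume "\<gamma> = - \<alpha>"
    then show ?thesis using yc_commutes1[of \<beta> j i] 2 assms by (simp add: yc_T)
  next
    assume "ip \<alpha> \<gamma> \<ge> 0"
    then show ?thesis using yc_commutes2[of \<gamma> \<beta> j i] 2 assms by (simp add: yc_y ip_sym)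
  next
    assume \<gamma>: "low \<gamma>"
    have "\<gamma> \<noteq> op \<beta>" using ip_op[OF 2] assms by auto
    then show ?thesis using Z_commutes[OF 2 \<gamma>] \<gamma> 2 assms by (simp add: yc_Z)
  qed
qed

definition yc_rel :: "'a => 'a => bool" where
  "yc_rel \<beta> \<gamma> \<longleftrightarrow> (\<forall>i\<in>I. \<forall>j\<in>I.
     yc \<beta> i + yc \<gamma> j = yc (\<beta> + \<gamma>) (of_int (N \<beta> \<gamma>) * i * j) + yc \<gamma> j + yc \<beta> i)"

lemma yc_add:
  assumes "\<beta> \<in> \<Phi>" "i \<in> I" "j \<in> I"
  shows "yc \<beta> (i + j) = yc \<beta> i + yc \<beta> j"
  using assms(1) by (cases rule: root_cases) (simp_all add: yc_T yc_Z yc_y T_add Z_add y_add assms)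

lemma yc_uminus:
  assumes "\<beta> \<in> \<Phi>" "i \<in> I" shows "yc \<beta> (- i) = - yc \<beta> i"
proof -
  have "yc \<beta> 0 = 0" using yc_add[of \<beta> 0 0] assms I_0 by (metis add.right_neutral add_left_imp_eq)
  then show ?thesis using yc_add[of \<beta> "- i" i] assms by (simp add: closed eq_neg_iff_add_eq_0)
qed

lemma yc_rel_sym:
  assumes "yc_rel \<beta> \<gamma>" "\<beta> \<in> \<Phi>" "\<gamma> \<in> \<Phi>" "ip \<beta> \<gamma> = -1"
  shows "yc_rel \<gamma> \<beta>" unfolding yc_rel_def
proof (intro ballI)
  fix j i assume ij: "j \<in> I" "i \<in> I"
  let ?s = "of_int (N \<beta> \<gamma>) * i * j"
  have s: "?s \<in> I" using ij by (auto intro: closed)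
  have "yc \<gamma> j + yc \<beta> i = - yc (\<beta> + \<gamma>) ?s + yc \<beta> i + yc \<gamma> j"
    using assms(1) ij by (intro rel_flip) (auto simp: yc_rel_def)
  also have "- yc (\<beta> + \<gamma>) ?s = yc (\<gamma> + \<beta>) (of_int (N \<gamma> \<beta>) * j * i)"
  proof -
    have anti: "of_int (N \<gamma> \<beta>) = (- of_int (N \<beta> \<gamma>) :: 'c)" by (rule of_int_anti[OF assms(2-4)])
    show ?thesis unfolding anti yc_uminus[OF add_root[OF assms(2-4)] s, symmetric] by (simp add: add_ac mult_ac)
  qed
  finally show "yc \<gamma> j + yc \<beta> i = yc (\<gamma> + \<beta>) (of_int (N \<gamma> \<beta>) * j * i) + yc \<beta> i + yc \<gamma> j" .
qed

lemma yc_rel_T: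
  assumes "\<gamma> \<in> \<Phi>" "ip (- \<alpha>) \<gamma> = -1"
  shows "yc_rel (- \<alpha>) \<gamma>"
proof -
  have 1: "ip \<alpha> \<gamma> = 1" using assms by (simp add: ip_lin)
  then have "low (- \<alpha> + \<gamma>)" using assms diff_root[of \<gamma> \<alpha>] \<alpha> by (simp add: ip_lin ip_self ip_sym[of \<gamma> \<alpha>])
  moreover have "ip \<alpha> \<gamma> \<ge> 0" using 1 by simp
  ultimately show ?thesis unfolding yc_rel_def
    using T_y_rel[OF assms(1) 1] by (auto simp: yc_T yc_Z yc_y)
qed

lemma yc_rel_y:
  assumes "\<beta> \<in> \<Phi>" "\<gamma> \<in> \<Phi>" "ip \<beta> \<gamma> = -1" "ip \<alpha> \<beta> \<ge> 0" "\<gamma> \<noteq> - \<alpha>"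
  shows "yc_rel \<beta> \<gamma>" using assms(2)
proof (cases rule: root_cases)
  case 1 then show ?thesis using assms by simp
next
  case 3 then show ?thesis using assms y_rel by (simp add: yc_rel_def yc_y ip_lin)
next
  case 2
  note [simp] = ip_lin ip_self \<alpha> ip_sym[of \<beta> \<alpha>] ip_sym[of \<gamma> \<alpha>] ip_sym[of \<gamma> \<beta>]
  have bg: "\<beta> + \<gamma> \<in> \<Phi>" using add_root assms by blast
  show ?thesis
  proof (cases "ip \<alpha> \<beta> = 0")
    case True
    then have "low (\<beta> + \<gamma>)" using bg 2 by simp
    then show ?thesis unfolding yc_rel_def using y_Z_rel[of \<beta> \<gamma>] True 2 assms by (auto simp: yc_Z yc_y)
  next
    case False
    then have ge: "ip \<alpha> \<beta> \<ge> 1" using ip_vals[OF \<alpha> assms(1)] assms(4) by auto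
    show ?thesis unfolding yc_rel_def
    proof (intro ballI)
      fix i j assume ij: "i \<in> I" "j \<in> I"
      let ?p = "of_int (N \<alpha> \<gamma>) * r * j" and ?s = "of_int (N \<beta> \<gamma>) * i * j"
      have I: "?p \<in> I" "?s \<in> I" using ij r by (auto intro: closed)
      have rt: "\<alpha> + \<gamma> \<in> \<Phi>" using low_root[OF 2] .
      \<comment> \<open>Here \<alpha> + \<gamma> pairs nonnegatively with \<beta> and with \<beta> +
        \<gamma>, so the extra factor of \<open>Z \<gamma>\<close> passes through unchanged.\<close>
      have 1: "commutes (y \<beta> i) (y (\<alpha> + \<gamma>) ?p)" and 3: "commutes (y (\<alpha> + \<gamma>) ?p) (y (\<beta> + \<gamma>) ?s)"
        using ij I rt bg assms ge 2 by (auto intro!: y_commutes)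
      have "y \<beta> i + (y (\<alpha> + \<gamma>) ?p + y \<gamma> j) = y (\<alpha> + \<gamma>) ?p + (y \<beta> i + y \<gamma> j)"
        by (rule commutes_left_commute[OF 1])
      also have "y \<beta> i + y \<gamma> j = y (\<beta> + \<gamma>) ?s + y \<gamma> j + y \<beta> i" using y_rel ij assms by blast
      also have "y (\<alpha> + \<gamma>) ?p + (y (\<beta> + \<gamma>) ?s + y \<gamma> j + y \<beta> i) = y (\<beta> + \<gamma>) ?s + (y (\<alpha> + \<gamma>) ?p + y \<gamma> j) + y \<beta> i"
        by (simp only: add.assoc commutes_left_commute[OF 3])
      finally show "yc \<beta> i + yc \<gamma> j = yc (\<beta> + \<gamma>) ?s + yc \<gamma> j + yc \<beta> i"
        using 2 ge by (simp add: yc_y yc_Z Z_def)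
    qed
  qed
qed

lemma yc_rel:
  assumes "\<beta> \<in> \<Phi>" "\<gamma> \<in> \<Phi>" "ip \<beta> \<gamma> = -1"
  shows "yc_rel \<beta> \<gamma>"
proof -
  have ip': "ip \<gamma> \<beta> = -1" using assms by (simp add: ip_sym)
  have "\<beta> = - \<alpha> \<or> low \<beta> \<or> ip \<alpha> \<beta> \<ge> 0" "\<gamma> = - \<alpha> \<or> low \<gamma> \<or> ip \<alpha> \<gamma> \<ge> 0"
    using root_cases assms(1,2) by blast+
  then consider "\<beta> = - \<alpha>" | "\<gamma> = - \<alpha>" | "ip \<alpha> \<beta> \<ge> 0" "\<gamma> \<noteq> - \<alpha>" | "ip \<alpha> \<gamma> \<ge> 0" "\<beta> \<noteq> - \<alpha>" | "low \<beta>" "low \<gamma>"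
    by blast
  then show ?thesis
  proof cases
    case 1 then show ?thesis using yc_rel_T assms by blast
  next
    case 2 then show ?thesis using yc_rel_T yc_rel_sym ip' assms by blast
  next
    case 3 then show ?thesis using yc_rel_y assms by blast
  next
    case 4 then show ?thesis using yc_rel_y yc_rel_sym ip' assms by blast
  next
    case 5
    \<comment> \<open>Two low roots with product -1 add up to -\<alpha>, so the relation is the
      commutator that defines \<open>T\<close>.\<close>
    have \<gamma>: "\<gamma> = op \<beta>" using ip_low_cases[OF 5] assms by auto
    then have "\<beta> + \<gamma> = - \<alpha>" by simp
    then show ?thesis unfolding yc_rel_def using T_comm[OF 5 \<gamma>] 5 by (auto simp: yc_T yc_Z comm_iff)
  qed
qed

lemma yc_steinberg: "steinberg I yc"
  using yc_add yc_commutes yc_rel unfolding steinberg_def yc_rel_def by blast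

lemma yc_J:
  assumes "\<beta> \<in> \<Phi>" "j \<in> J" shows "yc \<beta> j = 0"
  using assms(1) by (cases rule: root_cases) (simp_all add: yc_T yc_Z yc_y T_J Z_J y_J assms)

end

section \<open>Conjugation as a map of the Steinberg group of the ideal\<close>

context simply_laced
begin

text \<open>Decompositions of -\<delta> are pairs \<beta>, -\<delta> - \<beta>. If \<gamma> occurs
  in such a pair, the A3 condition supplies a \<beta> that has product 1 with \<gamma>, and then
  neither member of its pair is \<gamma>.\<close>

lemma root_decomp:
  assumes "\<delta> \<in> \<Phi>"
  shows "\<exists>\<beta> \<beta>'. \<beta> \<in> \<Phi> \<and> \<beta>' \<in> \<Phi> \<and> \<beta> + \<beta>' = - \<delta> \<and> ip \<beta> \<beta>' = -1 \<and>
    ip \<delta> \<beta> = -1 \<and> ip \<delta> \<beta>' = -1 \<and> \<beta> \<noteq> \<gamma> \<and> \<beta>' \<noteq> \<gamma>"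
proof -
  have *: ?thesis if "\<beta> \<in> \<Phi>" "ip \<delta> \<beta> = -1" "\<beta> \<noteq> \<gamma>" "- \<delta> - \<beta> \<noteq> \<gamma>" for \<beta>
    using that assms add_root[of \<delta> \<beta>] uminus_root[of "\<delta> + \<beta>"]
    by (intro exI[of _ \<beta>] exI[of _ "- \<delta> - \<beta>"]) (auto simp: ip_lin ip_self ip_sym[of \<beta> \<delta>])
  show ?thesis
  proof (cases "\<gamma> \<in> \<Phi> \<and> ip \<delta> \<gamma> = -1")
    case True
    then obtain \<beta> where \<beta>: "\<beta> \<in> \<Phi>" "ip \<beta> \<delta> = -1" "ip \<beta> \<gamma> = 1"
      using A2_extends[OF assms, of \<gamma>] by (auto simp: ip_sym)
    show ?thesis
    proof (rule *[of \<beta>])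
      show "\<beta> \<noteq> \<gamma>" using \<beta> ip_self[of \<gamma>] by auto
      show "- \<delta> - \<beta> \<noteq> \<gamma>" using \<beta> ip_self[of \<beta>] by (auto simp: ip_lin)
    qed (use \<beta> in \<open>auto simp: ip_sym\<close>)
  next
    case False
    obtain \<beta> where \<beta>: "\<beta> \<in> \<Phi>" "ip \<delta> \<beta> = -1" using nonisolated[OF assms] by (auto simp: ip_sym)
    then have "- \<delta> - \<beta> \<in> \<Phi>" "ip \<delta> (- \<delta> - \<beta>) = -1"
      using assms add_root[of \<delta> \<beta>] uminus_root[of "\<delta> + \<beta>"] by (auto simp: ip_lin ip_self)
    then show ?thesis using False \<beta> by (intro *[of \<beta>]) auto
  qed
qed

end

definition hom_on :: "'g::group_add set => ('g => 'h::group_add) => bool" where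
  "hom_on Y h \<longleftrightarrow> (\<forall>a\<in>Y. \<forall>b\<in>Y. h (a + b) = h a + h b)"

lemma hom_on_0: "hom_on (subgrp X) h ==> h 0 = 0"
  unfolding hom_on_def by (metis add.right_neutral add_left_imp_eq subgrp.zero)

lemma hom_on_uminus: "hom_on (subgrp X) h ==> a \<in> subgrp X ==> h (- a) = - h a"
  using hom_on_0[of X h] unfolding hom_on_def by (metis eq_neg_iff_add_eq_0 left_minus subgrp.uminus)

lemma hom_on_eq:
  assumes "hom_on (subgrp X) h" "hom_on (subgrp X) k" "\<And>x. x \<in> X' ==> h x = k x"
    and "a \<in> subgrp X'" "X' \<subseteq> subgrp X"
  shows "h a = k a"
proof -
  have sub: "subgrp X' \<subseteq> subgrp X" using assms(5) subgrp_mono by blast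
  show ?thesis using assms(4)
  proof induction
    case zero then show ?case using assms(1,2) hom_on_0 by metis
  next
    case (gen x) then show ?case using assms(3) by blast
  next
    case (add x y)
    then have "x \<in> subgrp X" "y \<in> subgrp X" using sub by auto
    then show ?case using add assms(1,2) unfolding hom_on_def by simp
  next
    case (uminus x) then show ?case using sub assms(1,2) hom_on_uminus by (metis subsetD)
  qed
qed

lemma hom_on_image:
  assumes "hom_on (subgrp X) h" "\<And>x. x \<in> X ==> h x \<in> subgrp X'" "a \<in> subgrp X"
  shows "h a \<in> subgrp X'" using assms(3)
proof induction
  case zero then show ?case using assms(1) hom_on_0 subgrp.zero by metis
next
  case (gen x) then show ?case using assms(2) by blast
next
  case (add x y) then show ?case using assms(1) subgrp.add unfolding hom_on_def by metis
next
  case (uminus x) then show ?case using assms(1) hom_on_uminus subgrp.uminus by metis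
qed

text \<open>The universal property is stated for targets in the same type \<open>'g\<close>, because
  the conjugated family takes its values there.\<close>

locale universal_steinberg = firm_steinberg \<Phi> ip N A I J y
  for \<Phi> :: "'a::ab_group_add set" and ip N and A I J :: "'c::comm_ring_1 set"
    and y :: "'a => 'c => 'g::group_add" +
  assumes universal: "steinberg I y' ==> (\<And>\<beta> j. \<beta> \<in> \<Phi> ==> j \<in> J ==> y' \<beta> j = 0) ==>
    \<exists>h :: 'g => 'g. hom_on (subgrp {y \<beta> i |\<beta> i. \<beta> \<in> \<Phi> \<and> i \<in> I}) h \<and>
      (\<forall>\<beta>\<in>\<Phi>. \<forall>i\<in>I. h (y \<beta> i) = y' \<beta> i)"
begin

definition Y :: "'g set" where "Y = subgrp {y \<beta> i |\<beta> i. \<beta> \<in> \<Phi> \<and> i \<in> I}"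

lemma y_Y: "\<beta> \<in> \<Phi> ==> i \<in> I ==> y \<beta> i \<in> Y" unfolding Y_def by (rule subgrp.gen) blast

lemma Y_add: "a \<in> Y ==> b \<in> Y ==> a + b \<in> Y" unfolding Y_def by (rule subgrp.add)
lemma Y_uminus: "a \<in> Y ==> - a \<in> Y" unfolding Y_def by (rule subgrp.uminus)

definition cj0 :: "'a => 'c => 'g => 'g" where
  "cj0 \<alpha> r = (SOME h. hom_on Y h \<and> (\<forall>\<beta>\<in>\<Phi>. \<forall>i\<in>I. h (y \<beta> i) = firm_conj.yc \<Phi> ip N I y \<alpha> r \<beta> i))"

lemma cj0:
  assumes "\<alpha> \<in> \<Phi>" "r \<in> A"
  shows "hom_on Y (cj0 \<alpha> r)" "\<beta> \<in> \<Phi> ==> i \<in> I ==> cj0 \<alpha> r (y \<beta> i) = firm_conj.yc \<Phi> ip N I y \<alpha> r \<beta> i"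
proof -
  interpret firm_conj \<Phi> ip N A I J y \<alpha> r by unfold_locales (fact assms)+
  have "\<exists>h. hom_on Y h \<and> (\<forall>\<beta>\<in>\<Phi>. \<forall>i\<in>I. h (y \<beta> i) = yc \<beta> i)"
    unfolding Y_def by (rule universal[OF yc_steinberg yc_J])
  from someI_ex[OF this] show "hom_on Y (cj0 \<alpha> r)"
    "\<beta> \<in> \<Phi> ==> i \<in> I ==> cj0 \<alpha> r (y \<beta> i) = firm_conj.yc \<Phi> ip N I y \<alpha> r \<beta> i" unfolding cj0_def by blast+
qed

text \<open>Extended by the identity outside \<open>Y\<close>, so as to become a permutation of the
  whole type.\<close>

definition cj :: "'a => 'c => 'g => 'g" where
  "cj \<alpha> r a = (if a \<in> Y then cj0 \<alpha> r a else a)"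

lemma cj_y:
  assumes "\<alpha> \<in> \<Phi>" "r \<in> A" "\<beta> \<in> \<Phi>" "i \<in> I"
  shows "ip \<alpha> \<beta> \<ge> 0 ==> cj \<alpha> r (y \<beta> i) = y \<beta> i"
    and "ip \<alpha> \<beta> = -1 ==> cj \<alpha> r (y \<beta> i) = y (\<alpha> + \<beta>) (of_int (N \<alpha> \<beta>) * r * i) + y \<beta> i"
proof -
  interpret firm_conj \<Phi> ip N A I J y \<alpha> r by unfold_locales (fact assms)+
  show "ip \<alpha> \<beta> \<ge> 0 ==> cj \<alpha> r (y \<beta> i) = y \<beta> i"
    "ip \<alpha> \<beta> = -1 ==> cj \<alpha> r (y \<beta> i) = y (\<alpha> + \<beta>) (of_int (N \<alpha> \<beta>) * r * i) + y \<beta> i"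
    using assms by (simp_all add: cj_def y_Y cj0 yc_y yc_Z Z_def)
qed

lemma y_decomp:
  assumes "\<beta> \<in> \<Phi>" "\<beta>' \<in> \<Phi>" "ip \<beta> \<beta>' = -1" "i \<in> I"
  obtains b c where "b \<in> I" "c \<in> I" "y (\<beta> + \<beta>') i = comm (y \<beta> b) (y \<beta>' c)"
proof -
  obtain b c where bc: "b \<in> I" "c \<in> I" "i = b * c" using factor[of i i] assms by blast
  let ?n = "of_int (N \<beta> \<beta>') :: 'c"
  have "y \<beta> b + y \<beta>' (?n * c) = y (\<beta> + \<beta>') (?n * b * (?n * c)) + y \<beta>' (?n * c) + y \<beta> b"
    using assms bc by (intro y_rel) (auto intro: closed)
  also have "?n * b * (?n * c) = ?n * (?n * (b * c))" by (simp only: mult_ac)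
  also have "... = i" using of_int_N_sq[of \<beta> \<beta>' "b * c"] assms bc by simp
  finally have "comm (y \<beta> b) (y \<beta>' (?n * c)) = y (\<beta> + \<beta>') i" by (rule commI)
  then show thesis using that[of b "?n * c"] bc by (auto intro: closed)
qed

lemma y_in_subgrp:
  assumes "\<beta> \<in> \<Phi>" "\<beta>' \<in> \<Phi>" "ip \<beta> \<beta>' = -1" "i \<in> I" "\<And>b. b \<in> I ==> y \<beta> b \<in> X" "\<And>b. b \<in> I ==> y \<beta>' b \<in> X"
  shows "y (\<beta> + \<beta>') i \<in> subgrp X"
proof -
  obtain b c where "b \<in> I" "c \<in> I" and eq: "y (\<beta> + \<beta>') i = comm (y \<beta> b) (y \<beta>' c)"
    by (rule y_decomp[OF assms(1-4)])
  then show ?thesis using assms(5)[of b] assms(6)[of c] unfolding eq comm_def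
    by (intro subgrp_minus subgrp.add subgrp.gen)
qed

text \<open>At roots other than -\<alpha> the map \<open>cj \<alpha> r\<close> has an explicit
  formula. Identities between such maps are checked on generators that avoid the opposite roots,
  which keeps the commutators behind \<open>T\<close> out of the computation.\<close>

definition avoid :: "'a set => 'g set" where
  "avoid B = {y \<beta> i |\<beta> i. \<beta> \<in> \<Phi> \<and> \<beta> \<notin> B \<and> i \<in> I}"

lemma Y_avoidI:
  assumes "\<And>\<delta>. \<delta> \<in> B ==> \<exists>\<beta>\<in>\<Phi> - B. \<exists>\<beta>'\<in>\<Phi> - B. ip \<beta> \<beta>' = -1 \<and> \<delta> = \<beta> + \<beta>'"
  shows "subgrp (avoid B) = Y"
proof
  show "subgrp (avoid B) \<subseteq> Y" 
    unfolding Y_def by (rule subgrp_subset, rule subgrp.gen) (auto simp: avoid_def)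
next
  have "y \<beta> i \<in> subgrp (avoid B)" if "\<beta> \<in> \<Phi>" "i \<in> I" for \<beta> i
  proof (cases "\<beta> \<in> B")
    case True
    then obtain \<gamma> \<gamma>' where "\<gamma> \<in> \<Phi> - B" "\<gamma>' \<in> \<Phi> - B" "ip \<gamma> \<gamma>' = -1" "\<beta> = \<gamma> + \<gamma>'" using assms by blast
    then show ?thesis using y_in_subgrp[of \<gamma> \<gamma>' i "avoid B"] that by (auto simp: avoid_def)
  next
    case False
    then show ?thesis using that by (intro subgrp.gen) (auto simp: avoid_def)
  qed
  then show "Y \<subseteq> subgrp (avoid B)"  unfolding Y_def by (intro subgrp_subset) auto
qed

lemma Y_avoid1: assumes "\<alpha> \<in> \<Phi>" shows "subgrp (avoid {- \<alpha>}) = Y"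
proof (rule Y_avoidI, goal_cases)
  case (1 \<delta>)
  obtain \<beta> \<beta>' where "\<beta> \<in> \<Phi>" "\<beta>' \<in> \<Phi>" "\<beta> + \<beta>' = - \<alpha>" "ip \<beta> \<beta>' = -1"
    "ip \<alpha> \<beta> = -1" "ip \<alpha> \<beta>' = -1" "\<beta> \<noteq> - \<alpha>" "\<beta>' \<noteq> - \<alpha>" using root_decomp[OF assms] by blast
  then show ?case using 1 by (intro bexI[of _ \<beta>] bexI[of _ \<beta>']) auto
qed

lemma Y_avoid2:
  assumes "\<alpha> \<in> \<Phi>" "\<alpha>' \<in> \<Phi>" shows "subgrp (avoid {- \<alpha>, - \<alpha>'}) = Y"
proof (rule Y_avoidI)
  have *: "\<exists>\<beta>\<in>\<Phi> - {- \<alpha>, - \<alpha>'}. \<exists>\<beta>'\<in>\<Phi> - {- \<alpha>, - \<alpha>'}. ip \<beta> \<beta>' = -1 \<and> - \<alpha> = \<beta> + \<beta>'"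
    if \<alpha>: "\<alpha> \<in> \<Phi>" for \<alpha> \<alpha>'
  proof -
    obtain \<beta> \<beta>' where b: "\<beta> \<in> \<Phi>" "\<beta>' \<in> \<Phi>" "\<beta> + \<beta>' = - \<alpha>" "ip \<beta> \<beta>' = -1"
      "ip \<alpha> \<beta> = -1" "ip \<alpha> \<beta>' = -1" "\<beta> \<noteq> - \<alpha>'" "\<beta>' \<noteq> - \<alpha>'" using root_decomp[OF \<alpha>] by blast
    moreover have "\<beta> \<noteq> - \<alpha>" "\<beta>' \<noteq> - \<alpha>" using b \<alpha> by (auto simp: ip_lin ip_self)
    ultimately show ?thesis by (intro bexI[of _ \<beta>] bexI[of _ \<beta>']) auto
  qed
  fix \<delta> assume "\<delta> \<in> {- \<alpha>, - \<alpha>'}"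
  then consider "\<delta> = - \<alpha>" | "\<delta> = - \<alpha>'" by blast
  then show "\<exists>\<beta>\<in>\<Phi> - {- \<alpha>, - \<alpha>'}. \<exists>\<beta>'\<in>\<Phi> - {- \<alpha>, - \<alpha>'}. ip \<beta> \<beta>' = -1 \<and> \<delta> = \<beta> + \<beta>'"
  proof cases
    case 1 then show ?thesis using *[OF assms(1), of \<alpha>'] by simp
  next
    case 2 then show ?thesis using *[OF assms(2), of \<alpha>] by (simp add: insert_commute)
  qed
qed

text \<open>Each of the three excluded roots is a sum of two others. \<open>root_decomp\<close> is
  told to miss one root of the A2 spanned by \<alpha> and \<alpha>'; the remaining ones are ruled
  out by their products or as partners of that root.\<close>

lemma Y_avoid3:
  assumes "\<alpha> \<in> \<Phi>" "\<alpha>' \<in> \<Phi>" "ip \<alpha> \<alpha>' = -1" shows "subgrp (avoid {- \<alpha>, - \<alpha>', - \<alpha> - \<alpha>'}) = Y"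
proof (rule Y_avoidI, goal_cases)
  case (1 \<delta>)
  let ?B = "{- \<alpha>, - \<alpha>', - \<alpha> - \<alpha>'}"
  note [simp] = ip_lin ip_self
  have sum: "\<alpha> + \<alpha>' \<in> \<Phi>" using add_root assms by blast
  have fin: ?case if "\<beta> \<in> \<Phi>" "\<beta>' \<in> \<Phi>" "ip \<beta> \<beta>' = -1" "\<delta> = \<beta> + \<beta>'" "\<beta> \<notin> ?B" "\<beta>' \<notin> ?B" for \<beta> \<beta>'
    using that by (intro bexI[of _ \<beta>] bexI[of _ \<beta>']) auto
  from 1 consider "\<delta> = - \<alpha>" | "\<delta> = - \<alpha>'" | "\<delta> = - (\<alpha> + \<alpha>')" by auto
  then show ?case
  proof cases
    case 1
    obtain \<beta> \<beta>' where b: "\<beta> \<in> \<Phi>" "\<beta>' \<in> \<Phi>" "\<beta> + \<beta>' = - \<alpha>" "ip \<beta> \<beta>' = -1"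
      "ip \<alpha> \<beta> = -1" "ip \<alpha> \<beta>' = -1" "\<beta> \<noteq> - \<alpha> - \<alpha>'" "\<beta>' \<noteq> - \<alpha> - \<alpha>'" using root_decomp[OF assms(1)] by blast
    then show ?thesis using 1 assms by (intro fin[of \<beta> \<beta>']) auto
  next
    case 2
    obtain \<beta> \<beta>' where b: "\<beta> \<in> \<Phi>" "\<beta>' \<in> \<Phi>" "\<beta> + \<beta>' = - \<alpha>'" "ip \<beta> \<beta>' = -1"
      "ip \<alpha>' \<beta> = -1" "ip \<alpha>' \<beta>' = -1" "\<beta> \<noteq> - \<alpha> - \<alpha>'" "\<beta>' \<noteq> - \<alpha> - \<alpha>'"
      using root_decomp[OF assms(2)] by blast
    then show ?thesis using 2 assms by (intro fin[of \<beta> \<beta>']) (auto simp: ip_sym[of \<alpha>' \<alpha>])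
  next
    case 3
    obtain \<beta> \<beta>' where b: "\<beta> \<in> \<Phi>" "\<beta>' \<in> \<Phi>" "\<beta> + \<beta>' = - (\<alpha> + \<alpha>')" "ip \<beta> \<beta>' = -1"
      "ip (\<alpha> + \<alpha>') \<beta> = -1" "ip (\<alpha> + \<alpha>') \<beta>' = -1" "\<beta> \<noteq> - \<alpha>" "\<beta>' \<noteq> - \<alpha>" using root_decomp[OF sum] by blast
    have "\<beta> \<noteq> - \<alpha>'" "\<beta>' \<noteq> - \<alpha>'" using b by (auto simp: algebra_simps)
    moreover have "\<beta> \<noteq> - \<alpha> - \<alpha>'" "\<beta>' \<noteq> - \<alpha> - \<alpha>'" using b assms by (auto simp: ip_sym[of \<alpha>' \<alpha>])
    ultimately show ?thesis using 3 b by (intro fin[of \<beta> \<beta>']) auto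
  qed
qed

lemma cj_hom: "\<alpha> \<in> \<Phi> ==> r \<in> A ==> hom_on Y (cj \<alpha> r)"
  using cj0(1)[of \<alpha> r] by (auto simp: hom_on_def cj_def Y_add)

lemma cj_add: "\<alpha> \<in> \<Phi> ==> r \<in> A ==> a \<in> Y ==> b \<in> Y ==> cj \<alpha> r (a + b) = cj \<alpha> r a + cj \<alpha> r b"
  using cj_hom unfolding hom_on_def by blast

lemma cj_Y:
  assumes "\<alpha> \<in> \<Phi>" "r \<in> A" "a \<in> Y" shows "cj \<alpha> r a \<in> Y"
proof -
  have "hom_on (subgrp (avoid {- \<alpha>})) (cj \<alpha> r)" using cj_hom Y_avoid1 assms by simp
  moreover have "cj \<alpha> r x \<in> Y" if x: "x \<in> avoid {- \<alpha>}" for x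
  proof -
    obtain \<beta> i where x: "x = y \<beta> i" "\<beta> \<in> \<Phi>" "\<beta> \<noteq> - \<alpha>" "i \<in> I" using x by (auto simp: avoid_def)
    then consider "ip \<alpha> \<beta> \<ge> 0" | "ip \<alpha> \<beta> = -1" using ip_vals[of \<alpha> \<beta>] ip_neg2[of \<alpha> \<beta>] assms by auto
    then show ?thesis
      by cases (use x assms add_root in \<open>auto simp: cj_y intro!: Y_add y_Y intro: closed\<close>)
  qed
  ultimately show ?thesis using hom_on_image[of "avoid {- \<alpha>}" "cj \<alpha> r" "{y \<beta> i |\<beta> i. \<beta> \<in> \<Phi> \<and> i \<in> I}" a]
      assms Y_avoid1[OF assms(1)] by (simp add: Y_def)
qed

end

section \<open>Steinberg relations between the conjugations\<close>

context simply_laced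
begin

text \<open>The relations of a semidirect product: \<open>z\<close> is a family over the module
  \<open>C\<close>, normalized by root elements \<open>x\<close> over \<open>A\<close>. For opposite
  roots nothing is prescribed.\<close>

definition module_family :: "'c::comm_ring_1 set => ('a => 'c => 'g::group_add) => 'c set => ('a => 'c => 'g) => bool" where
  "module_family A x C z \<longleftrightarrow>
     (\<forall>\<alpha>\<in>\<Phi>. \<forall>a\<in>C. \<forall>b\<in>C. z \<alpha> (a + b) = z \<alpha> a + z \<alpha> b) \<and>
     (\<forall>\<alpha>\<in>\<Phi>. \<forall>\<beta>\<in>\<Phi>. \<forall>a\<in>A. \<forall>b\<in>C. ip \<alpha> \<beta> \<ge> 0 --> commutes (x \<alpha> a) (z \<beta> b)) \<and>
     (\<forall>\<alpha>\<in>\<Phi>. \<forall>\<beta>\<in>\<Phi>. \<forall>a\<in>A. \<forall>b\<in>C. ip \<alpha> \<beta> = -1 -->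
        x \<alpha> a + z \<beta> b = z (\<alpha> + \<beta>) (of_int (N \<alpha> \<beta>) * a * b) + z \<beta> b + x \<alpha> a)"

lemma steinberg_module: "steinberg A x \<longleftrightarrow> module_family A x A x"
  by (simp add: steinberg_def module_family_def)

end

context universal_steinberg
begin

lemma Y_0: "0 \<in> Y" unfolding Y_def by (rule subgrp.zero)

lemma avoid_cases:
  assumes "x \<in> avoid B" "- \<alpha> \<in> B" "\<alpha> \<in> \<Phi>"
  obtains \<beta> i where "x = y \<beta> i" "\<beta> \<in> \<Phi>" "i \<in> I" "\<beta> \<notin> B" "ip \<alpha> \<beta> \<in> {-1, 0, 1, 2}"
  using assms ip_vals ip_neg2 by (fastforce simp: avoid_def)

lemma Y_comp_eq:
  assumes "hom_on Y h" "hom_on Y k" "subgrp (avoid B) = Y" "\<And>x. x \<in> avoid B ==> h x = k x" "a \<in> Y"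
  shows "h a = k a"
proof (rule hom_on_eq[of "avoid B" h k "avoid B"])
  show "avoid B \<subseteq> subgrp (avoid B)" by (auto intro: subgrp.gen)
qed (use assms in auto)

lemma hom_on_comp:
  assumes "\<alpha> \<in> \<Phi>" "r \<in> A" "hom_on Y h" shows "hom_on Y (\<lambda>x. h (cj \<alpha> r x))"
  using assms cj_add cj_Y unfolding hom_on_def by simp

lemma cj_mem: "a \<notin> Y ==> cj \<alpha> r a = a" by (simp add: cj_def)

lemma cj_plus:
  assumes "\<alpha> \<in> \<Phi>" "r \<in> A" "s \<in> A"
  shows "cj \<alpha> r (cj \<alpha> s a) = cj \<alpha> (r + s) a"
proof (cases "a \<in> Y")
  case True
  show ?thesis
  proof (rule Y_comp_eq[where B = "{- \<alpha>}", OF _ _ _ _ True])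
    show "hom_on Y (\<lambda>a. cj \<alpha> r (cj \<alpha> s a))" "hom_on Y (cj \<alpha> (r + s))" "subgrp (avoid {- \<alpha>}) = Y"
      using assms by (auto intro!: hom_on_comp cj_hom Y_avoid1 A_add)
    fix x assume "x \<in> avoid {- \<alpha>}"
    then obtain \<beta> i where x: "x = y \<beta> i" "\<beta> \<in> \<Phi>" "i \<in> I" "\<beta> \<notin> {- \<alpha>}" "ip \<alpha> \<beta> \<in> {-1, 0, 1, 2}"
      by (rule avoid_cases) (use assms in auto)
    have I: "of_int (N \<alpha> \<beta>) * s * i \<in> I" "of_int (N \<alpha> \<beta>) * r * i \<in> I"
       using assms x by (auto intro: closed)
    show "cj \<alpha> r (cj \<alpha> s x) = cj \<alpha> (r + s) x"
    proof (cases "ip \<alpha> \<beta> = -1")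
      case True
      have "y (\<alpha> + \<beta>) (of_int (N \<alpha> \<beta>) * (r + s) * i)
        = y (\<alpha> + \<beta>) (of_int (N \<alpha> \<beta>) * s * i) + y (\<alpha> + \<beta>) (of_int (N \<alpha> \<beta>) * r * i)"
        using y_add[OF add_root[OF assms(1) x(2) True] I] by (simp add: algebra_simps)
      then show ?thesis using True x assms I add_root[OF assms(1) x(2) True]
        by (simp add: cj_y cj_add y_Y A_add ip_lin ip_self add.assoc)
    next
      case False
      then show ?thesis using x assms by (auto simp add: cj_y A_add)
    qed
  qed
qed (simp add: cj_mem)

lemma cj_zero:
  assumes "\<alpha> \<in> \<Phi>" shows "cj \<alpha> 0 a = a"
proof (cases "a \<in> Y")
  case True
  show ?thesis
  proof (rule Y_comp_eq[where B = "{- \<alpha>}", OF _ _ _ _ True])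
    show "hom_on Y (\<lambda>a. a)" by (simp add: hom_on_def)
    show "hom_on Y (cj \<alpha> 0)" "subgrp (avoid {- \<alpha>}) = Y" using assms by (auto intro!: cj_hom Y_avoid1 A_0)
    fix x assume "x \<in> avoid {- \<alpha>}"
    then obtain \<beta> i where x: "x = y \<beta> i" "\<beta> \<in> \<Phi>" "i \<in> I" "\<beta> \<notin> {- \<alpha>}" "ip \<alpha> \<beta> \<in> {-1, 0, 1, 2}"
      by (rule avoid_cases) (use assms in auto)
    then show "cj \<alpha> 0 x = x" using assms add_root[of \<alpha> \<beta>] by (cases "ip \<alpha> \<beta> = -1") (auto simp: cj_y A_0)
  qed
qed (simp add: cj_mem)

lemma cj_bij: assumes "\<alpha> \<in> \<Phi>" "r \<in> A" shows "bij (cj \<alpha> r)"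
  by (rule o_bij[of "cj \<alpha> (- r)"]) (use assms in \<open>auto simp: fun_eq_iff cj_plus cj_zero A_uminus\<close>)

definition \<theta> :: "'a => 'c => 'g sym" where "\<theta> \<alpha> r = Sym (cj \<alpha> r)"

lemma ap_\<theta>: "\<alpha> \<in> \<Phi> ==> r \<in> A ==> ap (\<theta> \<alpha> r) = cj \<alpha> r" by (simp add: \<theta>_def ap_Sym cj_bij)

text \<open>The substantial case is that of orthogonal \<alpha> and \<alpha>' which both move
  \<beta>: both orders reach \<alpha> + \<alpha>' + \<beta>, with equal coefficients by the Jacobi
  identity.\<close>

lemma cj_commutes:
  assumes "\<alpha> \<in> \<Phi>" "\<alpha>' \<in> \<Phi>" "ip \<alpha> \<alpha>' \<ge> 0" "r \<in> A" "s \<in> A"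
  shows "cj \<alpha> r (cj \<alpha>' s a) = cj \<alpha>' s (cj \<alpha> r a)"
proof (cases "a \<in> Y")
  case True
  show ?thesis
  proof (rule Y_comp_eq[where B = "{- \<alpha>, - \<alpha>'}", OF _ _ _ _ True])
    show "hom_on Y (\<lambda>a. cj \<alpha> r (cj \<alpha>' s a))" "hom_on Y (\<lambda>a. cj \<alpha>' s (cj \<alpha> r a))"
      "subgrp (avoid {- \<alpha>, - \<alpha>'}) = Y" using assms by (auto intro!: hom_on_comp cj_hom Y_avoid2)
    fix x assume "x \<in> avoid {- \<alpha>, - \<alpha>'}"
    then obtain \<beta> i where x: "x = y \<beta> i" "\<beta> \<in> \<Phi>" "i \<in> I" "\<beta> \<notin> {- \<alpha>, - \<alpha>'}" "ip \<alpha> \<beta> \<in> {-1, 0, 1, 2}"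
      by (rule avoid_cases) (use assms in auto)
    then have x': "ip \<alpha>' \<beta> \<in> {-1, 0, 1, 2}" using ip_vals[of \<alpha>' \<beta>] ip_neg2[of \<alpha>' \<beta>] assms by auto
    have s: "ip \<alpha>' \<alpha> = ip \<alpha> \<alpha>'" by (rule ip_sym)
    note S = cj_y cj_add y_Y Y_add ip_lin ip_self s
    have I: "of_int (N \<alpha>' \<beta>) * s * i \<in> I" "of_int (N \<alpha> \<beta>) * r * i \<in> I"
       using assms x by (auto intro: closed)
    consider "ip \<alpha> \<beta> = -1" "ip \<alpha>' \<beta> = -1" "ip \<alpha> \<alpha>' = 0"
      | "ip \<alpha> \<beta> = -1" "ip \<alpha>' \<beta> = -1" "ip \<alpha> \<alpha>' \<ge> 1"
      | "ip \<alpha> \<beta> = -1" "ip \<alpha>' \<beta> \<ge> 0" | "ip \<alpha> \<beta> \<ge> 0" "ip \<alpha>' \<beta> = -1" | "ip \<alpha> \<beta> \<ge> 0" "ip \<alpha>' \<beta> \<ge> 0"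
      using x x' assms ip_vals[of \<alpha> \<alpha>'] by auto
    then show "cj \<alpha> r (cj \<alpha>' s x) = cj \<alpha>' s (cj \<alpha> r x)"
    proof cases
      case 1
      have rt: "\<alpha> + \<beta> \<in> \<Phi>" "\<alpha>' + \<beta> \<in> \<Phi>" using 1 assms x add_root by auto
      have "\<alpha> + (\<alpha>' + \<beta>) \<in> \<Phi>" by (rule add_root) (use 1 assms rt in \<open>auto simp: ip_lin\<close>)
      moreover have eq: "\<alpha>' + (\<alpha> + \<beta>) = \<alpha> + (\<alpha>' + \<beta>)" by (simp add: add_ac)
      ultimately have rt': "\<alpha>' + (\<alpha> + \<beta>) \<in> \<Phi>" by (simp only:)
      let ?n = "\<lambda>x y. of_int (N x y) :: 'c"
      have "?n \<alpha> \<beta> * ?n (\<alpha> + \<beta>) \<alpha>' = ?n \<beta> \<alpha>' * ?n \<alpha> (\<beta> + \<alpha>')"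
        by (rule of_int_jacobi) (use 1 assms x in \<open>auto simp: ip_sym[of \<beta> \<alpha>']\<close>)
      moreover have "?n (\<alpha> + \<beta>) \<alpha>' = - ?n \<alpha>' (\<alpha> + \<beta>)" "?n \<beta> \<alpha>' = - ?n \<alpha>' \<beta>"
        by (rule of_int_anti; use 1 assms x rt s in \<open>auto simp: ip_lin\<close>)+
      ultimately have J: "?n \<alpha>' (\<alpha> + \<beta>) * ?n \<alpha> \<beta> = ?n \<alpha> (\<alpha>' + \<beta>) * ?n \<alpha>' \<beta>"
        by (simp add: add.commute mult.commute)
      have c: "?n \<alpha>' (\<alpha> + \<beta>) * s * (?n \<alpha> \<beta> * r * i) = ?n \<alpha> (\<alpha>' + \<beta>) * r * (?n \<alpha>' \<beta> * s * i)" (is "?l = ?r")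
      proof -
        have "?l = (?n \<alpha>' (\<alpha> + \<beta>) * ?n \<alpha> \<beta>) * (r * s * i)" by (simp only: mult_ac)
        also have "... = ?r" unfolding J by (simp only: mult_ac)
        finally show ?thesis .
      qed
      have cm: "commutes (y (\<alpha>' + \<beta>) (?n \<alpha>' \<beta> * s * i)) (y (\<alpha> + \<beta>) (?n \<alpha> \<beta> * r * i))"
        by (rule y_commutes) (use 1 x(2,3) rt I in \<open>auto simp: ip_lin ip_self ip_sym[of \<beta> \<alpha>] ip_sym[of \<alpha>' \<alpha>]\<close>)
      show ?thesis
      proof -
        have I': "?n \<alpha> (\<alpha>' + \<beta>) * r * (?n \<alpha>' \<beta> * s * i) \<in> I" using I assms by (auto intro: closed)
        have "cj \<alpha> r (cj \<alpha>' s x) = y (\<alpha> + (\<alpha>' + \<beta>)) (?n \<alpha> (\<alpha>' + \<beta>) * r * (?n \<alpha>' \<beta> * s * i))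
            + y (\<alpha>' + \<beta>) (?n \<alpha>' \<beta> * s * i) + (y (\<alpha> + \<beta>) (?n \<alpha> \<beta> * r * i) + y \<beta> i)"
          using 1 x(1-3) assms rt I by (simp add: S)
        moreover have "cj \<alpha>' s (cj \<alpha> r x) = y (\<alpha>' + (\<alpha> + \<beta>)) (?n \<alpha>' (\<alpha> + \<beta>) * s * (?n \<alpha> \<beta> * r * i))
            + y (\<alpha> + \<beta>) (?n \<alpha> \<beta> * r * i) + (y (\<alpha>' + \<beta>) (?n \<alpha>' \<beta> * s * i) + y \<beta> i)"
          using 1 x(1-3) assms rt I by (simp add: S)
        ultimately show ?thesis unfolding c eq by (simp only: add.assoc commutes_left_commute[OF cm])
      qed
    next
      case 2
      have rt: "\<alpha> + \<beta> \<in> \<Phi>" "\<alpha>' + \<beta> \<in> \<Phi>" using 2 assms x add_root by auto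
      have cm: "commutes (y (\<alpha>' + \<beta>) (of_int (N \<alpha>' \<beta>) * s * i)) (y (\<alpha> + \<beta>) (of_int (N \<alpha> \<beta>) * r * i))"
        by (rule y_commutes) (use 2 x(2,3) rt I in \<open>auto simp: ip_lin ip_self ip_sym[of \<beta> \<alpha>] ip_sym[of \<alpha>' \<alpha>]\<close>)
      show ?thesis using 2 x assms rt I by (simp add: S commutes_left_commute[OF cm])
    next
      case 3
      have rt: "\<alpha> + \<beta> \<in> \<Phi>" using 3 assms x add_root by auto
      show ?thesis using 3 x assms rt I by (simp add: S)
    next
      case 4
      have rt: "\<alpha>' + \<beta> \<in> \<Phi>" using 4 assms x add_root by auto
      show ?thesis using 4 x assms rt I by (simp add: S)
    next
      case 5
      then show ?thesis using x assms by (simp add: S)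
    qed
  qed
qed (simp add: cj_mem)

lemma cj_rel:
  assumes "\<alpha> \<in> \<Phi>" "\<alpha>' \<in> \<Phi>" "ip \<alpha> \<alpha>' = -1" "r \<in> A" "s \<in> A"
  shows "cj \<alpha> r (cj \<alpha>' s a) = cj (\<alpha> + \<alpha>') (of_int (N \<alpha> \<alpha>') * r * s) (cj \<alpha>' s (cj \<alpha> r a))"
proof (cases "a \<in> Y")
  case True
  let ?t = "of_int (N \<alpha> \<alpha>') * r * s"
  have sum: "\<alpha> + \<alpha>' \<in> \<Phi>" using add_root assms by blast
  have tA: "?t \<in> A" using assms by (auto intro: closed)
  let ?B = "{- \<alpha>, - \<alpha>', - \<alpha> - \<alpha>'}"
  show ?thesis
  proof (rule Y_comp_eq[where B = ?B, OF _ _ _ _ True])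
    show "hom_on Y (\<lambda>a. cj \<alpha> r (cj \<alpha>' s a))" using assms by (intro hom_on_comp cj_hom)
    show "subgrp (avoid ?B) = Y" by (rule Y_avoid3[OF assms(1-3)])
    have "hom_on Y (\<lambda>a. cj (\<alpha> + \<alpha>') ?t (cj \<alpha>' s a))" using assms sum tA by (intro hom_on_comp cj_hom)
    from hom_on_comp[OF assms(1,4) this] show "hom_on Y (\<lambda>a. cj (\<alpha> + \<alpha>') ?t (cj \<alpha>' s (cj \<alpha> r a)))" .
    fix x assume "x \<in> avoid ?B"
    then obtain \<beta> i where x: "x = y \<beta> i" "\<beta> \<in> \<Phi>" "i \<in> I" "\<beta> \<notin> ?B" "ip \<alpha> \<beta> \<in> {-1, 0, 1, 2}"
      by (rule avoid_cases) (use assms in auto)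
    then have x': "ip \<alpha>' \<beta> \<in> {-1, 0, 1, 2}" using ip_vals[of \<alpha>' \<beta>] ip_neg2[of \<alpha>' \<beta>] assms by auto
    \<comment> \<open>If both products were -1, then \<beta> would be -\<alpha> - \<alpha>', which
      the chosen generators avoid.\<close>
    have "ip (\<alpha> + \<alpha>') \<beta> \<noteq> -2" using ip_neg2[OF sum x(2)] x(4) by auto
    then have x'': "\<not> (ip \<alpha> \<beta> = -1 \<and> ip \<alpha>' \<beta> = -1)" by (simp add: ip_lin)
    have s: "ip \<alpha>' \<alpha> = -1" using assms by (simp add: ip_sym)
    note S = cj_y cj_add y_Y Y_add ip_lin ip_self s assms x(1-3) sum tA
    have I: "of_int (N \<alpha>' \<beta>) * s * i \<in> I" "of_int (N \<alpha> \<beta>) * r * i \<in> I"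
       using assms x by (auto intro: closed)
    let ?n = "\<lambda>x y. of_int (N x y) :: 'c"
    consider "ip \<alpha> \<beta> = -1" "ip \<alpha>' \<beta> = 0" | "ip \<alpha> \<beta> = -1" "ip \<alpha>' \<beta> \<ge> 1"
      | "ip \<alpha> \<beta> = 0" "ip \<alpha>' \<beta> = -1" | "ip \<alpha> \<beta> \<ge> 1" "ip \<alpha>' \<beta> = -1" | "ip \<alpha> \<beta> \<ge> 0" "ip \<alpha>' \<beta> \<ge> 0"
      using x x' x'' by auto
    then show "cj \<alpha> r (cj \<alpha>' s x) = cj (\<alpha> + \<alpha>') ?t (cj \<alpha>' s (cj \<alpha> r x))"
    proof cases
      case 1
      have rt: "\<alpha> + \<beta> \<in> \<Phi>" using 1 assms x add_root by auto
      have rt': "\<alpha>' + (\<alpha> + \<beta>) \<in> \<Phi>" by (rule add_root) (use 1 assms rt s in \<open>auto simp: ip_lin\<close>)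
      have eq: "\<alpha> + (\<alpha>' + \<beta>) = \<alpha>' + (\<alpha> + \<beta>)" by (simp add: add_ac)
      have "?n \<alpha>' \<alpha> * ?n (\<alpha>' + \<alpha>) \<beta> = ?n \<alpha> \<beta> * ?n \<alpha>' (\<alpha> + \<beta>)"
        by (rule of_int_jacobi) (use 1 assms x s in auto)
      moreover have "?n \<alpha>' \<alpha> = - ?n \<alpha> \<alpha>'" by (rule of_int_anti) (use assms in auto)
      ultimately have "- (?n \<alpha> \<alpha>' * ?n (\<alpha> + \<alpha>') \<beta>) = ?n \<alpha> \<beta> * ?n \<alpha>' (\<alpha> + \<beta>)" by (simp add: add.commute)
      then have J: "?n (\<alpha> + \<alpha>') \<beta> * ?n \<alpha> \<alpha>' = - (?n \<alpha> \<beta> * ?n \<alpha>' (\<alpha> + \<beta>))"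
        by (metis minus_minus mult.commute)
      have "?n (\<alpha> + \<alpha>') \<beta> * ?t * i = (?n (\<alpha> + \<alpha>') \<beta> * ?n \<alpha> \<alpha>') * (r * s * i)" by (simp only: mult_ac)
      also have "... = - (?n \<alpha>' (\<alpha> + \<beta>) * s * (?n \<alpha> \<beta> * r * i))" unfolding J by (simp add: mult_ac)
      finally have c: "?n (\<alpha> + \<alpha>') \<beta> * ?t * i = - (?n \<alpha>' (\<alpha> + \<beta>) * s * (?n \<alpha> \<beta> * r * i))" .
      have I': "?n \<alpha>' (\<alpha> + \<beta>) * s * (?n \<alpha> \<beta> * r * i) \<in> I" using I assms by (auto intro: closed)
      have cm: "commutes (y (\<alpha> + \<beta>) (?n \<alpha> \<beta> * r * i)) (y (\<alpha>' + (\<alpha> + \<beta>)) (?n \<alpha>' (\<alpha> + \<beta>) * s * (?n \<alpha> \<beta> * r * i)))"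
        by (rule y_commutes) (use 1 x(2,3) rt rt' I I' s assms(1-3) in \<open>auto simp: ip_lin ip_self ip_sym[of \<beta> \<alpha>] ip_sym[of \<beta> \<alpha>']\<close>)
      note cm' = commutes_left_commute[OF commutes_minus_right[OF cm]]
      show ?thesis
        using 1 rt rt' I I' by (simp add: S c eq y_uminus add.assoc cm' del: add_uminus_conv_diff)
    next
      case 2
      have rt: "\<alpha> + \<beta> \<in> \<Phi>" using 2 assms x add_root by auto
      show ?thesis using 2 rt I by (simp add: S)
    next
      case 3
      have rt: "\<alpha>' + \<beta> \<in> \<Phi>" using 3 assms x add_root by auto
      have rt': "\<alpha> + (\<alpha>' + \<beta>) \<in> \<Phi>" by (rule add_root) (use 3 assms rt s in \<open>auto simp: ip_lin\<close>)
      have eq: "\<alpha> + \<alpha>' + \<beta> = \<alpha> + (\<alpha>' + \<beta>)" by (simp add: add_ac)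
      have J: "?n \<alpha> \<alpha>' * ?n (\<alpha> + \<alpha>') \<beta> = ?n \<alpha>' \<beta> * ?n \<alpha> (\<alpha>' + \<beta>)"
        by (rule of_int_jacobi) (use 3 assms x s in auto)
      have "?n (\<alpha> + \<alpha>') \<beta> * ?t * i = (?n \<alpha> \<alpha>' * ?n (\<alpha> + \<alpha>') \<beta>) * (r * s * i)" by (simp only: mult_ac)
      also have "... = ?n \<alpha> (\<alpha>' + \<beta>) * r * (?n \<alpha>' \<beta> * s * i)" unfolding J by (simp add: mult_ac)
      finally have c: "?n (\<alpha> + \<alpha>') \<beta> * ?t * i = ?n \<alpha> (\<alpha>' + \<beta>) * r * (?n \<alpha>' \<beta> * s * i)" .
      have I': "?n \<alpha> (\<alpha>' + \<beta>) * r * (?n \<alpha>' \<beta> * s * i) \<in> I" using I assms by (auto intro: closed)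
      have cm: "commutes (y (\<alpha>' + \<beta>) (?n \<alpha>' \<beta> * s * i)) (y (\<alpha> + (\<alpha>' + \<beta>)) (?n \<alpha> (\<alpha>' + \<beta>) * r * (?n \<alpha>' \<beta> * s * i)))"
        by (rule y_commutes) (use 3 x(2,3) rt rt' I I' s assms(1-3) in \<open>auto simp: ip_lin ip_self ip_sym[of \<beta> \<alpha>] ip_sym[of \<beta> \<alpha>']\<close>)
      show ?thesis using 3 rt rt' I I' by (simp add: S c eq add.assoc commutes_left_commute[OF cm])
    next
      case 4
      have rt: "\<alpha>' + \<beta> \<in> \<Phi>" using 4 assms x add_root by auto
      show ?thesis using 4 rt I by (simp add: S)
    next
      case 5
      then show ?thesis by (simp add: S)
    qed
  qed
qed (simp add: cj_mem)

lemma \<theta>_steinberg: "steinberg A \<theta>" unfolding steinberg_def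
proof (intro conjI ballI impI sym_eqI)
  fix \<alpha> \<beta> a b x assume *: "\<alpha> \<in> \<Phi>" "\<beta> \<in> \<Phi>" "a \<in> A" "b \<in> A"
  show "ap (\<theta> \<alpha> (a + b)) x = ap (\<theta> \<alpha> a + \<theta> \<alpha> b) x" using * by (simp add: ap_\<theta> A_add cj_plus)
  show "ap (\<theta> \<alpha> a + \<theta> \<beta> b) x = ap (\<theta> \<beta> b + \<theta> \<alpha> a) x" if "ip \<alpha> \<beta> \<ge> 0"
    using cj_commutes[of \<alpha> \<beta> a b x] * that by (simp add: ap_\<theta>)
  show "ap (\<theta> \<alpha> a + \<theta> \<beta> b) x = ap (\<theta> (\<alpha> + \<beta>) (of_int (N \<alpha> \<beta>) * a * b) + \<theta> \<beta> b + \<theta> \<alpha> a) x" if "ip \<alpha> \<beta> = -1"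
  proof -
    have "of_int (N \<alpha> \<beta>) * a * b \<in> A" using * by (auto intro: closed)
    then show ?thesis using cj_rel[of \<alpha> \<beta> a b x] * that by (simp add: ap_\<theta> add_root)
  qed
qed

text \<open>Where r maps \<open>I\<close> into \<open>J\<close>, the factor that conjugation adds to
  a generator vanishes.\<close>

lemma \<theta>_J: 
  assumes "\<alpha> \<in> \<Phi>" "r \<in> A" "\<And>i. i \<in> I ==> r * i \<in> J"
  shows "\<theta> \<alpha> r = 0"
proof (rule sym_eqI)
  fix a
  have "cj \<alpha> r a = a"
  proof (cases "a \<in> Y")
    case True
    show ?thesis
    proof (rule Y_comp_eq[where B = "{- \<alpha>}", OF _ _ _ _ True])
      show "hom_on Y (\<lambda>a. a)" by (simp add: hom_on_def)
      show "hom_on Y (cj \<alpha> r)" "subgrp (avoid {- \<alpha>}) = Y"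
        using assms by (auto intro!: cj_hom Y_avoid1 A_0)
      fix x assume "x \<in> avoid {- \<alpha>}"
      then obtain \<beta> i where x: "x = y \<beta> i" "\<beta> \<in> \<Phi>" "i \<in> I" "\<beta> \<notin> {- \<alpha>}" "ip \<alpha> \<beta> \<in> {-1, 0, 1, 2}"
        by (rule avoid_cases) (use assms in auto)
      have "of_int (N \<alpha> \<beta>) * r * i \<in> J" using AJ[OF A_int assms(3)[OF x(3)], of "N \<alpha> \<beta>"] by (simp add: mult.assoc)
      with x show "cj \<alpha> r x = x" using assms add_root[of \<alpha> \<beta>] by (cases "ip \<alpha> \<beta> = -1") (auto simp: cj_y y_J)
    qed
  qed (simp add: cj_mem)
  then show "ap (\<theta> \<alpha> r) a = ap 0 a" using assms by (simp add: ap_\<theta>)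
qed

text \<open>Left translations by \<open>Y\<close> live in the same permutation group as the
  conjugations; together they realize the semidirect product of \<open>Y\<close> with the acting
  group.\<close>

definition tr :: "'g => 'g sym" where
  "tr a = Sym (\<lambda>g. if g \<in> Y then a + g else g)"

lemma ap_tr:
  assumes "a \<in> Y" shows "ap (tr a) g = (if g \<in> Y then a + g else g)"
proof -
  have "bij (\<lambda>g. if g \<in> Y then a + g else g)" by (rule o_bij[of "\<lambda>g. if g \<in> Y then - a + g else g"])
      (use assms in \<open>auto simp: fun_eq_iff Y_add Y_uminus\<close>)
  then show ?thesis by (simp add: tr_def ap_Sym)
qed

lemma tr_add: "a \<in> Y ==> b \<in> Y ==> tr (a + b) = tr a + tr b"
  by (rule sym_eqI) (auto simp: ap_tr Y_add add.assoc)

lemma tr_inj: "a \<in> Y ==> b \<in> Y ==> tr a = tr b ==> a = b" by (metis Y_0 add.right_neutral ap_tr)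

lemma \<theta>_tr:
  assumes "\<alpha> \<in> \<Phi>" "r \<in> A" "a \<in> Y"
  shows "\<theta> \<alpha> r + tr a = tr (cj \<alpha> r a) + \<theta> \<alpha> r"
proof (rule sym_eqI)
  fix g
  show "ap (\<theta> \<alpha> r + tr a) g = ap (tr (cj \<alpha> r a) + \<theta> \<alpha> r) g"
    using assms by (cases "g \<in> Y") (auto simp: ap_\<theta> ap_tr cj_Y cj_add Y_add cj_mem)
qed

lemma tr_module: "module_family A \<theta> I (\<lambda>\<beta> i. tr (y \<beta> i))" unfolding module_family_def
proof (intro conjI ballI impI)
  fix \<alpha> \<beta> a b assume *: "\<alpha> \<in> \<Phi>" "\<beta> \<in> \<Phi>" "a \<in> A" "b \<in> I" "ip \<alpha> \<beta> = -1"
  then have "of_int (N \<alpha> \<beta>) * a * b \<in> I" "\<alpha> + \<beta> \<in> \<Phi>" by (auto intro: closed add_root)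
  then show "\<theta> \<alpha> a + tr (y \<beta> b) = tr (y (\<alpha> + \<beta>) (of_int (N \<alpha> \<beta>) * a * b)) + tr (y \<beta> b) + \<theta> \<alpha> a"
    using * by (simp add: \<theta>_tr y_Y cj_y tr_add)
qed (simp_all add: y_add tr_add y_Y \<theta>_tr cj_y)

end

section \<open>Gauss decomposition over a local ring\<close>

lemma conj_add: "cjg g (a + b) = cjg g a + cjg g b"
  by (simp add: cjg_def add.assoc diff_conv_add_uminus del: add_uminus_conv_diff)

lemma conj_0 [simp]: "cjg g 0 = 0" by (simp add: cjg_def)

lemma conj_uminus: "cjg g (- a) = - cjg g a"
  by (simp add: cjg_def add.assoc diff_conv_add_uminus minus_add del: add_uminus_conv_diff)

lemma conj_conj: "cjg (g + h) a = cjg g (cjg h a)"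
  by (simp add: cjg_def add.assoc diff_conv_add_uminus minus_add del: add_uminus_conv_diff)

lemma conj_move: "g + a = cjg g a + g"
  by (simp add: cjg_def add.assoc diff_conv_add_uminus del: add_uminus_conv_diff)

lemma conj_comm: "cjg g (comm a b) = comm (cjg g a) (cjg g b)"
  by (simp add: comm_def conj_add conj_uminus diff_conv_add_uminus del: add_uminus_conv_diff)

lemma conj_eqI: "g + a = b + g ==> cjg g a = b" by (simp add: cjg_def diff_eq_eq)

lemma conj_0_left [simp]: "cjg 0 a = a" by (simp add: cjg_def)

lemma conj_uminus_conj [simp]: "cjg (- g) (cjg g a) = a" using conj_conj[of "- g" g a] by simp

lemma conj_subgrp:
  assumes "\<And>x. x \<in> X ==> cjg g x \<in> subgrp X'" "a \<in> subgrp X"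
  shows "cjg g a \<in> subgrp X'"
  using assms(2) by induction (auto simp: conj_add conj_uminus intro: subgrp.intros(1,3,4) assms(1))

lemma subgrp_left_induct:
  assumes "g \<in> subgrp X" "P 0" "\<And>x g. x \<in> X ==> P g ==> P (x + g)" "\<And>x. x \<in> X ==> - x \<in> X"
  shows "P g"
proof -
  \<comment> \<open>Multiplication by g and by -g is treated at once, since passing to an inverse
    swaps the two claims.\<close>
  have "(\<forall>k. P k --> P (g + k)) \<and> (\<forall>k. P k --> P (- g + k))" using assms(1)
  proof induction
    case (add x y)
    then show ?case by (simp add: add.assoc minus_add del: add_uminus_conv_diff uminus_add_conv_diff)
  qed (use assms(3,4) in auto)
  then show ?thesis using assms(2) by (metis add.right_neutral)
qed

context simply_laced
begin

text \<open>Positivity comes from a functional f. The clause on differences is exactly what keeps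
  the positive unipotent group without \<alpha> stable under the root subgroup of -\<alpha>.\<close>

definition simple :: "('a => real) => 'a => bool" where
  "simple f \<alpha> \<longleftrightarrow> \<alpha> \<in> \<Phi> \<and> f \<alpha> > 0 \<and> (\<forall>\<beta>\<in>\<Phi>. f \<beta> > 0 \<and> \<beta> \<noteq> \<alpha> \<and> \<beta> - \<alpha> \<in> \<Phi> --> f (\<beta> - \<alpha>) > 0)"

text \<open>Injectivity on the roots orders them totally, so that a product of positive root
  elements can be taken apart one root at a time.\<close>

definition height :: "('a => real) => bool" where
  "height f \<longleftrightarrow> (\<forall>v w. f (v + w) = f v + f w) \<and> (\<forall>\<beta>\<in>\<Phi>. f \<beta> \<noteq> 0) \<and> inj_on f \<Phi> \<and>
     (\<forall>\<beta>\<in>\<Phi>. f \<beta> > 0 \<and> \<not> simple f \<beta> --> (\<exists>\<alpha>. simple f \<alpha> \<and> \<beta> - \<alpha> \<in> \<Phi> \<and> ip \<alpha> (\<beta> - \<alpha>) = -1))"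

end

text \<open>\<open>x\<close> are root elements over \<open>A\<close> and \<open>z\<close> is a
  module normalized by them. Locality reads: a is a unit or lies in the Jacobson radical. The module
  accompanies the decomposition because the torus factor must be controlled on it as well.\<close>

locale local_family = simply_laced \<Phi> ip N
  for \<Phi> :: "'a::ab_group_add set" and ip N +
  fixes A I :: "'c::comm_ring_1 set" and x z :: "'a => 'c => 'g::group_add"
  assumes A_1: "1 \<in> A" and A_add: "a \<in> A ==> b \<in> A ==> a + b \<in> A"
    and A_mult: "a \<in> A ==> b \<in> A ==> a * b \<in> A" and A_uminus: "a \<in> A ==> - a \<in> A"
    and I_add: "i \<in> I ==> j \<in> I ==> i + j \<in> I" and I_0: "0 \<in> I"
    and AI: "a \<in> A ==> i \<in> I ==> a * i \<in> I"
    and local: "a \<in> A ==> (\<exists>u\<in>A. a * u = 1) \<or> (\<forall>b\<in>A. \<exists>u\<in>A. (1 + a * b) * u = 1)"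
    and x_module: "module_family A x A x" and z_module: "module_family A x I z"
    and z_commutes: "\<beta> \<in> \<Phi> ==> \<gamma> \<in> \<Phi> ==> ip \<beta> \<gamma> \<ge> 0 ==> i \<in> I ==> j \<in> I ==> commutes (z \<beta> i) (z \<gamma> j)"
begin

lemma A_0: "0 \<in> A" using A_add[OF A_1 A_uminus[OF A_1]] by simp
lemma A_nat: "of_nat k \<in> A" by (induction k) (auto intro: A_0 A_add A_1)
lemma A_int: "of_int k \<in> A" by (cases k) (auto intro: A_nat A_uminus simp flip: of_nat_Suc)
lemmas closedA = A_1 A_0 A_add A_mult A_uminus A_int

text \<open>Both families obey the same formulas under conjugation by \<open>x\<close>; this
  predicate lets them be treated together.\<close>

definition fam :: "'c set => ('a => 'c => 'g) => bool" where
  "fam C y \<longleftrightarrow> (C = A \<and> y = x) \<or> (C = I \<and> y = z)"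

lemma fam_x: "fam A x" and fam_z: "fam I z" by (simp_all add: fam_def)

lemma fam_closed:
  assumes "fam C y"
  shows "c \<in> C ==> d \<in> C ==> c + d \<in> C" "0 \<in> C" "a \<in> A ==> c \<in> C ==> a * c \<in> C"
  using assms A_add I_add A_0 I_0 A_mult AI unfolding fam_def by auto

lemma fam_module: "fam C y ==> module_family A x C y" using x_module z_module by (auto simp: fam_def)

lemma fam_add: "fam C y ==> \<beta> \<in> \<Phi> ==> c \<in> C ==> d \<in> C ==> y \<beta> (c + d) = y \<beta> c + y \<beta> d"
  using fam_module unfolding module_family_def by blast

lemma fam_0 [simp]: "fam C y ==> \<beta> \<in> \<Phi> ==> y \<beta> 0 = 0"
  using fam_add[of C y \<beta> 0 0] fam_closed(2)[of C y] by (metis add.right_neutral add_left_imp_eq)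

lemma conj_fam_0:
  "fam C y ==> \<alpha> \<in> \<Phi> ==> \<beta> \<in> \<Phi> ==> ip \<alpha> \<beta> \<ge> 0 ==> a \<in> A ==> c \<in> C ==> cjg (x \<alpha> a) (y \<beta> c) = y \<beta> c"
  using fam_module unfolding module_family_def by (intro conj_eqI) blast

lemma conj_fam:
  "fam C y ==> \<alpha> \<in> \<Phi> ==> \<beta> \<in> \<Phi> ==> ip \<alpha> \<beta> = -1 ==> a \<in> A ==> c \<in> C ==>
     cjg (x \<alpha> a) (y \<beta> c) = y (\<alpha> + \<beta>) (of_int (N \<alpha> \<beta>) * a * c) + y \<beta> c"
  using fam_module unfolding module_family_def by (intro conj_eqI) blast

lemma x_uminus: "\<alpha> \<in> \<Phi> ==> a \<in> A ==> x \<alpha> (- a) = - x \<alpha> a"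
  using fam_add[OF fam_x, of \<alpha> "- a" a] fam_0[OF fam_x, of \<alpha>] A_uminus[of a] by (simp add: eq_neg_iff_add_eq_0)

lemma fam_decomp:
  assumes "fam C y" "\<beta> \<in> \<Phi>" "\<beta>' \<in> \<Phi>" "ip \<beta> \<beta>' = -1" "c \<in> C"
  shows "y (\<beta> + \<beta>') c = comm (x \<beta> (of_int (N \<beta> \<beta>'))) (y \<beta>' c)"
proof -
  let ?n = "of_int (N \<beta> \<beta>') :: 'c"
  have "x \<beta> ?n + y \<beta>' c = y (\<beta> + \<beta>') (?n * ?n * c) + y \<beta>' c + x \<beta> ?n"
    using fam_module[OF assms(1)] assms A_int unfolding module_family_def by blast
  also have "?n * ?n * c = c" using of_int_N_sq[OF assms(2-4), of c] by (simp add: mult.assoc)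
  finally show ?thesis by (intro commI[symmetric])
qed

text \<open>The subgroup generated by the root subgroups of \<open>\<alpha>\<close> and \<open>- \<alpha>\<close> acts on \<open>e \<alpha> \<beta> y p q\<close> as
  $2\times 2$ matrices act on the column vector $(p,q)$.\<close>

definition e :: "'a => 'a => ('a => 'c => 'g) => 'c => 'c => 'g" where
  "e \<alpha> \<beta> y p q = y \<beta> p + y (\<alpha> + \<beta>) q"

lemma fam_commutes:
  assumes "fam C y" "\<beta> \<in> \<Phi>" "\<gamma> \<in> \<Phi>" "ip \<beta> \<gamma> \<ge> 0" "c \<in> C" "d \<in> C"
  shows "commutes (y \<beta> c) (y \<gamma> d)"
  using assms x_module z_commutes unfolding fam_def module_family_def by blast

lemma conj_e_pos:
  assumes "fam C y" "\<alpha> \<in> \<Phi>" "\<beta> \<in> \<Phi>" "ip \<alpha> \<beta> = -1" "a \<in> A" "p \<in> C" "q \<in> C"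
  shows "cjg (x \<alpha> a) (e \<alpha> \<beta> y p q) = e \<alpha> \<beta> y p (q + of_int (N \<alpha> \<beta>) * a * p)"
proof -
  note [simp] = ip_lin ip_self ip_sym[of \<beta> \<alpha>]
  have rt: "\<alpha> + \<beta> \<in> \<Phi>" using add_root assms by blast
  let ?m = "of_int (N \<alpha> \<beta>) * a * p"
  have m: "?m \<in> C" by (intro fam_closed(3)[OF assms(1)] A_mult A_int assms(5,6))
  have cm: "commutes (y (\<alpha> + \<beta>) ?m) (y \<beta> p)" using assms rt m by (intro fam_commutes) auto
  have "cjg (x \<alpha> a) (e \<alpha> \<beta> y p q) = y (\<alpha> + \<beta>) ?m + y \<beta> p + y (\<alpha> + \<beta>) q"
    using conj_fam[OF assms(1-6)] conj_fam_0[OF assms(1,2) rt _ assms(5,7)] assms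
    by (simp add: e_def conj_add)
  also have "... = y \<beta> p + y (\<alpha> + \<beta>) (?m + q)"
    unfolding cm fam_add[OF assms(1) rt m assms(7)] by (simp only: add.assoc)
  finally show ?thesis by (simp add: e_def add.commute)
qed

lemma conj_e_neg:
  assumes "fam C y" "\<alpha> \<in> \<Phi>" "\<beta> \<in> \<Phi>" "ip \<alpha> \<beta> = -1" "a \<in> A" "p \<in> C" "q \<in> C"
  shows "cjg (x (- \<alpha>) a) (e \<alpha> \<beta> y p q) = e \<alpha> \<beta> y (p + of_int (N \<alpha> \<beta>) * a * q) q"
proof -
  note [simp] = ip_lin ip_self ip_sym[of \<beta> \<alpha>]
  have rt: "\<alpha> + \<beta> \<in> \<Phi>" "- \<alpha> \<in> \<Phi>" using add_root uminus_root assms by blast+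
  let ?m = "of_int (N \<alpha> \<beta>) * a * q"
  have m: "?m \<in> C" by (intro fam_closed(3)[OF assms(1)] A_mult A_int assms(5,7))
  have "cjg (x (- \<alpha>) a) (e \<alpha> \<beta> y p q) = y \<beta> p + (y \<beta> ?m + y (\<alpha> + \<beta>) q)"
    using conj_fam[OF assms(1) rt(2,1) _ assms(5,7)] conj_fam_0[OF assms(1) rt(2) assms(3) _ assms(5,6)] assms
      N_string[OF assms(2-4)] by (simp add: e_def conj_add)
  also have "... = y \<beta> (p + ?m) + y (\<alpha> + \<beta>) q"
    unfolding fam_add[OF assms(1,3,6) m] by (simp only: add.assoc)
  finally show ?thesis by (simp add: e_def)
qed

definition diag1 :: "'g => 'a => 'c => bool" where
  "diag1 h \<beta> u \<longleftrightarrow> (\<forall>C y. fam C y --> (\<forall>c\<in>C. cjg h (y \<beta> c) = y \<beta> (u * c)))"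

text \<open>The torus is described by its effect, scaling every root subgroup of both families by a
  unit, instead of by generators.\<close>

definition diag :: "'g => bool" where
  "diag h \<longleftrightarrow> (\<forall>\<beta>\<in>\<Phi>. \<exists>u\<in>A. \<exists>u'\<in>A. u * u' = 1 \<and> diag1 h \<beta> u)"

lemma diagE:
  assumes "diag h" "\<beta> \<in> \<Phi>"
  obtains u u' where "u \<in> A" "u' \<in> A" "u * u' = 1"
    "\<And>C y c. fam C y ==> c \<in> C ==> cjg h (y \<beta> c) = y \<beta> (u * c)"
proof -
  obtain u u' where u: "u \<in> A" "u' \<in> A" "u * u' = 1" "diag1 h \<beta> u"
    using assms unfolding diag_def by blast
  show thesis by (rule that[OF u(1-3)]) (use u(4) in \<open>simp add: diag1_def\<close>)
qed

lemma diag_add: assumes "diag h" "diag k" shows "diag (h + k)" unfolding diag_def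
proof
  fix \<beta> assume \<beta>: "\<beta> \<in> \<Phi>"
  obtain u u' where u: "u \<in> A" "u' \<in> A" "u * u' = 1"
    "\<And>C y c. fam C y ==> c \<in> C ==> cjg h (y \<beta> c) = y \<beta> (u * c)" using diagE[OF assms(1) \<beta>] by blast
  obtain v v' where v: "v \<in> A" "v' \<in> A" "v * v' = 1"
    "\<And>C y c. fam C y ==> c \<in> C ==> cjg k (y \<beta> c) = y \<beta> (v * c)" using diagE[OF assms(2) \<beta>] by blast
  have "(u * v) * (u' * v') = (u * u') * (v * v')" by (simp only: mult_ac)
  then have "(u * v) * (u' * v') = 1" using u v by simp
  moreover have "diag1 (h + k) \<beta> (u * v)"
    unfolding diag1_def using u v fam_closed(3) by (simp add: conj_conj mult.assoc)
  ultimately show "\<exists>u\<in>A. \<exists>u'\<in>A. u * u' = 1 \<and> diag1 (h + k) \<beta> u" using u v A_mult by blast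
qed

lemma diag_0: "diag 0" unfolding diag_def diag1_def using A_1 by force

text \<open>The matrix action gives the scalars at roots of product -1 and 1 with \<alpha>. Each of
  \<alpha> and -\<alpha> is a sum of two roots of one of these kinds, so its elements are
  commutators and are scaled by the square.\<close>

lemma diag_rank1:
  assumes \<alpha>: "\<alpha> \<in> \<Phi>" and h: "h = x \<alpha> a1 + x (- \<alpha>) a2 + x \<alpha> a3 + x (- \<alpha>) a4"
    and A: "a1 \<in> A" "a2 \<in> A" "a3 \<in> A" "a4 \<in> A" "w \<in> A" "w' \<in> A" "w * w' = 1"
    and act: "\<And>C y \<beta> p q. fam C y ==> \<beta> \<in> \<Phi> ==> ip \<alpha> \<beta> = -1 ==> p \<in> C ==> q \<in> C ==>
      cjg h (e \<alpha> \<beta> y p q) = e \<alpha> \<beta> y (w * p) (w' * q)"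
  shows "diag h"
proof -
  have neg: "- \<alpha> \<in> \<Phi>" using \<alpha> uminus_root by blast
  have low: "diag1 h \<beta> w" if "\<beta> \<in> \<Phi>" "ip \<alpha> \<beta> = -1" for \<beta> unfolding diag1_def
  proof (intro allI impI ballI)
    fix C y c assume "fam C y" "c \<in> C"
    then show "cjg h (y \<beta> c) = y \<beta> (w * c)"
      using act[of C y \<beta> c 0] that fam_closed(2)[of C y] add_root[OF \<alpha>, of \<beta>] by (simp add: e_def)
  qed
  have high: "diag1 h \<gamma> w'" if "\<gamma> \<in> \<Phi>" "ip \<alpha> \<gamma> = 1" for \<gamma> unfolding diag1_def
  proof (intro allI impI ballI)
    fix C y c assume "fam C y" "c \<in> C"
    then show "cjg h (y \<gamma> c) = y \<gamma> (w' * c)"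
      using act[of C y "\<gamma> - \<alpha>" 0 c] that fam_closed(2)[of C y] diff_root[of \<gamma> \<alpha>] \<alpha>
      by (simp add: e_def ip_lin ip_self ip_sym[of \<gamma> \<alpha>])
  qed
  have orth: "diag1 h \<beta> 1" if "\<beta> \<in> \<Phi>" "ip \<alpha> \<beta> = 0" for \<beta>
    unfolding diag1_def h using that A \<alpha> neg by (simp add: conj_conj conj_fam_0 ip_minus_left)
  have sum: "diag1 h (\<beta> + \<beta>') (u * u)"
    if "\<beta> \<in> \<Phi>" "\<beta>' \<in> \<Phi>" "ip \<beta> \<beta>' = -1" "diag1 h \<beta> u" "diag1 h \<beta>' u" "u \<in> A" for \<beta> \<beta>' u
    unfolding diag1_def
  proof (intro allI impI ballI)
    fix C y c assume f: "fam C y" "c \<in> C"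
    have "cjg h (y (\<beta> + \<beta>') c) = comm (x \<beta> (u * of_int (N \<beta> \<beta>'))) (y \<beta>' (u * c))"
      unfolding fam_decomp[OF f(1) that(1-3) f(2)] conj_comm
      using that(4,5) f fam_x A_int unfolding diag1_def by metis
    also have "... = y (\<beta> + \<beta>') (of_int (N \<beta> \<beta>') * (u * of_int (N \<beta> \<beta>')) * (u * c))"
      using fam_module[OF f(1)] that f fam_closed(3)[OF f(1)] unfolding module_family_def
      by (intro commI) (simp add: closedA)
    also have "of_int (N \<beta> \<beta>') * (u * of_int (N \<beta> \<beta>')) * (u * c) = u * u * c"
      using of_int_N_sq[OF that(1-3), of "u * u * c"] by (simp add: mult_ac)
    finally show "cjg h (y (\<beta> + \<beta>') c) = y (\<beta> + \<beta>') (u * u * c)" .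
  qed
  have sq: "w * w * (w' * w') = 1" "w' * w' * (w * w) = 1" "w' * w = 1"
    using A(7) by (metis mult.assoc mult.left_commute mult.commute mult_1_right)+
  show ?thesis unfolding diag_def
  proof
    fix \<beta> assume \<beta>: "\<beta> \<in> \<Phi>"
    consider "ip \<alpha> \<beta> = -1" | "ip \<alpha> \<beta> = 1" | "ip \<alpha> \<beta> = 0" | "\<beta> = \<alpha>" | "\<beta> = - \<alpha>"
      using ip_vals[OF \<alpha> \<beta>] ip_2[OF \<alpha> \<beta>] ip_neg2[OF \<alpha> \<beta>] by auto
    then show "\<exists>u\<in>A. \<exists>u'\<in>A. u * u' = 1 \<and> diag1 h \<beta> u"
    proof cases
      case 1 then show ?thesis using low \<beta> A by blast
    next
      case 2 then show ?thesis using high \<beta> A sq by blast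
    next
      case 3 then show ?thesis using orth[OF \<beta>] A_1 by force
    next
      case 4
      obtain \<gamma> \<gamma>' where g: "\<gamma> \<in> \<Phi>" "\<gamma>' \<in> \<Phi>" "\<gamma> + \<gamma>' = \<alpha>" "ip \<gamma> \<gamma>' = -1"
        "ip \<alpha> \<gamma> = 1" "ip \<alpha> \<gamma>' = 1" using root_decomp[OF neg, of \<alpha>] by (auto simp: ip_lin)
      then have "diag1 h \<alpha> (w' * w')" using sum[of \<gamma> \<gamma>' w'] high A by auto
      then show ?thesis using 4 sq A A_mult by blast
    next
      case 5
      obtain \<gamma> \<gamma>' where g: "\<gamma> \<in> \<Phi>" "\<gamma>' \<in> \<Phi>" "\<gamma> + \<gamma>' = - \<alpha>" "ip \<gamma> \<gamma>' = -1"
        "ip \<alpha> \<gamma> = -1" "ip \<alpha> \<gamma>' = -1" using root_decomp[OF \<alpha>] by blast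
      then have "diag1 h (- \<alpha>) (w * w)" using sum[of \<gamma> \<gamma>' w] low A by auto
      then show ?thesis using 5 sq A A_mult by blast
    qed
  qed
qed

text \<open>The factorization of a lower times an upper unipotent matrix in SL2, with diagonal part
  1 + ab and its inverse. The factor h is defined as what remains, and its action on pairs is then
  computed.\<close>

lemma rank1_swap:
  assumes \<alpha>: "\<alpha> \<in> \<Phi>" and A: "a \<in> A" "b \<in> A" "w' \<in> A" "(1 + a * b) * w' = 1"
  shows "\<exists>h. diag h \<and> x (- \<alpha>) b + x \<alpha> a = x \<alpha> (a * w') + h + x (- \<alpha>) (b * w')"
proof -
  have neg: "- \<alpha> \<in> \<Phi>" using \<alpha> uminus_root by blast
  define h where "h = x \<alpha> (- (a * w')) + x (- \<alpha>) b + x \<alpha> a + x (- \<alpha>) (- (b * w'))"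
  have "diag h"
  proof (rule diag_rank1[OF \<alpha> h_def, of "1 + a * b" w'])
    fix C y \<beta> p q assume f: "fam C y" "\<beta> \<in> \<Phi>" "ip \<alpha> \<beta> = -1" "p \<in> C" "q \<in> C"
    let ?n = "of_int (N \<alpha> \<beta>) :: 'c"
    have nA: "?n * a \<in> A" "?n * b \<in> A" "?n * (- (b * w')) \<in> A" "?n * (- (a * w')) \<in> A" using A by (auto intro: closedA)
    note cl = fam_closed[OF f(1)]
    define p1 where "p1 = p + ?n * (- (b * w')) * q"
    define q1 where "q1 = q + ?n * a * p1"
    define p2 where "p2 = p1 + ?n * b * q1"
    define q2 where "q2 = q1 + ?n * (- (a * w')) * p2"
    have mem: "p1 \<in> C" unfolding p1_def by (intro cl f nA)
    have mem1: "q1 \<in> C" unfolding q1_def by (intro cl f nA mem)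
    have mem2: "p2 \<in> C" unfolding p2_def by (intro cl f nA mem mem1)
    have act: "cjg h (e \<alpha> \<beta> y p q) = e \<alpha> \<beta> y p2 q2" unfolding h_def conj_conj p1_def[symmetric]
      using conj_e_neg[OF f(1) \<alpha> f(2,3) _ f(4,5), of "- (b * w')"]
        conj_e_pos[OF f(1) \<alpha> f(2,3) _ mem f(5), of a] conj_e_neg[OF f(1) \<alpha> f(2,3) _ mem mem1, of b]
        conj_e_pos[OF f(1) \<alpha> f(2,3) _ mem2 mem1, of "- (a * w')"] A
      by (simp add: p1_def[symmetric] q1_def[symmetric] p2_def[symmetric] q2_def[symmetric] closedA
          del: mult_minus_right mult_minus_left)
    have n: "?n * ?n = 1" using of_int_N_sq[OF \<alpha> f(2,3), of 1] by simp
    have "p2 = (1 + a * b * (?n * ?n)) * p1 + ?n * b * q" by (simp add: p2_def q1_def algebra_simps)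
    also have "... = (1 + a * b) * p - ?n * b * ((1 + a * b) * w') * q + ?n * b * q"
      by (simp add: n p1_def algebra_simps)
    finally have p2: "p2 = (1 + a * b) * p" unfolding A(4) by simp
    have "q2 = q1 - ?n * a * ((1 + a * b) * w') * p" by (simp add: q2_def p2 algebra_simps)
    also have "... = q - a * b * w' * (?n * ?n) * q" unfolding A(4) by (simp add: q1_def p1_def algebra_simps)
    also have "... = (1 + a * b) * w' * q - a * b * w' * q" unfolding A(4) n by simp
    finally have q2: "q2 = w' * q" by (simp add: algebra_simps)
    show "cjg h (e \<alpha> \<beta> y p q) = e \<alpha> \<beta> y ((1 + a * b) * p) (w' * q)" unfolding act p2 q2 ..
  qed (use A in \<open>auto intro: closedA\<close>)
  moreover have "x (- \<alpha>) b + x \<alpha> a = x \<alpha> (a * w') + h + x (- \<alpha>) (b * w')"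
    unfolding h_def using A \<alpha> neg by (simp add: x_uminus A_mult add.assoc)
  ultimately show ?thesis by blast
qed

text \<open>w is the Weyl element of rank one. It takes root elements at \<beta> of product -1 with
  \<alpha> to root elements at \<alpha> + \<beta>; elements at -\<alpha> are commutators of such
  elements.\<close>

lemma weyl_conj:
  assumes \<alpha>: "\<alpha> \<in> \<Phi>" and A: "a \<in> A" "a' \<in> A" "a * a' = 1" "c \<in> A"
    and w: "w = x \<alpha> a + x (- \<alpha>) (- a') + x \<alpha> a"
  shows "\<exists>d\<in>A. cjg w (x (- \<alpha>) c) = x \<alpha> d"
proof -
  have low: "cjg w (x \<beta> p) = x (\<alpha> + \<beta>) (of_int (N \<alpha> \<beta>) * a * p)"
    if "\<beta> \<in> \<Phi>" "ip \<alpha> \<beta> = -1" "p \<in> A" for \<beta> p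
  proof -
    let ?n = "of_int (N \<alpha> \<beta>) :: 'c"
    have n: "?n * ?n = 1" using of_int_N_sq[OF \<alpha> that(1,2), of 1] by simp
    have "?n * a' * (?n * a * p) = (?n * ?n) * (a * a') * p" by (simp only: mult_ac)
    then have 1: "?n * a' * (?n * a * p) = p" using n A by simp
    have "x \<beta> p = e \<alpha> \<beta> x p 0" using that add_root[OF \<alpha>] fam_0[OF fam_x] by (simp add: e_def)
    then have "cjg w (x \<beta> p) = cjg (x \<alpha> a) (cjg (x (- \<alpha>) (- a')) (e \<alpha> \<beta> x p (?n * a * p)))"
      using conj_e_pos[OF fam_x \<alpha> that(1,2) A(1) that(3) A_0] by (simp add: w conj_conj)
    also have "cjg (x (- \<alpha>) (- a')) (e \<alpha> \<beta> x p (?n * a * p)) = e \<alpha> \<beta> x 0 (?n * a * p)"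
      using conj_e_neg[OF fam_x \<alpha> that(1,2), of "- a'" p "?n * a * p"] that A 1 by (simp add: closedA)
    also have "cjg (x \<alpha> a) ... = e \<alpha> \<beta> x 0 (?n * a * p)"
      using conj_e_pos[OF fam_x \<alpha> that(1,2), of a 0 "?n * a * p"] that A by (simp add: closedA)
    finally show ?thesis using that fam_0[OF fam_x] by (simp add: e_def)
  qed
  obtain \<beta> \<beta>' where b: "\<beta> \<in> \<Phi>" "\<beta>' \<in> \<Phi>" "\<beta> + \<beta>' = - \<alpha>" "ip \<beta> \<beta>' = -1"
        "ip \<alpha> \<beta> = -1" "ip \<alpha> \<beta>' = -1" using root_decomp[OF \<alpha>] by blast
  have rts: "\<alpha> + \<beta> \<in> \<Phi>" "\<alpha> + \<beta>' \<in> \<Phi>" using add_root \<alpha> b by blast+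
  have ip': "ip (\<alpha> + \<beta>) (\<alpha> + \<beta>') = -1" using b \<alpha> by (simp add: ip_lin ip_self ip_sym[of \<beta> \<alpha>])
  let ?p = "of_int (N \<alpha> \<beta>) * a * of_int (N \<beta> \<beta>')" and ?q = "of_int (N \<alpha> \<beta>') * a * c"
  have "cjg w (x (\<beta> + \<beta>') c) = comm (x (\<alpha> + \<beta>) ?p) (x (\<alpha> + \<beta>') ?q)"
    unfolding fam_decomp[OF fam_x b(1,2,4) A(4)] conj_comm using low b A A_int by simp
  also have "... = x ((\<alpha> + \<beta>) + (\<alpha> + \<beta>')) (of_int (N (\<alpha> + \<beta>) (\<alpha> + \<beta>')) * ?p * ?q)"
    using x_module rts ip' A unfolding module_family_def by (intro commI) (simp add: closedA)
  also have "(\<alpha> + \<beta>) + (\<alpha> + \<beta>') = \<alpha> + (\<alpha> + (\<beta> + \<beta>'))" by (simp only: add_ac)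
  also have "... = \<alpha>" by (simp add: b)
  finally have "cjg w (x (- \<alpha>) c) = x \<alpha> (of_int (N (\<alpha> + \<beta>) (\<alpha> + \<beta>')) * ?p * ?q)" by (simp only: b)
  moreover have "of_int (N (\<alpha> + \<beta>) (\<alpha> + \<beta>')) * ?p * ?q \<in> A" by (intro A_mult A_int A(1,4))
  ultimately show ?thesis by blast
qed

lemma diag_move:
  assumes "diag h" "\<beta> \<in> \<Phi>" "a \<in> A"
  shows "\<exists>b\<in>A. h + x \<beta> a = x \<beta> b + h" "\<exists>b\<in>A. x \<beta> a + h = h + x \<beta> b"
proof -
  obtain u u' where u: "u \<in> A" "u' \<in> A" "u * u' = 1" "\<And>c. c \<in> A ==> cjg h (x \<beta> c) = x \<beta> (u * c)"
    using diagE[OF assms(1,2)] fam_x by metis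
  show "\<exists>b\<in>A. h + x \<beta> a = x \<beta> b + h"
    using u(4)[OF assms(3)] conj_move[of h "x \<beta> a"] A_mult[OF u(1) assms(3)] by auto
  have "h + x \<beta> (u' * a) = x \<beta> (u * (u' * a)) + h"
    using u(4)[OF A_mult[OF u(2) assms(3)]] conj_move[of h "x \<beta> (u' * a)"] by simp
  also have "u * (u' * a) = a" using u by (simp flip: mult.assoc)
  finally have "h + x \<beta> (u' * a) = x \<beta> a + h" .
  then show "\<exists>b\<in>A. x \<beta> a + h = h + x \<beta> b"
    using A_mult[OF u(2) assms(3)] by (intro bexI[of _ "u' * a"]) simp_all
qed

lemma x_add: "\<beta> \<in> \<Phi> ==> a \<in> A ==> b \<in> A ==> x \<beta> a + x \<beta> b = x \<beta> (a + b)" using fam_add[OF fam_x] by simp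

text \<open>If 1 + ab is a unit, the first two factors are swapped. Otherwise a is a unit, and
  extracting a Weyl element replaces b by n = 1/a + b. This is not a unit, since its multiple by a
  is 1 + ab; hence 1 + cn is a unit by locality and the last two factors are swapped
  instead.\<close>

lemma rank1_gauss:
  assumes \<alpha>: "\<alpha> \<in> \<Phi>" and A: "a \<in> A" "b \<in> A" "c \<in> A"
  shows "\<exists>b2\<in>A. \<exists>h. \<exists>e2\<in>A. \<exists>c2\<in>A. diag h \<and>
    x (- \<alpha>) a + x \<alpha> b + x (- \<alpha>) c = x \<alpha> b2 + h + x (- \<alpha>) e2 + x \<alpha> c2"
proof (cases "\<exists>u\<in>A. (1 + b * a) * u = 1")
  case True
  have neg: "- \<alpha> \<in> \<Phi>" using \<alpha> uminus_root by blast
  from True obtain u where u: "u \<in> A" "(1 + b * a) * u = 1" by blast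
  obtain h where h: "diag h" "x (- \<alpha>) a + x \<alpha> b = x \<alpha> (b * u) + h + x (- \<alpha>) (a * u)"
    using rank1_swap[OF \<alpha> A(2,1) u] by blast
  have "x (- \<alpha>) a + x \<alpha> b + x (- \<alpha>) c = x \<alpha> (b * u) + h + x (- \<alpha>) (a * u + c) + x \<alpha> 0"
    unfolding h(2) using A u neg \<alpha> fam_0[OF fam_x \<alpha>] by (simp add: A_mult add.assoc flip: x_add)
  then show ?thesis by (intro bexI[of _ "b * u"] exI[of _ h] bexI[of _ "a * u + c"] bexI[of _ 0] conjI)
      (use h(1) A u in \<open>auto intro: closedA\<close>)
next
  case False
  have neg: "- \<alpha> \<in> \<Phi>" using \<alpha> uminus_root by blast
  obtain a' where a': "a' \<in> A" "a * a' = 1" using local[OF A(1)] False A by (metis mult.commute)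
  define n where "n = a' + b"
  have nA: "n \<in> A" using a' A by (simp add: n_def A_add)
  have "\<not> (\<exists>u\<in>A. n * u = 1)"
  proof
    assume "\<exists>u\<in>A. n * u = 1"
    then obtain u where u: "u \<in> A" "n * u = 1" by blast
    have "(1 + b * a) * (a' * u) = (a' + b * (a * a')) * u" by (simp add: algebra_simps)
    also have "... = 1" unfolding a'(2) using u by (simp add: n_def)
    finally show False using False a' u A_mult by blast
  qed
  then obtain u where u: "u \<in> A" "(1 + c * n) * u = 1" using local[OF nA] A by (metis mult.commute)
  obtain h where h: "diag h" "x \<alpha> n + x (- \<alpha>) c = x (- \<alpha>) (c * u) + h + x \<alpha> (n * u)"
    using rank1_swap[OF neg A(3) nA u] by auto
  define w where "w = x \<alpha> (- a') + x (- \<alpha>) (- (- a)) + x \<alpha> (- a')"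
  have aa: "- a' * - a = 1" using a' by (simp add: mult.commute)
  obtain d where d: "d \<in> A" "cjg w (x (- \<alpha>) (c * u)) = x \<alpha> d"
    using weyl_conj[OF \<alpha> _ _ aa _ w_def, of "c * u"] a' A u by (auto simp: closedA)
  obtain c1 where c1: "c1 \<in> A" "x \<alpha> (- a') + h = h + x \<alpha> c1" using diag_move(2)[OF h(1) \<alpha>, of "- a'"] a' A_uminus by blast
  obtain e1 where e1: "e1 \<in> A" "x (- \<alpha>) a + h = h + x (- \<alpha>) e1" using diag_move(2)[OF h(1) neg A(1)] by blast
  have "x (- \<alpha>) a = x \<alpha> a' + w + x \<alpha> a'" unfolding w_def using \<alpha> a' by (simp add: x_uminus add.assoc)
  then have "x (- \<alpha>) a + x \<alpha> b + x (- \<alpha>) c = x \<alpha> a' + w + (x \<alpha> a' + x \<alpha> b) + x (- \<alpha>) c"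
    by (simp only: add.assoc)
  also have "... = x \<alpha> a' + w + (x \<alpha> n + x (- \<alpha>) c)" using \<alpha> a' A by (simp add: x_add n_def add.assoc)
  also have "... = x \<alpha> a' + (w + x (- \<alpha>) (c * u)) + h + x \<alpha> (n * u)"
    unfolding h(2) by (simp only: add.assoc)
  also have "w + x (- \<alpha>) (c * u) = x \<alpha> d + w" using conj_move[of w "x (- \<alpha>) (c * u)"] d by simp
  also have "x \<alpha> a' + (x \<alpha> d + w) + h + x \<alpha> (n * u)
     = (x \<alpha> a' + x \<alpha> d + x \<alpha> (- a')) + x (- \<alpha>) a + (x \<alpha> (- a') + h) + x \<alpha> (n * u)"
    by (simp add: w_def add.assoc)
  also have "... = (x \<alpha> a' + x \<alpha> d + x \<alpha> (- a')) + (x (- \<alpha>) a + h) + (x \<alpha> c1 + x \<alpha> (n * u))"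
    unfolding c1 by (simp only: add.assoc)
  also have "... = (x \<alpha> a' + x \<alpha> d + x \<alpha> (- a')) + h + x (- \<alpha>) e1 + (x \<alpha> c1 + x \<alpha> (n * u))"
    unfolding e1 by (simp only: add.assoc)
  also have "... = x \<alpha> (a' + d + - a') + h + x (- \<alpha>) e1 + x \<alpha> (c1 + n * u)"
    using \<alpha> a' d c1 nA u by (simp only: x_add closedA)
  finally have "x (- \<alpha>) a + x \<alpha> b + x (- \<alpha>) c = x \<alpha> (a' + d + - a') + h + x (- \<alpha>) e1 + x \<alpha> (c1 + n * u)" .
  moreover have "a' + d + - a' \<in> A" "c1 + n * u \<in> A" using a' d c1 nA u by (auto intro: closedA)
  ultimately show ?thesis using h(1) e1(1) by blast
qed

section \<open>Unipotent subgroups and the decomposition in higher rank\<close>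

definition Ugrp :: "('a => real) => 'g set" where
  "Ugrp f = subgrp {x \<beta> a |\<beta> a. \<beta> \<in> \<Phi> \<and> f \<beta> > 0 \<and> a \<in> A}"

text \<open>For simple \<alpha> this is the unipotent radical of the minimal parabolic subgroup
  attached to \<alpha>.\<close>

definition Uminor :: "('a => real) => 'a => 'g set" where
  "Uminor f \<alpha> = subgrp {x \<beta> a |\<beta> a. \<beta> \<in> \<Phi> \<and> f \<beta> > 0 \<and> \<beta> \<noteq> \<alpha> \<and> a \<in> A}"

lemma x_Ugrp: "\<beta> \<in> \<Phi> ==> f \<beta> > 0 ==> a \<in> A ==> x \<beta> a \<in> Ugrp f"
  unfolding Ugrp_def by (rule subgrp.gen) blast

lemma Uminor_Ugrp: "Uminor f \<alpha> \<subseteq> Ugrp f"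
  unfolding Ugrp_def Uminor_def by (rule subgrp_subset, rule subgrp.gen) blast

lemma Ugrp_add: "u \<in> Ugrp f ==> v \<in> Ugrp f ==> u + v \<in> Ugrp f" unfolding Ugrp_def by (rule subgrp.add)

lemma Ugrp_uminus: "u \<in> Ugrp f ==> - u \<in> Ugrp f" unfolding Ugrp_def by (rule subgrp.uminus)

text \<open>Every root that arises by adding \<alpha> or -\<alpha> is again positive because
  \<alpha> is simple, and none of them is \<alpha> itself, as its product with the added root is
  1.\<close>

lemma Uminor_conj:
  assumes f: "\<And>v w. f (v + w) = f v + f w" and s: "simple f \<alpha>" and g: "g = x \<alpha> c \<or> g = x (- \<alpha>) c" "c \<in> A"
    and u: "u \<in> Uminor f \<alpha>"
  shows "cjg g u \<in> Uminor f \<alpha>" using u unfolding Uminor_def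
proof (rule conj_subgrp[rotated], goal_cases)
  case (1 k)
  then obtain \<beta> a where b: "k = x \<beta> a" "\<beta> \<in> \<Phi>" "f \<beta> > 0" "\<beta> \<noteq> \<alpha>" "a \<in> A" by blast
  have \<alpha>: "\<alpha> \<in> \<Phi>" "f \<alpha> > 0" "- \<alpha> \<in> \<Phi>" using s uminus_root by (auto simp: simple_def)
  let ?X = "{x \<beta> a |\<beta> a. \<beta> \<in> \<Phi> \<and> f \<beta> > 0 \<and> \<beta> \<noteq> \<alpha> \<and> a \<in> A}"
  have gen: "x \<gamma> a' \<in> subgrp ?X" if "\<gamma> \<in> \<Phi>" "f \<gamma> > 0" "\<gamma> \<noteq> \<alpha>" "a' \<in> A" for \<gamma> a'
    by (rule subgrp.gen) (use that in blast)
  have f0: "f 0 = 0" using f[of 0 0] by simp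
  have fm: "f (- v) = - f v" for v using f[of v "- v"] f0 by simp
  have nb: "\<beta> \<noteq> - \<alpha>" using b \<alpha> fm[of \<alpha>] by auto
  have key: "cjg (x \<delta> c) (x \<beta> a) \<in> subgrp ?X"
    if \<delta>: "\<delta> = \<alpha> \<or> \<delta> = - \<alpha>" for \<delta>
  proof -
    have \<delta>\<Phi>: "\<delta> \<in> \<Phi>" using \<delta> \<alpha> by auto
    have "ip \<delta> \<beta> \<noteq> -2" using ip_neg2[OF \<delta>\<Phi> b(2)] \<delta> b nb by auto
    then consider "ip \<delta> \<beta> \<ge> 0" | "ip \<delta> \<beta> = -1" using ip_vals[OF \<delta>\<Phi> b(2)] by auto
    then show ?thesis
    proof cases
      case 1
      then show ?thesis using conj_fam_0[OF fam_x \<delta>\<Phi> b(2)] g b gen by simp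
    next
      case 2
      have sum: "\<delta> + \<beta> \<in> \<Phi>" using add_root \<delta>\<Phi> b 2 by blast
      have "f (\<delta> + \<beta>) > 0"
      proof (cases "\<delta> = \<alpha>")
        case True then show ?thesis using f \<alpha> b by simp
      next
        case False
        then have "\<delta> + \<beta> = \<beta> - \<alpha>" using \<delta> by simp
        then show ?thesis using s b sum by (simp add: simple_def)
      qed
      moreover have "\<delta> + \<beta> \<noteq> \<alpha>"
      proof
        assume eq: "\<delta> + \<beta> = \<alpha>"
        have "ip \<delta> (\<delta> + \<beta>) = 1" using 2 \<delta>\<Phi> by (simp add: ip_lin ip_self)
        then show False unfolding eq using \<delta> \<alpha> by (auto simp: ip_lin ip_self)
      qed
      moreover have "of_int (N \<delta> \<beta>) * c * a \<in> A" using g b by (intro A_mult A_int)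
      ultimately show ?thesis
        using conj_fam[OF fam_x \<delta>\<Phi> b(2) 2 g(2) b(5)] sum gen b by (auto intro!: subgrp.add)
    qed
  qed
  then show ?case using g b by auto
qed

lemma Ugrp_split:
  assumes f: "\<And>v w. f (v + w) = f v + f w" and s: "simple f \<alpha>" and u: "u \<in> Ugrp f"
  shows "\<exists>u1\<in>Uminor f \<alpha>. \<exists>a\<in>A. u = u1 + x \<alpha> a"
proof -
  have \<alpha>: "\<alpha> \<in> \<Phi>" using s by (simp add: simple_def)
  have U0: "0 \<in> Uminor f \<alpha>" and Uadd: "\<And>u v. u \<in> Uminor f \<alpha> ==> v \<in> Uminor f \<alpha> ==> u + v \<in> Uminor f \<alpha>"
    and Umin: "\<And>u. u \<in> Uminor f \<alpha> ==> - u \<in> Uminor f \<alpha>"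
    unfolding Uminor_def by (auto intro: subgrp.intros)
  note cj = Uminor_conj[OF f s]
  show ?thesis using u unfolding Ugrp_def
  proof induction
    case zero
    then show ?case using U0 A_0 fam_0[OF fam_x \<alpha>] by (intro bexI[of _ 0]) auto
  next
    case (gen k)
    then obtain \<beta> a where b: "k = x \<beta> a" "\<beta> \<in> \<Phi>" "f \<beta> > 0" "a \<in> A" by blast
    show ?case
    proof (cases "\<beta> = \<alpha>")
      case True then show ?thesis using b U0 by (intro bexI[of _ 0] bexI[of _ a]) auto
    next
      case False
      then have "k \<in> Uminor f \<alpha>" unfolding Uminor_def using b by (intro subgrp.gen) blast
      then show ?thesis using A_0 fam_0[OF fam_x \<alpha>] by (intro bexI[of _ k] bexI[of _ 0]) auto
    qed
  next
    case (add k l)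
    then obtain u1 a u2 b where *: "u1 \<in> Uminor f \<alpha>" "a \<in> A" "k = u1 + x \<alpha> a" "u2 \<in> Uminor f \<alpha>" "b \<in> A" "l = u2 + x \<alpha> b"
      by blast
    have "k + l = u1 + (x \<alpha> a + u2) + x \<alpha> b" by (simp only: * add.assoc)
    also have "... = u1 + cjg (x \<alpha> a) u2 + (x \<alpha> a + x \<alpha> b)" unfolding conj_move[of _ u2] by (simp only: add.assoc)
    finally have "k + l = u1 + cjg (x \<alpha> a) u2 + x \<alpha> (a + b)" using * \<alpha> x_add by simp
    then show ?case using * cj Uadd A_add by blast
  next
    case (uminus k)
    then obtain u1 a where *: "u1 \<in> Uminor f \<alpha>" "a \<in> A" "k = u1 + x \<alpha> a" by blast
    have "- k = x \<alpha> (- a) + - u1" using * \<alpha> by (simp add: x_uminus minus_add del: add_uminus_conv_diff)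
    also have "... = cjg (x \<alpha> (- a)) (- u1) + x \<alpha> (- a)" by (rule conj_move)
    finally show ?case using * cj Umin A_uminus by blast
  qed
qed

lemma Ugrp_split_left:
  assumes f: "\<And>v w. f (v + w) = f v + f w" and s: "simple f \<alpha>" and u: "u \<in> Ugrp f"
  shows "\<exists>u1\<in>Uminor f \<alpha>. \<exists>a\<in>A. u = x \<alpha> a + u1"
proof -
  have \<alpha>: "\<alpha> \<in> \<Phi>" using s by (simp add: simple_def)
  obtain u1 a where *: "u1 \<in> Uminor f \<alpha>" "a \<in> A" "- u = u1 + x \<alpha> a"
    using Ugrp_split[OF f s Ugrp_uminus[OF u]] by blast
  have "u = - (u1 + x \<alpha> a)" by (metis *(3) minus_minus)
  also have "... = x \<alpha> (- a) + - u1" using * \<alpha> by (simp add: x_uminus minus_add del: add_uminus_conv_diff)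
  finally show ?thesis using * A_uminus subgrp.uminus unfolding Uminor_def by blast
qed

definition Egrp :: "'g set" where
  "Egrp = subgrp {x \<beta> a |\<beta> a. \<beta> \<in> \<Phi> \<and> a \<in> A}"

text \<open>The big cell need not exhaust the group over a local ring; the second positive factor u'
  makes up for the difference.\<close>

definition gauss :: "('a => real) => 'g => bool" where
  "gauss f g \<longleftrightarrow> (\<exists>u\<in>Ugrp f. \<exists>h. \<exists>v\<in>Ugrp (\<lambda>v. - f v). \<exists>u'\<in>Ugrp f. diag h \<and> g = u + h + v + u')"

lemma gauss_pos:
  assumes "gauss f g" "k \<in> Ugrp f" shows "gauss f (k + g)"
proof -
  obtain u h v u' where *: "u \<in> Ugrp f" "v \<in> Ugrp (\<lambda>v. - f v)" "u' \<in> Ugrp f" "diag h" "g = u + h + v + u'"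
    using assms unfolding gauss_def by blast
  then have "k + g = (k + u) + h + v + u'" by (simp only: add.assoc)
  then show ?thesis unfolding gauss_def using * Ugrp_add[OF assms(2)] by blast
qed

text \<open>Only the parts of u and v along \<alpha> interact with the new factor. The complements
  in \<open>Uminor\<close> are moved aside by conjugation, \<open>rank1_gauss\<close> reorders the
  middle, and the positive remainder joins u'.\<close>

lemma gauss_neg:
  assumes f: "\<And>v w. f (v + w) = f v + f w" and s: "simple f \<alpha>" and s': "simple (\<lambda>v. - f v) (- \<alpha>)"
    and g: "gauss f g" and a: "a \<in> A"
  shows "gauss f (x (- \<alpha>) a + g)"
proof -
  let ?f' = "\<lambda>v. - f v"
  have f': "?f' (v + w) = ?f' v + ?f' w" for v w using f by simp
  have \<alpha>: "\<alpha> \<in> \<Phi>" "- \<alpha> \<in> \<Phi>" "f \<alpha> > 0" "?f' (- \<alpha>) > 0" using s s' by (auto simp: simple_def)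
  obtain u h v u' where *: "u \<in> Ugrp f" "v \<in> Ugrp ?f'" "u' \<in> Ugrp f" "diag h" "g = u + h + v + u'"
    using g unfolding gauss_def by blast
  obtain u1 b where u: "u1 \<in> Uminor f \<alpha>" "b \<in> A" "u = u1 + x \<alpha> b" using Ugrp_split[OF f s *(1)] by blast
  obtain v1 c where v: "v1 \<in> Uminor ?f' (- \<alpha>)" "c \<in> A" "v = x (- \<alpha>) c + v1"
    using Ugrp_split_left[OF f' s' *(2)] by blast
  obtain c' where c': "c' \<in> A" "h + x (- \<alpha>) c = x (- \<alpha>) c' + h" using diag_move(1)[OF *(4) \<alpha>(2) v(2)] by blast
  obtain b2 k e2 c2 where k: "b2 \<in> A" "diag k" "e2 \<in> A" "c2 \<in> A"
    "x (- \<alpha>) a + x \<alpha> b + x (- \<alpha>) c' = x \<alpha> b2 + k + x (- \<alpha>) e2 + x \<alpha> c2"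
    using rank1_gauss[OF \<alpha>(1) a u(2) c'(1)] by blast
  obtain c3 where c3: "c3 \<in> A" "x \<alpha> c2 + h = h + x \<alpha> c3" using diag_move(2)[OF *(4) \<alpha>(1) k(4)] by blast
  obtain e3 where e3: "e3 \<in> A" "x (- \<alpha>) e2 + h = h + x (- \<alpha>) e3" using diag_move(2)[OF *(4) \<alpha>(2) k(3)] by blast
  define u2 where "u2 = cjg (x (- \<alpha>) a) u1"
  define v2 where "v2 = cjg (x \<alpha> c3) v1"
  have u2: "u2 \<in> Uminor f \<alpha>" unfolding u2_def by (rule Uminor_conj[OF f s _ a u(1)]) simp
  have v2: "v2 \<in> Uminor ?f' (- \<alpha>)" unfolding v2_def by (rule Uminor_conj[OF f' s' _ c3(1) v(1)]) simp
  have "x (- \<alpha>) a + g = (x (- \<alpha>) a + u1) + x \<alpha> b + (h + x (- \<alpha>) c) + v1 + u'"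
    by (simp only: * u v add.assoc)
  also have "... = u2 + (x (- \<alpha>) a + x \<alpha> b + x (- \<alpha>) c') + h + v1 + u'"
    unfolding conj_move[of _ u1] u2_def[symmetric] c' by (simp only: add.assoc)
  also have "... = u2 + x \<alpha> b2 + k + x (- \<alpha>) e2 + (x \<alpha> c2 + h) + v1 + u'"
    unfolding k by (simp only: add.assoc)
  also have "... = u2 + x \<alpha> b2 + k + (x (- \<alpha>) e2 + h) + (x \<alpha> c3 + v1) + u'"
    unfolding c3 by (simp only: add.assoc)
  also have "... = (u2 + x \<alpha> b2) + (k + h) + (x (- \<alpha>) e3 + v2) + (x \<alpha> c3 + u')"
    unfolding e3 conj_move[of _ v1] v2_def[symmetric] by (simp only: add.assoc)
  finally have eq: "x (- \<alpha>) a + g = (u2 + x \<alpha> b2) + (k + h) + (x (- \<alpha>) e3 + v2) + (x \<alpha> c3 + u')" .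
  have "u2 + x \<alpha> b2 \<in> Ugrp f" using u2 Uminor_Ugrp \<alpha> k by (blast intro: Ugrp_add x_Ugrp)
  moreover have "x (- \<alpha>) e3 + v2 \<in> Ugrp ?f'"
    using v2 Uminor_Ugrp[of ?f'] x_Ugrp[of "- \<alpha>" ?f' e3] \<alpha> e3 by (blast intro: Ugrp_add)
  moreover have "x \<alpha> c3 + u' \<in> Ugrp f" using * c3 \<alpha> by (blast intro: Ugrp_add x_Ugrp)
  ultimately show ?thesis unfolding gauss_def eq using diag_add k(2) *(4) by blast
qed

theorem gauss_decomposition:
  assumes f: "\<And>v w. f (v + w) = f v + f w" and fin: "\<And>\<beta>. \<beta> \<in> \<Phi> ==> f \<beta> \<noteq> 0"
    and base: "\<And>\<beta>. \<beta> \<in> \<Phi> ==> f \<beta> > 0 ==> \<not> simple f \<beta> ==>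
      \<exists>\<alpha>. simple f \<alpha> \<and> \<beta> - \<alpha> \<in> \<Phi> \<and> ip \<alpha> (\<beta> - \<alpha>) = -1"
    and g: "g \<in> Egrp"
  shows "gauss f g"
proof -
  have f0: "f 0 = 0" using f[of 0 0] by simp
  have fm: "f (- v) = - f v" for v using f[of v "- v"] f0 by simp
  have fd: "f (v - w) = f v - f w" for v w using f[of v "- w"] fm by simp
  define X where "X = {x \<alpha> a |\<alpha> a. simple f \<alpha> \<and> a \<in> A} \<union> {x (- \<alpha>) a |\<alpha> a. simple f \<alpha> \<and> a \<in> A}"
  have sX: "simple f \<alpha> ==> a \<in> A ==> x \<alpha> a \<in> X \<and> x (- \<alpha>) a \<in> X" for \<alpha> a unfolding X_def by blast
  \<comment> \<open>The heights are real numbers, so the induction counts the values of f on roots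
    below that of \<beta>.\<close>
  define R where "R \<beta> = (f ` {\<gamma> \<in> \<Phi>. f \<gamma> < f \<beta>})" for \<beta>
  have pos: "\<forall>a\<in>A. x \<beta> a \<in> subgrp X \<and> x (- \<beta>) a \<in> subgrp X" if "\<beta> \<in> \<Phi>" "f \<beta> > 0" for \<beta> using that
  proof (induction "card (R \<beta>)" arbitrary: \<beta> rule: less_induct)
    case less
    show ?case
    proof (cases "simple f \<beta>")
      case True then show ?thesis using sX subgrp.gen by metis
    next
      case False
      then obtain \<alpha> where \<alpha>: "simple f \<alpha>" "\<beta> - \<alpha> \<in> \<Phi>" "ip \<alpha> (\<beta> - \<alpha>) = -1" using base less by blast
      have a\<Phi>: "\<alpha> \<in> \<Phi>" "f \<alpha> > 0" "- \<alpha> \<in> \<Phi>" using \<alpha> uminus_root by (auto simp: simple_def)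
      have "\<beta> \<noteq> \<alpha>" using False \<alpha> by blast
      then have p: "f (\<beta> - \<alpha>) > 0" using \<alpha> less by (simp add: simple_def)
      have lt: "f (\<beta> - \<alpha>) < f \<beta>" using a\<Phi> fd by simp
      have "f (\<beta> - \<alpha>) \<in> R \<beta> - R (\<beta> - \<alpha>)" "R (\<beta> - \<alpha>) \<subseteq> R \<beta>" using lt \<alpha> by (auto simp: R_def)
      then have "R (\<beta> - \<alpha>) \<subset> R \<beta>" by blast
      then have "card (R (\<beta> - \<alpha>)) < card (R \<beta>)" using finite_roots by (intro psubset_card_mono) (auto simp: R_def)
      from less(1)[OF this \<alpha>(2) p] have IH: "\<And>a. a \<in> A ==> x (\<beta> - \<alpha>) a \<in> subgrp X \<and> x (- (\<beta> - \<alpha>)) a \<in> subgrp X" by blast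
      have e: "x \<beta> a = comm (x \<alpha> (of_int (N \<alpha> (\<beta> - \<alpha>)))) (x (\<beta> - \<alpha>) a)" if "a \<in> A" for a
        using fam_decomp[OF fam_x a\<Phi>(1) \<alpha>(2,3) that] by simp
      have e': "x (- \<beta>) a = comm (x (- \<alpha>) (of_int (N (- \<alpha>) (- (\<beta> - \<alpha>))))) (x (- (\<beta> - \<alpha>)) a)" if "a \<in> A" for a
      proof -
        have "ip (- \<alpha>) (- (\<beta> - \<alpha>)) = -1" using \<alpha>(3) by (simp only: ip_minus_left ip_minus_right minus_minus)
        moreover have "- \<alpha> + - (\<beta> - \<alpha>) = - \<beta>" by simp
        ultimately show ?thesis using fam_decomp[OF fam_x a\<Phi>(3) uminus_root[OF \<alpha>(2)] _ that] by simp
      qed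
      show ?thesis
        using e e' IH sX[OF \<alpha>(1)] A_int unfolding comm_def by (auto intro!: subgrp_minus subgrp.add intro: subgrp.gen)
    qed
  qed
  have "Egrp \<subseteq> subgrp X" unfolding Egrp_def
  proof (rule subgrp_subset)
    fix k assume "k \<in> {x \<beta> a |\<beta> a. \<beta> \<in> \<Phi> \<and> a \<in> A}"
    then obtain \<beta> a where k: "k = x \<beta> a" "\<beta> \<in> \<Phi>" "a \<in> A" by blast
    show "k \<in> subgrp X"
    proof (cases "f \<beta> > 0")
      case True then show ?thesis using pos k by blast
    next
      case False
      then have "f (- \<beta>) > 0" using fm fin[OF k(2)] by simp
      from pos[OF uminus_root[OF k(2)] this] k show ?thesis by simp
    qed
  qed
  then have "g \<in> subgrp X" using g by blast
  then show ?thesis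
  proof (rule subgrp_left_induct)
    have "0 \<in> Ugrp f" "0 \<in> Ugrp (\<lambda>v. - f v)" unfolding Ugrp_def by (rule subgrp.zero)+
    then show "gauss f 0" unfolding gauss_def using diag_0 by force
  next
    fix k g assume k: "k \<in> X" and g: "gauss f g"
    from k consider \<alpha> a where "k = x \<alpha> a" "simple f \<alpha>" "a \<in> A" | \<alpha> a where "k = x (- \<alpha>) a" "simple f \<alpha>" "a \<in> A"
      unfolding X_def by blast
    then show "gauss f (k + g)"
    proof cases
      case 1 then show ?thesis using gauss_pos[OF g] x_Ugrp by (simp add: simple_def)
    next
      case 2
      have "simple (\<lambda>v. - f v) (- \<alpha>)" unfolding simple_def
      proof (intro conjI ballI impI)
        show "- \<alpha> \<in> \<Phi>" "- f (- \<alpha>) > 0" using 2 fm uminus_root by (auto simp: simple_def)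
        fix \<beta> assume b: "\<beta> \<in> \<Phi>" "0 < - f \<beta> \<and> \<beta> \<noteq> - \<alpha> \<and> \<beta> - - \<alpha> \<in> \<Phi>"
        have "- \<beta> - \<alpha> \<in> \<Phi>" using uminus_root[of "\<beta> - - \<alpha>"] b by simp
        moreover have "- \<beta> \<in> \<Phi>" "f (- \<beta>) > 0" "- \<beta> \<noteq> \<alpha>" using b fm uminus_root by auto
        ultimately have "f (- \<beta> - \<alpha>) > 0" using 2(2) unfolding simple_def by blast
        then show "- f (\<beta> - - \<alpha>) > 0" using fm fd f by simp
      qed
      then show ?thesis using gauss_neg[OF f 2(2) _ g 2(3)] 2 by simp
    qed
  next
    fix k assume "k \<in> X"
    then obtain \<alpha> a where k: "k = x \<alpha> a \<or> k = x (- \<alpha>) a" "simple f \<alpha>" "a \<in> A" unfolding X_def by blast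
    then have "\<alpha> \<in> \<Phi>" "- \<alpha> \<in> \<Phi>" using uminus_root by (auto simp: simple_def)
    then have "- k = x \<alpha> (- a) \<or> - k = x (- \<alpha>) (- a)" using k x_uminus by auto
    then show "- k \<in> X" using sX[OF k(2) A_uminus[OF k(3)]] by auto
  qed
qed

end

section \<open>The ring of square matrices\<close>

text \<open>A type of its own, so that the multiplication of its ring structure is the matrix
  product.\<close>

typedef ('q, 'n) sqm = "UNIV :: ('n => 'n => 'q) set" morphisms ent Sqm ..

setup_lifting type_definition_sqm

lemma sqm_eqI: "(\<And>i j. ent M i j = ent M' i j) ==> M = M'" by transfer auto

instantiation sqm :: (comm_ring_1, finite) ring_1
begin
lift_definition zero_sqm :: "('a, 'b) sqm" is "\<lambda>i j. 0" .
lift_definition one_sqm :: "('a, 'b) sqm" is "\<lambda>i j. if i = j then 1 else 0" .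
lift_definition plus_sqm :: "('a, 'b) sqm => ('a, 'b) sqm => ('a, 'b) sqm" is "\<lambda>A B i j. A i j + B i j" .
lift_definition minus_sqm :: "('a, 'b) sqm => ('a, 'b) sqm => ('a, 'b) sqm" is "\<lambda>A B i j. A i j - B i j" .
lift_definition uminus_sqm :: "('a, 'b) sqm => ('a, 'b) sqm" is "\<lambda>A i j. - A i j" .
lift_definition times_sqm :: "('a, 'b) sqm => ('a, 'b) sqm => ('a, 'b) sqm" is "\<lambda>A B i j. \<Sum>k\<in>UNIV. A i k * B k j" .
instance
proof
  fix a b c :: "('a, 'b) sqm"
  show "a * b * c = a * (b * c)"
    by transfer (auto simp: fun_eq_iff sum_distrib_left sum_distrib_right mult.assoc intro: sum.swap)
  show "1 * a = a" by transfer (auto simp: fun_eq_iff if_distrib[of "\<lambda>x. x * _"] cong: if_cong)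
  show "a * 1 = a" by transfer (auto simp: fun_eq_iff if_distrib[of "\<lambda>x. _ * x"] cong: if_cong)
  show "(a + b) * c = a * c + b * c" by transfer (simp add: distrib_right sum.distrib)
  show "a * (b + c) = a * b + a * c" by transfer (simp add: distrib_left sum.distrib)
  show "(0 :: ('a, 'b) sqm) \<noteq> 1" by transfer (auto simp: fun_eq_iff)
qed (transfer; simp add: fun_eq_iff)+
end

lemma ent_0 [simp]: "ent 0 i j = 0" by transfer simp
lemma ent_1: "ent 1 i j = (if i = j then 1 else 0)" by transfer simp
lemma ent_add [simp]: "ent (A + B) i j = ent A i j + ent B i j" by transfer simp
lemma ent_diff [simp]: "ent (A - B) i j = ent A i j - ent B i j" by transfer simp
lemma ent_uminus [simp]: "ent (- A) i j = - ent A i j" by transfer simp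
lemma ent_mult: "ent (A * B) i j = (\<Sum>k\<in>UNIV. ent A i k * ent B k j)" by transfer simp
lemma ent_sum: "ent (\<Sum>x\<in>X. f x) i j = (\<Sum>x\<in>X. ent (f x) i j)"
  by (induction X rule: infinite_finite_induct) auto
lemma ent_Sqm [simp]: "ent (Sqm f) i j = f i j" by (simp add: Sqm_inverse)

lift_definition scl :: "'q::comm_ring_1 => ('q, 'n::finite) sqm => ('q, 'n) sqm" is "\<lambda>c A i j. c * A i j" .

lemma ent_scl [simp]: "ent (scl c A) i j = c * ent A i j" by transfer simp

lemma scl_mult_left [simp]: "scl c A * B = scl c (A * B)"
  by (rule sqm_eqI) (simp add: ent_mult sum_distrib_left mult.assoc)
lemma scl_mult_right [simp]: "A * scl c B = scl c (A * B)"
  by (rule sqm_eqI) (simp add: ent_mult sum_distrib_left mult.left_commute)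
lemma scl_scl [simp]: "scl c (scl d A) = scl (c * d) A" by (rule sqm_eqI) (simp add: mult.assoc)
lemma scl_1 [simp]: "scl 1 A = A" by (rule sqm_eqI) simp
lemma scl_0 [simp]: "scl 0 A = 0" "scl c 0 = 0" by (rule sqm_eqI; simp)+
lemma scl_add: "scl c (A + B) = scl c A + scl c B" by (rule sqm_eqI) (simp add: distrib_left)
lemma scl_diff: "scl c (A - B) = scl c A - scl c B" by (rule sqm_eqI) (simp add: right_diff_distrib)
lemma scl_add_left: "scl (c + d) A = scl c A + scl d A" by (rule sqm_eqI) (simp add: distrib_right)
lemma scl_uminus: "scl (- c) A = - scl c A" "scl c (- A) = - scl c A" by (rule sqm_eqI; simp)+
lemma scl_sum: "scl c (\<Sum>x\<in>X. f x) = (\<Sum>x\<in>X. scl c (f x))"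
  by (rule sqm_eqI) (simp add: ent_sum sum_distrib_left)
lemma scl_power: "scl c A ^ k = scl (c ^ k) (A ^ k)" by (induction k) (simp_all add: mult_ac)

lift_definition mmap :: "('q => 'r) => ('q, 'n) sqm => ('r, 'n) sqm" is "\<lambda>h A i j. h (A i j)" .

lemma ent_mmap [simp]: "ent (mmap h A) i j = h (ent A i j)" by transfer simp

section \<open>Exponentials of nilpotent matrices\<close>

definition dpow :: "nat => ('q::field_char_0, 'n::finite) sqm => ('q, 'n) sqm" where
  "dpow k X = scl (inverse (fact k)) (X ^ k)"

definition nexp :: "nat => ('q::field_char_0, 'n::finite) sqm => ('q, 'n) sqm" where
  "nexp m X = (\<Sum>k<m. dpow k X)"

lemma dpow_0 [simp]: "dpow 0 X = 1" by (simp add: dpow_def)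

lemma dpow_Suc: "scl (of_nat (Suc k)) (dpow (Suc k) X) = X * dpow k X"
  unfolding dpow_def fact_Suc scl_scl by (simp add: field_simps del: of_nat_Suc)

lemma dpow_zero:
  assumes "X ^ n = 0" "n \<le> k" shows "dpow k X = 0"
proof -
  have "X ^ (n + (k - n)) = 0" unfolding power_add assms(1) by simp
  then have "X ^ k = 0" using assms(2) by simp
  then show ?thesis by (simp add: dpow_def)
qed

lemma scl_cancel: "c \<noteq> 0 ==> scl c A = scl c B ==> A = B" for c :: "'q::field"
  by (metis scl_scl scl_1 left_inverse)

lemma dpow_commute: "X * Y = Y * X ==> dpow k X * Y = Y * dpow k X"
  by (simp add: dpow_def power_commuting_commutes)

text \<open>The binomial formula in divided powers, proved after multiplication by k + 1: X times
  the i-th divided power of X is i + 1 times the next one, and likewise for Y.\<close>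

lemma dpow_add:
  fixes X Y :: "('q::field_char_0, 'n::finite) sqm"
  assumes "X * Y = Y * X"
  shows "dpow k (X + Y) = (\<Sum>i\<le>k. dpow i X * dpow (k - i) Y)"
proof (induction k)
  case (Suc k)
  let ?s = "\<lambda>i c. scl (of_nat i) c"
  have "?s (Suc k) (dpow (Suc k) (X + Y)) = X * (\<Sum>i\<le>k. dpow i X * dpow (k - i) Y) + Y * (\<Sum>i\<le>k. dpow i X * dpow (k - i) Y)"
    unfolding dpow_Suc Suc by (simp add: distrib_right)
  also have "... = (\<Sum>i\<le>k. (X * dpow i X) * dpow (k - i) Y) + (\<Sum>i\<le>k. dpow i X * (Y * dpow (k - i) Y))"
    using dpow_commute[OF assms] by (simp add: sum_distrib_left flip: mult.assoc)
  also have "... = (\<Sum>i\<le>k. ?s (Suc i) (dpow (Suc i) X * dpow (k - i) Y)) + (\<Sum>i\<le>k. ?s (Suc (k - i)) (dpow i X * dpow (Suc (k - i)) Y))"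
    unfolding dpow_Suc[symmetric] by simp
  also have "(\<Sum>i\<le>k. ?s (Suc i) (dpow (Suc i) X * dpow (k - i) Y)) = (\<Sum>i\<le>Suc k. ?s i (dpow i X * dpow (Suc k - i) Y))"
    by (subst sum.atMost_Suc_shift) simp
  also have "(\<Sum>i\<le>k. ?s (Suc (k - i)) (dpow i X * dpow (Suc (k - i)) Y)) = (\<Sum>i\<le>Suc k. ?s (Suc k - i) (dpow i X * dpow (Suc k - i) Y))"
    by (simp add: Suc_diff_le algebra_simps)
  also have "(\<Sum>i\<le>Suc k. ?s i (dpow i X * dpow (Suc k - i) Y)) + (\<Sum>i\<le>Suc k. ?s (Suc k - i) (dpow i X * dpow (Suc k - i) Y))
     = (\<Sum>i\<le>Suc k. ?s (Suc k) (dpow i X * dpow (Suc k - i) Y))"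
    unfolding sum.distrib[symmetric] scl_add_left[symmetric] of_nat_add[symmetric]
    by (rule sum.cong) simp_all
  also have "... = ?s (Suc k) (\<Sum>i\<le>Suc k. dpow i X * dpow (Suc k - i) Y)" by (simp only: scl_sum)
  finally show ?case by (rule scl_cancel[rotated]) (simp del: of_nat_Suc)
qed simp

lemma nexp_more:
  assumes "X ^ n = 0" "n \<le> m" shows "nexp m X = nexp n X"
  unfolding nexp_def using assms by (intro sum.mono_neutral_right) (auto intro: dpow_zero)

lemma nexp_add:
  assumes c: "X * Y = Y * X" and X: "X ^ n = 0" and Y: "Y ^ n = 0"
  shows "nexp (2 * n) (X + Y) = nexp n X * nexp n Y"
proof -
  let ?m = "2 * n"
  have "nexp n X * nexp n Y = nexp ?m X * nexp ?m Y" using nexp_more[OF X, of ?m] nexp_more[OF Y, of ?m] by simp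
  also have "... = (\<Sum>i<?m. \<Sum>j<?m. dpow i X * dpow j Y)" by (simp add: nexp_def sum_product)
  also have "... = (\<Sum>(i, j)\<in>{..<?m} \<times> {..<?m}. dpow i X * dpow j Y)" by (rule sum.cartesian_product)
  also have "... = (\<Sum>(i, j)\<in>{(i, j). i + j < ?m}. dpow i X * dpow j Y)"
  proof -
    \<comment> \<open>Truncation at 2n fits the triangular reindexing: in total degree 2n or more
      one of the two powers vanishes.\<close>
    have "dpow i X * dpow j Y = 0" if "\<not> i + j < ?m" for i j
    proof -
      have "n \<le> i \<or> n \<le> j" using that by linarith
      then show ?thesis using dpow_zero[OF X] dpow_zero[OF Y] by fastforce
    qed
    then show ?thesis by (intro sum.mono_neutral_right) auto
  qed
  also have "... = (\<Sum>k<?m. \<Sum>i\<le>k. dpow i X * dpow (k - i) Y)" by (rule sum.triangle_reindex)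
  also have "... = nexp ?m (X + Y)" by (simp add: nexp_def dpow_add[OF c])
  finally show ?thesis by simp
qed

lemma nexp_lessThan_Suc: "nexp (Suc m) X = 1 + (\<Sum>k<m. dpow (Suc k) X)"
  unfolding nexp_def by (subst sum.lessThan_Suc_shift) simp

text \<open>Z = [X, F] commutes with X, so moving F past the power k + 1 of X leaves k + 1 copies of
  Z times the k-th power; in divided powers the integer cancels.\<close>

lemma dpow_conj:
  assumes XF: "X * F = F * X + Z" and XZ: "X * Z = Z * X"
  shows "dpow (Suc k) X * F = F * dpow (Suc k) X + Z * dpow k X"
proof -
  have pw: "X ^ Suc k * F = F * X ^ Suc k + scl (of_nat (Suc k)) (Z * X ^ k)" for k
  proof (induction k)
    case 0 then show ?case by (simp add: XF)
  next
    case (Suc k)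
    have "X ^ Suc (Suc k) * F = X * (X ^ Suc k * F)" by (simp add: mult.assoc)
    also have "... = (X * F) * X ^ Suc k + scl (of_nat (Suc k)) ((X * Z) * X ^ k)"
      unfolding Suc by (simp add: distrib_left mult.assoc)
    also have "... = F * X ^ Suc (Suc k) + (scl 1 (Z * X ^ Suc k) + scl (of_nat (Suc k)) (Z * X ^ Suc k))"
      unfolding XF XZ by (simp add: distrib_right mult.assoc)
    also have "scl 1 (Z * X ^ Suc k) + scl (of_nat (Suc k)) (Z * X ^ Suc k) = scl (of_nat (Suc (Suc k))) (Z * X ^ Suc k)"
      unfolding scl_add_left[symmetric] by simp
    finally show ?case .
  qed
  have "dpow (Suc k) X * F = F * dpow (Suc k) X + scl (inverse (fact (Suc k)) * of_nat (Suc k)) (Z * X ^ k)"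
    unfolding dpow_def by (simp only: scl_mult_left scl_mult_right pw scl_add scl_scl)
  also have "inverse (fact (Suc k)) * of_nat (Suc k) = (inverse (fact k) :: 'a)"
    by (simp add: field_simps del: of_nat_Suc)
  finally show ?thesis by (simp add: dpow_def)
qed

lemma nexp_conj:
  assumes XF: "X * F = F * X + Z" and XZ: "X * Z = Z * X" and X: "X ^ n = 0"
  shows "nexp n X * F = (F + Z) * nexp n X"
proof -
  \<comment> \<open>The sum on the left runs one term further, because the term with Z lowers the
    degree by one.\<close>
  have "nexp (Suc n) X * F = F * nexp (Suc n) X + Z * nexp n X" unfolding nexp_lessThan_Suc
    by (simp add: distrib_right distrib_left sum_distrib_left sum_distrib_right dpow_conj[OF XF XZ] sum.distrib nexp_def add.assoc)
  then show ?thesis using nexp_more[OF X, of "Suc n"] by (simp add: distrib_right)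
qed

lemma nexp_commute: "X * F = F * X ==> nexp n X * F = F * nexp n X"
  by (simp add: nexp_def sum_distrib_left sum_distrib_right dpow_commute)

lemma nexp_commute2: "X * F = F * X ==> nexp n X * nexp m F = nexp m F * nexp n X"
  using nexp_commute[of F "nexp n X" m] nexp_commute[of X F n] by simp

text \<open>Conjugation by the exponential of X takes F to F + Z, hence the exponential of F to that
  of F + Z, which splits because F and Z commute.\<close>

lemma nexp_rel:
  assumes XF: "X * F = F * X + Z" and XZ: "X * Z = Z * X" and FZ: "F * Z = Z * F"
    and X: "X ^ n = 0" and F: "F ^ n = 0" and Z: "Z ^ n = 0"
  shows "nexp n X * nexp n F = nexp n Z * nexp n F * nexp n X"
proof -
  have pw: "nexp n X * F ^ k = (F + Z) ^ k * nexp n X" for k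
  proof (induction k)
    case (Suc k)
    have "nexp n X * F ^ Suc k = (nexp n X * F) * F ^ k" by (simp add: mult.assoc)
    also have "... = (F + Z) * (nexp n X * F ^ k)" unfolding nexp_conj[OF XF XZ X] by (simp add: mult.assoc)
    finally show ?case unfolding Suc by (simp add: mult.assoc)
  qed simp
  have "nexp n X * nexp n F = nexp n X * nexp (2 * n) F" using nexp_more[OF F, of "2 * n"] by simp
  also have "... = nexp (2 * n) (Z + F) * nexp n X"
    by (simp add: nexp_def[of "2 * n"] sum_distrib_left sum_distrib_right dpow_def pw add.commute[of Z])
  also have "nexp (2 * n) (Z + F) = nexp n Z * nexp n F" using FZ Z F by (intro nexp_add) simp_all
  finally show ?thesis .
qed

text \<open>The pattern of an sl2 triple: for X = aE it is used with K = aH and L = a^2 E, and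
  conjugation by the exponential of X takes F to F + K - L.\<close>

lemma dpow_conj_opp:
  assumes XF: "X * F = F * X + K" and XK: "X * K = K * X - scl 2 L" and XL: "X * L = L * X"
  shows "dpow (Suc (Suc k)) X * F = F * dpow (Suc (Suc k)) X + K * dpow (Suc k) X - L * dpow k X"
proof -
  let ?s = "\<lambda>i. scl (of_nat i)"
  have pw: "X ^ Suc (Suc k) * F = F * X ^ Suc (Suc k) + ?s (Suc (Suc k)) (K * X ^ Suc k) - ?s (Suc (Suc k) * Suc k) (L * X ^ k)" for k
  proof (induction k)
    case 0
    have "X * X * F = X * (X * F)" by (simp add: mult.assoc)
    also have "... = (X * F) * X + X * K" by (simp only: XF distrib_left distrib_right mult.assoc[symmetric])
    also have "... = F * X * X + (scl 1 (K * X) + scl 1 (K * X)) - scl 2 L"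
      unfolding XF XK by (simp add: distrib_right mult.assoc)
    also have "scl 1 (K * X) + scl 1 (K * X) = scl 2 (K * X)" unfolding scl_add_left[symmetric] by simp
    finally show ?case by (simp add: mult.assoc)
  next
    case (Suc k)
    have "X ^ Suc (Suc (Suc k)) * F = X * (X ^ Suc (Suc k) * F)" by (simp add: mult.assoc)
    also have "... = (X * F) * X ^ Suc (Suc k) + ?s (Suc (Suc k)) ((X * K) * X ^ Suc k) - ?s (Suc (Suc k) * Suc k) ((X * L) * X ^ k)"
      unfolding Suc by (simp add: distrib_left right_diff_distrib mult.assoc)
    also have "... = F * X ^ Suc (Suc (Suc k)) + (scl 1 (K * X ^ Suc (Suc k)) + ?s (Suc (Suc k)) (K * X ^ Suc (Suc k)))
        - (scl (2 * of_nat (Suc (Suc k))) (L * X ^ Suc k) + ?s (Suc (Suc k) * Suc k) (L * X ^ Suc k))"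
      unfolding XF XK XL
      by (simp add: distrib_right left_diff_distrib mult.assoc scl_diff mult.commute del: of_nat_Suc)
    also have "scl 1 (K * X ^ Suc (Suc k)) + ?s (Suc (Suc k)) (K * X ^ Suc (Suc k)) = ?s (Suc (Suc (Suc k))) (K * X ^ Suc (Suc k))"
      unfolding scl_add_left[symmetric] by simp
    also have "scl (2 * of_nat (Suc (Suc k))) (L * X ^ Suc k) + ?s (Suc (Suc k) * Suc k) (L * X ^ Suc k) = ?s (Suc (Suc (Suc k)) * Suc (Suc k)) (L * X ^ Suc k)"
      unfolding scl_add_left[symmetric] by (simp add: algebra_simps)
    finally show ?case .
  qed
  have "dpow (Suc (Suc k)) X * F = F * dpow (Suc (Suc k)) X
      + scl (inverse (fact (Suc (Suc k))) * of_nat (Suc (Suc k))) (K * X ^ Suc k)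
      - scl (inverse (fact (Suc (Suc k))) * of_nat (Suc (Suc k) * Suc k)) (L * X ^ k)"
    unfolding dpow_def by (simp only: scl_mult_left scl_mult_right pw scl_add scl_diff scl_scl)
  also have "inverse (fact (Suc (Suc k))) * of_nat (Suc (Suc k)) = (inverse (fact (Suc k)) :: 'a)"
    by (simp add: field_simps del: of_nat_Suc)
  also have "inverse (fact (Suc (Suc k))) * of_nat (Suc (Suc k) * Suc k) = (inverse (fact k) :: 'a)"
    by (simp add: fact_Suc field_simps del: of_nat_Suc mult_Suc mult_Suc_right)
  finally show ?thesis by (simp only: dpow_def scl_mult_right)
qed

lemma nexp_conj_opp:
  assumes XF: "X * F = F * X + K" and XK: "X * K = K * X - scl 2 L" and XL: "X * L = L * X" and X: "X ^ n = 0"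
  shows "nexp n X * F = (F + K - L) * nexp n X"
proof -
  have s: "nexp (Suc (Suc n)) X = 1 + X + (\<Sum>k<n. dpow (Suc (Suc k)) X)"
    unfolding nexp_def by (subst sum.lessThan_Suc_shift)+ (simp add: dpow_def add.assoc)
  have s1: "nexp (Suc n) X = 1 + (\<Sum>k<n. dpow (Suc k) X)" by (rule nexp_lessThan_Suc)
  have "nexp (Suc (Suc n)) X * F = F * nexp (Suc (Suc n)) X + K * nexp (Suc n) X - L * nexp n X"
    unfolding s s1 nexp_def[of n X]
    by (simp add: distrib_right distrib_left sum_distrib_left sum_distrib_right dpow_conj_opp[OF XF XK XL]
        sum.distrib sum_subtractf XF)
  then show ?thesis using nexp_more[OF X, of "Suc (Suc n)"] nexp_more[OF X, of "Suc n"]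
    by (simp add: distrib_right left_diff_distrib)
qed

section \<open>Integral matrices of root vectors and their exponentials\<close>

lemma mmap_add: "(\<And>a b. h (a + b) = h a + h b) ==> mmap h (A + B) = mmap h A + mmap h B"
  by (rule sqm_eqI) simp

lemma mmap_mult:
  assumes "\<And>a b. h (a + b) = h a + h b" "\<And>a b. h (a * b) = h a * h b" "h 0 = 0"
  shows "mmap h (A * B) = mmap h A * mmap h B"
proof (rule sqm_eqI)
  fix i j
  show "ent (mmap h (A * B)) i j = ent (mmap h A * mmap h B) i j"
    using sum_comp_morphism[of h "\<lambda>k. ent A i k * ent B k j" UNIV] assms by (simp add: ent_mult comp_def)
qed

lemma mmap_1: "h 0 = 0 ==> h 1 = 1 ==> mmap h 1 = 1" by (rule sqm_eqI) (simp add: ent_1)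

abbreviation mint :: "(int, 'n::finite) sqm => ('q::comm_ring_1, 'n) sqm" where
  "mint \<equiv> mmap of_int"

lemma mint_add: "mint (A + B) = mint A + mint B" by (rule mmap_add) simp
lemma mint_mult: "mint (A * B) = mint A * mint B" by (rule mmap_mult) auto
lemma mint_1: "mint 1 = 1" by (rule mmap_1) auto
lemma mint_0: "mint 0 = 0" by (rule sqm_eqI) simp
lemma mint_diff: "mint (A - B) = mint A - mint B" by (rule sqm_eqI) simp
lemma mint_scl: "mint (scl c A) = scl (of_int c) (mint A)" by (rule sqm_eqI) simp
lemma mint_power: "mint (A ^ k) = mint A ^ k" by (induction k) (auto simp: mint_1 mint_mult)

text \<open>\<open>D \<alpha> k\<close> is the integral matrix of the k-th divided power of a root
  vector; relations over the integers can be transported to every ring. \<open>D_content\<close>,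
  the primitivity of the root matrices, is what remains here of simple connectedness.\<close>

locale lie_matrices = simply_laced \<Phi> ip N
  for \<Phi> :: "'a::ab_group_add set" and ip N +
  fixes D :: "'a => nat => (int, 'n::finite) sqm"
  assumes D_fact: "\<alpha> \<in> \<Phi> ==> scl (fact k) (D \<alpha> k) = D \<alpha> 1 ^ k"
    and D_nil: "\<alpha> \<in> \<Phi> ==> D \<alpha> 1 ^ CARD('n) = 0"
    and D_commute: "\<alpha> \<in> \<Phi> ==> \<beta> \<in> \<Phi> ==> ip \<alpha> \<beta> \<ge> 0 ==> D \<alpha> 1 * D \<beta> 1 = D \<beta> 1 * D \<alpha> 1"
    and D_rel: "\<alpha> \<in> \<Phi> ==> \<beta> \<in> \<Phi> ==> ip \<alpha> \<beta> = -1 ==>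
      D \<alpha> 1 * D \<beta> 1 = D \<beta> 1 * D \<alpha> 1 + scl (N \<alpha> \<beta>) (D (\<alpha> + \<beta>) 1)"
    and D_coroot: "\<alpha> \<in> \<Phi> ==> \<beta> \<in> \<Phi> ==>
      (D \<alpha> 1 * D (- \<alpha>) 1 - D (- \<alpha>) 1 * D \<alpha> 1) * D \<beta> 1 =
      D \<beta> 1 * (D \<alpha> 1 * D (- \<alpha>) 1 - D (- \<alpha>) 1 * D \<alpha> 1) + scl \<lfloor>ip \<alpha> \<beta>\<rfloor> (D \<beta> 1)"
    and D_content: "\<alpha> \<in> \<Phi> ==> prime p ==> \<exists>i j. \<not> int p dvd ent (D \<alpha> 1) i j"
begin

definition E :: "'a => ('q::comm_ring_1, 'n) sqm" where "E \<alpha> = mint (D \<alpha> 1)"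
definition H :: "'a => ('q::comm_ring_1, 'n) sqm" where "H \<alpha> = E \<alpha> * E (- \<alpha>) - E (- \<alpha>) * E \<alpha>"

text \<open>Built from integral divided powers, hence meaningful over every commutative ring; over a
  field of characteristic 0 it is an exponential.\<close>

definition T :: "'a => 'q::comm_ring_1 => ('q, 'n) sqm" where
  "T \<alpha> a = (\<Sum>k<CARD('n). scl (a ^ k) (mint (D \<alpha> k)))"

lemma E_nil: "\<alpha> \<in> \<Phi> ==> E \<alpha> ^ CARD('n) = 0" unfolding E_def mint_power[symmetric] D_nil mint_0 ..

lemma E_commute: "\<alpha> \<in> \<Phi> ==> \<beta> \<in> \<Phi> ==> ip \<alpha> \<beta> \<ge> 0 ==> E \<alpha> * E \<beta> = E \<beta> * E \<alpha>"
  using arg_cong[OF D_commute[of \<alpha> \<beta>], of mint] by (simp add: E_def mint_mult)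

lemma E_rel: "\<alpha> \<in> \<Phi> ==> \<beta> \<in> \<Phi> ==> ip \<alpha> \<beta> = -1 ==>
  E \<alpha> * E \<beta> = E \<beta> * E \<alpha> + scl (of_int (N \<alpha> \<beta>)) (E (\<alpha> + \<beta>))"
  using D_rel[of \<alpha> \<beta>] by (simp add: E_def flip: mint_mult mint_scl mint_add)

lemma H_E: "\<alpha> \<in> \<Phi> ==> \<beta> \<in> \<Phi> ==> H \<alpha> * E \<beta> = E \<beta> * H \<alpha> + scl (of_int \<lfloor>ip \<alpha> \<beta>\<rfloor>) (E \<beta>)"
  using D_coroot[of \<alpha> \<beta>] by (simp add: E_def H_def flip: mint_mult mint_scl mint_add mint_diff)

lemma mint_D: "\<alpha> \<in> \<Phi> ==> mint (D \<alpha> k) = dpow k (E \<alpha> :: ('q::field_char_0, 'n) sqm)"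
proof -
  assume \<alpha>: "\<alpha> \<in> \<Phi>"
  have "scl (of_int (fact k)) (mint (D \<alpha> k)) = (E \<alpha> ^ k :: ('q, 'n) sqm)"
    unfolding E_def mint_power[symmetric] D_fact[OF \<alpha>, symmetric] mint_scl ..
  then have "scl (inverse (fact k)) (E \<alpha> ^ k :: ('q, 'n) sqm) = scl (inverse (fact k)) (scl (of_int (fact k)) (mint (D \<alpha> k)))"
    by simp
  then show ?thesis by (simp add: dpow_def)
qed

lemma T_nexp: "\<alpha> \<in> \<Phi> ==> T \<alpha> a = nexp CARD('n) (scl a (E \<alpha>))" for a :: "'q::field_char_0"
  unfolding T_def nexp_def by (simp add: mint_D dpow_def scl_power mult.commute)

lemma aE_nil: "\<alpha> \<in> \<Phi> ==> scl a (E \<alpha>) ^ CARD('n) = 0" by (simp add: scl_power E_nil)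

lemma T_add:
  assumes "\<alpha> \<in> \<Phi>" shows "T \<alpha> (a + b) = T \<alpha> a * T \<alpha> (b :: 'q::field_char_0)"
proof -
  have "nexp (2 * CARD('n)) (scl a (E \<alpha>) + scl b (E \<alpha>)) = T \<alpha> a * T \<alpha> b"
    unfolding T_nexp[OF assms] by (rule nexp_add) (simp_all add: aE_nil assms mult.commute)
  then show ?thesis
    using nexp_more[OF aE_nil[OF assms, of "a + b"], of "2 * CARD('n)"] by (simp add: T_nexp assms scl_add_left)
qed

lemma T_0: "\<alpha> \<in> \<Phi> ==> T \<alpha> (0 :: 'q::field_char_0) = 1"
proof -
  assume \<alpha>: "\<alpha> \<in> \<Phi>"
  have "nexp m (0 :: ('q, 'n) sqm) = 1" if "m > 0" for m
  proof -
    have "nexp m (0 :: ('q, 'n) sqm) = nexp 1 0" by (rule nexp_more) (use that in auto)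
    then show ?thesis by (simp add: nexp_def)
  qed
  then show ?thesis using \<alpha> by (simp add: T_nexp)
qed

lemma T_uminus: "\<alpha> \<in> \<Phi> ==> T \<alpha> a * T \<alpha> (- a) = 1" "\<alpha> \<in> \<Phi> ==> T \<alpha> (- a) * T \<alpha> a = 1" for a :: "'q::field_char_0"
  using T_add[of \<alpha> a "- a"] T_add[of \<alpha> "- a" a] T_0[of \<alpha>, where 'q = 'q] by (metis add.right_inverse add.left_inverse)+

lemma T_commute:
  assumes "\<alpha> \<in> \<Phi>" "\<beta> \<in> \<Phi>" "ip \<alpha> \<beta> \<ge> 0"
  shows "T \<alpha> a * T \<beta> b = T \<beta> b * T \<alpha> (a :: 'q::field_char_0)"
  unfolding T_nexp[OF assms(1)] T_nexp[OF assms(2)]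
  by (rule nexp_commute2) (simp add: E_commute[OF assms] mult.commute)

lemma T_rel:
  assumes "\<alpha> \<in> \<Phi>" "\<beta> \<in> \<Phi>" "ip \<alpha> \<beta> = -1"
  shows "T \<alpha> a * T \<beta> b = T (\<alpha> + \<beta>) (of_int (N \<alpha> \<beta>) * a * b) * T \<beta> b * T \<alpha> (a :: 'q::field_char_0)"
proof -
  have rt: "\<alpha> + \<beta> \<in> \<Phi>" using add_root assms by blast
  have "E \<alpha> * E (\<alpha> + \<beta>) = (E (\<alpha> + \<beta>) * E \<alpha> :: ('q, 'n) sqm)" "E \<beta> * E (\<alpha> + \<beta>) = (E (\<alpha> + \<beta>) * E \<beta> :: ('q, 'n) sqm)"
    by (rule E_commute; use assms rt in \<open>simp add: ip_lin ip_self ip_sym[of \<beta> \<alpha>]\<close>)+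
  then show ?thesis unfolding T_nexp[OF assms(1)] T_nexp[OF assms(2)] T_nexp[OF rt]
    by (intro nexp_rel) (simp_all add: aE_nil assms rt E_rel scl_add mult_ac)
qed

lemma T_E_commute:
  assumes "\<alpha> \<in> \<Phi>" "\<beta> \<in> \<Phi>" "ip \<alpha> \<beta> \<ge> 0"
  shows "T \<alpha> a * E \<beta> = E \<beta> * T \<alpha> (a :: 'q::field_char_0)"
  unfolding T_nexp[OF assms(1)] by (rule nexp_commute) (simp add: E_commute[OF assms])

lemma T_E_rel:
  assumes "\<alpha> \<in> \<Phi>" "\<beta> \<in> \<Phi>" "ip \<alpha> \<beta> = -1"
  shows "T \<alpha> a * E \<beta> = (E \<beta> + scl (of_int (N \<alpha> \<beta>) * a) (E (\<alpha> + \<beta>))) * T \<alpha> (a :: 'q::field_char_0)"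
proof -
  have rt: "\<alpha> + \<beta> \<in> \<Phi>" using add_root assms by blast
  have "E \<alpha> * E (\<alpha> + \<beta>) = (E (\<alpha> + \<beta>) * E \<alpha> :: ('q, 'n) sqm)"
    by (rule E_commute; use assms rt in \<open>simp add: ip_lin ip_self\<close>)+
  then show ?thesis unfolding T_nexp[OF assms(1)]
    by (intro nexp_conj) (simp_all add: aE_nil assms rt E_rel scl_add mult_ac)
qed

lemma T_E_opp:
  assumes "\<alpha> \<in> \<Phi>"
  shows "T \<alpha> a * E (- \<alpha>) = (E (- \<alpha>) + scl a (H \<alpha>) - scl (a * a) (E \<alpha>)) * T \<alpha> (a :: 'q::field_char_0)"
proof -
  have h: "\<lfloor>ip \<alpha> \<alpha>\<rfloor> = 2" using assms by (simp add: ip_self)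
  have EH: "E \<alpha> * H \<alpha> = H \<alpha> * E \<alpha> - scl 2 (E \<alpha> :: ('q, 'n) sqm)"
    using H_E[OF assms assms, where 'b = 'q] by (simp add: h)
  show ?thesis unfolding T_nexp[OF assms]
  proof (rule nexp_conj_opp)
    show "scl a (E \<alpha>) * E (- \<alpha>) = E (- \<alpha>) * scl a (E \<alpha>) + scl a (H \<alpha>)" by (simp add: H_def scl_diff)
    show "scl a (E \<alpha>) * scl a (H \<alpha>) = scl a (H \<alpha>) * scl a (E \<alpha>) - scl 2 (scl (a * a) (E \<alpha>))"
      by (simp add: EH scl_diff mult_ac)
  qed (simp_all add: aE_nil assms mult_ac)
qed

lemma T_C:
  assumes "\<alpha> \<in> \<Phi>" "C * E \<alpha> = E \<alpha> * C + scl l (E \<alpha>)"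
  shows "T \<alpha> a * C = (C - scl (l * a) (E \<alpha>)) * T \<alpha> (a :: 'q::field_char_0)"
proof -
  have "T \<alpha> a * C = (C + scl (- (l * a)) (E \<alpha>)) * T \<alpha> a" unfolding T_nexp[OF assms(1)]
    by (intro nexp_conj) (simp_all add: aE_nil assms scl_add scl_uminus mult_ac)
  then show ?thesis by (simp add: scl_uminus)
qed

end

section \<open>Linear independence of the root elements modulo an ideal\<close>

text \<open>\<open>A\<close> and \<open>K\<close> will be a localization and the ideal generated in
  it by \<open>J\<close>, both as subsets of a field.\<close>

locale lie_local = lie_matrices \<Phi> ip N D
  for \<Phi> :: "'a::ab_group_add set" and ip N and D :: "'a => nat => (int, 'n::finite) sqm" +
  fixes A K :: "'q::field_char_0 set"
  assumes A_1: "1 \<in> A" and A_add: "a \<in> A ==> b \<in> A ==> a + b \<in> A"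
    and A_mult: "a \<in> A ==> b \<in> A ==> a * b \<in> A" and A_uminus: "a \<in> A ==> - a \<in> A"
    and K_A: "k \<in> K ==> k \<in> A" and K_0: "0 \<in> K"
    and K_add: "k \<in> K ==> l \<in> K ==> k + l \<in> K" and AK: "a \<in> A ==> k \<in> K ==> a * k \<in> K"
begin

lemma A_0: "0 \<in> A" using K_0 K_A by blast
lemma A_nat: "of_nat k \<in> A" by (induction k) (auto intro: A_0 A_add A_1)
lemma A_int: "of_int k \<in> A" by (cases k) (auto intro: A_nat A_uminus simp flip: of_nat_Suc)
lemma A_sum: "(\<And>x. x \<in> X ==> f x \<in> A) ==> sum f X \<in> A"
  by (induction X rule: infinite_finite_induct) (auto intro: A_0 A_add)
lemma A_power: "a \<in> A ==> a ^ k \<in> A" by (induction k) (auto intro: A_1 A_mult)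
lemma K_uminus: "k \<in> K ==> - k \<in> K" using AK[OF A_uminus[OF A_1]] by simp
lemma KA: "k \<in> K ==> a \<in> A ==> k * a \<in> K" by (metis AK mult.commute)
lemma K_diff: "k \<in> K ==> l \<in> K ==> k - l \<in> K" using K_add[of k "- l"] K_uminus by simp
lemma K_sum: "(\<And>x. x \<in> X ==> f x \<in> K) ==> sum f X \<in> K"
  by (induction X rule: infinite_finite_induct) (auto intro: K_0 K_add)

definition entA :: "('q, 'n) sqm => bool" where "entA M \<longleftrightarrow> (\<forall>i j. ent M i j \<in> A)"
definition entK :: "('q, 'n) sqm => bool" where "entK M \<longleftrightarrow> (\<forall>i j. ent M i j \<in> K)"

lemma entA_mult: "entA M ==> entA M' ==> entA (M * M')"
  unfolding entA_def ent_mult by (auto intro!: A_sum A_mult)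
lemma entA_mint: "entA (mint M)" unfolding entA_def by (auto intro: A_int)
lemma entA_E: "entA (E \<alpha>)" unfolding E_def by (rule entA_mint)
lemma entA_1: "entA 1" unfolding entA_def ent_1 by (auto intro: A_0 A_1)
lemma entA_scl: "a \<in> A ==> entA M ==> entA (scl a M)" unfolding entA_def by (auto intro: A_mult)
lemma entA_sum: "(\<And>x. x \<in> X ==> entA (f x)) ==> entA (sum f X)"
  unfolding entA_def ent_sum by (auto intro!: A_sum)
lemma entK_multA: "entA M ==> entK M' ==> entK (M * M')"
  unfolding entA_def entK_def ent_mult by (auto intro!: K_sum AK)
lemma entK_A_mult: "entK M ==> entA M' ==> entK (M * M')"
  unfolding entA_def entK_def ent_mult by (auto intro!: K_sum KA)
lemma entK_add: "entK M ==> entK M' ==> entK (M + M')" unfolding entK_def by (auto intro: K_add)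
lemma entK_diff: "entK M ==> entK M' ==> entK (M - M')" unfolding entK_def by (auto intro: K_diff)
lemma entK_uminus: "entK M ==> entK (- M)" unfolding entK_def by (auto intro: K_uminus)
lemma entK_0: "entK 0" unfolding entK_def by (auto intro: K_0)
lemma entK_scl: "k \<in> K ==> entA M ==> entK (scl k M)" unfolding entA_def entK_def by (auto intro: KA)
lemma entK_sum: "(\<And>x. x \<in> X ==> entK (f x)) ==> entK (sum f X)"
  unfolding entK_def ent_sum by (auto intro!: K_sum)

lemma entA_T: "a \<in> A ==> entA (T \<alpha> a)" unfolding T_def by (intro entA_sum entA_scl entA_mint A_power)

lemma T_entK:
  assumes "\<alpha> \<in> \<Phi>" "k \<in> K" shows "entK (T \<alpha> k - 1)"
proof -
  have "T \<alpha> k - 1 = (\<Sum>i<CARD('n). scl (k ^ i) (mint (D \<alpha> i)) - (if i = 0 then 1 else 0))"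
    unfolding T_def sum_subtractf by simp
  moreover have "entK (scl (k ^ i) (mint (D \<alpha> i)) - (if i = 0 then 1 else 0))" for i
  proof (cases i)
    case 0
    then show ?thesis using assms by (simp add: mint_D entK_0)
  next
    case (Suc i')
    have "k ^ i \<in> K" unfolding Suc power_Suc2 by (intro AK A_power K_A assms)
    then show ?thesis using Suc entK_scl entA_mint by simp
  qed
  ultimately show ?thesis by (simp add: entK_sum)
qed

definition ad :: "('q, 'n) sqm => ('q, 'n) sqm => ('q, 'n) sqm" where
  "ad F X = F * X - X * F"

lemma ad_add: "ad F (X + Y) = ad F X + ad F Y" by (simp add: ad_def algebra_simps)
lemma ad_scl: "ad F (scl c X) = scl c (ad F X)" by (simp add: ad_def scl_diff)
lemma ad_sum: "ad F (\<Sum>x\<in>X. g x) = (\<Sum>x\<in>X. ad F (g x))"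
  by (simp add: ad_def sum_distrib_left sum_distrib_right sum_subtractf)
lemma ad_0: "ad F 0 = 0" by (simp add: ad_def)

text \<open>The Cartan part of an element is remembered only through its diagonal action on the root
  matrices; no coordinates are recorded for it.\<close>

definition cart :: "('q, 'n) sqm => bool" where
  "cart C \<longleftrightarrow> (\<forall>\<gamma>\<in>\<Phi>. \<exists>l\<in>A. C * E \<gamma> = E \<gamma> * C + scl l (E \<gamma>))"

definition rep :: "('a => 'q) => ('q, 'n) sqm => ('q, 'n) sqm" where
  "rep r C = (\<Sum>\<gamma>\<in>\<Phi>. scl (r \<gamma>) (E \<gamma>)) + C"

lemma cart_add: assumes "cart C" "cart C'" shows "cart (C + C')" unfolding cart_def
proof
  fix \<gamma> assume "\<gamma> \<in> \<Phi>"
  then obtain l l' where l: "l \<in> A" "l' \<in> A" "C * E \<gamma> = E \<gamma> * C + scl l (E \<gamma>)" "C' * E \<gamma> = E \<gamma> * C' + scl l' (E \<gamma>)"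
    using assms unfolding cart_def by blast
  then have "(C + C') * E \<gamma> = E \<gamma> * (C + C') + scl (l + l') (E \<gamma>)"
    by (simp add: distrib_left distrib_right scl_add_left)
  then show "\<exists>l\<in>A. (C + C') * E \<gamma> = E \<gamma> * (C + C') + scl l (E \<gamma>)" using l A_add by blast
qed

lemma cart_scl: assumes "cart C" "a \<in> A" shows "cart (scl a C)" unfolding cart_def
proof
  fix \<gamma> assume "\<gamma> \<in> \<Phi>"
  then obtain l where l: "l \<in> A" "C * E \<gamma> = E \<gamma> * C + scl l (E \<gamma>)"
    using assms unfolding cart_def by blast
  then have "scl a C * E \<gamma> = E \<gamma> * scl a C + scl (a * l) (E \<gamma>)" by (simp add: scl_add)
  then show "\<exists>l\<in>A. scl a C * E \<gamma> = E \<gamma> * scl a C + scl l (E \<gamma>)" using l assms A_mult by blast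
qed

lemma cart_0: "cart 0" unfolding cart_def using A_0 by force

lemma cart_uminus: "cart C ==> cart (- C)"
  using cart_scl[of C "- 1"] A_uminus[OF A_1] by (simp add: scl_uminus(1))

lemma cart_H: "\<alpha> \<in> \<Phi> ==> cart (H \<alpha>)" unfolding cart_def using H_E A_int by blast

text \<open>The square of ad of \<open>E (- \<gamma>)\<close> shifts by -2\<gamma>, and the only
  root from which this leads to a root or to zero is \<gamma>.\<close>

lemma ad2_E:
  assumes "\<gamma> \<in> \<Phi>" "\<delta> \<in> \<Phi>"
  shows "ad (E (- \<gamma>)) (ad (E (- \<gamma>)) (E \<delta>)) = (if \<delta> = \<gamma> then scl (- 2) (E (- \<gamma>)) else 0)"
proof -
  have neg: "- \<gamma> \<in> \<Phi>" using uminus_root assms by blast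
  have ad0: "ad (E (- \<gamma>)) (E \<delta>') = 0" if "\<delta>' \<in> \<Phi>" "ip \<gamma> \<delta>' \<le> 0" for \<delta>'
    unfolding ad_def using E_commute[OF neg that(1), where 'b = 'q] that(2) by (simp add: ip_lin)
  consider "\<delta> = \<gamma>" | "ip \<gamma> \<delta> = 1" "\<delta> \<noteq> \<gamma>" | "ip \<gamma> \<delta> \<le> 0" "\<delta> \<noteq> \<gamma>"
    using ip_vals[OF assms] ip_2[OF assms] ip_self assms by fastforce
  then show ?thesis
  proof cases
    case 1
    have "\<lfloor>ip \<gamma> (- \<gamma>)\<rfloor> = -2" using assms by (simp add: ip_lin ip_self)
    then have "H \<gamma> * E (- \<gamma>) = E (- \<gamma>) * H \<gamma> + scl (-2) (E (- \<gamma>) :: ('q, 'n) sqm)"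
      using H_E[OF assms(1) neg, where 'b = 'q] by simp
    moreover have "ad (E (- \<gamma>)) (E \<delta>) = - H \<gamma>" unfolding 1 by (simp add: ad_def H_def)
    ultimately show ?thesis using 1 by (simp add: ad_def)
  next
    case 2
    have ip': "ip (- \<gamma>) \<delta> = -1" using 2 by (simp add: ip_lin)
    have "ad (E (- \<gamma>)) (E \<delta>) = scl (of_int (N (- \<gamma>) \<delta>)) (E (- \<gamma> + \<delta>))"
      unfolding ad_def using E_rel[OF neg assms(2) ip', where 'b = 'q] by simp
    moreover have "ad (E (- \<gamma>)) (E (- \<gamma> + \<delta>)) = 0"
      using add_root[OF neg assms(2) ip'] assms(1) 2 by (intro ad0) (auto simp: ip_lin ip_self)
    ultimately show ?thesis using 2 by (simp add: ad_scl)
  next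
    case 3
    then show ?thesis using ad0[of \<delta>] assms by (simp add: ad_0)
  qed
qed

text \<open>With F = \<open>E (- \<gamma>)\<close>, the square of ad F isolates -2 times
  \<open>r \<gamma>\<close> times F. Both sides can be halved integrally, since the square of ad F
  is twice an expression in the divided power \<open>D (- \<gamma>) 2\<close>. The integers k for
  which k times \<open>r \<gamma>\<close> lies in \<open>K\<close> then contain all entries of
  \<open>D (- \<gamma>) 1\<close> and are closed under gcd, so primitivity yields k = 1.\<close>

lemma rep_entK:
  assumes X: "entK (rep r C)" and C: "cart C" and r: "\<And>\<gamma>. \<gamma> \<in> \<Phi> ==> r \<gamma> \<in> A" and \<gamma>: "\<gamma> \<in> \<Phi>"
  shows "r \<gamma> \<in> K"
proof -
  let ?F = "E (- \<gamma>) :: ('q, 'n) sqm"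
  have neg: "- \<gamma> \<in> \<Phi>" using uminus_root \<gamma> by blast
  have C0: "ad ?F (ad ?F C) = 0"
  proof -
    obtain l where "C * ?F = ?F * C + scl l ?F" using C neg unfolding cart_def by blast
    then have "ad ?F C = scl (- l) ?F" by (simp add: ad_def scl_uminus)
    then show ?thesis by (simp add: ad_def)
  qed
  have "ad ?F (ad ?F (rep r C)) = (\<Sum>\<delta>\<in>\<Phi>. scl (r \<delta>) (if \<delta> = \<gamma> then scl (- 2) ?F else 0))"
    unfolding rep_def ad_add ad_sum ad_scl C0 by (simp add: ad2_E \<gamma> cong: sum.cong)
  also have "... = (\<Sum>\<delta>\<in>\<Phi>. if \<delta> = \<gamma> then scl (r \<gamma> * - 2) ?F else 0)"
    by (intro sum.cong) (auto simp: scl_uminus)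
  also have "... = scl (r \<gamma> * - 2) ?F" using \<gamma> finite_roots by simp
  finally have *: "ad ?F (ad ?F (rep r C)) = scl (r \<gamma> * - 2) ?F" .
  let ?D2 = "mint (D (- \<gamma>) 2) :: ('q, 'n) sqm"
  have D2: "scl 2 ?D2 = ?F * ?F" by (simp add: mint_D[OF neg] dpow_def power2_eq_square fact_2)
  have q: "ad ?F (ad ?F X) = scl 2 (?D2 * X - ?F * X * ?F + X * ?D2)" for X
  proof -
    have "ad ?F (ad ?F X) = (?F * ?F) * X - (scl 1 (?F * X * ?F) + scl 1 (?F * X * ?F)) + X * (?F * ?F)"
      by (simp add: ad_def algebra_simps)
    also have "scl 1 (?F * X * ?F) + scl 1 (?F * X * ?F) = scl 2 (?F * X * ?F)"
      unfolding scl_add_left[symmetric] by simp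
    finally show ?thesis unfolding D2[symmetric] by (simp add: scl_diff scl_add)
  qed
  have "scl 2 (?D2 * rep r C - ?F * rep r C * ?F + rep r C * ?D2) = scl 2 (scl (- r \<gamma>) ?F)"
    using * unfolding q by (simp add: mult.commute)
  then have "?D2 * rep r C - ?F * rep r C * ?F + rep r C * ?D2 = scl (- r \<gamma>) ?F"
    by (rule scl_cancel[rotated]) simp
  moreover have "entK (?D2 * rep r C - ?F * rep r C * ?F + rep r C * ?D2)"
    by (intro entK_add entK_diff entK_A_mult entK_multA entA_mint entA_E X)
  ultimately have F: "entK (scl (- r \<gamma>) ?F)" by simp
  define S where "S = {k. of_int k * r \<gamma> \<in> K}"
  have ent_S: "ent (D (- \<gamma>) 1) i j \<in> S" for i j
  proof -
    have "- r \<gamma> * of_int (ent (D (- \<gamma>) 1) i j) \<in> K" using F by (simp add: entK_def E_def)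
    then show ?thesis using K_uminus unfolding S_def by (metis mem_Collect_eq minus_minus mult.commute mult_minus_left)
  qed
  have S_lin: "a * k + b * l \<in> S" if "k \<in> S" "l \<in> S" for a b k l
  proof -
    have "of_int a * (of_int k * r \<gamma>) + of_int b * (of_int l * r \<gamma>) \<in> K"
      using that unfolding S_def by (auto intro: K_add AK A_int)
    then show ?thesis by (simp add: S_def algebra_simps)
  qed
  have S_gcd: "Gcd F \<in> S" if "finite F" "F \<subseteq> S" for F using that
  proof (induction F rule: finite_induct)
    case empty then show ?case by (simp add: S_def K_0)
  next
    case (insert k F)
    obtain a b where "a * k + b * Gcd F = gcd k (Gcd F)" using bezout_int by blast
    then show ?case using S_lin[of k "Gcd F" a b] insert by simp
  qed
  let ?F = "(\<lambda>(i, j). ent (D (- \<gamma>) 1) i j) ` UNIV"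
  have "Gcd ?F = 1"
  proof (rule ccontr)
    assume ne: "Gcd ?F \<noteq> 1"
    obtain p where p: "prime p" "int p dvd Gcd ?F"
    proof (cases "Gcd ?F = 0")
      \<comment> \<open>If the gcd vanishes, every prime divides all entries, and 2 is as good as
        any.\<close>
      case True show thesis by (rule that[of 2]) (simp_all only: True dvd_0_right two_is_prime_nat)
    next
      case False
      have nn: "int (nat (Gcd ?F)) = Gcd ?F" by simp
      then have "nat (Gcd ?F) \<noteq> 1" using ne by linarith
      then obtain p where p: "prime p" "p dvd nat (Gcd ?F)" using prime_factor_nat by blast
      then have "int p dvd int (nat (Gcd ?F))" by (simp only: int_dvd_int_iff)
      then show thesis using that[of p] p nn by (simp only:)
    qed
    have "int p dvd ent (D (- \<gamma>) 1) i j" for i j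
    proof -
      have "ent (D (- \<gamma>) 1) i j \<in> ?F" by (rule image_eqI[of _ _ "(i, j)"]) simp_all
      from dvd_trans[OF p(2) Gcd_dvd[OF this]] show ?thesis .
    qed
    then show False using D_content[OF neg p(1)] by blast
  qed
  moreover have "?F \<subseteq> S" using ent_S by (auto simp del: One_nat_def)
  then have "Gcd ?F \<in> S" by (rule S_gcd[OF finite_imageI[OF finite]])
  ultimately have "1 \<in> S" by (simp only:)
  then show ?thesis by (simp add: S_def)
qed

lemma rep_add: "rep r C + rep r' C' = rep (\<lambda>\<gamma>. r \<gamma> + r' \<gamma>) (C + C')"
  by (simp add: rep_def scl_add_left sum.distrib add_ac)

lemma rep_scl: "scl c (rep r C) = rep (\<lambda>\<gamma>. c * r \<gamma>) (scl c C)" by (simp add: rep_def scl_add scl_sum)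

lemma rep_uminus: "- rep r C = rep (\<lambda>\<gamma>. - r \<gamma>) (- C)" by (simp add: rep_def scl_uminus sum_negf)

lemma rep_E:
  assumes "\<gamma> \<in> \<Phi>" shows "rep (\<lambda>\<delta>. if \<delta> = \<gamma> then c else 0) 0 = scl c (E \<gamma>)"
proof -
  have "(\<Sum>\<delta>\<in>\<Phi>. scl (if \<delta> = \<gamma> then c else 0) (E \<delta>)) = (\<Sum>\<delta>\<in>\<Phi>. if \<delta> = \<gamma> then scl c (E \<gamma>) else 0)"
    by (intro sum.cong) auto
  then show ?thesis using assms finite_roots by (simp add: rep_def)
qed

lemma rep_diff_entK:
  assumes "entK (rep r C - rep r' C')" "cart C" "cart C'" "\<And>\<gamma>. \<gamma> \<in> \<Phi> ==> r \<gamma> \<in> A" "\<And>\<gamma>. \<gamma> \<in> \<Phi> ==> r' \<gamma> \<in> A" "\<gamma> \<in> \<Phi>"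
  shows "r \<gamma> - r' \<gamma> \<in> K"
proof -
  have "rep r C - rep r' C' = rep (\<lambda>\<gamma>. r \<gamma> + - r' \<gamma>) (C + - C')"
    unfolding rep_add[symmetric] rep_uminus[symmetric] by simp
  then have "r \<gamma> + - r' \<gamma> \<in> K"
    using assms by (intro rep_entK[of _ "C + - C'"]) (auto intro: cart_add cart_uminus A_add A_uminus simp del: add_uminus_conv_diff)
  then show ?thesis by simp
qed

text \<open>The filtration with respect to which conjugation by \<open>t \<beta> a\<close> with \<open>f \<beta> > 0\<close> is unipotent.\<close>

definition lsp :: "('a => real) => real => ('q, 'n) sqm => bool" where
  "lsp f s X \<longleftrightarrow> (\<exists>r C. X = rep r C \<and> (\<forall>\<gamma>\<in>\<Phi>. r \<gamma> \<in> A \<and> (f \<gamma> \<le> s --> r \<gamma> = 0)) \<and> cart C \<and> (s \<ge> 0 --> C = 0))"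

lemma lsp_add: assumes "lsp f s X" "lsp f s Y" shows "lsp f s (X + Y)"
proof -
  obtain r C where r: "X = rep r C" "\<forall>\<gamma>\<in>\<Phi>. r \<gamma> \<in> A \<and> (f \<gamma> \<le> s --> r \<gamma> = 0)" "cart C" "s \<ge> 0 --> C = 0"
    using assms(1) unfolding lsp_def by blast
  obtain r' C' where r': "Y = rep r' C'" "\<forall>\<gamma>\<in>\<Phi>. r' \<gamma> \<in> A \<and> (f \<gamma> \<le> s --> r' \<gamma> = 0)" "cart C'" "s \<ge> 0 --> C' = 0"
    using assms(2) unfolding lsp_def by blast
  show ?thesis unfolding lsp_def by (rule exI[of _ "\<lambda>\<gamma>. r \<gamma> + r' \<gamma>"], rule exI[of _ "C + C'"])
      (use r r' in \<open>auto simp: rep_add A_add cart_add\<close>)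
qed

lemma lsp_0: "lsp f s 0" unfolding lsp_def
  by (rule exI[of _ "\<lambda>_. 0"], rule exI[of _ 0]) (auto simp: rep_def A_0 cart_0)

lemma lsp_E: "\<gamma> \<in> \<Phi> ==> a \<in> A ==> f \<gamma> > s ==> lsp f s (scl a (E \<gamma>))" unfolding lsp_def
  by (rule exI[of _ "\<lambda>\<delta>. if \<delta> = \<gamma> then a else 0"], rule exI[of _ 0]) (auto simp: rep_E A_0 cart_0)

lemma lsp_C: "cart C ==> s < 0 ==> lsp f s C" unfolding lsp_def
  by (rule exI[of _ "\<lambda>_. 0"], rule exI[of _ C]) (auto simp: rep_def A_0)

lemma lsp_scl: assumes "lsp f s X" "a \<in> A" shows "lsp f s (scl a X)"
proof -
  obtain r C where r: "X = rep r C" "\<forall>\<gamma>\<in>\<Phi>. r \<gamma> \<in> A \<and> (f \<gamma> \<le> s --> r \<gamma> = 0)" "cart C" "s \<ge> 0 --> C = 0"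
    using assms(1) unfolding lsp_def by blast
  show ?thesis unfolding lsp_def by (rule exI[of _ "\<lambda>\<gamma>. a * r \<gamma>"], rule exI[of _ "scl a C"])
      (use r assms in \<open>auto simp: rep_scl A_mult cart_scl\<close>)
qed

lemma lsp_sum: "(\<And>x. x \<in> X ==> lsp f s (g x)) ==> lsp f s (sum g X)"
  by (induction X rule: infinite_finite_induct) (auto intro: lsp_0 lsp_add)

lemma lsp_mono: assumes "lsp f s X" "s' \<le> s" shows "lsp f s' X"
proof -
  obtain r C where r: "X = rep r C" "\<forall>\<gamma>\<in>\<Phi>. r \<gamma> \<in> A \<and> (f \<gamma> \<le> s --> r \<gamma> = 0)" "cart C" "s \<ge> 0 --> C = 0"
    using assms(1) unfolding lsp_def by blast
  then show ?thesis unfolding lsp_def by (intro exI[of _ r] exI[of _ C]) (use assms in auto)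
qed

section \<open>The adjoint action of root elements\<close>

definition Ad :: "('q, 'n) sqm inv_elt => ('q, 'n) sqm => ('q, 'n) sqm" where
  "Ad g X = val g * X * val (- g)"

lemma Ad_add: "Ad g (X + Y) = Ad g X + Ad g Y" by (simp add: Ad_def algebra_simps)
lemma Ad_diff: "Ad g (X - Y) = Ad g X - Ad g Y" by (simp add: Ad_def algebra_simps)
lemma Ad_scl: "Ad g (scl c X) = scl c (Ad g X)" by (simp add: Ad_def)
lemma Ad_sum: "Ad g (\<Sum>x\<in>X. h x) = (\<Sum>x\<in>X. Ad g (h x))"
  by (simp add: Ad_def sum_distrib_left sum_distrib_right)
lemma Ad_plus: "Ad (g + h) X = Ad g (Ad h X)" by (simp add: Ad_def minus_add mult.assoc del: add_uminus_conv_diff)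
lemma Ad_0 [simp]: "Ad 0 X = X" by (simp add: Ad_def)
lemma Ad_eqI: "val g * X = Y * val g ==> Ad g X = Y" by (simp add: Ad_def mult.assoc)
lemma Ad_rep: "Ad g (rep r C) = (\<Sum>\<gamma>\<in>\<Phi>. scl (r \<gamma>) (Ad g (E \<gamma>))) + Ad g C"
  by (simp add: rep_def Ad_add Ad_sum Ad_scl)

definition t :: "'a => 'q => ('q, 'n) sqm inv_elt" where
  "t \<beta> a = (SOME g. val g = T \<beta> a \<and> val (- g) = T \<beta> (- a))"

lemma t: assumes "\<beta> \<in> \<Phi>" shows val_t: "val (t \<beta> a) = T \<beta> a" and val_uminus_t: "val (- t \<beta> a) = T \<beta> (- a)"
  using someI_ex[OF ex_inv_elt[OF T_uminus[OF assms]]] unfolding t_def by blast+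

text \<open>The new terms lie at \<beta> + \<gamma> or, for \<gamma> = -\<beta>, in degree 0 and at
  \<beta>. Each time the degree grows by at least \<open>f \<beta>\<close>, hence by more than
  c.\<close>

lemma Ad_t_E:
  assumes f: "\<And>v w. f (v + w) = f v + f w" and b: "\<beta> \<in> \<Phi>" "a \<in> A" "f \<beta> > c" "c \<ge> 0" and \<gamma>: "\<gamma> \<in> \<Phi>"
  shows "lsp f (f \<gamma> + c) (Ad (t \<beta> a) (E \<gamma>) - E \<gamma>)"
proof -
  have f0: "f 0 = 0" using f[of 0 0] by simp
  have fm: "f (- v) = - f v" for v using f[of v "- v"] f0 by simp
  consider "ip \<beta> \<gamma> \<ge> 0" | "ip \<beta> \<gamma> = -1" | "\<gamma> = - \<beta>" using ip_vals[OF b(1) \<gamma>] ip_neg2[OF b(1) \<gamma>] by auto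
  then show ?thesis
  proof cases
    case 1
    have "Ad (t \<beta> a) (E \<gamma>) = E \<gamma>" by (rule Ad_eqI) (simp add: val_t b T_E_commute[OF b(1) \<gamma> 1])
    then show ?thesis by (simp add: lsp_0)
  next
    case 2
    have "Ad (t \<beta> a) (E \<gamma>) = E \<gamma> + scl (of_int (N \<beta> \<gamma>) * a) (E (\<beta> + \<gamma>))"
      by (rule Ad_eqI) (simp add: val_t b T_E_rel[OF b(1) \<gamma> 2])
    then show ?thesis using add_root[OF b(1) \<gamma> 2] b f by (simp add: lsp_E A_mult A_int)
  next
    case 3
    have eq: "Ad (t \<beta> a) (E \<gamma>) = E \<gamma> + scl a (H \<beta>) - scl (a * a) (E \<beta>)"
      unfolding 3 by (rule Ad_eqI) (simp add: val_t b T_E_opp)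
    have neg: "f \<gamma> + c < 0" using 3 b fm by simp
    have "lsp f (f \<gamma> + c) (scl a (H \<beta>) + scl (- (a * a)) (E \<beta>))"
      by (intro lsp_add lsp_C lsp_E cart_scl cart_H A_uminus A_mult b neg) (use neg b in linarith)
    then show ?thesis unfolding eq by (simp add: scl_uminus)
  qed
qed

lemma Ad_t_lsp:
  assumes f: "\<And>v w. f (v + w) = f v + f w" and b: "\<beta> \<in> \<Phi>" "a \<in> A" "f \<beta> > 0" and X: "lsp f s X"
  shows "lsp f s (Ad (t \<beta> a) X)"
proof -
  obtain r C where r: "X = rep r C" "\<forall>\<gamma>\<in>\<Phi>. r \<gamma> \<in> A \<and> (f \<gamma> \<le> s --> r \<gamma> = 0)" "cart C" "s \<ge> 0 --> C = 0"
    using X unfolding lsp_def by blast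
  have "lsp f s (scl (r \<gamma>) (Ad (t \<beta> a) (E \<gamma>)))" if \<gamma>: "\<gamma> \<in> \<Phi>" for \<gamma>
  proof (cases "f \<gamma> \<le> s")
    case True then show ?thesis using r \<gamma> by (simp add: lsp_0)
  next
    case False
    have 1: "lsp f s (Ad (t \<beta> a) (E \<gamma>) - E \<gamma>)"
      by (rule lsp_mono[OF Ad_t_E[OF f b(1,2,3) _ \<gamma>]]) (use False in auto)
    have 2: "lsp f s (E \<gamma>)" using lsp_E[OF \<gamma> A_1, of s f] False by simp
    have "lsp f s (Ad (t \<beta> a) (E \<gamma>))" using lsp_add[OF 1 2] by simp
    then show ?thesis using r \<gamma> by (simp add: lsp_scl)
  qed
  moreover have "lsp f s (Ad (t \<beta> a) C)"
  proof (cases "s \<ge> 0")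
    case True then show ?thesis using r by (simp add: Ad_def lsp_0)
  next
    case False
    obtain l where l: "l \<in> A" "C * E \<beta> = E \<beta> * C + scl l (E \<beta>)" using r b unfolding cart_def by blast
    have "Ad (t \<beta> a) C = C - scl (l * a) (E \<beta>)" by (rule Ad_eqI) (simp add: val_t b T_C[OF b(1) l(2)])
    then have "Ad (t \<beta> a) C = C + scl (- (l * a)) (E \<beta>)" by (simp add: scl_uminus)
    moreover have "lsp f s (C + scl (- (l * a)) (E \<beta>))"
      using False by (intro lsp_add lsp_C lsp_E r b A_uminus A_mult l) (use b in auto)
    ultimately show ?thesis by simp
  qed
  ultimately show ?thesis unfolding r(1) Ad_rep by (intro lsp_add lsp_sum)
qed

end

section \<open>Elements of the kernel over a local ring act trivially\<close>

text \<open>\<open>ev\<close> turns coefficients into elements of the local ring \<open>A\<close>.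
  By \<open>\<theta>_K\<close> and \<open>y_K\<close> coefficients in \<open>K\<close> are trivial
  in the group, which is why congruence of matrices modulo \<open>K\<close> decides about the
  action.\<close>

locale local_step = lie_local \<Phi> ip N D A K
  for \<Phi> :: "'a::ab_group_add set" and ip N and D :: "'a => nat => (int, 'n::finite) sqm"
    and A K :: "'q::field_char_0 set" +
  fixes Ac Ic :: "'c::comm_ring_1 set" and ev :: "'c => 'q"
    and \<theta> y :: "'a => 'c => 'h::group_add" and ht :: "'a => real"
  assumes ev_add: "ev (a + b) = ev a + ev b" and ev_mult: "ev (a * b) = ev a * ev b" and ev_1: "ev 1 = 1"
    and ev_A: "a \<in> Ac ==> ev a \<in> A"
    and Ac_1: "1 \<in> Ac" and Ac_add: "a \<in> Ac ==> b \<in> Ac ==> a + b \<in> Ac"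
    and Ac_mult: "a \<in> Ac ==> b \<in> Ac ==> a * b \<in> Ac" and Ac_uminus: "a \<in> Ac ==> - a \<in> Ac"
    and Ic_add: "i \<in> Ic ==> j \<in> Ic ==> i + j \<in> Ic" and Ic_0: "0 \<in> Ic"
    and AcIc: "a \<in> Ac ==> i \<in> Ic ==> a * i \<in> Ic"
    and Ac_local: "a \<in> Ac ==> (\<exists>u\<in>Ac. a * u = 1) \<or> (\<forall>b\<in>Ac. \<exists>u\<in>Ac. (1 + a * b) * u = 1)"
    and \<theta>_module: "module_family Ac \<theta> Ac \<theta>" and y_module: "module_family Ac \<theta> Ic y"
    and y_commutes: "\<beta> \<in> \<Phi> ==> \<gamma> \<in> \<Phi> ==> ip \<beta> \<gamma> \<ge> 0 ==> i \<in> Ic ==> j \<in> Ic ==> commutes (y \<beta> i) (y \<gamma> j)"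
    and \<theta>_K: "\<beta> \<in> \<Phi> ==> a \<in> Ac ==> ev a \<in> K ==> \<theta> \<beta> a = 0"
    and y_K: "\<beta> \<in> \<Phi> ==> a \<in> Ac ==> ev a \<in> K ==> i \<in> Ic ==> y \<beta> (a * i) = 0"
    and y_normal: "\<alpha> \<in> \<Phi> ==> a \<in> Ac ==> \<beta> \<in> \<Phi> ==> i \<in> Ic ==>
      cjg (\<theta> \<alpha> a) (y \<beta> i) \<in> subgrp {y \<beta> i |\<beta> i. \<beta> \<in> \<Phi> \<and> i \<in> Ic}"
    and height: "height ht"
begin

lemma ht_add: "ht (v + w) = ht v + ht w" and ht_nz: "\<beta> \<in> \<Phi> ==> ht \<beta> \<noteq> 0" and ht_inj: "inj_on ht \<Phi>"
  and ht_base: "\<beta> \<in> \<Phi> ==> ht \<beta> > 0 ==> \<not> simple ht \<beta> ==>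
    \<exists>\<alpha>. simple ht \<alpha> \<and> \<beta> - \<alpha> \<in> \<Phi> \<and> ip \<alpha> (\<beta> - \<alpha>) = -1" using height unfolding height_def by blast+

lemma ev_0: "ev 0 = 0" using ev_add[of 0 0] by simp
lemma ev_uminus: "ev (- a) = - ev a" using ev_add[of a "- a"] ev_0 by (simp add: eq_neg_iff_add_eq_0 add.commute)
lemma ev_nat: "ev (of_nat k) = of_nat k" by (induction k) (auto simp: ev_0 ev_1 ev_add)
lemma ev_int: "ev (of_int k) = of_int k"
  by (cases k) (auto simp: ev_nat ev_uminus ev_add ev_1 simp flip: of_nat_Suc)

text \<open>Action and matrix are carried in one product group, so that a single Gauss decomposition
  serves both; \<open>z\<close> has trivial matrix part.\<close>

definition x :: "'a => 'c => 'h \<times> ('q, 'n) sqm inv_elt" where "x \<beta> a = (\<theta> \<beta> a, t \<beta> (ev a))"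
definition z :: "'a => 'c => 'h \<times> ('q, 'n) sqm inv_elt" where "z \<beta> i = (y \<beta> i, 0)"

lemma t_add: "\<beta> \<in> \<Phi> ==> t \<beta> (a + b) = t \<beta> a + t \<beta> b" by (rule inv_elt_eqI) (simp add: val_t T_add)
lemma t_commute: "\<alpha> \<in> \<Phi> ==> \<beta> \<in> \<Phi> ==> ip \<alpha> \<beta> \<ge> 0 ==> t \<alpha> a + t \<beta> b = t \<beta> b + t \<alpha> a"
  by (rule inv_elt_eqI) (simp add: val_t T_commute[of \<alpha> \<beta>])
lemma t_rel: "\<alpha> \<in> \<Phi> ==> \<beta> \<in> \<Phi> ==> ip \<alpha> \<beta> = -1 ==>
  t \<alpha> a + t \<beta> b = t (\<alpha> + \<beta>) (of_int (N \<alpha> \<beta>) * a * b) + t \<beta> b + t \<alpha> a"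
  by (rule inv_elt_eqI) (simp add: val_t T_rel[of \<alpha> \<beta>] add_root)

sublocale L: local_family \<Phi> ip N Ac Ic x z
proof
  show "module_family Ac x Ac x" using \<theta>_module unfolding module_family_def x_def
    by (auto simp: ev_add ev_mult ev_int t_add t_rel intro: t_commute)
  show "module_family Ac x Ic z" using y_module unfolding module_family_def x_def z_def by auto
qed (use Ac_1 Ac_add Ac_mult Ac_uminus Ic_add Ic_0 AcIc Ac_local y_commutes in \<open>auto simp: z_def\<close>)

lemma fst_x [simp]: "fst (x \<beta> a) = \<theta> \<beta> a" and snd_x [simp]: "snd (x \<beta> a) = t \<beta> (ev a)"
  by (simp_all add: x_def)

lemma Egrp_entA: "g \<in> L.Egrp ==> entA (val (snd g)) \<and> entA (val (- snd g))" unfolding L.Egrp_def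
proof (induction rule: subgrp.induct)
  case zero
  then show ?case by (simp add: entA_1 uminus_inv_elt.abs_eq)
next
  case (gen g)
  then obtain \<beta> a where "g = x \<beta> a" "\<beta> \<in> \<Phi>" "a \<in> Ac" by blast
  then show ?case by (simp add: val_t val_uminus_t entA_T ev_A A_uminus)
next
  case (add g h)
  then show ?case by (simp add: minus_add entA_mult del: add_uminus_conv_diff)
qed (simp)

text \<open>Triviality of the adjoint action modulo \<open>K\<close>. A Cartan part is allowed
  because the root coefficients already determine a unipotent element.\<close>

definition Kk :: "'h \<times> ('q, 'n) sqm inv_elt => bool" where
  "Kk u \<longleftrightarrow> (\<forall>\<gamma>\<in>\<Phi>. \<exists>C. cart C \<and> entK (Ad (snd u) (E \<gamma>) - E \<gamma> - C))"

definition Ug :: "('a => real) => real => ('h \<times> ('q, 'n) sqm inv_elt) set" where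
  "Ug f s = subgrp {x \<beta> a |\<beta> a. \<beta> \<in> \<Phi> \<and> f \<beta> > s \<and> a \<in> Ac}"

lemma Ug_Egrp: "Ug f s \<subseteq> L.Egrp"
  unfolding Ug_def L.Egrp_def by (rule subgrp_subset, rule subgrp.gen) blast

lemma Ug_left_induct [consumes 1, case_names zero step]:
  assumes "u \<in> Ug f s" "P 0" "\<And>\<beta> a u. \<beta> \<in> \<Phi> ==> f \<beta> > s ==> a \<in> Ac ==> P u ==> P (x \<beta> a + u)"
  shows "P u"
proof (rule subgrp_left_induct[OF assms(1)[unfolded Ug_def], where P = P])
  fix g assume "g \<in> {x \<beta> a |\<beta> a. \<beta> \<in> \<Phi> \<and> f \<beta> > s \<and> a \<in> Ac}"
  then obtain \<beta> a where g: "g = x \<beta> a" "\<beta> \<in> \<Phi>" "f \<beta> > s" "a \<in> Ac" by blast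
  then have "- g = x \<beta> (- a)" by (simp add: L.x_uminus)
  then show "- g \<in> {x \<beta> a |\<beta> a. \<beta> \<in> \<Phi> \<and> f \<beta> > s \<and> a \<in> Ac}" using g Ac_uminus by blast
qed (use assms(2,3) in auto)

lemma Ad_Ug_lsp:
  assumes f: "\<And>v w. f (v + w) = f v + f w" and u: "u \<in> Ug f s" and s: "s \<ge> 0" and \<gamma>: "\<gamma> \<in> \<Phi>"
  shows "lsp f (f \<gamma> + s) (Ad (snd u) (E \<gamma>) - E \<gamma>)" using u
proof (induction rule: Ug_left_induct)
  case zero then show ?case by (simp add: lsp_0)
next
  case (step \<beta> a u)
  have "Ad (snd (x \<beta> a + u)) (E \<gamma>) - E \<gamma> = Ad (t \<beta> (ev a)) (Ad (snd u) (E \<gamma>) - E \<gamma>) + (Ad (t \<beta> (ev a)) (E \<gamma>) - E \<gamma>)"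
    by (simp add: Ad_plus Ad_diff)
  moreover have "lsp f (f \<gamma> + s) (Ad (t \<beta> (ev a)) (Ad (snd u) (E \<gamma>) - E \<gamma>))"
    using step s by (intro Ad_t_lsp[OF f] ev_A) auto
  moreover have "lsp f (f \<gamma> + s) (Ad (t \<beta> (ev a)) (E \<gamma>) - E \<gamma>)"
    using step s \<gamma> by (intro Ad_t_E[OF f] ev_A) auto
  ultimately show ?case by (simp only: lsp_add)
qed

text \<open>\<beta> is the lowest root above s, so moving its factor to the front creates factors at
  higher roots only.\<close>

lemma Ug_split:
  assumes f: "\<And>v w. f (v + w) = f v + f w" and inj: "inj_on f \<Phi>" and u: "u \<in> Ug f s" and s: "s \<ge> 0"
    and b: "\<beta> \<in> \<Phi>" "f \<beta> > s" and min: "\<And>\<delta>. \<delta> \<in> \<Phi> ==> f \<delta> > s ==> f \<beta> \<le> f \<delta>"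
  shows "\<exists>a\<in>Ac. \<exists>u'\<in>Ug f (f \<beta>). u = x \<beta> a + u'" using u
proof (induction rule: Ug_left_induct)
  case zero
  then show ?case using L.A_0 L.fam_0[OF L.fam_x b(1)] subgrp.zero unfolding Ug_def by force
next
  case (step \<delta> c u)
  then obtain a u' where IH: "a \<in> Ac" "u' \<in> Ug f (f \<beta>)" "u = x \<beta> a + u'" by blast
  show ?case
  proof (cases "\<delta> = \<beta>")
    case True
    then have "x \<delta> c + u = x \<beta> (c + a) + u'" using IH step L.x_add by (simp add: add.assoc[symmetric])
    then show ?thesis using IH step Ac_add by blast
  next
    case False
    have gt: "f \<delta> > f \<beta>" using min[OF step(1,2)] False inj step(1) b(1) by (metis inj_onD order_le_less)
    have gen: "x \<gamma> c' \<in> Ug f (f \<beta>)" if "\<gamma> \<in> \<Phi>" "f \<gamma> > f \<beta>" "c' \<in> Ac" for \<gamma> c'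
      unfolding Ug_def using that by (intro subgrp.gen) blast
    have na: "- a \<in> Ac" using IH Ac_uminus by blast
    have "cjg (x \<beta> (- a)) (x \<delta> c) \<in> Ug f (f \<beta>)"
    proof -
      have f0: "f 0 = 0" using f[of 0 0] by simp
      have "f (- \<beta>) = - f \<beta>" using f[of \<beta> "- \<beta>"] f0 by simp
      then have "\<delta> \<noteq> - \<beta>" using b gt s by auto
      then consider "ip \<beta> \<delta> \<ge> 0" | "ip \<beta> \<delta> = -1" using ip_vals[OF b(1) step(1)] ip_neg2[OF b(1) step(1)] by auto
      then show ?thesis
      proof cases
        case 1
        then show ?thesis using L.conj_fam_0[OF L.fam_x b(1) step(1) 1 na step(3)] gen step gt by simp
      next
        case 2
        have "f (\<beta> + \<delta>) > f \<beta>" using f b gt s by simp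
        then have "x (\<beta> + \<delta>) (of_int (N \<beta> \<delta>) * - a * c) \<in> Ug f (f \<beta>)"
          by (intro gen add_root[OF b(1) step(1) 2] Ac_mult L.A_int na step(3))
        then show ?thesis unfolding L.conj_fam[OF L.fam_x b(1) step(1) 2 na step(3)]
          using gen[OF step(1) gt step(3)] by (simp add: Ug_def subgrp.add)
      qed
    qed
    moreover have "x \<delta> c + u = x \<beta> a + (cjg (x \<beta> (- a)) (x \<delta> c) + u')"
    proof -
      have "cjg (x \<beta> (- a)) (x \<delta> c) = - x \<beta> a + x \<delta> c + x \<beta> a"
        using L.x_uminus[OF b(1) IH(1)] by (simp add: cjg_def)
      then show ?thesis by (simp add: IH(3) add.assoc)
    qed
    ultimately show ?thesis using IH unfolding Ug_def by (meson subgrp.add)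
  qed
qed

lemma low_exists: "\<beta> \<in> \<Phi> ==> \<exists>\<gamma>\<in>\<Phi>. ip \<beta> \<gamma> = -1" using nonisolated[of \<beta>] ip_sym by metis

lemma lsp_rep_entK:
  assumes "entK (scl c (E \<delta>) + Y - C)" "c \<in> A" "\<delta> \<in> \<Phi>" "lsp f (f \<delta>) Y" "cart C"
  shows "c \<in> K"
proof -
  obtain r C' where r: "Y = rep r C'" "\<forall>\<gamma>\<in>\<Phi>. r \<gamma> \<in> A \<and> (f \<gamma> \<le> f \<delta> --> r \<gamma> = 0)" "cart C'"
    using assms(4) unfolding lsp_def by blast
  have "scl c (E \<delta>) + Y - C = rep (\<lambda>\<gamma>. (if \<gamma> = \<delta> then c else 0) + r \<gamma>) (0 + C') - rep (\<lambda>_. 0) C"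
    unfolding r(1) rep_add[symmetric] rep_E[OF assms(3)] by (simp add: rep_def)
  then have "(if \<delta> = \<delta> then c else 0) + r \<delta> - 0 \<in> K"
    using assms r by (intro rep_diff_entK[of _ "0 + C'" _ C]) (auto simp: A_add A_0)
  then show ?thesis using r assms by simp
qed

text \<open>For the lowest root \<beta> and a root \<gamma> of product -1 with it, the coefficient
  of \<open>E (\<beta> + \<gamma>)\<close> in the adjoint image of \<open>E \<gamma>\<close> is
  \<open>ev a\<close> up to sign, all later contributions being of greater height. So
  \<open>ev a\<close> lies in \<open>K\<close>; the first factor then acts trivially and is
  congruent to 1, and the induction continues with the remaining factors.\<close>

lemma peel:
  assumes f: "\<And>v w. f (v + w) = f v + f w" and inj: "inj_on f \<Phi>"
  shows "u \<in> Ug f s ==> s \<ge> 0 ==> Kk u ==> fst u = 0"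
proof (induction "card {\<delta>\<in>\<Phi>. f \<delta> > s}" arbitrary: u s rule: less_induct)
  case less
  let ?B = "{\<delta>\<in>\<Phi>. f \<delta> > s}"
  show ?case
  proof (cases "?B = {}")
    case True
    then have e: "{x \<beta> a |\<beta> a. \<beta> \<in> \<Phi> \<and> f \<beta> > s \<and> a \<in> Ac} = {}" by blast
    have "u = 0" using less(2)[unfolded Ug_def e] by induction auto
    then show ?thesis by simp
  next
    case False
    have fin: "finite ?B" using finite_roots by simp
    obtain \<beta> where b: "\<beta> \<in> ?B" "\<And>\<delta>. \<delta> \<in> ?B ==> f \<beta> \<le> f \<delta>"
    proof (rule that[of "arg_min_on f ?B"])
      show "arg_min_on f ?B \<in> ?B" by (rule arg_min_if_finite[OF fin False])
      fix \<delta> assume "\<delta> \<in> ?B"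
      then have "\<not> f \<delta> < f (arg_min_on f ?B)" using arg_min_if_finite(2)[OF fin False, of f] by blast
      then show "f (arg_min_on f ?B) \<le> f \<delta>" by simp
    qed
    have b\<Phi>: "\<beta> \<in> \<Phi>" "f \<beta> > s" using b by auto
    obtain a u' where a: "a \<in> Ac" "u' \<in> Ug f (f \<beta>)" "u = x \<beta> a + u'"
      using Ug_split[OF f inj less(2,3) b\<Phi>] b by blast
    obtain \<gamma> where \<gamma>: "\<gamma> \<in> \<Phi>" "ip \<beta> \<gamma> = -1" using low_exists b\<Phi> by blast
    have rt: "\<beta> + \<gamma> \<in> \<Phi>" using add_root b\<Phi> \<gamma> by blast
    have pos: "f \<beta> > 0" using b\<Phi> less(3) by simp
    let ?T = "t \<beta> (ev a)"
    let ?c = "of_int (N \<beta> \<gamma>) * ev a"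
    have cA: "?c \<in> A" using a ev_A A_mult A_int by blast
    have Y: "lsp f (f (\<beta> + \<gamma>)) (Ad (snd u') (E \<gamma>) - E \<gamma>)"
      using Ad_Ug_lsp[OF f a(2) _ \<gamma>(1)] pos f by (simp add: add.commute)
    define Y' where "Y' = Ad ?T (Ad (snd u') (E \<gamma>) - E \<gamma>)"
    have Y': "lsp f (f (\<beta> + \<gamma>)) Y'" unfolding Y'_def by (rule Ad_t_lsp[OF f b\<Phi>(1) ev_A[OF a(1)] pos Y])
    have "Ad ?T (E \<gamma>) = E \<gamma> + scl ?c (E (\<beta> + \<gamma>))"
      by (rule Ad_eqI) (simp add: val_t b\<Phi> T_E_rel[OF b\<Phi>(1) \<gamma>])
    then have eq: "Ad (snd u) (E \<gamma>) - E \<gamma> = scl ?c (E (\<beta> + \<gamma>)) + Y'"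
      by (simp add: a(3) Ad_plus Y'_def Ad_diff)
    obtain C where "cart C" "entK (Ad (snd u) (E \<gamma>) - E \<gamma> - C)" using less(4) \<gamma> unfolding Kk_def by blast
    then have "?c \<in> K" using lsp_rep_entK[OF _ cA rt Y'] unfolding eq by blast
    then have "of_int (N \<beta> \<gamma>) * ?c \<in> K" using AK A_int by blast
    then have aK: "ev a \<in> K" using of_int_N_sq[OF b\<Phi>(1) \<gamma>, of "ev a"] by simp
    have "fst u = fst u'" using a \<theta>_K[OF b\<Phi>(1) a(1) aK] by simp
    moreover have "Kk u'" unfolding Kk_def
    proof
      fix \<delta> assume d: "\<delta> \<in> \<Phi>"
      obtain C where C: "cart C" "entK (Ad (snd u) (E \<delta>) - E \<delta> - C)" using less(4) d unfolding Kk_def by blast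
      have u': "entA (val (snd u'))" "entA (val (- snd u'))" using a(2) Ug_Egrp Egrp_entA by blast+
      let ?X = "Ad (snd u') (E \<delta>)"
      have X: "entA ?X" unfolding Ad_def by (intro entA_mult u' entA_E)
      have "Ad (snd u) (E \<delta>) - ?X = (val ?T - 1) * ?X * val (- ?T) + ?X * (val (- ?T) - 1)"
        by (simp add: a(3) Ad_def minus_add algebra_simps del: add_uminus_conv_diff)
      also have "entK ..." unfolding val_t[OF b\<Phi>(1)] val_uminus_t[OF b\<Phi>(1)]
        by (intro entK_add entK_A_mult entK_multA T_entK b\<Phi> aK X entA_T A_uminus ev_A a K_uminus)
      finally have "entK ((Ad (snd u) (E \<delta>) - E \<delta> - C) - (Ad (snd u) (E \<delta>) - ?X))"
        using entK_diff C(2) by blast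
      then show "\<exists>C. cart C \<and> entK (?X - E \<delta> - C)" using C(1) by (auto simp: algebra_simps)
    qed
    moreover have "{\<delta>\<in>\<Phi>. f \<delta> > f \<beta>} \<subset> ?B" using b\<Phi> by auto
    then have "card {\<delta>\<in>\<Phi>. f \<delta> > f \<beta>} < card ?B" using fin by (rule psubset_card_mono[rotated])
    ultimately show ?thesis using less(1)[OF _ a(2)] pos by simp
  qed
qed

text \<open>A diagonal element scales the root elements at all coefficients. For integer
  coefficients m this is a polynomial identity in m, whose linear coefficient is the claim.\<close>

lemma diag_E:
  assumes h: "L.diag1 h \<beta> u" "u \<in> Ac" and b: "\<beta> \<in> \<Phi>"
  shows "Ad (snd h) (E \<beta>) = scl (ev u) (E \<beta>)"
proof (rule Ad_eqI)
  let ?V = "val (snd h)" and ?n = "CARD('n)"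
  have conj: "?V * T \<beta> (of_int m) = T \<beta> (ev u * of_int m) * ?V" for m
  proof -
    have "cjg h (x \<beta> (of_int m)) = x \<beta> (u * of_int m)"
      using h L.fam_x L.A_int unfolding L.diag1_def by blast
    then have "snd h + t \<beta> (of_int m) = t \<beta> (ev u * of_int m) + snd h"
      using conj_move[of h "x \<beta> (of_int m)"] by (metis ev_int ev_mult snd_add snd_x)
    then have "val (snd h + t \<beta> (of_int m)) = val (t \<beta> (ev u * of_int m) + snd h)" by simp
    then show ?thesis by (simp add: val_t b)
  qed
  define M where "M k = ?V * mint (D \<beta> k) - scl (ev u ^ k) (mint (D \<beta> k) * ?V)" for k
  have sum0: "(\<Sum>k<?n. scl (of_int m ^ k) (M k)) = 0" for m
    using conj[of m] by (simp add: T_def M_def sum_distrib_left sum_distrib_right scl_diff sum_subtractf power_mult_distrib mult.commute)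
  have M1: "M k = 0" if k: "k < ?n" for k
  proof (rule sqm_eqI)
    fix i j
    define p where "p = (\<Sum>k<?n. monom (ent (M k) i j) k)"
    have "poly p (of_int m) = 0" for m
    proof -
      have "ent (\<Sum>k<?n. scl (of_int m ^ k) (M k)) i j = 0" by (simp only: sum0 ent_0)
      then show ?thesis by (simp add: p_def poly_sum poly_monom ent_sum mult.commute)
    qed
    then have "range of_int \<subseteq> {v. poly p v = 0}" by auto
    moreover have "inj (of_int :: int => 'q)" by (simp add: inj_on_def)
    then have "infinite (range (of_int :: int => 'q))" using finite_imageD infinite_UNIV_int by blast
    ultimately have "infinite {v. poly p v = 0}" using finite_subset by blast
    then have "p = 0" using poly_roots_finite by blast
    then have "coeff p k = 0" by simp
    then show "ent (M k) i j = ent 0 i j" using k by (simp add: p_def coeff_sum)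
  qed
  show "?V * E \<beta> = scl (ev u) (E \<beta>) * ?V"
  proof (cases "?n > 1")
    case True
    then show ?thesis using M1[of 1] by (simp add: M_def E_def)
  next
    \<comment> \<open>In dimension one the linear term is cut off by the truncation, but there the
      root matrix is zero by nilpotency.\<close>
    case False
    moreover have "?n > 0" by simp
    ultimately have "?n = 1" by linarith
    then have "E \<beta> = (0 :: ('q, 'n) sqm)" using E_nil[OF b, where 'b = 'q] by simp
    then show ?thesis by simp
  qed
qed

lemma diag_cart:
  assumes h: "L.diag h" and C: "cart C"
  shows "cart (Ad (snd h) C)" unfolding cart_def
proof
  fix \<gamma> assume g: "\<gamma> \<in> \<Phi>"
  obtain u u' where u: "u \<in> Ac" "u' \<in> Ac" "u * u' = 1" "L.diag1 h \<gamma> u" using h g unfolding L.diag_def by blast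
  have "ev u * ev u' = 1" using u by (metis ev_1 ev_mult)
  then have E: "E \<gamma> = scl (ev u') (Ad (snd h) (E \<gamma>))"
    unfolding diag_E[OF u(4,1) g] by (simp add: mult.commute)
  obtain l where l: "l \<in> A" "C * E \<gamma> = E \<gamma> * C + scl l (E \<gamma>)" using C g unfolding cart_def by blast
  have hom: "Ad k X * Ad k Y = Ad k (X * Y)" for k X Y
  proof -
    have "Ad k X * Ad k Y = val k * X * (val (- k) * val k) * Y * val (- k)" by (simp only: Ad_def mult.assoc)
    then show ?thesis by (simp add: Ad_def mult.assoc)
  qed
  have "Ad (snd h) C * Ad (snd h) (E \<gamma>) = Ad (snd h) (E \<gamma>) * Ad (snd h) C + scl l (Ad (snd h) (E \<gamma>))"
    unfolding hom l(2) by (simp add: Ad_add Ad_scl)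
  then have "Ad (snd h) C * scl (ev u') (Ad (snd h) (E \<gamma>)) =
     scl (ev u') (Ad (snd h) (E \<gamma>)) * Ad (snd h) C + scl l (scl (ev u') (Ad (snd h) (E \<gamma>)))"
    by (simp add: scl_add mult.commute)
  then show "\<exists>l\<in>A. Ad (snd h) C * E \<gamma> = E \<gamma> * Ad (snd h) C + scl l (E \<gamma>)"
    unfolding E[symmetric] using l by blast
qed

lemma Ugrp_Ug: "L.Ugrp f = Ug f 0" by (simp add: L.Ugrp_def Ug_def)

lemma sum_entK:
  assumes "\<And>\<gamma>. \<gamma> \<in> \<Phi> ==> r \<gamma> \<in> K" shows "entK (rep r 0)"
  unfolding rep_def using assms by (auto intro!: entK_sum entK_scl entA_E)

text \<open>Modulo \<open>K\<close>, hv and the inverse of u act alike on \<open>E \<gamma>\<close>.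
  Besides a multiple of \<open>E \<gamma>\<close> and a Cartan part, one side involves lower roots
  only and the other higher roots only. Comparing coefficients puts all of these into
  \<open>K\<close> and makes the scalar of h at \<gamma> congruent to 1; \<open>peel\<close> then
  applies to -u and to v.\<close>

lemma big_cell:
  assumes c: "c = u + h + v" "c \<in> L.Egrp" "entK (val (snd c) - 1)"
    and u: "u \<in> L.Ugrp ht" and h: "L.diag h" and v: "v \<in> L.Ugrp (\<lambda>v. - ht v)"
  shows "fst u = 0" "fst v = 0" "\<And>\<beta> i. \<beta> \<in> \<Phi> ==> i \<in> Ic ==> cjg (fst h) (y \<beta> i) = y \<beta> i"
proof -
  let ?U = "snd (- u)" and ?V = "snd v" and ?H = "snd h"
  have mu: "- u \<in> L.Ugrp ht" by (rule L.Ugrp_uminus[OF u])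
  have fm: "\<And>v w. (\<lambda>v. - ht v) (v + w) = (\<lambda>v. - ht v) v + (\<lambda>v. - ht v) w" by (simp add: ht_add)
  have "\<forall>\<beta>\<in>\<Phi>. \<exists>w. w \<in> Ac \<and> (\<exists>w'\<in>Ac. w * w' = 1) \<and> L.diag1 h \<beta> w" using h unfolding L.diag_def by blast
  then obtain ch where ch: "\<And>\<beta>. \<beta> \<in> \<Phi> ==> ch \<beta> \<in> Ac" "\<And>\<beta>. \<beta> \<in> \<Phi> ==> \<exists>w'\<in>Ac. ch \<beta> * w' = 1"
    "\<And>\<beta>. \<beta> \<in> \<Phi> ==> L.diag1 h \<beta> (ch \<beta>)" by metis
  have key: "ev (ch \<gamma>) - 1 \<in> K \<and> (\<exists>C. cart C \<and> entK (Ad ?U (E \<gamma>) - E \<gamma> - C)) \<and> (\<exists>C. cart C \<and> entK (Ad ?V (E \<gamma>) - E \<gamma> - C))"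
    if g: "\<gamma> \<in> \<Phi>" for \<gamma>
  proof -
    have "lsp ht (ht \<gamma> + 0) (Ad ?U (E \<gamma>) - E \<gamma>)"
      by (rule Ad_Ug_lsp[OF ht_add mu[unfolded Ugrp_Ug] order_refl g])
    then obtain r C where r: "Ad ?U (E \<gamma>) - E \<gamma> = rep r C" "\<forall>\<delta>\<in>\<Phi>. r \<delta> \<in> A \<and> (ht \<delta> \<le> ht \<gamma> --> r \<delta> = 0)" "cart C"
      unfolding lsp_def by auto
    have "lsp (\<lambda>v. - ht v) (- ht \<gamma> + 0) (Ad ?V (E \<gamma>) - E \<gamma>)"
      by (rule Ad_Ug_lsp[OF fm v[unfolded Ugrp_Ug] order_refl g])
    then obtain s C' where s: "Ad ?V (E \<gamma>) - E \<gamma> = rep s C'" "\<forall>\<delta>\<in>\<Phi>. s \<delta> \<in> A \<and> (ht \<gamma> \<le> ht \<delta> --> s \<delta> = 0)" "cart C'"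
      unfolding lsp_def by auto
    let ?r = "\<lambda>\<delta>. (if \<delta> = \<gamma> then 1 else 0) + r \<delta>" and ?s = "\<lambda>\<delta>. (if \<delta> = \<gamma> then ev (ch \<gamma>) else 0) + ev (ch \<delta>) * s \<delta>"
    have EU: "Ad ?U (E \<gamma>) = rep ?r (0 + C)"
      unfolding rep_add[symmetric] rep_E[OF g] r(1)[symmetric] by simp
    have EV: "Ad ?H (Ad ?V (E \<gamma>)) = rep ?s (0 + Ad ?H C')"
    proof -
      have "Ad ?V (E \<gamma>) = E \<gamma> + rep s C'" unfolding s(1)[symmetric] by simp
      then have "Ad ?H (Ad ?V (E \<gamma>)) = scl (ev (ch \<gamma>)) (E \<gamma>) + ((\<Sum>\<delta>\<in>\<Phi>. scl (s \<delta>) (scl (ev (ch \<delta>)) (E \<delta>))) + Ad ?H C')"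
        using diag_E[OF ch(3,1)] g by (simp add: Ad_add Ad_rep)
      also have "... = scl (ev (ch \<gamma>)) (E \<gamma>) + rep (\<lambda>\<delta>. ev (ch \<delta>) * s \<delta>) (Ad ?H C')"
        by (simp add: rep_def mult.commute)
      finally show ?thesis unfolding rep_add[symmetric] rep_E[OF g] .
    qed
    have uA: "entA (val ?U)" "entA (val (- ?U))" using Egrp_entA Ug_Egrp mu unfolding Ugrp_Ug by blast+
    have cA: "entA (val (snd c))" "entA (val (- snd c))" using Egrp_entA c(2) by blast+
    have "Ad ?H (Ad ?V (E \<gamma>)) = Ad ?U (Ad (snd c) (E \<gamma>))"
      unfolding c(1) by (simp add: Ad_plus[symmetric] add.assoc)
    moreover have "entK (Ad ?U (Ad (snd c) (E \<gamma>)) - Ad ?U (E \<gamma>))"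
    proof -
      have "entK (1 - val (- snd c))"
      proof -
        have "1 - val (- snd c) = (val (snd c) - 1) * val (- snd c)" by (simp add: left_diff_distrib)
        then show ?thesis using entK_A_mult[OF c(3) cA(2)] by simp
      qed
      from entK_uminus[OF this] have i: "entK (val (- snd c) - 1)" by simp
      have "Ad (snd c) (E \<gamma>) - E \<gamma> = (val (snd c) - 1) * E \<gamma> * val (- snd c) + E \<gamma> * (val (- snd c) - 1)"
        by (simp add: Ad_def algebra_simps)
      also have "entK ..." by (intro entK_add entK_A_mult entK_multA c cA entA_E i)
      finally have "entK (val ?U * (Ad (snd c) (E \<gamma>) - E \<gamma>) * val (- ?U))"
        by (intro entK_A_mult entK_multA uA)
      then show ?thesis by (simp add: Ad_def algebra_simps)
    qed
    ultimately have k: "entK (rep ?s (0 + Ad ?H C') - rep ?r (0 + C))" unfolding EV EU by simp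
    have d: "?s \<delta> - ?r \<delta> \<in> K" if "\<delta> \<in> \<Phi>" for \<delta> by (rule rep_diff_entK[OF k _ _ _ _ that])
        (use r s ch(1) g diag_cart[OF h s(3)] in \<open>auto intro!: A_add A_mult ev_A A_1 A_0 cart_add cart_0\<close>)
    have 1: "ev (ch \<gamma>) - 1 \<in> K" using d[OF g] r(2) s(2) g by simp
    have rK: "r \<delta> \<in> K" if "\<delta> \<in> \<Phi>" for \<delta>
    proof (cases "ht \<delta> \<le> ht \<gamma>")
      case True then show ?thesis using r that K_0 by simp
    next
      case False
      then have "\<delta> \<noteq> \<gamma>" "s \<delta> = 0" using s that by auto
      then show ?thesis using d[OF that] K_uminus by fastforce
    qed
    have sK: "s \<delta> \<in> K" if dl: "\<delta> \<in> \<Phi>" for \<delta>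
    proof (cases "ht \<gamma> \<le> ht \<delta>")
      case True then show ?thesis using s dl K_0 by simp
    next
      case False
      then have "\<delta> \<noteq> \<gamma>" "r \<delta> = 0" using r dl by auto
      then have "ev (ch \<delta>) * s \<delta> \<in> K" using d[OF dl] by simp
      moreover obtain w' where w: "w' \<in> Ac" "ch \<delta> * w' = 1" using ch(2)[OF dl] by blast
      then have "ev w' * ev (ch \<delta>) = 1" by (metis ev_1 ev_mult mult.commute)
      then have "ev w' * (ev (ch \<delta>) * s \<delta>) = s \<delta>" by (simp flip: mult.assoc)
      ultimately show ?thesis using AK[OF ev_A[OF w(1)]] by metis
    qed
    have "entK (Ad ?U (E \<gamma>) - E \<gamma> - C)" unfolding r(1) using sum_entK[of r] rK by (simp add: rep_def)
    moreover have "entK (Ad ?V (E \<gamma>) - E \<gamma> - C')" unfolding s(1) using sum_entK[of s] sK by (simp add: rep_def)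
    ultimately show ?thesis using 1 r(3) s(3) by blast
  qed
  have "fst (- u) = 0"
    by (rule peel[OF ht_add ht_inj mu[unfolded Ugrp_Ug] order_refl]) (use key in \<open>auto simp: Kk_def\<close>)
  then show "fst u = 0" by simp
  have "inj_on (\<lambda>v. - ht v) \<Phi>" using ht_inj by (auto simp: inj_on_def)
  then show "fst v = 0"
    by (rule peel[OF fm _ v[unfolded Ugrp_Ug] order_refl]) (use key in \<open>auto simp: Kk_def\<close>)
  fix \<beta> i assume b: "\<beta> \<in> \<Phi>" "i \<in> Ic"
  have "cjg h (z \<beta> i) = z \<beta> (ch \<beta> * i)" using ch(3)[OF b(1)] b(2) L.fam_z unfolding L.diag1_def by blast
  then have "fst (cjg h (z \<beta> i)) = y \<beta> (ch \<beta> * i)" by (simp add: z_def)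
  then have "cjg (fst h) (y \<beta> i) = y \<beta> (ch \<beta> * i)" by (simp add: cjg_def z_def)
  also have "ch \<beta> * i = (ch \<beta> + - 1) * i + i" by (simp add: algebra_simps)
  also have "y \<beta> ... = y \<beta> ((ch \<beta> + - 1) * i) + y \<beta> i"
    using y_module b ch(1)[OF b(1)] unfolding module_family_def by (metis AcIc Ac_1 Ac_add Ac_uminus)
  also have "y \<beta> ((ch \<beta> + - 1) * i) = 0"
    using key[OF b(1)] b ch(1)[OF b(1)] by (intro y_K Ac_add Ac_uminus Ac_1) (simp_all add: ev_add ev_uminus ev_1 del: add_uminus_conv_diff, simp_all)
  finally show "cjg (fst h) (y \<beta> i) = y \<beta> i" by simp
qed

theorem kernel_acts_trivially:
  assumes g: "g \<in> L.Egrp" "entK (val (snd g) - 1)" and b: "\<beta> \<in> \<Phi>" "i \<in> Ic"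
  shows "cjg (fst g) (y \<beta> i) = y \<beta> i"
proof -
  have "L.gauss ht g" by (rule L.gauss_decomposition[OF ht_add ht_nz ht_base g(1)])
  then obtain u h v u' where d: "u \<in> L.Ugrp ht" "L.diag h" "v \<in> L.Ugrp (\<lambda>v. - ht v)" "u' \<in> L.Ugrp ht" "g = u + h + v + u'"
    unfolding L.gauss_def by blast
  define c where "c = (u' + u) + h + v"
  \<comment> \<open>Conjugation by u' joins the two positive factors, so c lies in the big cell and
    is still congruent to 1.\<close>
  have c: "c = cjg u' g" by (simp add: c_def d(5) cjg_def add.assoc diff_conv_add_uminus del: add_uminus_conv_diff)
  have u'E: "u' \<in> L.Egrp" using d(4) Ug_Egrp unfolding Ugrp_Ug by blast
  have "c \<in> L.Egrp" unfolding c cjg_def using u'E g(1) unfolding L.Egrp_def by (intro subgrp_minus subgrp.add)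
  moreover have "entK (val (snd c) - 1)"
  proof -
    have "val (snd c) - 1 = val (snd u') * (val (snd g) - 1) * val (- snd u')"
    proof -
      have "val (snd c) = val (snd u') * val (snd g) * val (- snd u')"
        by (simp add: c cjg_def diff_conv_add_uminus[of _ u'] del: add_uminus_conv_diff)
      moreover have "val (snd u') * (val (snd g) - 1) * val (- snd u')
          = val (snd u') * val (snd g) * val (- snd u') - val (snd u') * val (- snd u')"
        by (simp only: right_diff_distrib left_diff_distrib mult_1_right)
      ultimately show ?thesis by simp
    qed
    then show ?thesis using entK_A_mult entK_multA g(2) Egrp_entA[OF u'E] by simp
  qed
  ultimately have bc: "fst (u' + u) = 0" "fst v = 0" "cjg (fst h) (y \<beta> i') = y \<beta> i'" if "\<beta> \<in> \<Phi>" "i' \<in> Ic" for \<beta> i'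
    using big_cell[OF c_def _ _ L.Ugrp_add[OF d(4,1)] d(2,3)] that by blast+
  let ?Y = "subgrp {y \<beta> i |\<beta> i. \<beta> \<in> \<Phi> \<and> i \<in> Ic}"
  have uY: "cjg (fst e) k \<in> ?Y" if "e \<in> L.Egrp" "k \<in> ?Y" for e k
  proof -
    have "\<forall>k\<in>?Y. cjg (fst e) k \<in> ?Y"
    \<comment> \<open>For the constant functional 1 the group \<open>Ug\<close> is all of
      \<open>Egrp\<close>, so its induction rule applies.\<close>
    proof (rule Ug_left_induct[of e "\<lambda>_. 1" 0 "\<lambda>e. \<forall>k\<in>?Y. cjg (fst e) k \<in> ?Y"])
      show "e \<in> Ug (\<lambda>_. 1) 0" using that(1) by (simp add: Ug_def L.Egrp_def)
      fix \<alpha> a and u :: "'h \<times> ('q, 'n) sqm inv_elt"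
      assume *: "\<alpha> \<in> \<Phi>" "a \<in> Ac" "\<forall>k\<in>?Y. cjg (fst u) k \<in> ?Y"
      show "\<forall>k\<in>?Y. cjg (fst (x \<alpha> a + u)) k \<in> ?Y"
      proof
        fix k assume "k \<in> ?Y"
        then have "cjg (fst u) k \<in> ?Y" using * by blast
        then have "cjg (\<theta> \<alpha> a) (cjg (fst u) k) \<in> ?Y"
          by (rule conj_subgrp[rotated]) (use y_normal * in blast)
        then show "cjg (fst (x \<alpha> a + u)) k \<in> ?Y" by (simp add: conj_conj)
      qed
    qed simp
    then show ?thesis using that(2) by blast
  qed
  have "y \<beta> i \<in> ?Y" using b by (intro subgrp.gen) blast
  then have k: "cjg (fst u') (y \<beta> i) \<in> ?Y" by (rule uY[OF u'E])
  have "cjg (fst h) k = k" if "k \<in> ?Y" for k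
    using that by induction (auto simp: conj_add conj_uminus bc(3))
  then have "cjg (fst c) (cjg (fst u') (y \<beta> i)) = cjg (fst u') (y \<beta> i)"
    using k bc(1,2)[OF b] by (simp add: c_def)
  moreover have "fst g = - fst u' + fst c + fst u'"
    by (simp add: c cjg_def add.assoc diff_conv_add_uminus del: add_uminus_conv_diff)
  ultimately show ?thesis by (simp add: conj_conj)
qed

end

section \<open>The root systems of type E\<close>

locale type_E =
  fixes l :: nat and \<Phi> \<Delta> :: "'a::euclidean_space set" and s :: "nat => 'a"
  assumes l: "l \<in> {6, 7, 8}" and root_system: "root_system \<Phi>" and root_base: "root_base \<Phi> \<Delta>"
    and s: "bij_betw s {1..l} \<Delta>"
    and cartan: "i \<in> {1..l} ==> j \<in> {1..l} ==> pairing (s i) (s j) = of_int (cartan_matrix_E i j)"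
begin

lemma finite_\<Phi>: "finite \<Phi>" and span_\<Phi>: "span \<Phi> = UNIV" and zero_\<Phi>: "0 \<notin> \<Phi>"
  and scale_\<Phi>: "\<alpha> \<in> \<Phi> ==> c *\<^sub>R \<alpha> \<in> \<Phi> ==> c = 1 \<or> c = -1"
  and refl_\<Phi>: "\<alpha> \<in> \<Phi> ==> \<beta> \<in> \<Phi> ==> \<beta> - pairing \<beta> \<alpha> *\<^sub>R \<alpha> \<in> \<Phi>"
  and int_\<Phi>: "\<alpha> \<in> \<Phi> ==> \<beta> \<in> \<Phi> ==> pairing \<beta> \<alpha> \<in> \<int>" using root_system unfolding root_system_def by blast+

lemma \<Delta>_\<Phi>: "\<delta> \<in> \<Delta> ==> \<delta> \<in> \<Phi>" and indep: "independent \<Delta>" using root_base unfolding root_base_def by blast+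

lemma finite_\<Delta>: "finite \<Delta>" and card_\<Delta>: "card \<Delta> = l"
  using bij_betw_finite[OF s] bij_betw_same_card[OF s] by auto

lemma s_\<Delta>: "i \<in> {1..l} ==> s i \<in> \<Delta>" using s by (auto simp: bij_betw_def)

lemma s_surj: "\<delta> \<in> \<Delta> ==> \<exists>i\<in>{1..l}. \<delta> = s i" using s by (auto simp: bij_betw_def)

text \<open>The nodes 1 to 6 are connected in all three diagrams; 7 and 8 continue the chain as far
  as l allows.\<close>

lemma dynkin_connected:
  assumes "\<And>i j. i \<in> {1..l} ==> j \<in> {1..l} ==> cartan_matrix_E i j = -1 ==> Q i ==> Q j"
    and "i \<in> {1..l}" "j \<in> {1..l}" "Q i"
  shows "Q j"
proof -
  have l6: "l \<ge> 6" "l \<le> 8" using l by auto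
  have e: "cartan_matrix_E 1 3 = -1" "cartan_matrix_E 3 4 = -1" "cartan_matrix_E 4 5 = -1" "cartan_matrix_E 5 6 = -1"
     "cartan_matrix_E 6 7 = -1" "cartan_matrix_E 7 8 = -1" "cartan_matrix_E 2 4 = -1"
     "cartan_matrix_E 3 1 = -1" "cartan_matrix_E 4 3 = -1" "cartan_matrix_E 5 4 = -1" "cartan_matrix_E 6 5 = -1"
     "cartan_matrix_E 7 6 = -1" "cartan_matrix_E 8 7 = -1" "cartan_matrix_E 4 2 = -1"
    by (simp_all add: cartan_matrix_E_def doubleton_eq_iff)
  have eq: "Q a \<longleftrightarrow> Q b" if "a \<in> {1..l}" "b \<in> {1..l}" "cartan_matrix_E a b = -1" "cartan_matrix_E b a = -1" for a b
    using assms(1) that by blast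
  have 1: "Q 3 \<longleftrightarrow> Q 4" "Q 1 \<longleftrightarrow> Q 3" "Q 2 \<longleftrightarrow> Q 4" "Q 4 \<longleftrightarrow> Q 5" "Q 5 \<longleftrightarrow> Q 6" by (rule eq; use l6 e in simp)+
  have 7: "l \<ge> 7 ==> Q 6 \<longleftrightarrow> Q 7" by (rule eq; use l6 e in simp)
  have 8: "l \<ge> 8 ==> Q 7 \<longleftrightarrow> Q 8" by (rule eq; use l6 e in simp)
  have all: "Q k \<longleftrightarrow> Q 4" if "k \<in> {1..l}" for k
  proof -
    have "k = 1 \<or> k = 2 \<or> k = 3 \<or> k = 4 \<or> k = 5 \<or> k = 6 \<or> k = 7 \<or> k = 8" using that l6 by auto
    then show ?thesis using that 1 7 8 by auto
  qed
  show ?thesis using all assms by blast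
qed

definition len :: real where "len = s 1 \<bullet> s 1"

lemma one_l: "1 \<in> {1..l}" using l by auto

lemma simple_len: "\<delta> \<in> \<Delta> ==> \<delta> \<bullet> \<delta> = len"
proof -
  assume "\<delta> \<in> \<Delta>"
  then obtain j where j: "j \<in> {1..l}" "\<delta> = s j" using s_surj by blast
  have "s j \<bullet> s j = len"
  proof (rule dynkin_connected[of "\<lambda>j. s j \<bullet> s j = len" 1 j])
    fix i j assume ij: "i \<in> {1..l}" "j \<in> {1..l}" "cartan_matrix_E i j = -1" "s i \<bullet> s i = len"
    have "cartan_matrix_E j i = -1"
      using ij(3) by (simp only: cartan_matrix_E_def insert_commute[of j i] eq_commute[of j i])
    then have "pairing (s i) (s j) = -1" "pairing (s j) (s i) = -1" using cartan ij by auto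
    moreover have "s i \<noteq> 0" "s j \<noteq> 0" using s_\<Delta> \<Delta>_\<Phi> zero_\<Phi> ij by metis+
    ultimately have "2 * (s i \<bullet> s j) = - (s j \<bullet> s j)" "2 * (s i \<bullet> s j) = - (s i \<bullet> s i)"
      by (simp_all add: pairing_def divide_eq_eq inner_commute)
    then show "s j \<bullet> s j = len" using ij by simp
  qed (use one_l j in \<open>auto simp: len_def\<close>)
  then show ?thesis using j by simp
qed

lemma len_pos: "len > 0"
proof -
  have "s 1 \<noteq> 0" using s_\<Delta>[OF one_l] \<Delta>_\<Phi> zero_\<Phi> by metis
  then show ?thesis by (simp add: len_def)
qed

text \<open>Scaled so that every root has square 2, once all roots are known to have the same
  length.\<close>

definition ip :: "'a => 'a => real" where "ip x y = 2 * (x \<bullet> y) / len"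

lemma ip_add: "ip (x + y) z = ip x z + ip y z" by (simp add: ip_def inner_add_left add_divide_distrib distrib_left)
lemma ip_commute: "ip x y = ip y x" by (simp add: ip_def inner_commute)

lemma pairing_simple: "\<delta> \<in> \<Delta> ==> pairing \<beta> \<delta> = ip \<beta> \<delta>" by (simp add: pairing_def ip_def simple_len)

lemma coord_unique:
  assumes "(\<Sum>\<delta>\<in>\<Delta>. c \<delta> *\<^sub>R \<delta>) = (\<Sum>\<delta>\<in>\<Delta>. d \<delta> *\<^sub>R \<delta>)" "\<delta> \<in> \<Delta>"
  shows "c \<delta> = d \<delta>"
proof -
  have "(\<Sum>\<delta>\<in>\<Delta>. (c \<delta> - d \<delta>) *\<^sub>R \<delta>) = 0" using assms(1) by (simp add: scaleR_diff_left sum_subtractf)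
  then have "c \<delta> - d \<delta> = 0" using indep assms(2) finite_\<Delta> independentD[of \<Delta> \<Delta> "\<lambda>\<delta>. c \<delta> - d \<delta>" \<delta>] by auto
  then show ?thesis by simp
qed

definition pos :: "'a => bool" where
  "pos \<beta> \<longleftrightarrow> (\<exists>c :: 'a => nat. \<beta> = (\<Sum>\<delta>\<in>\<Delta>. of_nat (c \<delta>) *\<^sub>R \<delta>))"

lemma pos_or_neg: assumes "\<beta> \<in> \<Phi>" shows "pos \<beta> \<or> pos (- \<beta>)"
proof -
  obtain c :: "'a => int" where c: "\<beta> = (\<Sum>\<delta>\<in>\<Delta>. of_int (c \<delta>) *\<^sub>R \<delta>)"
    "(\<forall>\<delta>\<in>\<Delta>. c \<delta> \<ge> 0) \<or> (\<forall>\<delta>\<in>\<Delta>. c \<delta> \<le> 0)" using root_base assms unfolding root_base_def by blast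
  from c(2) show ?thesis
  proof
    assume "\<forall>\<delta>\<in>\<Delta>. c \<delta> \<ge> 0"
    then have "\<beta> = (\<Sum>\<delta>\<in>\<Delta>. of_nat (nat (c \<delta>)) *\<^sub>R \<delta>)" unfolding c(1) by (intro sum.cong) auto
    then have "pos \<beta>" unfolding pos_def by (rule exI[of _ "\<lambda>\<delta>. nat (c \<delta>)"])
    then show ?thesis ..
  next
    assume "\<forall>\<delta>\<in>\<Delta>. c \<delta> \<le> 0"
    then have "- \<beta> = (\<Sum>\<delta>\<in>\<Delta>. of_nat (nat (- c \<delta>)) *\<^sub>R \<delta>)" unfolding c(1) sum_negf[symmetric] by (intro sum.cong) auto
    then have "pos (- \<beta>)" unfolding pos_def by (rule exI[of _ "\<lambda>\<delta>. nat (- c \<delta>)"])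
    then show ?thesis ..
  qed
qed

lemma coord_pos:
  assumes \<beta>: "\<beta> \<in> \<Phi>" "\<beta> = (\<Sum>\<delta>\<in>\<Delta>. of_int (c \<delta>) *\<^sub>R \<delta>)" and e: "\<eta> \<in> \<Delta>" "c \<eta> > 0"
  shows "\<forall>\<delta>\<in>\<Delta>. c \<delta> \<ge> 0"
proof -
  obtain d :: "'a => int" where d: "\<beta> = (\<Sum>\<delta>\<in>\<Delta>. of_int (d \<delta>) *\<^sub>R \<delta>)"
    "(\<forall>\<delta>\<in>\<Delta>. d \<delta> \<ge> 0) \<or> (\<forall>\<delta>\<in>\<Delta>. d \<delta> \<le> 0)" using root_base \<beta> unfolding root_base_def by blast
  have "c \<delta> = d \<delta>" if "\<delta> \<in> \<Delta>" for \<delta>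
    using coord_unique[of "\<lambda>\<delta>. of_int (c \<delta>)" "\<lambda>\<delta>. of_int (d \<delta>)" \<delta>] \<beta>(2) d(1) that by simp
  then show ?thesis using d(2) e by force
qed

lemma single_coord:
  assumes \<beta>: "\<beta> \<in> \<Phi>" "\<beta> = (\<Sum>\<delta>\<in>\<Delta>. of_nat (c \<delta>) *\<^sub>R \<delta>)" and e: "\<eta> \<in> \<Delta>" "\<And>\<delta>. \<delta> \<in> \<Delta> ==> \<delta> \<noteq> \<eta> ==> c \<delta> = 0"
  shows "\<beta> = \<eta>"
proof -
  have "(\<Sum>\<delta>\<in>\<Delta>. of_nat (c \<delta>) *\<^sub>R \<delta>) = (\<Sum>\<delta>\<in>\<Delta>. if \<delta> = \<eta> then of_nat (c \<eta>) *\<^sub>R \<eta> else 0)"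
    by (rule sum.cong) (use e in auto)
  then have b: "\<beta> = real (c \<eta>) *\<^sub>R \<eta>" using \<beta>(2) e finite_\<Delta> by simp
  then have "real (c \<eta>) = 1 \<or> real (c \<eta>) = -1" using scale_\<Phi>[OF \<Delta>_\<Phi>[OF e(1)]] \<beta>(1) by metis
  then show ?thesis using b by auto
qed

text \<open>Only the coordinate at \<eta> changes. Since \<beta> differs from \<eta>, it has another
  positive coordinate, and this fixes the sign of the new root.\<close>

lemma pos_descent:
  assumes \<beta>: "\<beta> \<in> \<Phi>" "\<beta> = (\<Sum>\<delta>\<in>\<Delta>. of_nat (c \<delta>) *\<^sub>R \<delta>)" and e: "\<eta> \<in> \<Delta>" "\<beta> \<noteq> \<eta>"
    and \<beta>': "\<beta> - of_int k *\<^sub>R \<eta> \<in> \<Phi>"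
  shows "\<exists>d :: 'a => nat. \<beta> - of_int k *\<^sub>R \<eta> = (\<Sum>\<delta>\<in>\<Delta>. of_nat (d \<delta>) *\<^sub>R \<delta>) \<and> (\<forall>\<delta>\<in>\<Delta>. int (d \<delta>) = int (c \<delta>) - (if \<delta> = \<eta> then k else 0))"
proof -
  define d where "d \<delta> = int (c \<delta>) - (if \<delta> = \<eta> then k else 0)" for \<delta>
  have "(\<Sum>\<delta>\<in>\<Delta>. of_int (d \<delta>) *\<^sub>R \<delta>) = (\<Sum>\<delta>\<in>\<Delta>. of_nat (c \<delta>) *\<^sub>R \<delta>) - (\<Sum>\<delta>\<in>\<Delta>. if \<delta> = \<eta> then of_int k *\<^sub>R \<eta> else 0)"
    unfolding sum_subtractf[symmetric] by (rule sum.cong) (auto simp: d_def scaleR_diff_left)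
  then have eq: "\<beta> - of_int k *\<^sub>R \<eta> = (\<Sum>\<delta>\<in>\<Delta>. of_int (d \<delta>) *\<^sub>R \<delta>)" using \<beta>(2) e finite_\<Delta> by simp
  obtain \<eta>' where "\<eta>' \<in> \<Delta>" "\<eta>' \<noteq> \<eta>" "c \<eta>' \<noteq> 0" using single_coord[OF \<beta> e(1)] e(2) by blast
  then have "d \<eta>' > 0" by (simp add: d_def)
  then have nn: "\<forall>\<delta>\<in>\<Delta>. d \<delta> \<ge> 0" using coord_pos[OF \<beta>' eq \<open>\<eta>' \<in> \<Delta>\<close>] by blast
  have "\<beta> - of_int k *\<^sub>R \<eta> = (\<Sum>\<delta>\<in>\<Delta>. of_nat (nat (d \<delta>)) *\<^sub>R \<delta>)" unfolding eq using nn by (intro sum.cong) auto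
  moreover have "\<forall>\<delta>\<in>\<Delta>. int (nat (d \<delta>)) = int (c \<delta>) - (if \<delta> = \<eta> then k else 0)" using nn by (simp add: d_def)
  ultimately show ?thesis by (intro exI[of _ "\<lambda>\<delta>. nat (d \<delta>)"] conjI)
qed

lemma ex_pos_ip:
  assumes \<beta>: "\<beta> \<in> \<Phi>" "\<beta> = (\<Sum>\<delta>\<in>\<Delta>. of_nat (c \<delta>) *\<^sub>R \<delta>)"
  shows "\<exists>\<eta>\<in>\<Delta>. ip \<beta> \<eta> > 0"
proof (rule ccontr)
  assume "\<not> ?thesis"
  then have *: "\<And>\<eta>. \<eta> \<in> \<Delta> ==> \<beta> \<bullet> \<eta> \<le> 0" using len_pos by (auto simp: ip_def not_less divide_le_0_iff)
  have "\<beta> \<bullet> \<beta> = (\<Sum>\<delta>\<in>\<Delta>. real (c \<delta>) * (\<beta> \<bullet> \<delta>))" by (subst (2) \<beta>(2)) (simp add: inner_sum_right)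
  also have "... \<le> 0" by (intro sum_nonpos mult_nonneg_nonpos *) auto
  finally have "\<beta> = 0" by (metis inner_gt_zero_iff not_less)
  then show False using \<beta>(1) zero_\<Phi> by blast
qed

lemma refl_len: "\<alpha> \<noteq> 0 ==> (\<beta> - pairing \<beta> \<alpha> *\<^sub>R \<alpha>) \<bullet> (\<beta> - pairing \<beta> \<alpha> *\<^sub>R \<alpha>) = \<beta> \<bullet> \<beta>"
  for \<alpha> \<beta> :: 'a
  by (simp add: pairing_def inner_diff_left inner_diff_right inner_commute field_simps power2_eq_square)

text \<open>Some simple root has positive product with \<beta>; reflecting in it preserves the
  length and lowers the sum of the coordinates, until a simple root is reached.\<close>

lemma pos_len:
  assumes "\<beta> \<in> \<Phi>" "\<beta> = (\<Sum>\<delta>\<in>\<Delta>. of_nat (c \<delta>) *\<^sub>R \<delta>)"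
  shows "\<beta> \<bullet> \<beta> = len" using assms
proof (induction "\<Sum>\<delta>\<in>\<Delta>. c \<delta>" arbitrary: \<beta> c rule: less_induct)
  case less
  obtain \<eta> where e: "\<eta> \<in> \<Delta>" "ip \<beta> \<eta> > 0" using ex_pos_ip[OF less(2,3)] by blast
  show ?case
  proof (cases "\<beta> = \<eta>")
    case True then show ?thesis using e simple_len by simp
  next
    case False
    obtain k where k: "pairing \<beta> \<eta> = of_int k" using int_\<Phi>[OF \<Delta>_\<Phi>[OF e(1)] less(2)] by (auto elim: Ints_cases)
    have k0: "k > 0" using e k pairing_simple[of \<eta> \<beta>] by simp
    have r: "\<beta> - of_int k *\<^sub>R \<eta> \<in> \<Phi>" using refl_\<Phi>[OF \<Delta>_\<Phi>[OF e(1)] less(2)] k by simp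
    obtain d :: "'a => nat" where d: "\<beta> - of_int k *\<^sub>R \<eta> = (\<Sum>\<delta>\<in>\<Delta>. of_nat (d \<delta>) *\<^sub>R \<delta>)"
      "\<forall>\<delta>\<in>\<Delta>. int (d \<delta>) = int (c \<delta>) - (if \<delta> = \<eta> then k else 0)"
      using pos_descent[OF less(2,3) e(1) False r] by blast
    have "(\<Sum>\<delta>\<in>\<Delta>. d \<delta>) < (\<Sum>\<delta>\<in>\<Delta>. c \<delta>)"
    proof (rule sum_strict_mono_ex1[OF finite_\<Delta>])
      have *: "int (d \<delta>) \<le> int (c \<delta>)" if "\<delta> \<in> \<Delta>" for \<delta> using d(2) that k0 by auto
      then show "\<forall>\<delta>\<in>\<Delta>. d \<delta> \<le> c \<delta>" by auto
      have "int (d \<eta>) < int (c \<eta>)" using d(2) e k0 by auto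
      then show "\<exists>\<delta>\<in>\<Delta>. d \<delta> < c \<delta>" using e by auto
    qed
    from less(1)[OF this r d(1)] have "(\<beta> - of_int k *\<^sub>R \<eta>) \<bullet> (\<beta> - of_int k *\<^sub>R \<eta>) = len" .
    moreover have "\<eta> \<noteq> 0" using e \<Delta>_\<Phi> zero_\<Phi> by blast
    ultimately show ?thesis using refl_len[of \<eta> \<beta>] k by simp
  qed
qed

lemma uminus_\<Phi>: assumes "\<alpha> \<in> \<Phi>" shows "- \<alpha> \<in> \<Phi>"
proof -
  have "pairing \<alpha> \<alpha> = 2" using assms zero_\<Phi> by (auto simp: pairing_def)
  then show ?thesis using refl_\<Phi>[OF assms assms] by (simp add: scaleR_2)
qed

lemma root_len: assumes "\<beta> \<in> \<Phi>" shows "\<beta> \<bullet> \<beta> = len"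
proof -
  have "\<gamma> \<bullet> \<gamma> = len" if "\<gamma> \<in> \<Phi>" "pos \<gamma>" for \<gamma>
    using that(2) pos_len[OF that(1)] unfolding pos_def by blast
  from this[of \<beta>] this[of "- \<beta>"] show ?thesis using pos_or_neg[OF assms] assms uminus_\<Phi> by auto
qed

lemma pairing_ip: "\<alpha> \<in> \<Phi> ==> pairing \<beta> \<alpha> = ip \<beta> \<alpha>" by (simp add: pairing_def ip_def root_len)

lemma ip_eq_2:
  assumes "\<alpha> \<in> \<Phi>" "\<beta> \<in> \<Phi>" "ip \<alpha> \<beta> = 2" shows "\<alpha> = \<beta>"
proof -
  have "\<alpha> \<bullet> \<beta> = len" using assms(3) len_pos by (simp add: ip_def field_simps)
  then have "(\<alpha> - \<beta>) \<bullet> (\<alpha> - \<beta>) = 0"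
    using root_len assms by (simp add: inner_diff_left inner_diff_right inner_commute)
  then show ?thesis by simp
qed

lemma ip_values:
  assumes "\<alpha> \<in> \<Phi>" "\<beta> \<in> \<Phi>" shows "ip \<alpha> \<beta> \<in> {-2, -1, 0, 1, 2}"
proof -
  have "ip \<alpha> \<beta> \<in> \<int>" using int_\<Phi>[OF assms(2,1)] pairing_ip[OF assms(2)] by simp
  then obtain k where k: "ip \<alpha> \<beta> = of_int k" by (auto elim: Ints_cases)
  have "\<bar>\<alpha> \<bullet> \<beta>\<bar> \<le> norm \<alpha> * norm \<beta>" by (rule Cauchy_Schwarz_ineq2)
  also have "... = len" using root_len assms len_pos by (simp add: norm_eq_sqrt_inner)
  finally have "\<bar>ip \<alpha> \<beta>\<bar> \<le> 2" using len_pos by (simp add: ip_def abs_mult field_simps)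
  then have "\<bar>k\<bar> \<le> 2" unfolding k by linarith
  then have "k = -2 \<or> k = -1 \<or> k = 0 \<or> k = 1 \<or> k = 2" by linarith
  then show ?thesis using k by auto
qed

lemma add_\<Phi>: "\<alpha> \<in> \<Phi> ==> \<beta> \<in> \<Phi> ==> ip \<alpha> \<beta> = -1 ==> \<alpha> + \<beta> \<in> \<Phi>"
  using refl_\<Phi>[of \<alpha> \<beta>] pairing_ip[of \<alpha> \<beta>] by (simp add: ip_commute add.commute)

text \<open>Otherwise every root lies in the span of B or is orthogonal to B. The simple roots in
  the span are then closed under adjacency in the diagram, and at least one exists, so all of them
  lie in a space of dimension at most 2, against the rank.\<close>

lemma escapes_span:
  assumes B: "B \<subseteq> \<Phi>" "B \<noteq> {}" "finite B" "card B \<le> 2"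
  shows "\<exists>\<delta>\<in>\<Phi>. \<delta> \<notin> span B \<and> (\<exists>b\<in>B. ip \<delta> b \<noteq> 0)"
proof (rule ccontr)
  assume "\<not> ?thesis"
  then have H: "\<And>\<delta>. \<delta> \<in> \<Phi> ==> \<delta> \<in> span B \<or> (\<forall>b\<in>B. ip \<delta> b = 0)" by blast
  have orth: "ip \<delta> w = 0" if "\<forall>b\<in>B. ip \<delta> b = 0" "w \<in> span B" for \<delta> w using that(2)
  proof (induction rule: span_induct_alt)
    case base then show ?case by (simp add: ip_def)
  next
    case (step c b w)
    then have "\<delta> \<bullet> b = 0" "\<delta> \<bullet> w = 0" using that(1) len_pos by (auto simp: ip_def)
    then show ?case by (simp add: ip_def inner_add_right)
  qed
  have closed: "s j \<in> span B" if "i \<in> {1..l}" "j \<in> {1..l}" "cartan_matrix_E i j = -1" "s i \<in> span B" for i j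
  proof (rule ccontr)
    assume "s j \<notin> span B"
    then have "ip (s j) (s i) = 0" using H[OF \<Delta>_\<Phi>[OF s_\<Delta>[OF that(2)]]] orth that by blast
    then show False using cartan[OF that(1,2)] that(3) pairing_simple[OF s_\<Delta>[OF that(2)]] by (simp add: ip_commute)
  qed
  obtain b where b: "b \<in> B" using B by blast
  have "\<exists>i\<in>{1..l}. s i \<in> span B"
  proof (rule ccontr)
    assume "\<not> ?thesis"
    then have "\<And>i. i \<in> {1..l} ==> ip (s i) b = 0" using H \<Delta>_\<Phi> s_\<Delta> b by blast
    then have z: "\<And>\<delta>. \<delta> \<in> \<Delta> ==> \<delta> \<bullet> b = 0" using s_surj len_pos unfolding ip_def by fastforce
    obtain c :: "'a => int" where c: "b = (\<Sum>\<delta>\<in>\<Delta>. of_int (c \<delta>) *\<^sub>R \<delta>)"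
      using root_base b B unfolding root_base_def by blast
    have "b \<bullet> b = (\<Sum>\<delta>\<in>\<Delta>. of_int (c \<delta>) * (\<delta> \<bullet> b))" by (subst c) (simp add: inner_sum_left)
    also have "... = 0" using z by simp
    finally show False using b B zero_\<Phi> by auto
  qed
  then obtain i where i: "i \<in> {1..l}" "s i \<in> span B" by blast
  have "s j \<in> span B" if "j \<in> {1..l}" for j
    by (rule dynkin_connected[of "\<lambda>j. s j \<in> span B" i j]) (use closed i that in auto)
  then have "\<Delta> \<subseteq> span B" using s_surj by blast
  then have "card \<Delta> \<le> card B" using independent_span_bound[OF B(3) indep] by blast
  then show False using card_\<Delta> B(4) l by auto
qed

lemma neg_ip: "ip (- x) y = - ip x y" "ip x (- y) = - ip x y" by (simp_all add: ip_def)

lemma ip_self2: "\<alpha> \<in> \<Phi> ==> ip \<alpha> \<alpha> = 2" using len_pos by (simp add: ip_def root_len)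

lemma ip_outside:
  assumes "\<delta> \<in> \<Phi>" "\<beta> \<in> \<Phi>" "\<delta> \<notin> span B" "\<beta> \<in> span B" shows "ip \<delta> \<beta> \<in> {-1, 0, 1}"
proof -
  have "\<delta> \<noteq> \<beta>" "\<delta> \<noteq> - \<beta>" using assms span_neg by blast+
  then have "ip \<delta> \<beta> \<noteq> 2" "ip (- \<delta>) \<beta> \<noteq> 2" using ip_eq_2 assms uminus_\<Phi> by fastforce+
  then show ?thesis using ip_values[OF assms(1,2)] by (auto simp: neg_ip)
qed

lemma ex_low: assumes "\<alpha> \<in> \<Phi>" shows "\<exists>\<beta>\<in>\<Phi>. ip \<beta> \<alpha> = -1"
proof -
  obtain \<delta> where d: "\<delta> \<in> \<Phi>" "\<delta> \<notin> span {\<alpha>}" "ip \<delta> \<alpha> \<noteq> 0" using escapes_span[of "{\<alpha>}"] assms by auto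
  then have "ip \<delta> \<alpha> = -1 \<or> ip \<delta> \<alpha> = 1" using ip_outside[OF d(1) assms d(2)] by (auto intro: span_base)
  then show ?thesis using d uminus_\<Phi>[OF d(1)] neg_ip[of \<delta> \<alpha>] by force
qed

text \<open>A root \<delta> outside the plane of \<alpha> and \<gamma>, and not orthogonal to it,
  has up to sign one of three pairs of products with them; accordingly \<delta> - \<alpha>, \<delta>
  or \<delta> + \<gamma> is the root sought.\<close>

lemma ex_A3:
  assumes a: "\<alpha> \<in> \<Phi>" "\<gamma> \<in> \<Phi>" "ip \<gamma> \<alpha> = -1"
  shows "\<exists>\<beta>\<in>\<Phi>. ip \<beta> \<alpha> = -1 \<and> ip \<beta> \<gamma> = 1"
proof -
  let ?B = "{\<alpha>, \<gamma>}"
  have "card ?B \<le> 2" by (simp add: card_insert_if)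
  then obtain \<delta> where d: "\<delta> \<in> \<Phi>" "\<delta> \<notin> span ?B" "ip \<delta> \<alpha> \<noteq> 0 \<or> ip \<delta> \<gamma> \<noteq> 0"
    using escapes_span[of ?B] a by auto
  have key: ?thesis if d: "\<delta> \<in> \<Phi>" "(ip \<delta> \<alpha>, ip \<delta> \<gamma>) \<in> {(1, 0), (-1, 1), (0, -1)}" for \<delta>
  proof -
    consider "ip \<delta> \<alpha> = 1" "ip \<delta> \<gamma> = 0" | "ip \<delta> \<alpha> = -1" "ip \<delta> \<gamma> = 1" | "ip \<delta> \<alpha> = 0" "ip \<delta> \<gamma> = -1"
      using d by auto
    then show ?thesis
    proof cases
      case 1
      have "\<delta> + - \<alpha> \<in> \<Phi>" using 1 by (intro add_\<Phi> d uminus_\<Phi> a) (simp add: neg_ip)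
      then show ?thesis using 1 a
        by (intro bexI[of _ "\<delta> + - \<alpha>"]) (auto simp: ip_add neg_ip ip_self2 ip_commute[of \<alpha> \<gamma>] simp del: add_uminus_conv_diff)
    next
      case 2 then show ?thesis using d by blast
    next
      case 3
      have "\<delta> + \<gamma> \<in> \<Phi>" using 3 by (intro add_\<Phi> d a)
      then show ?thesis using 3 a by (intro bexI[of _ "\<delta> + \<gamma>"]) (auto simp: ip_add ip_self2)
    qed
  qed
  have vals: "ip \<delta> \<alpha> \<in> {-1, 0, 1}" "ip \<delta> \<gamma> \<in> {-1, 0, 1}"
    by (rule ip_outside[OF d(1) _ d(2)]; use a in \<open>simp add: span_base\<close>)+
  have sum: "\<alpha> + \<gamma> \<in> \<Phi>" using add_\<Phi> a by (simp add: ip_commute)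
  have "ip \<delta> (\<alpha> + \<gamma>) \<in> {-1, 0, 1}"
    by (rule ip_outside[OF d(1) sum d(2)]) (intro span_add span_base; simp)
  then have "ip \<delta> \<alpha> + ip \<delta> \<gamma> \<in> {-1, 0, 1}" by (simp add: ip_commute[of \<delta>] ip_add)
  then have "(ip \<delta> \<alpha>, ip \<delta> \<gamma>) \<in> {(1, 0), (-1, 1), (0, -1)} \<or> (ip (- \<delta>) \<alpha>, ip (- \<delta>) \<gamma>) \<in> {(1, 0), (-1, 1), (0, -1)}"
    using vals d(3) by (auto simp: neg_ip)
  then show ?thesis using key d(1) uminus_\<Phi> by blast
qed

text \<open>A multiple of the functional found so far is added to the inner product with the new
  vector; only finitely many multiples fail.\<close>

lemma linear_nonvanishing:
  assumes "finite W" "0 \<notin> W"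
  shows "\<exists>g :: 'a => real. linear g \<and> (\<forall>w\<in>W. g w \<noteq> 0)" using assms
proof (induction W rule: finite_induct)
  case empty
  have "linear (\<lambda>_ :: 'a. 0 :: real)" by (rule linearI) auto
  then show ?case by blast
next
  case (insert w W)
  then obtain g :: "'a => real" where g: "linear g" "\<forall>w\<in>W. g w \<noteq> 0" by auto
  define S where "S = insert 0 ((\<lambda>v. - (v \<bullet> w) / g v) ` W) \<union> {- (w \<bullet> w) / g w}"
  have "finite S" using insert by (simp add: S_def)
  then obtain c :: real where c: "c \<notin> S" using ex_new_if_finite[OF infinite_UNIV_char_0] by blast
  have lin: "linear (\<lambda>v. v \<bullet> w + c * g v)"
    using g(1) by (intro linearI) (auto simp: linear_add linear_scale inner_add_left algebra_simps)
  moreover have "v \<bullet> w + c * g v \<noteq> 0" if "v \<in> insert w W" for v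
  proof (cases "g v = 0")
    case True
    then have "v = w" using g that by auto
    then show ?thesis using True insert by auto
  next
    case False
    then have "c \<noteq> - (v \<bullet> w) / g v" using c that by (auto simp: S_def)
    then show ?thesis using False by (auto simp: field_simps)
  qed
  ultimately show ?case by blast
qed

text \<open>The functional with value 1 on the simple roots is perturbed by a small positive
  multiple of one that separates the roots. Positivity on the base persists under small
  perturbations, and each coincidence between two roots is avoided by all sufficiently small
  multiples.\<close>

lemma height_exists:
  "\<exists>f :: 'a => real. (\<forall>v w. f (v + w) = f v + f w) \<and> (\<forall>\<delta>\<in>\<Delta>. f \<delta> > 0) \<and> inj_on f \<Phi>"
proof -
  obtain g0 :: "'a => real" where g0: "linear g0" "\<forall>\<delta>\<in>\<Delta>. g0 \<delta> = 1"
    using linear_independent_extend[OF indep, of "\<lambda>_. 1"] by blast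
  define W where "W = (\<lambda>(a, b). a - b) ` ({(a, b). a \<in> \<Phi> \<and> b \<in> \<Phi> \<and> a \<noteq> b})"
  have "{(a, b). a \<in> \<Phi> \<and> b \<in> \<Phi> \<and> a \<noteq> b} \<subseteq> \<Phi> \<times> \<Phi>" by auto
  then have "finite W" unfolding W_def by (intro finite_imageI) (rule finite_subset, auto intro: finite_\<Phi>)
  moreover have "0 \<notin> W" by (auto simp: W_def)
  ultimately obtain g :: "'a => real" where g: "linear g" "\<forall>w\<in>W. g w \<noteq> 0" using linear_nonvanishing by blast
  have ev1: "eventually (\<lambda>c. g0 w + c * g w \<noteq> 0) (at_right (0::real))" if "w \<in> W" for w
  proof (cases "g0 w = 0")
    case True
    have "eventually (\<lambda>c. c \<in> {0<..}) (at_right (0::real))" by (simp add: eventually_at_right_less)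
    then show ?thesis by eventually_elim (use True g that in auto)
  next
    case False
    have "((\<lambda>c. g0 w + c * g w) \<longlongrightarrow> g0 w + 0 * g w) (at_right 0)" by (intro tendsto_intros)
    then show ?thesis using False by (intro tendsto_imp_eventually_ne) auto
  qed
  have ev2: "eventually (\<lambda>c. g0 \<delta> + c * g \<delta> > 0) (at_right (0::real))" if "\<delta> \<in> \<Delta>" for \<delta>
  proof -
    have "((\<lambda>c. g0 \<delta> + c * g \<delta>) \<longlongrightarrow> g0 \<delta> + 0 * g \<delta>) (at_right 0)" by (intro tendsto_intros)
    then show ?thesis using g0 that by (intro order_tendstoD(1)) auto
  qed
  have "eventually (\<lambda>c. (\<forall>w\<in>W. g0 w + c * g w \<noteq> 0) \<and> (\<forall>\<delta>\<in>\<Delta>. g0 \<delta> + c * g \<delta> > 0)) (at_right (0::real))"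
    using ev1 ev2 \<open>finite W\<close> finite_\<Delta> by (intro eventually_conj eventually_ball_finite) auto
  then obtain c where c: "\<forall>w\<in>W. g0 w + c * g w \<noteq> 0" "\<forall>\<delta>\<in>\<Delta>. g0 \<delta> + c * g \<delta> > 0"
    using eventually_happens'[OF trivial_limit_at_right_real] by blast
  define f where "f v = g0 v + c * g v" for v
  have add: "f (v + w) = f v + f w" for v w using g0 g by (simp add: f_def linear_add algebra_simps)
  have "inj_on f \<Phi>"
  proof (rule inj_onI, rule ccontr)
    fix a b assume ab: "a \<in> \<Phi>" "b \<in> \<Phi>" "f a = f b" "a \<noteq> b"
    then have "a - b \<in> W" by (force simp: W_def)
    then have "f (a - b) \<noteq> 0" using c by (simp add: f_def)
    then show False using add[of "a - b" b] ab by simp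
  qed
  then show ?thesis using add c by (intro exI[of _ f]) (auto simp: f_def)
qed

lemma height_pos:
  assumes f: "\<forall>v w. f (v + w) = f v + f w" "\<forall>\<delta>\<in>\<Delta>. f \<delta> > (0::real)" and b: "\<beta> \<in> \<Phi>"
    and c: "\<beta> = (\<Sum>\<delta>\<in>\<Delta>. of_nat (c \<delta>) *\<^sub>R \<delta>)"
  shows "f \<beta> > 0"
proof -
  have f0: "f 0 = 0" using f(1)[rule_format, of 0 0] by simp
  have fs: "f (\<Sum>x\<in>X. h x) = (\<Sum>x\<in>X. f (h x))" for X and h :: "'a => 'a"
    by (induction X rule: infinite_finite_induct) (auto simp: f0 f)
  have fn: "f (real n *\<^sub>R v) = real n * f v" for n v
    by (induction n) (auto simp: f0 f scaleR_add_left algebra_simps)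
  have eq: "f \<beta> = (\<Sum>\<delta>\<in>\<Delta>. real (c \<delta>) * f \<delta>)" by (subst c) (simp add: fs fn)
  obtain \<eta> where e: "\<eta> \<in> \<Delta>" "c \<eta> \<noteq> 0"
  proof (rule ccontr)
    assume "\<not> thesis"
    then have "\<And>\<delta>. \<delta> \<in> \<Delta> ==> c \<delta> = 0" using that by blast
    then have "\<beta> = 0" unfolding c by (intro sum.neutral) simp
    then show False using b zero_\<Phi> by blast
  qed
  show ?thesis unfolding eq by (rule sum_pos2[OF finite_\<Delta> e(1)])
      (use e f(2) in \<open>simp_all add: less_imp_le\<close>)
qed

lemma height_pos_iff:
  assumes f: "\<forall>v w. f (v + w) = f v + f w" "\<forall>\<delta>\<in>\<Delta>. f \<delta> > (0::real)" and b: "\<beta> \<in> \<Phi>"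
  shows "f \<beta> > 0 \<longleftrightarrow> pos \<beta>" "f \<beta> \<noteq> 0"
proof -
  have f0: "f 0 = 0" using f(1)[rule_format, of 0 0] by simp
  have fm: "f (- v) = - f v" for v using f(1)[rule_format, of v "- v"] f0 by simp
  have 1: "f \<gamma> > 0" if "\<gamma> \<in> \<Phi>" "pos \<gamma>" for \<gamma>
    using height_pos[OF f that(1)] that(2) unfolding pos_def by blast
  have 2: "pos \<beta> --> f \<beta> > 0" "pos (- \<beta>) --> f \<beta> < 0" using 1[OF b] 1[OF uminus_\<Phi>[OF b]] fm[of \<beta>] by auto
  then show "f \<beta> > 0 \<longleftrightarrow> pos \<beta>" "f \<beta> \<noteq> 0" using pos_or_neg[OF b] by auto
qed

lemma simple_root:
  assumes f: "\<forall>v w. f (v + w) = f v + f w" "\<forall>\<delta>\<in>\<Delta>. f \<delta> > (0::real)"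
    and b: "\<beta> \<in> \<Phi>" "f \<beta> > 0" "\<beta> \<noteq> \<eta>" "\<eta> \<in> \<Delta>" "\<beta> - \<eta> \<in> \<Phi>"
  shows "f (\<beta> - \<eta>) > 0"
proof -
  obtain c :: "'a => nat" where c: "\<beta> = (\<Sum>\<delta>\<in>\<Delta>. of_nat (c \<delta>) *\<^sub>R \<delta>)"
    using height_pos_iff[OF f b(1)] b(2) unfolding pos_def by blast
  have "\<beta> - of_int 1 *\<^sub>R \<eta> \<in> \<Phi>" using b by simp
  from pos_descent[OF b(1) c b(4,3) this] have "pos (\<beta> - \<eta>)" unfolding pos_def by auto
  then show ?thesis using height_pos_iff[OF f b(5)] by blast
qed

lemma height_base:
  assumes f: "\<forall>v w. f (v + w) = f v + f w" "\<forall>\<delta>\<in>\<Delta>. f \<delta> > (0::real)"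
    and b: "\<beta> \<in> \<Phi>" "f \<beta> > 0" "\<beta> \<notin> \<Delta>"
  shows "\<exists>\<eta>\<in>\<Delta>. \<beta> - \<eta> \<in> \<Phi> \<and> ip \<eta> (\<beta> - \<eta>) = -1"
proof -
  obtain c :: "'a => nat" where c: "\<beta> = (\<Sum>\<delta>\<in>\<Delta>. of_nat (c \<delta>) *\<^sub>R \<delta>)"
    using height_pos_iff[OF f b(1)] b(2) unfolding pos_def by blast
  obtain \<eta> where e: "\<eta> \<in> \<Delta>" "ip \<beta> \<eta> > 0" using ex_pos_ip[OF b(1) c] by blast
  have e\<Phi>: "\<eta> \<in> \<Phi>" using e \<Delta>_\<Phi> by blast
  have "ip \<beta> \<eta> \<noteq> 2" using ip_eq_2[OF b(1) e\<Phi>] b(3) e by auto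
  then have 1: "ip \<beta> \<eta> = 1" using ip_values[OF b(1) e\<Phi>] e by auto
  have "\<beta> + - \<eta> \<in> \<Phi>" by (rule add_\<Phi>[OF b(1) uminus_\<Phi>[OF e\<Phi>]]) (simp add: neg_ip 1)
  moreover have "ip (\<beta> + - \<eta>) \<eta> = -1" unfolding ip_add neg_ip using 1 ip_self2[OF e\<Phi>] by simp
  then have "ip \<eta> (\<beta> + - \<eta>) = -1" by (simp only: ip_commute)
  ultimately show ?thesis using e by auto
qed

end

section \<open>Structure constants\<close>

lemma linear_hom:
  assumes "Vector_Spaces.linear s1 s2 f"
  shows "f (x + y) = f x + f y" "f (s1 c x) = s2 c (f x)"
  using assms by (simp_all add: Vector_Spaces.linear_iff_module_hom module_hom.add module_hom.scale)

text \<open>The base \<open>\<Delta>\<close> belonging to the Chevalley base and the base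
  \<open>\<Delta>'\<close> with the prescribed Cartan matrix may differ; they share the root
  system.\<close>

locale E_algebra = chevalley_base smul br \<Phi> \<Delta> e + R: type_E l \<Phi> \<Delta>' s
  for smul :: "complex => 'g::ab_group_add => 'g" and br :: "'g => 'g => 'g"
    and \<Phi> \<Delta> :: "'a::euclidean_space set" and e :: "'a => 'g" and l \<Delta>' s
begin

lemma ip_add_right: "R.ip z (x + y) = R.ip z x + R.ip z y" by (simp only: R.ip_commute[of z] R.ip_add)

lemma br_add: "br (x + y) z = br x z + br y z" "br z (x + y) = br z x + br z y"
  and br_scale: "br (smul c x) z = smul c (br x z)" "br z (smul c x) = smul c (br z x)"
  using linear_hom[OF br_linear_left] linear_hom[OF br_linear_right] by blast+

lemma br_anti: "br y x = - br x y"
proof -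
  have "br (x + y) (x + y) = br y x + br x y" unfolding br_add unfolding br_self by (simp add: add.commute)
  then have "br y x + br x y = 0" unfolding br_self by simp
  then show ?thesis by (simp only: eq_neg_iff_add_eq_0)
qed

lemma br_0: "br x 0 = 0" "br 0 x = 0" using br_add(1)[of 0 0 x] br_add(2)[of x 0 0] by simp_all

lemma br_uminus: "br (- x) y = - br x y" "br x (- y) = - br x y"
  using br_add(1)[of "- x" x y] br_add(2)[of x "- y" y] by (simp_all add: br_0 eq_neg_iff_add_eq_0)

lemma br_leibniz: "br x (br y z) = br (br x y) z + br y (br x z)"
proof -
  have "br x (br y z) + (- br y (br x z) - br (br x y) z) = 0"
    using jacobi[of x y z] unfolding br_anti[of "br x y" z] br_anti[of z x] by (simp add: br_uminus algebra_simps)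
  then show ?thesis by (simp add: algebra_simps)
qed

lemma e_nz: assumes "\<alpha> \<in> \<Phi>" shows "e \<alpha> \<noteq> 0"
proof -
  have "e \<alpha> \<in> e ` \<Phi> \<union> coroot_vector br e ` \<Delta>" by (rule UnI1, rule imageI, rule assms)
  moreover have "0 \<notin> e ` \<Phi> \<union> coroot_vector br e ` \<Delta>"
  proof
    assume "0 \<in> e ` \<Phi> \<union> coroot_vector br e ` \<Delta>"
    then have "dependent (e ` \<Phi> \<union> coroot_vector br e ` \<Delta>)" by (rule dependent_zero)
    then show False by (rule notE[OF basis_independent])
  qed
  ultimately show ?thesis by metis
qed

lemma e_cancel: "\<alpha> \<in> \<Phi> ==> smul a (e \<alpha>) = smul b (e \<alpha>) ==> a = b" using scale_right_imp_eq e_nz by blast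

abbreviation h :: "'a => 'g" where "h \<alpha> \<equiv> br (e \<alpha>) (e (- \<alpha>))"

lemma h_e: "\<alpha> \<in> \<Phi> ==> \<beta> \<in> \<Phi> ==> br (h \<alpha>) (e \<beta>) = smul (of_real (R.ip \<alpha> \<beta>)) (e \<beta>)"
  using root_vector[of \<alpha> \<beta>] unfolding coroot_vector_def R.ip_commute[of \<alpha> \<beta>] by (metis R.pairing_ip)

lemma nonroot:
  assumes "\<alpha> \<in> \<Phi>" "\<beta> \<in> \<Phi>" "R.ip \<alpha> \<beta> \<ge> 0" shows "\<alpha> + \<beta> \<notin> \<Phi>" "\<alpha> + \<beta> \<noteq> 0"
proof -
  have "R.ip (\<alpha> + \<beta>) (\<alpha> + \<beta>) = 4 + 2 * R.ip \<alpha> \<beta>"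
    using R.ip_self2[OF assms(1)] R.ip_self2[OF assms(2)] R.ip_commute[of \<beta> \<alpha>]
    by (simp add: R.ip_add ip_add_right)
  then have "R.ip (\<alpha> + \<beta>) (\<alpha> + \<beta>) > 2" using assms by simp
  then show "\<alpha> + \<beta> \<notin> \<Phi>" "\<alpha> + \<beta> \<noteq> 0" using R.ip_self2[of "\<alpha> + \<beta>"] by (auto simp: R.ip_def)
qed

lemma br_commute: "\<alpha> \<in> \<Phi> ==> \<beta> \<in> \<Phi> ==> R.ip \<alpha> \<beta> \<ge> 0 ==> br (e \<alpha>) (e \<beta>) = 0"
  using br_nonroot nonroot by blast

text \<open>A complex number at first; it turns out to be a sign in \<open>c_sq\<close>. The choice
  keeps the companion equation at the opposite roots.\<close>

definition c :: "'a => 'a => complex" where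
  "c \<alpha> \<beta> = (SOME c. br (e \<alpha>) (e \<beta>) = smul c (e (\<alpha> + \<beta>)) \<and>
             br (e (- \<alpha>)) (e (- \<beta>)) = smul (- c) (e (- (\<alpha> + \<beta>))))"

context
  fixes \<alpha> \<beta> assumes ab: "\<alpha> \<in> \<Phi>" "\<beta> \<in> \<Phi>" "R.ip \<alpha> \<beta> = -1"
begin

lemma sum_root: "\<alpha> + \<beta> \<in> \<Phi>" using R.add_\<Phi> ab by blast

lemma br_c: "br (e \<alpha>) (e \<beta>) = smul (c \<alpha> \<beta>) (e (\<alpha> + \<beta>))"
  and br_c': "br (e (- \<alpha>)) (e (- \<beta>)) = smul (- c \<alpha> \<beta>) (e (- (\<alpha> + \<beta>)))"
  using someI_ex[OF br_root[OF ab(1,2) sum_root]] unfolding c_def by auto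

end

lemma ip_c: assumes "\<alpha> \<in> \<Phi>" "\<beta> \<in> \<Phi>" "R.ip \<alpha> \<beta> = -1"
  shows "R.ip \<beta> \<alpha> = -1" "R.ip (- \<alpha>) (- \<beta>) = -1" "R.ip \<beta> (- (\<alpha> + \<beta>)) = -1" "R.ip (- (\<alpha> + \<beta>)) \<alpha> = -1"
    "R.ip (- \<alpha>) (\<alpha> + \<beta>) = -1"
  using assms R.ip_self2[OF assms(1)] R.ip_self2[OF assms(2)] R.ip_commute[of \<beta> \<alpha>]
  by (simp_all add: R.neg_ip R.ip_add ip_add_right del: minus_add_distrib)

lemma c_anti: assumes "\<alpha> \<in> \<Phi>" "\<beta> \<in> \<Phi>" "R.ip \<alpha> \<beta> = -1" shows "c \<beta> \<alpha> = - c \<alpha> \<beta>"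
proof (rule e_cancel)
  show "\<alpha> + \<beta> \<in> \<Phi>" using sum_root assms by blast
  show "smul (c \<beta> \<alpha>) (e (\<alpha> + \<beta>)) = smul (- c \<alpha> \<beta>) (e (\<alpha> + \<beta>))"
    using br_c[OF assms] br_c[OF assms(2,1) ip_c(1)[OF assms]] br_anti[of "e \<beta>" "e \<alpha>"]
    by (simp add: add.commute scale_minus_left)
qed

lemma c_neg: assumes "\<alpha> \<in> \<Phi>" "\<beta> \<in> \<Phi>" "R.ip \<alpha> \<beta> = -1" shows "c (- \<alpha>) (- \<beta>) = - c \<alpha> \<beta>"
proof (rule e_cancel)
  show "- (\<alpha> + \<beta>) \<in> \<Phi>" using sum_root R.uminus_\<Phi> assms by blast
  show "smul (c (- \<alpha>) (- \<beta>)) (e (- (\<alpha> + \<beta>))) = smul (- c \<alpha> \<beta>) (e (- (\<alpha> + \<beta>)))"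
    using br_c'[OF assms] br_c[OF R.uminus_\<Phi>[OF assms(1)] R.uminus_\<Phi>[OF assms(2)] ip_c(2)[OF assms]]
    by (simp add: add.commute)
qed

text \<open>For roots \<open>\<alpha> + \<beta> + \<delta> = 0\<close> the Jacobi identity is a relation between the three coroot vectors;
  acting with it on \<open>e \<alpha>\<close> and \<open>e \<beta>\<close> gives two linear equations for the structure constants.\<close>

lemma c_cyclic:
  assumes ab: "\<alpha> \<in> \<Phi>" "\<beta> \<in> \<Phi>" "R.ip \<alpha> \<beta> = -1" shows "c (- (\<alpha> + \<beta>)) \<alpha> = c \<alpha> \<beta>"
proof -
  define \<delta> where "\<delta> = - (\<alpha> + \<beta>)"
  have d: "\<delta> \<in> \<Phi>" using sum_root R.uminus_\<Phi> ab \<delta>_def by blast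
  have s: "\<beta> + \<delta> = - \<alpha>" "\<delta> + \<alpha> = - \<beta>" "\<alpha> + \<beta> = - \<delta>" by (auto simp: \<delta>_def)
  have ips: "R.ip \<beta> \<delta> = -1" "R.ip \<delta> \<alpha> = -1" using ip_c[OF ab] by (simp_all add: \<delta>_def)
  have "br (e \<alpha>) (br (e \<beta>) (e \<delta>)) + br (e \<beta>) (br (e \<delta>) (e \<alpha>)) + br (e \<delta>) (br (e \<alpha>) (e \<beta>)) = 0"
    by (rule jacobi)
  then have "smul (c \<beta> \<delta>) (h \<alpha>) + smul (c \<delta> \<alpha>) (h \<beta>) + smul (c \<alpha> \<beta>) (h \<delta>) = 0"
    unfolding br_c[OF ab] br_c[OF ab(2) d ips(1)] br_c[OF d ab(1) ips(2)] br_scale s .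
  then have eq: "br (smul (c \<beta> \<delta>) (h \<alpha>) + smul (c \<delta> \<alpha>) (h \<beta>) + smul (c \<alpha> \<beta>) (h \<delta>)) (e \<gamma>) = 0" for \<gamma>
    by (simp add: br_0)
  have k: "smul (c \<beta> \<delta> * R.ip \<alpha> \<gamma> + c \<delta> \<alpha> * R.ip \<beta> \<gamma> + c \<alpha> \<beta> * R.ip \<delta> \<gamma>) (e \<gamma>) = smul 0 (e \<gamma>)" if "\<gamma> \<in> \<Phi>" for \<gamma>
    using eq[of \<gamma>] unfolding br_add br_scale h_e[OF ab(1) that] h_e[OF ab(2) that] h_e[OF d that]
    by (simp add: scale_left_distrib)
  have "c \<beta> \<delta> * 2 - c \<delta> \<alpha> - c \<alpha> \<beta> = 0" "c \<delta> \<alpha> * 2 - c \<beta> \<delta> - c \<alpha> \<beta> = 0"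
    using e_cancel[OF ab(1) k[OF ab(1)]] e_cancel[OF ab(2) k[OF ab(2)]] ips ab
    by (simp_all add: R.ip_self2 R.ip_commute[of \<beta> \<alpha>] R.ip_commute[of \<delta> \<beta>])
  moreover have "v = w" if "u * 2 - v - w = 0" "v * 2 - u - w = 0" for u v w :: complex
  proof -
    have "u = v * 2 - w" using that(2) by (simp add: algebra_simps)
    then show ?thesis using that(1) by simp
  qed
  ultimately have "c \<delta> \<alpha> = c \<alpha> \<beta>" by blast
  then show ?thesis by (simp add: \<delta>_def)
qed

lemma c_string: assumes ab: "\<alpha> \<in> \<Phi>" "\<beta> \<in> \<Phi>" "R.ip \<alpha> \<beta> = -1" shows "c (- \<alpha>) (\<alpha> + \<beta>) = c \<alpha> \<beta>"
proof -
  have g: "- (\<alpha> + \<beta>) \<in> \<Phi>" "- \<alpha> \<in> \<Phi>" "\<alpha> + \<beta> \<in> \<Phi>" using sum_root R.uminus_\<Phi> ab by blast+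
  have "c (\<alpha> + \<beta>) (- \<alpha>) = - c (- (\<alpha> + \<beta>)) \<alpha>"
    using c_neg[OF g(1) ab(1) ip_c(4)[OF ab]] by (simp del: minus_add_distrib)
  moreover have "c (\<alpha> + \<beta>) (- \<alpha>) = - c (- \<alpha>) (\<alpha> + \<beta>)" by (rule c_anti[OF g(2,3) ip_c(5)[OF ab]])
  ultimately show ?thesis using c_cyclic[OF ab] by simp
qed

text \<open>By the Leibniz rule, bracketing with e_{-\<alpha>} takes [e_\<alpha>, e_\<beta>] back to
  e_\<beta>, since the coroot vector of \<alpha> acts on e_\<beta> by -1. Evaluated with structure
  constants, the same element is the product of the constants for \<alpha>, \<beta> and for
  -\<alpha>, \<alpha> + \<beta>, which are equal.\<close>

lemma c_sq: assumes ab: "\<alpha> \<in> \<Phi>" "\<beta> \<in> \<Phi>" "R.ip \<alpha> \<beta> = -1" shows "c \<alpha> \<beta> * c \<alpha> \<beta> = 1"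
proof (rule e_cancel[OF ab(2)])
  have g: "- \<alpha> \<in> \<Phi>" "\<alpha> + \<beta> \<in> \<Phi>" using sum_root R.uminus_\<Phi> ab by blast+
  have "br (e (- \<alpha>)) (br (e \<alpha>) (e \<beta>)) = br (br (e (- \<alpha>)) (e \<alpha>)) (e \<beta>) + br (e \<alpha>) (br (e (- \<alpha>)) (e \<beta>))"
    by (rule br_leibniz)
  also have "br (e (- \<alpha>)) (e \<beta>) = 0" by (rule br_commute) (use ab g in \<open>auto simp: R.neg_ip\<close>)
  also have "br (e (- \<alpha>)) (e \<alpha>) = - h \<alpha>" by (rule br_anti)
  finally have "br (e (- \<alpha>)) (br (e \<alpha>) (e \<beta>)) = e \<beta>" using ab by (simp add: br_uminus br_0 h_e)
  then show "smul (c \<alpha> \<beta> * c \<alpha> \<beta>) (e \<beta>) = smul 1 (e \<beta>)"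
    using br_c[OF g ip_c(5)[OF ab]] by (simp add: br_c[OF ab] br_scale c_string[OF ab])
qed

lemma c_jacobi:
  assumes abc: "\<alpha> \<in> \<Phi>" "\<beta> \<in> \<Phi>" "\<gamma> \<in> \<Phi>" "R.ip \<alpha> \<beta> = -1" "R.ip \<beta> \<gamma> = -1" "R.ip \<alpha> \<gamma> = 0"
  shows "c \<alpha> \<beta> * c (\<alpha> + \<beta>) \<gamma> = c \<beta> \<gamma> * c \<alpha> (\<beta> + \<gamma>)"
proof (rule e_cancel)
  have s: "\<alpha> + \<beta> \<in> \<Phi>" "\<beta> + \<gamma> \<in> \<Phi>" using sum_root abc by blast+
  have i: "R.ip (\<alpha> + \<beta>) \<gamma> = -1" "R.ip \<alpha> (\<beta> + \<gamma>) = -1" using abc by (simp_all add: R.ip_add ip_add_right)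
  show "\<alpha> + \<beta> + \<gamma> \<in> \<Phi>" using sum_root[OF s(1) abc(3) i(1)] .
  have "br (e \<alpha>) (br (e \<beta>) (e \<gamma>)) = br (br (e \<alpha>) (e \<beta>)) (e \<gamma>) + br (e \<beta>) (br (e \<alpha>) (e \<gamma>))"
    by (rule br_leibniz)
  also have "br (e \<alpha>) (e \<gamma>) = 0" by (rule br_commute) (use abc in auto)
  finally show "smul (c \<alpha> \<beta> * c (\<alpha> + \<beta>) \<gamma>) (e (\<alpha> + \<beta> + \<gamma>)) = smul (c \<beta> \<gamma> * c \<alpha> (\<beta> + \<gamma>)) (e (\<alpha> + \<beta> + \<gamma>))"
    using br_c[OF s(1) abc(3) i(1)] br_c[OF abc(1) s(2) i(2)]
    unfolding br_c[OF abc(1,2,4)] br_c[OF abc(2,3,5)] br_scale br_0 by (simp add: add.assoc del: scale_cancel_right)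
qed

abbreviation N :: "'a => 'a => int" where "N \<equiv> structure_constant smul br e"

lemma N_c: assumes ab: "\<alpha> \<in> \<Phi>" "\<beta> \<in> \<Phi>" "R.ip \<alpha> \<beta> = -1" shows "of_int (N \<alpha> \<beta>) = c \<alpha> \<beta>"
proof -
  have "c \<alpha> \<beta> = 1 \<or> c \<alpha> \<beta> = -1" using c_sq[OF ab] by (simp add: square_eq_1_iff)
  then obtain n :: int where n: "c \<alpha> \<beta> = of_int n" by (metis of_int_1 of_int_minus)
  have "N \<alpha> \<beta> = n" unfolding structure_constant_def br_c[OF ab] n
    by (rule the_equality, simp) (metis e_cancel[OF sum_root[OF ab]] of_int_eq_iff)
  then show ?thesis using n by simp
qed

lemma br_N: "\<alpha> \<in> \<Phi> ==> \<beta> \<in> \<Phi> ==> R.ip \<alpha> \<beta> = -1 ==> br (e \<alpha>) (e \<beta>) = smul (of_int (N \<alpha> \<beta>)) (e (\<alpha> + \<beta>))"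
  by (simp add: N_c br_c)

sublocale simply_laced \<Phi> R.ip N
proof
  show "finite \<Phi>" by (rule R.finite_\<Phi>)
  fix x x' z :: 'a
  show "R.ip (x + x') z = R.ip x z + R.ip x' z" by (rule R.ip_add)
  show "R.ip x z = R.ip z x" by (rule R.ip_commute)
next
  fix \<alpha> assume a: "\<alpha> \<in> \<Phi>"
  show "R.ip \<alpha> \<alpha> = 2" by (rule R.ip_self2[OF a])
  show "- \<alpha> \<in> \<Phi>" by (rule R.uminus_\<Phi>[OF a])
  show "\<exists>\<beta>\<in>\<Phi>. R.ip \<beta> \<alpha> = -1" by (rule R.ex_low[OF a])
  fix \<beta> assume b: "\<beta> \<in> \<Phi>"
  show "R.ip \<alpha> \<beta> \<in> {-2, -1, 0, 1, 2}" by (rule R.ip_values[OF a b])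
  show "\<alpha> = \<beta>" if "R.ip \<alpha> \<beta> = 2" by (rule R.ip_eq_2[OF a b that])
  show "\<exists>\<gamma>\<in>\<Phi>. R.ip \<gamma> \<alpha> = -1 \<and> R.ip \<gamma> \<beta> = 1" if "R.ip \<beta> \<alpha> = -1" by (rule R.ex_A3[OF a b that])
  assume i: "R.ip \<alpha> \<beta> = -1"
  note ab = a b i
  show s: "\<alpha> + \<beta> \<in> \<Phi>" by (rule R.add_\<Phi>[OF ab])
  have "of_int (N \<alpha> \<beta> * N \<alpha> \<beta>) = (1 :: complex)" by (simp add: N_c[OF ab] c_sq[OF ab])
  then show "N \<alpha> \<beta> * N \<alpha> \<beta> = 1" by (simp only: of_int_eq_1_iff)
  have "of_int (N \<beta> \<alpha>) = (of_int (- N \<alpha> \<beta>) :: complex)"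
    by (simp add: N_c[OF ab] N_c[OF b a ip_c(1)[OF ab]] c_anti[OF ab])
  then show "N \<beta> \<alpha> = - N \<alpha> \<beta>" by (simp only: of_int_eq_iff)
  have "of_int (N (- \<alpha>) (\<alpha> + \<beta>)) = (of_int (N \<alpha> \<beta>) :: complex)"
    by (simp add: N_c[OF ab] N_c[OF R.uminus_\<Phi>[OF a] s ip_c(5)[OF ab]] c_string[OF ab])
  then show "N (- \<alpha>) (\<alpha> + \<beta>) = N \<alpha> \<beta>" by (simp only: of_int_eq_iff)
  fix \<gamma> assume g: "\<gamma> \<in> \<Phi>" "R.ip \<beta> \<gamma> = -1" "R.ip \<alpha> \<gamma> = 0"
  have s2: "\<beta> + \<gamma> \<in> \<Phi>" by (rule R.add_\<Phi>[OF b g(1,2)])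
  have i': "R.ip (\<alpha> + \<beta>) \<gamma> = -1" "R.ip \<alpha> (\<beta> + \<gamma>) = -1" using ab g by (simp_all add: R.ip_add ip_add_right)
  have "of_int (N \<alpha> \<beta> * N (\<alpha> + \<beta>) \<gamma>) = (of_int (N \<beta> \<gamma> * N \<alpha> (\<beta> + \<gamma>)) :: complex)"
    using c_jacobi[OF a b g(1) i g(2,3)]
    by (simp add: N_c[OF ab] N_c[OF s g(1) i'(1)] N_c[OF b g(1,2)] N_c[OF a s2 i'(2)])
  then show "N \<alpha> \<beta> * N (\<alpha> + \<beta>) \<gamma> = N \<beta> \<gamma> * N \<alpha> (\<beta> + \<gamma>)" by (simp only: of_int_eq_iff)
qed

end

section \<open>Integral matrices of a representation\<close>

lemma linear_relation:
  fixes f :: "nat => 'k::field ^ 'n"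
  assumes m: "CARD('n) < m"
  shows "\<exists>c. (\<exists>k<m. c k \<noteq> 0) \<and> (\<Sum>k<m. c k *s f k) = 0"
proof (cases "inj_on f {..<m}")
  case False
  then obtain a b where ab: "a < m" "b < m" "a \<noteq> b" "f a = f b" by (auto simp: inj_on_def)
  have "(\<Sum>k<m. (if k = a then 1 else if k = b then -1 else 0) *s f k) =
     (\<Sum>k<m. (if k = a then f a else 0) - (if k = b then f b else 0))" using ab by (intro sum.cong) auto
  also have "... = 0" using ab by (simp add: sum_subtractf)
  finally show ?thesis using ab by (intro exI[of _ "\<lambda>k. if k = a then 1 else if k = b then -1 else 0"]) auto
next
  case True
  have "vec.dependent (f ` {..<m})"
  proof (rule ccontr)
    assume "\<not> ?thesis"
    then have "card (f ` {..<m}) \<le> vec.dim (UNIV :: ('k^'n) set)" by (intro vec.independent_card_le_dim) auto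
    then show False using m card_image[OF True] unfolding vec_dim_card by simp
  qed
  then obtain t u where t: "finite t" "t \<subseteq> f ` {..<m}" "(\<Sum>v\<in>t. u v *s v) = 0" "\<exists>v\<in>t. u v \<noteq> 0"
    unfolding vec.dependent_explicit by blast
  define c where "c k = (if f k \<in> t then u (f k) else 0)" for k
  have "(\<Sum>k<m. c k *s f k) = (\<Sum>v\<in>f ` {..<m}. (if v \<in> t then u v *s v else 0))"
    unfolding sum.reindex[OF True] by (rule sum.cong) (auto simp: c_def)
  also have "... = (\<Sum>v\<in>t. u v *s v)" using t(2) by (simp add: sum.If_cases Int_absorb1)
  finally have "(\<Sum>k<m. c k *s f k) = 0" using t by simp
  moreover have "\<exists>k<m. c k \<noteq> 0" using t(2,4) by (auto simp: c_def)
  ultimately show ?thesis by blast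
qed

lemma ad_power:
  assumes "H * E = E * H + scl (2 :: 'q::comm_ring_1) (E :: ('q, 'n::finite) sqm)"
  shows "H * E ^ k = E ^ k * H + scl (of_nat (2 * k)) (E ^ k)"
proof (induction k)
  case (Suc k)
  have "H * E ^ Suc k = (H * E) * E ^ k" by (simp add: mult.assoc)
  also have "... = E * (H * E ^ k) + scl 2 (E ^ Suc k)" by (simp add: assms distrib_right mult.assoc)
  also have "... = E ^ Suc k * H + scl (2 + of_nat (2 * k)) (E ^ Suc k)"
    unfolding Suc by (simp add: distrib_left mult.assoc scl_add_left algebra_simps)
  also have "2 + of_nat (2 * k) = (of_nat (2 * Suc k) :: 'q)" by simp
  finally show ?case .
qed simp

text \<open>The powers of \<open>E\<close> are eigenvectors of the derivation \<open>[H, _]\<close> for distinct eigenvalues.\<close>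

lemma power_relation:
  assumes HE: "H * E = E * H + scl 2 (E :: ('q::field_char_0, 'n::finite) sqm)"
    and "finite S" "(\<Sum>k\<in>S. scl (c k) (E ^ k)) = 0" "k0 \<in> S" "c k0 \<noteq> 0"
  shows "\<exists>m. E ^ m = 0" using assms(2-)
proof (induction S arbitrary: c k0 rule: finite_induct)
  case (insert x S)
  let ?R = "\<Sum>k\<in>insert x S. scl (c k) (E ^ k)"
  have "(\<Sum>k\<in>insert x S. scl (c k * of_nat (2 * k)) (E ^ k)) = H * ?R - ?R * H"
    unfolding sum_distrib_left sum_distrib_right sum_subtractf[symmetric]
    by (rule sum.cong) (simp_all add: ad_power[OF HE] scl_add)
  then have "(\<Sum>k\<in>insert x S. scl (c k * of_nat (2 * k)) (E ^ k)) - scl (of_nat (2 * x)) ?R = 0"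
    using insert.prems by simp
  then have "(\<Sum>k\<in>insert x S. scl (c k * (of_nat (2 * k) - of_nat (2 * x))) (E ^ k)) = 0"
    unfolding scl_sum sum_subtractf[symmetric] scl_scl
    by (subst (asm) sum.cong[OF HOL.refl, of _ _ "\<lambda>k. scl (c k * (of_nat (2 * k) - of_nat (2 * x))) (E ^ k)"])
      (auto intro!: sqm_eqI simp: algebra_simps)
  then have r: "(\<Sum>k\<in>S. scl (c k * (of_nat (2 * k) - of_nat (2 * x))) (E ^ k)) = 0" using insert by simp
  show ?case
  proof (cases "\<exists>k\<in>S. c k \<noteq> 0")
    case True
    then obtain k where k: "k \<in> S" "c k \<noteq> 0" by blast
    have "k \<noteq> x" using k insert by blast
    then have "c k * (of_nat (2 * k) - of_nat (2 * x)) \<noteq> 0" using k by simp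
    then show ?thesis by (rule insert.IH[OF r k(1)])
  next
    case False
    then have "c x \<noteq> 0" "(\<Sum>k\<in>S. scl (c k) (E ^ k)) = 0" using insert.prems by auto
    then have "scl (c x) (E ^ x) = 0" using insert by simp
    then have "E ^ x = 0" using \<open>c x \<noteq> 0\<close> scl_cancel[of "c x" "E ^ x" 0] by simp
    then show ?thesis ..
  qed
qed simp

text \<open>If the nilpotency index exceeded n, the corresponding columns of the powers of E would
  be linearly dependent. Multiplying a relation by the power of E that kills all terms but the
  lowest leaves a nonzero multiple of a nonzero column.\<close>

lemma nilpotent_power:
  assumes "E ^ m = (0 :: ('q::field, 'n::finite) sqm)"
  shows "E ^ CARD('n) = 0"
proof (rule ccontr)
  assume nz: "E ^ CARD('n) \<noteq> 0"
  define m0 where "m0 = (LEAST m. E ^ m = 0)"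
  have m0: "E ^ m0 = 0" unfolding m0_def using assms by (rule LeastI)
  have big: "E ^ k = 0" if "k \<ge> m0" for k
  proof -
    have "E ^ k = E ^ m0 * E ^ (k - m0)" using that by (simp flip: power_add)
    then show ?thesis using m0 by simp
  qed
  then have m0n: "CARD('n) < m0" using nz not_less by blast
  then have "m0 - 1 < (LEAST m. E ^ m = 0)" unfolding m0_def[symmetric] by simp
  then have "E ^ (m0 - 1) \<noteq> 0" by (rule not_less_Least)
  then obtain i j where ij: "ent (E ^ (m0 - 1)) i j \<noteq> 0" by (metis sqm_eqI ent_0)
  obtain c where c: "\<exists>k<m0. c k \<noteq> 0" "(\<Sum>k<m0. c k *s (\<chi> i. ent (E ^ k) i j)) = 0"
    using linear_relation[OF m0n, of "\<lambda>k. \<chi> i. ent (E ^ k) i j"] by blast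
  define p where "p = (LEAST k. c k \<noteq> 0)"
  obtain k0 where k0: "k0 < m0" "c k0 \<noteq> 0" using c(1) by blast
  have p: "c p \<noteq> 0" unfolding p_def by (rule LeastI[of "\<lambda>k. c k \<noteq> 0", OF k0(2)])
  have p_le: "c k = 0" if "k < p" for k using not_less_Least[of k "\<lambda>k. c k \<noteq> 0"] that unfolding p_def by blast
  have pm: "p < m0" using p_le[of k0] k0 by linarith
  define q where "q = m0 - 1 - p"
  have rel: "(\<Sum>k<m0. c k * ent (E ^ k) i' j) = 0" for i' using arg_cong[OF c(2), of "\<lambda>v. v $ i'"] by simp
  have "0 = (\<Sum>i'\<in>UNIV. ent (E ^ q) i i' * (\<Sum>k<m0. c k * ent (E ^ k) i' j))" by (simp add: rel)
  also have "... = (\<Sum>k<m0. c k * ent (E ^ (q + k)) i j)"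
    unfolding sum_distrib_left power_add ent_mult by (subst sum.swap) (simp add: mult_ac)
  also have "... = (\<Sum>k<m0. if k = p then c p * ent (E ^ (m0 - 1)) i j else 0)"
  proof (rule sum.cong)
    fix k assume "k \<in> {..<m0}"
    have "c k = 0" if "k < p" using p_le that .
    moreover have "E ^ (q + k) = 0" if "k > p" using that pm by (intro big) (simp add: q_def)
    ultimately show "c k * ent (E ^ (q + k)) i j = (if k = p then c p * ent (E ^ (m0 - 1)) i j else 0)"
      using pm by (cases k p rule: linorder_cases) (auto simp: q_def)
  qed simp
  also have "... = c p * ent (E ^ (m0 - 1)) i j" using pm by simp
  finally show False using p ij by simp
qed

text \<open>The powers of E lie in a space of dimension n^2, so they satisfy some linear
  relation.\<close>

lemma raising_nilpotent:
  assumes HE: "H * E = E * H + scl 2 (E :: ('q::field_char_0, 'n::finite) sqm)"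
  shows "E ^ CARD('n) = 0"
proof -
  define m where "m = Suc CARD('n \<times> 'n)"
  obtain c where c: "\<exists>k<m. c k \<noteq> 0" "(\<Sum>k<m. c k *s (\<chi> p :: 'n \<times> 'n. ent (E ^ k) (fst p) (snd p))) = 0"
    using linear_relation[of m "\<lambda>k. \<chi> p :: 'n \<times> 'n. ent (E ^ k) (fst p) (snd p)"] unfolding m_def by blast
  have "(\<Sum>k<m. c k * ent (E ^ k) i j) = 0" for i j using arg_cong[OF c(2), of "\<lambda>v. v $ (i, j)"] by simp
  then have "(\<Sum>k<m. scl (c k) (E ^ k)) = 0" by (intro sqm_eqI) (simp add: ent_sum)
  then obtain m' where "E ^ m' = 0" using power_relation[OF HE, of "{..<m}" c] c(1) by auto
  then show ?thesis by (rule nilpotent_power)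
qed

section \<open>Integrality and primitivity of the root matrices\<close>

lemma det_cong:
  fixes A B :: "int ^ 'n ^ 'n"
  assumes "\<And>i j. [A $ i $ j = B $ i $ j] (mod p)"
  shows "[det A = det B] (mod p)"
  unfolding det_def by (intro cong_sum cong_mult cong_refl cong_prod assms)

lemma det_of_int: "det (\<chi> i j. of_int (A $ i $ j)) = (of_int (det A) :: 'q::comm_ring_1)"
  for A :: "int ^ 'n ^ 'n" by (simp add: det_def)

text \<open>The determinant of C - m vanishes, while modulo p this matrix is scalar with determinant
  a power of -m.\<close>

lemma eigenvalue_dvd:
  fixes C :: "(int, 'n::finite) sqm" and v :: "complex ^ 'n"
  assumes p: "prime p" and C: "\<And>i j. int p dvd ent C i j"
    and v: "v \<noteq> 0" "\<And>i. (\<Sum>j\<in>UNIV. of_int (ent C i j) * v $ j) = of_int m * v $ i"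
  shows "int p dvd m"
proof -
  define A :: "int ^ 'n ^ 'n" where "A = (\<chi> i j. ent C i j - (if i = j then m else 0))"
  define A' :: "complex ^ 'n ^ 'n" where "A' = (\<chi> i j. of_int (A $ i $ j))"
  have "A' *v v = 0"
  proof (rule vec_eq_iff[THEN iffD2], rule allI)
    fix i
    have "(A' *v v) $ i = (\<Sum>j\<in>UNIV. of_int (ent C i j) * v $ j - (if i = j then of_int m * v $ j else 0))"
      unfolding matrix_vector_mult_def A'_def A_def by (auto simp: left_diff_distrib intro!: sum.cong)
    then show "(A' *v v) $ i = 0 $ i" by (simp add: sum_subtractf v)
  qed
  then have "\<not> invertible A'" unfolding invertible_def using v(1) matrix_left_invertible_ker[of A'] by blast
  then have "of_int (det A) = (0 :: complex)" by (simp add: invertible_det_nz A'_def det_of_int)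
  then have d0: "det A = 0" by simp
  have "[det A = det (\<chi> i j :: 'n. if i = j then - m else 0)] (mod int p)"
  proof (rule det_cong)
    fix i j
    have "[ent C i j - (if i = j then m else 0) = 0 - (if i = j then m else 0)] (mod int p)"
      by (rule cong_diff) (use C in \<open>auto simp: cong_0_iff\<close>)
    then show "[A $ i $ j = (\<chi> i j. if i = j then - m else 0) $ i $ j] (mod int p)"
      by (simp add: A_def split: if_splits)
  qed
  also have "det (\<chi> i j :: 'n. if i = j then - m else 0) = (- m) ^ CARD('n)" by (subst det_diagonal) auto
  finally have "int p dvd (- m) ^ CARD('n)" using d0 by (metis cong_0_iff cong_sym)
  then have "int p dvd - m" by (rule prime_dvd_power[rotated]) (use p in simp)
  then show ?thesis by simp
qed

locale E_representation = simply_connected_representation smul br \<Phi> \<Delta> e \<pi> + E_algebra smul br \<Phi> \<Delta> e l \<Delta>' s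
  for smul :: "complex => 'g::ab_group_add => 'g" and br :: "'g => 'g => 'g"
    and \<Phi> \<Delta> :: "'a::euclidean_space set" and e :: "'a => 'g" and \<pi> :: "'g => complex ^ 'n => complex ^ 'n" and l \<Delta>' s
begin

definition rep :: "'g => (complex, 'n) sqm" where "rep x = Sqm (\<lambda>i j. \<pi> x (axis j 1) $ i)"

lemma rep_apply: "\<pi> x v $ i = (\<Sum>j\<in>UNIV. ent (rep x) i j * v $ j)"
  using matrix_works[OF rep_linear[of x], of v, symmetric] by (simp add: matrix_vector_mult_def rep_def matrix_def)

lemma rep_power: "ent (rep x ^ k) i j = (\<pi> x ^^ k) (axis j 1) $ i"
proof (induction k arbitrary: i)
  case (Suc k) then show ?case using rep_apply[of x "(\<pi> x ^^ k) (axis j 1)" i] by (simp add: ent_mult)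
qed (simp add: ent_1 axis_def)

lemma rep_bracket: "rep (br x y) = rep x * rep y - rep y * rep x"
proof (rule sqm_eqI)
  fix i j
  have e: "ent (rep z) k j = \<pi> z (axis j 1) $ k" for k z by (simp add: rep_def)
  show "ent (rep (br x y)) i j = ent (rep x * rep y - rep y * rep x) i j"
    by (simp add: e rep_br ent_mult rep_apply[of x "\<pi> y (axis j 1)"] rep_apply[of y "\<pi> x (axis j 1)"])
qed

lemma rep_scale: "rep (smul a x) = scl a (rep x)" and rep_0: "rep 0 = 0"
proof -
  have 1: "\<pi> (smul a x) v = a *s \<pi> x v" "\<pi> (x + y) v = \<pi> x v + \<pi> y v" for a x y v
    using linear_hom[OF rep_linear_left[of v]] by blast+
  show "rep (smul a x) = scl a (rep x)" by (rule sqm_eqI) (simp add: rep_def 1)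
  have "\<pi> 0 v = 0" for v using 1(2)[of 0 0 v] by simp
  then show "rep 0 = 0" by (intro sqm_eqI) (simp add: rep_def)
qed

definition D :: "'a => nat => (int, 'n) sqm" where
  "D \<alpha> k = Sqm (\<lambda>i j. \<lfloor>Re (divided_power_entry e \<pi> \<alpha> k i j)\<rfloor>)"

lemma mint_inj: "mint A = (mint B :: (complex, 'n) sqm) ==> A = B"
proof (rule sqm_eqI)
  fix i j assume "mint A = (mint B :: (complex, 'n) sqm)"
  then have "ent (mint A :: (complex, 'n) sqm) i j = ent (mint B) i j" by simp
  then show "ent A i j = ent B i j" by simp
qed

lemma D_rep: assumes "\<alpha> \<in> \<Phi>" shows "mint (D \<alpha> k) = dpow k (rep (e \<alpha>))"
proof (rule sqm_eqI)
  fix i j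
  obtain z where z: "divided_power_entry e \<pi> \<alpha> k i j = of_int z" using admissible[OF assms] Ints_cases by blast
  have "ent (dpow k (rep (e \<alpha>))) i j = divided_power_entry e \<pi> \<alpha> k i j"
    by (simp add: dpow_def rep_power divided_power_entry_def field_simps)
  then show "ent (mint (D \<alpha> k)) i j = ent (dpow k (rep (e \<alpha>))) i j" by (simp add: D_def z)
qed

lemma D1_rep: "\<alpha> \<in> \<Phi> ==> mint (D \<alpha> 1) = rep (e \<alpha>)" by (simp only: D_rep) (simp add: dpow_def)

lemma rep_bracket_D: "\<alpha> \<in> \<Phi> ==> \<beta> \<in> \<Phi> ==> mint (D \<alpha> 1 * D \<beta> 1 - D \<beta> 1 * D \<alpha> 1) = rep (br (e \<alpha>) (e \<beta>))"
  by (simp only: mint_diff mint_mult D1_rep rep_bracket)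

text \<open>If p divided the matrix of the root vector, it would divide that of the coroot vector,
  hence the values of all weights on this coroot. The weights generate the weight lattice, which
  contains a root of product -1 with \<alpha>.\<close>

lemma content:
  assumes \<alpha>: "\<alpha> \<in> \<Phi>" and p: "prime p" shows "\<exists>i j. \<not> int p dvd ent (D \<alpha> 1) i j"
proof (rule ccontr)
  assume "\<not> ?thesis"
  then have d: "int p dvd ent (D \<alpha> 1) i j" for i j by blast
  define C where "C = D \<alpha> 1 * D (- \<alpha>) 1 - D (- \<alpha>) 1 * D \<alpha> 1"
  have C: "int p dvd ent C i j" for i j
    unfolding C_def ent_diff ent_mult by (intro dvd_diff dvd_sum dvd_mult dvd_mult2 d)
  have Ch: "mint C = rep (h \<alpha>)" unfolding C_def by (rule rep_bracket_D[OF \<alpha> uminus_root[OF \<alpha>]])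
  have *: "\<exists>k. pairing \<mu> \<alpha> = of_int (int p * k)" if "\<mu> \<in> group_closure (weights br \<Phi> e \<pi>)" for \<mu>
    using that
  proof induction
    case (base \<mu>)
    show ?case
    \<comment> \<open>The group closure starts from the weights together with 0.\<close>
    proof (cases "\<mu> = 0")
      case True then show ?thesis by (intro exI[of _ 0]) (simp add: pairing_def)
    next
      case False
      then have mu: "\<mu> \<in> weights br \<Phi> e \<pi>" using base by simp
      then have "\<mu> \<in> weight_lattice \<Phi>" using weights_generate group_closure.base[of \<mu>] by auto
      then obtain m where m: "pairing \<mu> \<alpha> = of_int m" using \<alpha> Ints_cases unfolding weight_lattice_def by blast
      obtain v where v: "v \<noteq> 0" "\<pi> (h \<alpha>) v = of_real (pairing \<mu> \<alpha>) *s v"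
        using mu \<alpha> unfolding weights_def coroot_vector_def by blast
      have "int p dvd m"
      proof (rule eigenvalue_dvd[OF p C v(1)])
        fix i
        have "(\<Sum>j\<in>UNIV. ent (mint C) i j * v $ j) = \<pi> (h \<alpha>) v $ i" unfolding Ch by (rule rep_apply[symmetric])
        then show "(\<Sum>j\<in>UNIV. of_int (ent C i j) * v $ j) = of_int m * v $ i" by (simp add: v m)
      qed
      then show ?thesis using m by (auto simp: dvd_def)
    qed
  next
    case (diff \<mu> \<nu>)
    then obtain a b where "pairing \<mu> \<alpha> = of_int (int p * a)" "pairing \<nu> \<alpha> = of_int (int p * b)" by blast
    moreover have "pairing (\<mu> - \<nu>) \<alpha> = pairing \<mu> \<alpha> - pairing \<nu> \<alpha>"
      by (simp add: pairing_def inner_diff_left right_diff_distrib diff_divide_distrib)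
    ultimately show ?case by (intro exI[of _ "a - b"]) (simp add: right_diff_distrib)
  qed
  obtain \<beta> where b: "\<beta> \<in> \<Phi>" "R.ip \<beta> \<alpha> = -1" using nonisolated[OF \<alpha>] by blast
  have "\<beta> \<in> weight_lattice \<Phi>" using R.int_\<Phi> b by (auto simp: weight_lattice_def)
  then obtain k where "pairing \<beta> \<alpha> = of_int (int p * k)" using * weights_generate by auto
  then have "of_int (int p * k) = (of_int (-1) :: real)" using R.pairing_ip[OF \<alpha>] b by simp
  then have "int p * k = -1" by (simp only: of_int_eq_iff)
  then have "int p dvd 1" by (metis dvd_minus_iff dvd_triv_left)
  then show False using p by (simp add: prime_nat_iff)
qed

sublocale lie_matrices \<Phi> R.ip N D
proof
  fix \<alpha> assume a: "\<alpha> \<in> \<Phi>"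
  have na: "- \<alpha> \<in> \<Phi>" by (rule uminus_root[OF a])
  show "scl (fact k) (D \<alpha> k) = D \<alpha> 1 ^ k" for k
    by (rule mint_inj) (simp only: mint_scl mint_power D_rep[OF a], simp add: dpow_def)
  have "rep (h \<alpha>) * rep (e \<alpha>) - rep (e \<alpha>) * rep (h \<alpha>) = scl 2 (rep (e \<alpha>))"
    unfolding rep_bracket[symmetric] h_e[OF a a] rep_scale by (simp add: ip_self[OF a])
  then have "rep (h \<alpha>) * rep (e \<alpha>) = rep (e \<alpha>) * rep (h \<alpha>) + scl 2 (rep (e \<alpha>))" by (simp add: algebra_simps)
  then have "rep (e \<alpha>) ^ CARD('n) = 0" by (rule raising_nilpotent)
  then show "D \<alpha> 1 ^ CARD('n) = 0" by (intro mint_inj) (simp only: mint_power D1_rep[OF a] mint_0)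
  show "\<exists>i j. \<not> int p dvd ent (D \<alpha> 1) i j" if "prime p" for p by (rule content[OF a that])
  fix \<beta> assume b: "\<beta> \<in> \<Phi>"
  show "D \<alpha> 1 * D \<beta> 1 = D \<beta> 1 * D \<alpha> 1" if "R.ip \<alpha> \<beta> \<ge> 0"
  proof -
    have "D \<alpha> 1 * D \<beta> 1 - D \<beta> 1 * D \<alpha> 1 = 0"
      by (rule mint_inj) (simp only: rep_bracket_D[OF a b] br_commute[OF a b that] rep_0 mint_0)
    then show ?thesis by simp
  qed
  show "D \<alpha> 1 * D \<beta> 1 = D \<beta> 1 * D \<alpha> 1 + scl (N \<alpha> \<beta>) (D (\<alpha> + \<beta>) 1)" if "R.ip \<alpha> \<beta> = -1"
  proof -
    have "D \<alpha> 1 * D \<beta> 1 - D \<beta> 1 * D \<alpha> 1 = scl (N \<alpha> \<beta>) (D (\<alpha> + \<beta>) 1)" by (rule mint_inj)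
        (simp only: rep_bracket_D[OF a b] br_N[OF a b that] mint_scl D1_rep[OF add_root[OF a b that]] rep_scale)
    then show ?thesis by (simp add: algebra_simps)
  qed
  let ?C = "D \<alpha> 1 * D (- \<alpha>) 1 - D (- \<alpha>) 1 * D \<alpha> 1"
  have "R.ip \<alpha> \<beta> = of_int \<lfloor>R.ip \<alpha> \<beta>\<rfloor>" using ip_vals[OF a b] by auto
  then have i: "complex_of_real (R.ip \<alpha> \<beta>) = of_int \<lfloor>R.ip \<alpha> \<beta>\<rfloor>" by (metis of_real_of_int_eq)
  have "?C * D \<beta> 1 - D \<beta> 1 * ?C = scl \<lfloor>R.ip \<alpha> \<beta>\<rfloor> (D \<beta> 1)"
  proof (rule mint_inj)
    have "mint (?C * D \<beta> 1 - D \<beta> 1 * ?C) = rep (br (h \<alpha>) (e \<beta>))"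
      unfolding mint_diff[of "?C * D \<beta> 1"] mint_mult[of ?C] mint_mult[of _ ?C] rep_bracket_D[OF a na] D1_rep[OF b]
      by (simp only: rep_bracket)
    then show "mint (?C * D \<beta> 1 - D \<beta> 1 * ?C) = (mint (scl \<lfloor>R.ip \<alpha> \<beta>\<rfloor> (D \<beta> 1)) :: (complex, 'n) sqm)"
      by (simp only: h_e[OF a b] rep_scale mint_scl D1_rep[OF b] i)
  qed
  then show "?C * D \<beta> 1 = D \<beta> 1 * ?C + scl \<lfloor>R.ip \<alpha> \<beta>\<rfloor> (D \<beta> 1)" by (simp add: algebra_simps)
qed

end

section \<open>Presented groups\<close>

fun weval :: "('x => 'g::group_add) => 'x group_word => 'g" where
  "weval f [] = 0"
| "weval f ((b, x) # w) = (if b then f x else - f x) + weval f w"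

lemma weval_append: "weval f (u @ v) = weval f u + weval f v"
  by (induction f u rule: weval.induct) (auto simp: add.assoc)

abbreviation word_inv :: "'x group_word => 'x group_word" where
  "word_inv w \<equiv> rev (map (\<lambda>(b, x). (\<not> b, x)) w)"

lemma weval_inv: "weval f (word_inv w) = - weval f w"
  by (induction f w rule: weval.induct) (auto simp: weval_append minus_add)

lemma weval_subgrp: "w \<in> lists (UNIV \<times> S) ==> weval f w \<in> subgrp (f ` S)"
  by (induction f w rule: weval.induct) (auto intro!: subgrp.zero subgrp.add subgrp.uminus intro: subgrp.gen)

lemma ex_weval:
  assumes "g \<in> subgrp (f ` S)" shows "\<exists>w\<in>lists (UNIV \<times> S). weval f w = g" using assms
proof induction
  case zero then show ?case by (intro bexI[of _ "[]"]) auto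
next
  case (gen g)
  then obtain x where "x \<in> S" "g = f x" by blast
  then show ?case by (intro bexI[of _ "[(True, x)]"]) auto
next
  case (add g h)
  then obtain u v where "u \<in> lists (UNIV \<times> S)" "v \<in> lists (UNIV \<times> S)" "weval f u = g" "weval f v = h" by blast
  then show ?case by (intro bexI[of _ "u @ v"]) (auto simp: weval_append)
next
  case (uminus g)
  then obtain u where "u \<in> lists (UNIV \<times> S)" "weval f u = g" by blast
  then show ?case by (intro bexI[of _ "word_inv u"]) (auto simp: weval_inv in_lists_conv_set)
qed

text \<open>A derivation uses finitely many relators, so it survives if each relator holds only
  eventually. This carries relations between functions over to their values at almost all
  pairs.\<close>

lemma word_equiv_eventually:
  assumes "(u, v) \<in> word_equiv S Rel" and "\<And>r. r \<in> Rel ==> eventually (\<lambda>z. weval (f z) r = 0) F"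
  shows "eventually (\<lambda>z. weval (f z) u = weval (f z) v) F" using assms(1)
proof induction
  case (sym v w) then show ?case by (auto elim: eventually_mono)
next
  case (trans u v w) from trans.IH show ?case by eventually_elim simp
next
  case (append u u' v v') from append.IH show ?case by eventually_elim (simp add: weval_append)
next
  case (relator r) then show ?case using assms(2) by simp
qed auto

lemma word_equiv_weval:
  assumes "(u, v) \<in> word_equiv S Rel" "\<And>r. r \<in> Rel ==> weval f r = 0"
  shows "weval f u = weval f v"
  using word_equiv_eventually[of u v S Rel "\<lambda>_ :: unit. f" "principal UNIV"] assms by simp

locale presentation =
  fixes S :: "'x set" and Rel :: "'x group_word set"
  assumes Rel: "r \<in> Rel ==> r \<in> lists (UNIV \<times> S)"
begin

abbreviation W where "W \<equiv> lists (UNIV \<times> S)"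
abbreviation eqv where "eqv \<equiv> word_equiv S Rel"
definition cls :: "'x group_word => 'x group_word set" where "cls w = eqv `` {w}"

lemma eqv_W: "(u, v) \<in> eqv ==> u \<in> W \<and> v \<in> W" by (induction rule: word_equiv.induct) (auto dest: Rel)

lemma equiv_eqv: "equiv W eqv"
  by (rule equivI) (auto intro!: refl_onI symI transI intro: word_equiv.refl word_equiv.sym word_equiv.trans dest: eqv_W)

lemma cls_eq: "u \<in> W ==> v \<in> W ==> cls u = cls v \<longleftrightarrow> (u, v) \<in> eqv"
  unfolding cls_def by (rule eq_equiv_class_iff[OF equiv_eqv])

lemma carrier_cls: "carrier (presented_group S Rel) = cls ` W"
  by (auto simp: presented_group_def quotient_def cls_def)

lemma mult_cls: assumes "u \<in> W" "v \<in> W" shows "cls u \<otimes>\<^bsub>presented_group S Rel\<^esub> cls v = cls (u @ v)"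
proof -
  have "cls (u' @ v') = cls (u @ v)" if "u' \<in> cls u" "v' \<in> cls v" for u' v'
  proof -
    have *: "(u, u') \<in> eqv" "(v, v') \<in> eqv" using that by (auto simp: cls_def)
    then have "(u @ v, u' @ v') \<in> eqv" by (rule word_equiv.append)
    then show ?thesis using eqv_W[OF *(1)] eqv_W[OF *(2)] by (simp add: cls_eq word_equiv.sym)
  qed
  moreover have "u \<in> cls u" "v \<in> cls v" using assms by (auto simp: cls_def intro: word_equiv.refl)
  ultimately have "(\<Union>u'\<in>cls u. \<Union>v'\<in>cls v. cls (u' @ v')) = cls (u @ v)" by blast
  then show ?thesis by (simp add: presented_group_def cls_def)
qed

lemma inv_eqv: "w \<in> W ==> (word_inv w @ w, []) \<in> eqv"
proof (induction w)
  case (Cons p w)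
  obtain b x where p: "p = (b, x)" "x \<in> S" using Cons by auto
  have w: "w \<in> W" "word_inv w \<in> W" using Cons by (auto simp: in_lists_conv_set)
  have "([(\<not> b, x), (b, x)], []) \<in> eqv" using word_equiv.cancel[OF p(2), of "\<not> b"] by simp
  from word_equiv.append[OF word_equiv.append[OF word_equiv.refl[OF w(2)] this] word_equiv.refl[OF w(1)]]
  have "(word_inv (p # w) @ (p # w), word_inv w @ w) \<in> eqv" by (simp add: p)
  then show ?case using Cons w by (auto intro: word_equiv.trans)
qed (auto intro: word_equiv.refl)

lemma inv_eqv': assumes "w \<in> W" shows "(w @ word_inv w, []) \<in> eqv"
proof -
  have "word_inv w \<in> W" using assms by (auto simp: in_lists_conv_set)
  then have "(word_inv (word_inv w) @ word_inv w, []) \<in> eqv" by (rule inv_eqv)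
  moreover have "word_inv (word_inv w) = w" by (simp add: rev_map case_prod_beta comp_def)
  ultimately show ?thesis by simp
qed

text \<open>The Cayley representation turns the group into a group of permutations of a type.\<close>

definition act :: "'x group_word => 'x group_word set sym" where
  "act w = Sym (\<lambda>C. if C \<in> cls ` W then cls w \<otimes>\<^bsub>presented_group S Rel\<^esub> C else C)"

lemma ap_act: assumes "w \<in> W" shows "ap (act w) C = (if C \<in> cls ` W then cls w \<otimes>\<^bsub>presented_group S Rel\<^esub> C else C)"
proof -
  have inv: "word_inv w \<in> W" using assms by (auto simp: in_lists_conv_set)
  have 1: "cls a \<otimes>\<^bsub>presented_group S Rel\<^esub> (cls b \<otimes>\<^bsub>presented_group S Rel\<^esub> C) = C" "cls b \<otimes>\<^bsub>presented_group S Rel\<^esub> C \<in> cls ` W"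
    if C: "C \<in> cls ` W" and ab: "a \<in> W" "b \<in> W" "(a @ b, []) \<in> eqv" for a b C
  proof -
    obtain v where v: "v \<in> W" "C = cls v" using C by blast
    show "cls b \<otimes>\<^bsub>presented_group S Rel\<^esub> C \<in> cls ` W" using v ab by (simp add: mult_cls)
    have "(a @ b @ v, v) \<in> eqv" using word_equiv.append[OF ab(3) word_equiv.refl[OF v(1)]] by simp
    then show "cls a \<otimes>\<^bsub>presented_group S Rel\<^esub> (cls b \<otimes>\<^bsub>presented_group S Rel\<^esub> C) = C"
      using v ab by (simp add: mult_cls cls_eq)
  qed
  define f where "f v C = (if C \<in> cls ` W then cls v \<otimes>\<^bsub>presented_group S Rel\<^esub> C else C)" for v C
  have "f a (f b C) = C" if "a \<in> W" "b \<in> W" "(a @ b, []) \<in> eqv" for a b C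
    using 1[OF _ that, of C] by (simp add: f_def)
  from this[OF assms inv inv_eqv'[OF assms]] this[OF inv assms inv_eqv[OF assms]]
  have "bij (f w)" by (intro o_bij[of "f (word_inv w)"]) (simp_all add: fun_eq_iff)
  then have "bij (\<lambda>C. if C \<in> cls ` W then cls w \<otimes>\<^bsub>presented_group S Rel\<^esub> C else C)" by (simp add: f_def[abs_def])
  then show ?thesis by (simp add: act_def ap_Sym)
qed

lemma act_append: assumes "u \<in> W" "v \<in> W" shows "act (u @ v) = act u + act v"
proof (rule sym_eqI)
  fix C
  have uv: "u @ v \<in> W" using assms by simp
  show "ap (act (u @ v)) C = ap (act u + act v) C"
  proof (cases "C \<in> cls ` W")
    case True
    then obtain w where w: "w \<in> W" "C = cls w" by blast
    have "v @ w \<in> W" using w assms by simp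
    then show ?thesis using w assms uv by (simp add: ap_act mult_cls del: append_in_lists_conv)
  next
    case False then show ?thesis using assms uv by (simp add: ap_act del: append_in_lists_conv)
  qed
qed

lemma act_eq: assumes "u \<in> W" "v \<in> W" shows "act u = act v \<longleftrightarrow> (u, v) \<in> eqv"
proof
  assume "act u = act v"
  then have "ap (act u) (cls []) = ap (act v) (cls [])" by simp
  then show "(u, v) \<in> eqv" using assms by (simp add: ap_act mult_cls cls_eq)
next
  assume "(u, v) \<in> eqv"
  then have "cls u = cls v" using assms by (simp add: cls_eq)
  then show "act u = act v" by (simp only: act_def)
qed

definition gn :: "'x => 'x group_word set sym" where "gn x = act [(True, x)]"

lemma act_Nil: "act [] = 0"
  using act_append[of "[]" "[]"] by (metis add.right_neutral add_left_imp_eq append_Nil lists.Nil)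

lemma weval_gn: "w \<in> W ==> weval gn w = act w"
proof (induction w)
  case (Cons p w)
  obtain b x where p: "p = (b, x)" "x \<in> S" using Cons by auto
  have "act [(True, x), (False, x)] = 0"
    using word_equiv.cancel[OF p(2), of True Rel] act_eq[of "[(True, x), (False, x)]" "[]"] p by (simp add: act_Nil)
  then have "gn x + act [(False, x)] = 0"
    using act_append[of "[(True, x)]" "[(False, x)]"] p by (simp add: gn_def)
  then have "act [(False, x)] = - gn x" by (metis add.inverse_unique)
  moreover have "act (p # w) = act [p] + act w" using act_append[of "[p]" w] Cons p by simp
  ultimately show ?case using Cons p by (cases b) (simp_all add: gn_def)
qed (simp add: act_Nil)

lemma weval_gn_eq: "u \<in> W ==> v \<in> W ==> weval gn u = weval gn v \<longleftrightarrow> (u, v) \<in> eqv"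
  by (simp add: weval_gn act_eq)

lemma gn_relator: "r \<in> Rel ==> weval gn r = 0"
  using weval_gn_eq[of r "[]"] Rel word_equiv.relator by simp

lemma gn_universal:
  assumes "\<And>r. r \<in> Rel ==> weval f r = 0"
  shows "\<exists>h. hom_on (subgrp (gn ` S)) h \<and> (\<forall>x\<in>S. h (gn x) = f x)"
proof -
  define h where "h g = weval f (SOME w. w \<in> W \<and> weval gn w = g)" for g
  have h: "h (weval gn w) = weval f w" if "w \<in> W" for w
  proof -
    define w' where "w' = (SOME w'. w' \<in> W \<and> weval gn w' = weval gn w)"
    have w': "w' \<in> W \<and> weval gn w' = weval gn w" 
      unfolding w'_def by (rule someI[of "\<lambda>v. v \<in> W \<and> weval gn v = weval gn w" w]) (use that in simp)
    then have "(w', w) \<in> eqv" using weval_gn_eq[of w' w] that by simp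
    then have "weval f w' = weval f w" by (rule word_equiv_weval) (rule assms)
    then show ?thesis by (simp add: h_def w'_def)
  qed
  have "h (a + b) = h a + h b" if ab: "a \<in> subgrp (gn ` S)" "b \<in> subgrp (gn ` S)" for a b
  proof -
    obtain u v where uv: "u \<in> W" "v \<in> W" "weval gn u = a" "weval gn v = b"
      using ex_weval[OF ab(1)] ex_weval[OF ab(2)] by blast
    have "h (weval gn (u @ v)) = weval f (u @ v)" by (rule h) (use uv in simp)
    then show ?thesis using h[OF uv(1)] h[OF uv(2)] uv by (simp add: weval_append)
  qed
  moreover have "h (gn x) = f x" if "x \<in> S" for x using h[of "[(True, x)]"] that by simp
  ultimately show ?thesis unfolding hom_on_def by blast
qed

end

context simply_laced
begin

text \<open>The last set of relators imposes the congruence modulo \<open>J\<close>: for an ideal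
  \<open>J\<close> the Steinberg group of the quotient is presented by elements of
  \<open>C\<close>.\<close>

definition steinberg_words :: "'c::comm_ring_1 set => 'c set => ('a \<times> 'c) group_word set" where
  "steinberg_words C J =
     {[(True, (\<alpha>, a)), (True, (\<alpha>, b)), (False, (\<alpha>, a + b))] | \<alpha> a b. \<alpha> \<in> \<Phi> \<and> a \<in> C \<and> b \<in> C} \<union>
     {commutator_word (\<alpha>, a) (\<beta>, b) | \<alpha> \<beta> a b. \<alpha> \<in> \<Phi> \<and> \<beta> \<in> \<Phi> \<and> ip \<alpha> \<beta> \<ge> 0 \<and> a \<in> C \<and> b \<in> C} \<union>
     {commutator_word (\<alpha>, a) (\<beta>, b) @ [(False, (\<alpha> + \<beta>, of_int (N \<alpha> \<beta>) * a * b))] | \<alpha> \<beta> a b.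
        \<alpha> \<in> \<Phi> \<and> \<beta> \<in> \<Phi> \<and> ip \<alpha> \<beta> = -1 \<and> a \<in> C \<and> b \<in> C} \<union>
     {[(True, (\<beta>, j))] | \<beta> j. \<beta> \<in> \<Phi> \<and> j \<in> J}"

lemma weval_steinberg_words:
  fixes f :: "'x => 'g::group_add"
  shows "weval f [(True, x), (True, x'), (False, x'')] = 0 \<longleftrightarrow> f x'' = f x + f x'"
  "weval f (commutator_word x x') = 0 \<longleftrightarrow> commutes (f x) (f x')"
  "weval f (commutator_word x x' @ [(False, x'')]) = 0 \<longleftrightarrow> f x + f x' = f x'' + f x' + f x"
proof -
  have *: "a + b = 0 \<longleftrightarrow> a = - b" for a b :: 'g by (metis add_eq_0_iff2 eq_neg_iff_add_eq_0)
  show "weval f [(True, x), (True, x'), (False, x'')] = 0 \<longleftrightarrow> f x'' = f x + f x'"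
    using eq_iff_diff_eq_0[of "f x + f x'" "f x''"] by (auto simp: add_diff_eq)
  have c: "weval f (commutator_word x x') = comm (f x) (f x')"
    by (simp add: commutator_word_def comm_def add_diff_eq)
  show "weval f (commutator_word x x') = 0 \<longleftrightarrow> commutes (f x) (f x')" by (simp only: c comm_zero_iff)
  show "weval f (commutator_word x x' @ [(False, x'')]) = 0 \<longleftrightarrow> f x + f x' = f x'' + f x' + f x"
    by (simp add: weval_append c comm_iff[symmetric] *)
qed

lemma steinberg_words_iff:
  "(\<forall>r\<in>steinberg_words C J. weval (\<lambda>(\<alpha>, a). x \<alpha> a) r = 0) \<longleftrightarrow>
     steinberg C x \<and> (\<forall>\<beta>\<in>\<Phi>. \<forall>j\<in>J. x \<beta> j = 0)" (is "(\<forall>r\<in>_. ?e r = 0) \<longleftrightarrow> _")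
proof -
  have *: "(\<forall>r\<in>{w x x' | x x'. P x x'}. Q r) \<longleftrightarrow> (\<forall>x x'. P x x' --> Q (w x x'))"
    "(\<forall>r\<in>{w3 x x' x'' | x x' x''. P3 x x' x''}. Q r) \<longleftrightarrow> (\<forall>x x' x''. P3 x x' x'' --> Q (w3 x x' x''))"
    "(\<forall>r\<in>{w4 x x' z z' | x x' z z'. P4 x x' z z'}. Q r) \<longleftrightarrow> (\<forall>x x' z z'. P4 x x' z z' --> Q (w4 x x' z z'))"
    for P P3 P4 Q w w3 w4 by blast+
  have "(\<forall>r\<in>steinberg_words C J. ?e r = 0) \<longleftrightarrow>
    (\<forall>\<alpha> a b. \<alpha> \<in> \<Phi> \<and> a \<in> C \<and> b \<in> C --> ?e [(True, (\<alpha>, a)), (True, (\<alpha>, b)), (False, (\<alpha>, a + b))] = 0) \<and>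
    (\<forall>\<alpha> \<beta> a b. \<alpha> \<in> \<Phi> \<and> \<beta> \<in> \<Phi> \<and> ip \<alpha> \<beta> \<ge> 0 \<and> a \<in> C \<and> b \<in> C --> ?e (commutator_word (\<alpha>, a) (\<beta>, b)) = 0) \<and>
    (\<forall>\<alpha> \<beta> a b. \<alpha> \<in> \<Phi> \<and> \<beta> \<in> \<Phi> \<and> ip \<alpha> \<beta> = -1 \<and> a \<in> C \<and> b \<in> C -->
       ?e (commutator_word (\<alpha>, a) (\<beta>, b) @ [(False, (\<alpha> + \<beta>, of_int (N \<alpha> \<beta>) * a * b))]) = 0) \<and>
    (\<forall>\<beta> j. \<beta> \<in> \<Phi> \<and> j \<in> J --> ?e [(True, (\<beta>, j))] = 0)"
    unfolding steinberg_words_def ball_Un * conj_assoc ..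
  also have "... \<longleftrightarrow> steinberg C x \<and> (\<forall>\<beta>\<in>\<Phi>. \<forall>j\<in>J. x \<beta> j = 0)" unfolding weval_steinberg_words steinberg_def
    by (simp only: case_prod_conv weval.simps if_True add_0_right) blast
  finally show ?thesis .
qed

end

section \<open>Germs of deeply divisible functions\<close>

locale subring_ideal =
  fixes P J :: "'q::comm_ring_1 set"
  assumes P_1: "1 \<in> P" and P_add: "p \<in> P ==> q \<in> P ==> p + q \<in> P"
    and P_mult: "p \<in> P ==> q \<in> P ==> p * q \<in> P" and P_uminus: "p \<in> P ==> - p \<in> P"
    and J_P: "j \<in> J ==> j \<in> P" and J_zero: "0 \<in> J"
    and J_plus: "j \<in> J ==> i \<in> J ==> j + i \<in> J" and PJ: "p \<in> P ==> j \<in> J ==> p * j \<in> J"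
begin

lemma P_0: "0 \<in> P" using J_P J_zero by blast

end

text \<open>\<open>S\<close> is meant as the complement of a maximal ideal of \<open>P\<close>;
  \<open>S_local\<close> is the form in which maximality makes the ring of fractions local.\<close>

locale localization = subring_ideal P J for P J :: "'q::field_char_0 set" +
  fixes S :: "'q set"
  assumes S_P: "s \<in> S ==> s \<in> P" and S_1: "1 \<in> S" and S_0: "0 \<notin> S"
    and S_mult: "s \<in> S ==> u \<in> S ==> s * u \<in> S"
    and S_local: "p \<in> P ==> p \<in> S \<or> (\<forall>u\<in>S. \<forall>q\<in>P. u + p * q \<in> S)"
begin

lemma S_power: "s \<in> S ==> s ^ k \<in> S" by (induction k) (auto intro: S_1 S_mult)

text \<open>\<open>F\<close> is the filter of pairs \<open>(s, k)\<close> for which \<open>s\<close> is highly divisible and \<open>k\<close> is large.\<close>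

definition dv :: "'q => 'q => bool" where "dv u s \<longleftrightarrow> (\<exists>v\<in>S. s = u * v)"

definition F :: "('q \<times> nat) filter" where
  "F = (INF (u, K)\<in>S \<times> UNIV. principal {(s, k). dv u s \<and> K \<le> k})"

lemma eventually_F: "eventually Q F \<longleftrightarrow> (\<exists>u\<in>S. \<exists>K. \<forall>s k. dv u s \<and> K \<le> k --> Q (s, k))"
proof -
  have "eventually Q F \<longleftrightarrow> (\<exists>b\<in>S \<times> UNIV. eventually Q (case b of (u, K) => principal {(s, k). dv u s \<and> K \<le> k}))"
    unfolding F_def
  proof (rule eventually_INF_base)
    show "S \<times> UNIV \<noteq> ({} :: ('q \<times> nat) set)" using S_1 by auto
    fix a b :: "'q \<times> nat" assume ab: "a \<in> S \<times> UNIV" "b \<in> S \<times> UNIV"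
    obtain u K u' K' where e: "a = (u, K)" "b = (u', K')" "u \<in> S" "u' \<in> S" using ab by auto
    have "dv u s \<and> dv u' s" if d: "dv (u * u') s" for s
    proof -
      obtain v where "v \<in> S" "s = u * (u' * v)" "s = u' * (u * v)" using d by (auto simp: dv_def mult_ac)
      then show ?thesis unfolding dv_def using S_mult e by blast
    qed
    then have *: "{(s, k). dv (u * u') s \<and> max K K' \<le> k} \<subseteq> {(s, k). dv u s \<and> K \<le> k} \<inter> {(s, k). dv u' s \<and> K' \<le> k}" by auto
    show "\<exists>x\<in>S \<times> UNIV. (case x of (u, K) => principal {(s, k). dv u s \<and> K \<le> k}) \<le>
      inf (case a of (u, K) => principal {(s, k). dv u s \<and> K \<le> k}) (case b of (u, K) => principal {(s, k). dv u s \<and> K \<le> k})"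
    proof (rule bexI[of _ "(u * u', max K K')"])
      show "(u * u', max K K') \<in> S \<times> UNIV" using e S_mult by simp
    qed (unfold e prod.case inf_principal principal_le_iff, rule *)
  qed
  then show ?thesis unfolding eventually_principal by (auto simp: eventually_principal) blast+
qed

lemma ev_dv: "u \<in> S ==> eventually (\<lambda>z. dv u (fst z)) F" unfolding eventually_F by auto

lemma ev_ge: "eventually (\<lambda>z. K \<le> snd z) F" unfolding eventually_F using S_1 by auto

lemma ev_S: "eventually (\<lambda>z. fst z \<in> S) F"
  using ev_dv[OF S_1] by (auto simp: dv_def elim: eventually_mono)

text \<open>The index j measures the loss of divisibility. Raising it by one halves the exponent,
  and of the two halves one is kept while the other can be spent.\<close>

definition dp :: "'q set => nat => ('q \<times> nat => 'q) => bool" where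
  "dp B j f \<longleftrightarrow> eventually (\<lambda>z. \<exists>p\<in>B. f z = fst z ^ 2 ^ (snd z - j) * p) F"

definition deep :: "'q set => ('q \<times> nat => 'q) set" where "deep B = {f. \<exists>j. dp B j f}"

lemma dp_mono:
  assumes B: "\<And>p b. p \<in> P ==> b \<in> B ==> p * b \<in> B" and f: "dp B j f" and j: "j \<le> j'"
  shows "dp B j' f" unfolding dp_def using f[unfolded dp_def] ev_S
proof eventually_elim
  case (elim z)
  then obtain p where p: "p \<in> B" "f z = fst z ^ 2 ^ (snd z - j) * p" by blast
  have "(2::nat) ^ (snd z - j') \<le> 2 ^ (snd z - j)" using j by (intro power_increasing) auto
  then obtain m where "(2::nat) ^ (snd z - j) = 2 ^ (snd z - j') + m" using le_Suc_ex by blast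
  then have "f z = fst z ^ 2 ^ (snd z - j') * (fst z ^ m * p)" using p by (simp add: power_add mult.assoc)
  then show ?case using B[OF S_P[OF S_power[OF elim(2), of m]] p(1)] by blast
qed

lemma dp_add:
  assumes B: "\<And>p b. p \<in> B ==> b \<in> B ==> p + b \<in> B" and f: "dp B j f" and g: "dp B j g"
  shows "dp B j (f + g)" unfolding dp_def using f[unfolded dp_def] g[unfolded dp_def]
  by eventually_elim (auto simp flip: distrib_left intro: B)

lemma dp_mult:
  assumes B: "\<And>p b. p \<in> P ==> b \<in> B ==> p * b \<in> B" and f: "dp P j f" and g: "dp B j g"
  shows "dp B j (f * g)" unfolding dp_def using f[unfolded dp_def] g[unfolded dp_def] ev_S
proof eventually_elim
  case (elim z)
  then obtain p b where p: "p \<in> P" "b \<in> B" "f z = fst z ^ 2 ^ (snd z - j) * p" "g z = fst z ^ 2 ^ (snd z - j) * b" by blast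
  then have "fst z ^ 2 ^ (snd z - j) * (p * b) \<in> B" using S_P[OF S_power[OF elim(3)]] by (intro B) auto
  then show ?case using p by (intro bexI[of _ "fst z ^ 2 ^ (snd z - j) * (p * b)"]) (simp_all add: mult_ac)
qed

text \<open>One half of the power of s is kept, and the other absorbs the denominator u, of which s
  is eventually a multiple.\<close>

lemma dp_scale:
  assumes D: "\<And>q p b. q \<in> P ==> p \<in> C ==> b \<in> B ==> q * (p * b) \<in> D" and f: "dp B j f"
    and a: "p \<in> C" "u \<in> S" "a = p / u"
  shows "dp D (Suc j) ((\<lambda>_. a) * f)"
  unfolding dp_def using f[unfolded dp_def] ev_dv[OF a(2)] ev_ge[of "Suc j"]
proof eventually_elim
  case (elim z)
  then obtain b v where b: "b \<in> B" "f z = fst z ^ 2 ^ (snd z - j) * b" and v: "v \<in> S" "fst z = u * v"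
    unfolding dv_def by blast
  have u: "u \<noteq> 0" using a S_0 by blast
  define m where "m = (2::nat) ^ (snd z - Suc j)"
  have "snd z - j = Suc (snd z - Suc j)" using elim by simp
  then have m: "(2::nat) ^ (snd z - j) = m + m" by (simp add: m_def)
  have "m > 0" by (simp add: m_def)
  then have "fst z ^ m = u * (v * fst z ^ (m - 1))" using v by (simp add: power_eq_if)
  then have "a * fst z ^ m = p * (v * fst z ^ (m - 1))" using u a by simp
  moreover have "a * f z = fst z ^ m * (a * fst z ^ m * b)" by (simp add: b m power_add mult_ac)
  ultimately have "a * f z = fst z ^ m * ((v * fst z ^ (m - 1)) * (p * b))" by (simp only: mult_ac)
  moreover have "fst z \<in> S" using v a(2) S_mult by simp
  then have "v * fst z ^ (m - 1) \<in> P" using v S_P S_power S_mult by blast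
  then have "(v * fst z ^ (m - 1)) * (p * b) \<in> D" by (rule D[OF _ a(1) b(1)])
  ultimately show ?case unfolding m_def by auto
qed

lemma dp_P: assumes "dp B j f" "\<And>p b. p \<in> P ==> b \<in> B ==> p * b \<in> B" shows "eventually (\<lambda>z. f z \<in> B) F"
  using assms(1)[unfolded dp_def] ev_S by eventually_elim (use assms(2) S_P S_power in auto)

lemma deep_P: "f \<in> deep P ==> eventually (\<lambda>z. f z \<in> P) F"
  and deep_J: "f \<in> deep J ==> eventually (\<lambda>z. f z \<in> J) F"
  unfolding deep_def using dp_P P_mult PJ by blast+

lemma deep_common:
  assumes B: "\<And>p b. p \<in> P ==> b \<in> B ==> p * b \<in> B" and X: "finite X" "X \<subseteq> deep B"
  shows "\<exists>j0. \<forall>j\<ge>j0. \<forall>f\<in>X. dp B j f" using X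
proof (induction X)
  case (insert f X)
  then obtain j0 j1 where "\<forall>j\<ge>j0. \<forall>f\<in>X. dp B j f" "dp B j1 f" by (auto simp: deep_def)
  then show ?case using dp_mono[OF B] by (intro exI[of _ "max j0 j1"]) auto
qed simp

text \<open>Every deeply divisible function is divisible by \<open>dd j\<close> for large \<open>j\<close>; this is what makes the
  ring of germs firm.\<close>

definition dd :: "nat => 'q \<times> nat => 'q" where
  "dd j z = (if fst z \<in> S then fst z ^ 2 ^ (snd z - Suc j) else 1)"

text \<open>As \<open>dd j\<close> has the value 1 at pairs outside \<open>S\<close>, this is an
  exact pointwise quotient everywhere.\<close>

definition qt :: "nat => ('q \<times> nat => 'q) => 'q \<times> nat => 'q" where "qt j f z = f z / dd j z"

lemma dd_nz: "dd j z \<noteq> 0" using S_0 by (auto simp: dd_def)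

lemma dd_qt: "f = dd j * qt j f" by (simp add: fun_eq_iff qt_def dd_nz)

lemma dd_deep: "dd j \<in> deep P"
proof -
  have "dp P (Suc j) (dd j)" unfolding dp_def using ev_S
    by eventually_elim (use P_1 in \<open>auto simp: dd_def intro!: bexI[of _ 1]\<close>)
  then show ?thesis by (auto simp: deep_def)
qed

lemma qt_deep: assumes f: "dp B j f" shows "qt j f \<in> deep B"
proof -
  have "dp B (Suc j) (qt j f)" unfolding dp_def using f[unfolded dp_def] ev_S ev_ge[of "Suc j"]
  proof eventually_elim
    case (elim z)
    then obtain p where p: "p \<in> B" "f z = fst z ^ 2 ^ (snd z - j) * p" by blast
    define m where "m = (2::nat) ^ (snd z - Suc j)"
    have "snd z - j = Suc (snd z - Suc j)" using elim by simp
    then have m: "(2::nat) ^ (snd z - j) = m + m" by (simp add: m_def)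
    have "fst z \<noteq> 0" using elim S_0 by metis
    then have "qt j f z = fst z ^ m * p" using elim p by (simp add: qt_def dd_def m power_add flip: m_def)
    then show ?case using p unfolding m_def by blast
  qed
  then show ?thesis by (auto simp: deep_def)
qed

definition A :: "'q set" where "A = {p / u |p u. p \<in> P \<and> u \<in> S}"
text \<open>Fractions become constant functions, so that \<open>A\<close> and \<open>I\<close> sit
  inside one ring.\<close>

definition Ac :: "('q \<times> nat => 'q) set" where "Ac = (\<lambda>a _. a) ` A"

lemma A_I: "p \<in> P ==> u \<in> S ==> p / u \<in> A" by (auto simp: A_def)
lemma P_A: "p \<in> P ==> p \<in> A" using A_I[OF _ S_1] by simp

lemma A_E: assumes "a \<in> A" obtains p u where "p \<in> P" "u \<in> S" "u \<noteq> 0" "a = p / u"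
  using assms S_0 by (auto simp: A_def)

lemma A_closed:
  assumes a: "a \<in> A" "b \<in> A" shows "a + b \<in> A" "a * b \<in> A" "- a \<in> A"
proof -
  obtain p u q v where e: "p \<in> P" "u \<in> S" "u \<noteq> 0" "a = p / u" "q \<in> P" "v \<in> S" "v \<noteq> 0" "b = q / v"
    using a by (auto elim!: A_E)
  have "a + b = (p * v + u * q) / (u * v)" using e by (simp add: field_simps)
  moreover have "p * v + u * q \<in> P" using e P_add P_mult S_P by blast
  ultimately show "a + b \<in> A" using A_I S_mult e by metis
  have "a * b = (p * q) / (u * v)" using e by simp
  then show "a * b \<in> A" using A_I[OF P_mult S_mult] e by simp
  have "- a = (- p) / u" using e by simp
  then show "- a \<in> A" using A_I P_uminus e by metis
qed

lemma A_local: assumes "a \<in> A" shows "(\<exists>u\<in>A. a * u = 1) \<or> (\<forall>b\<in>A. \<exists>u\<in>A. (1 + a * b) * u = 1)"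
proof -
  obtain p u where e: "p \<in> P" "u \<in> S" "u \<noteq> 0" "a = p / u" using assms by (rule A_E)
  show ?thesis
  proof (cases "p \<in> S")
    case True
    then have "p \<noteq> 0" using S_0 by blast
    then show ?thesis using e A_I[OF S_P[OF e(2)] True] by (intro disjI1 bexI[of _ "u / p"]) simp_all
  next
    case False
    show ?thesis
    proof (intro disjI2 ballI)
      fix b assume "b \<in> A"
      then obtain q v where f: "q \<in> P" "v \<in> S" "v \<noteq> 0" "b = q / v" by (rule A_E)
      have s: "u * v + p * q \<in> S" using S_local[OF e(1)] False S_mult[OF e(2) f(2)] f(1) by blast
      then have "u * v + p * q \<noteq> 0" using S_0 by metis
      then have "(1 + a * b) * (u * v / (u * v + p * q)) = 1" using e f by (simp add: field_simps)
      then show "\<exists>w\<in>A. (1 + a * b) * w = 1" using A_I[OF S_P[OF S_mult[OF e(2) f(2)]] s] by blast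
    qed
  qed
qed

lemma Ac_I: "a \<in> A ==> (\<lambda>_. a) \<in> Ac" by (simp add: Ac_def)

lemma Ac_closed:
  assumes "a \<in> Ac" "b \<in> Ac" shows "a + b \<in> Ac" "a * b \<in> Ac" "- a \<in> Ac"
proof -
  obtain c d where "c \<in> A" "a = (\<lambda>_. c)" "d \<in> A" "b = (\<lambda>_. d)" using assms by (auto simp: Ac_def)
  then have "a + b = (\<lambda>_. c + d)" "a * b = (\<lambda>_. c * d)" "- a = (\<lambda>_. - c)" "c + d \<in> A" "c * d \<in> A" "- c \<in> A"
    using A_closed by (auto simp: fun_eq_iff)
  then show "a + b \<in> Ac" "a * b \<in> Ac" "- a \<in> Ac" by (simp_all only: Ac_I)
qed

lemma Ac_1: "1 \<in> Ac" using Ac_I[OF P_A[OF P_1]] by (simp add: one_fun_def)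

lemma Ac_local: assumes "a \<in> Ac" shows "(\<exists>u\<in>Ac. a * u = 1) \<or> (\<forall>b\<in>Ac. \<exists>u\<in>Ac. (1 + a * b) * u = 1)"
proof -
  obtain c where c: "c \<in> A" "a = (\<lambda>_. c)" using assms by (auto simp: Ac_def)
  have 1: "\<exists>u\<in>Ac. a * u = 1" if "u \<in> A" "c * u = 1" for u
    using that c by (intro bexI[of _ "\<lambda>_. u"]) (auto simp: fun_eq_iff intro: Ac_I)
  have 2: "\<exists>u\<in>Ac. (1 + a * b) * u = 1" if A: "\<forall>b\<in>A. \<exists>u\<in>A. (1 + c * b) * u = 1" and b: "b \<in> Ac" for b
  proof -
    obtain d where d: "d \<in> A" "b = (\<lambda>_. d)" using b by (auto simp: Ac_def)
    then obtain u where "u \<in> A" "(1 + c * d) * u = 1" using A by blast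
    then show ?thesis using c d by (intro bexI[of _ "\<lambda>_. u"]) (auto simp: fun_eq_iff intro: Ac_I)
  qed
  show ?thesis using A_local[OF c(1)] 1 2 by blast
qed

lemma deep_scale:
  assumes "a \<in> Ac" "f \<in> deep B" "\<And>p b. p \<in> P ==> b \<in> B ==> p * b \<in> B"
  shows "a * f \<in> deep B"
proof -
  obtain p u j where "p \<in> P" "u \<in> S" "a = (\<lambda>_. p / u)" "dp B j f" using assms by (auto simp: Ac_def deep_def A_def)
  then show ?thesis using dp_scale[of P B B j f p u "p / u"] assms(3) by (auto simp: deep_def)
qed

lemma deep_closed:
  assumes B: "\<And>p b. p \<in> P ==> b \<in> B ==> p * b \<in> B" "\<And>p b. p \<in> B ==> b \<in> B ==> p + b \<in> B"
  shows "f \<in> deep B ==> g \<in> deep B ==> f + g \<in> deep B" "f \<in> deep P ==> g \<in> deep B ==> f * g \<in> deep B"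
proof -
  assume fg: "f \<in> deep B" "g \<in> deep B"
  then obtain j0 where "\<forall>j\<ge>j0. \<forall>f\<in>{f, g}. dp B j f" using deep_common[of B "{f, g}"] B by auto
  then have "dp B j0 f" "dp B j0 g" by auto
  then show "f + g \<in> deep B" using dp_add[OF B(2)] by (auto simp: deep_def)
next
  assume f: "f \<in> deep P" and g: "g \<in> deep B"
  obtain j0 where j0: "\<forall>j\<ge>j0. dp P j f" using deep_common[of P "{f}"] f P_mult by auto
  obtain j1 where j1: "\<forall>j\<ge>j1. dp B j g" using deep_common[of B "{g}"] g B by auto
  have "dp B (max j0 j1) (f * g)" by (rule dp_mult[OF B(1)]) (use j0 j1 in auto)
  then show "f * g \<in> deep B" by (auto simp: deep_def)
qed

sublocale firm_ideal Ac "deep P" "deep J"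
proof
  fix f g assume fg: "f \<in> deep P" "g \<in> deep P"
  obtain j where "\<forall>f\<in>{f, g}. dp P j f" using deep_common[of P "{f, g}"] fg P_mult by auto
  then have "qt j f \<in> deep P" "qt j g \<in> deep P" by (auto intro: qt_deep)
  then show "\<exists>d\<in>deep P. \<exists>f'\<in>deep P. \<exists>g'\<in>deep P. f = d * f' \<and> g = d * g'" using dd_deep dd_qt by blast
next
  fix b c b' c' assume d: "b \<in> deep P" "c \<in> deep P" "b' \<in> deep P" "c' \<in> deep P" "b * c - b' * c' \<in> deep J"
  obtain j0 where j0: "\<forall>j\<ge>j0. \<forall>f\<in>{b, c, b', c'}. dp P j f" using deep_common[of P "{b, c, b', c'}"] d P_mult by auto
  obtain j1 where j1: "\<forall>j\<ge>j1. dp J j (b * c - b' * c')" using deep_common[of J "{b * c - b' * c'}"] d PJ by auto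
  define j where "j = max j0 j1"
  have q: "qt j b \<in> deep P" "qt j c \<in> deep P" "qt j b' \<in> deep P" "qt j c' \<in> deep P"
    "qt j (b * c - b' * c') \<in> deep J" using j0 j1 by (auto simp: j_def intro!: qt_deep)
  \<comment> \<open>A single division by \<open>dd j\<close> leaves one of the two common factors in
    place, as \<open>firm\<close> demands.\<close>
  have "qt j (b * c - b' * c') = dd j * qt j b * qt j c - dd j * qt j b' * qt j c'"
    by (simp add: fun_eq_iff qt_def dd_nz diff_divide_distrib)
  then have "dd j * qt j b * qt j c - dd j * qt j b' * qt j c' \<in> deep J" using q(5) by simp
  then show "\<exists>d\<in>deep P. \<exists>b1\<in>deep P. \<exists>c1\<in>deep P. \<exists>b1'\<in>deep P. \<exists>c1'\<in>deep P.
      b = d * b1 \<and> c = d * c1 \<and> b' = d * b1' \<and> c' = d * c1' \<and> d * b1 * c1 - d * b1' * c1' \<in> deep J"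
    using dd_deep[of j] dd_qt[of _ j] q(1-4) by blast
next
  have "dp J 0 0" unfolding dp_def using J_zero by (auto simp: zero_fun_def intro!: always_eventually)
  then show "0 \<in> deep J" by (auto simp: deep_def)
next
  fix f assume "f \<in> deep J"
  then obtain j where "dp J j f" by (auto simp: deep_def)
  then have "dp P j f" unfolding dp_def by (rule eventually_mono) (use J_P in blast)
  then show "f \<in> deep P" by (auto simp: deep_def)
next
  show "1 \<in> Ac" by (rule Ac_1)
  fix f g assume fg: "f \<in> Ac" "g \<in> Ac"
  then show "f + g \<in> Ac" "f * g \<in> Ac" "- f \<in> Ac" by (rule Ac_closed)+
next
  fix f g assume f: "f \<in> deep P"
  show "f + g \<in> deep P" "f * g \<in> deep P" if "g \<in> deep P" using deep_closed[of P f g] P_mult P_add f that by auto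
  show "f * g \<in> deep J" if "g \<in> deep J" using deep_closed(2)[of J f g] PJ J_plus f that by auto
next
  fix f g assume "f \<in> deep J" "g \<in> deep J"
  then show "f + g \<in> deep J" using deep_closed(1)[of J f g] PJ J_plus by auto
next
  fix f g assume "f \<in> Ac"
  then show "g \<in> deep P ==> f * g \<in> deep P" "g \<in> deep J ==> f * g \<in> deep J"
    using deep_scale[of f g P] deep_scale[of f g J] P_mult PJ by auto
qed

end

section \<open>The local argument\<close>

text \<open>\<open>X\<close> will be the family of generators of the given Steinberg group, with
  coefficients taken in \<open>P\<close> and mapped to the base ring.\<close>

locale localized_steinberg = lie_matrices \<Phi> ip N D + localization P J S
  for \<Phi> :: "'a::ab_group_add set" and ip N and D :: "'a => nat => (int, 'n::finite) sqm"
    and P J S :: "'q::field_char_0 set" +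
  fixes X :: "'a => 'q => 'g::group_add" and ht :: "'a => real"
  assumes X_steinberg: "steinberg P X" and X_J: "\<beta> \<in> \<Phi> ==> j \<in> J ==> X \<beta> j = 0"
    and height: "height ht"
begin

abbreviation I where "I \<equiv> deep P"
abbreviation JI where "JI \<equiv> deep J"

sublocale G: presentation "\<Phi> \<times> I" "steinberg_words I JI"
proof
  fix r assume "r \<in> steinberg_words I JI"
  moreover have "of_int k * a * b \<in> I" if "a \<in> I" "b \<in> I" for k a b by (intro I_mult AI A_int that)
  ultimately show "r \<in> lists (UNIV \<times> (\<Phi> \<times> I))"
    unfolding steinberg_words_def commutator_word_def by (auto intro: closed add_root J_I)
qed

definition y :: "'a => ('q \<times> nat => 'q) => ('a \<times> ('q \<times> nat => 'q)) group_word set sym" where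
  "y \<beta> f = G.gn (\<beta>, f)"

lemma gn_y: "(\<lambda>(\<beta>, f). y \<beta> f) = G.gn" by (simp add: y_def fun_eq_iff)

lemma gn_image: "G.gn ` (\<Phi> \<times> I) = {y \<beta> f |\<beta> f. \<beta> \<in> \<Phi> \<and> f \<in> I}" by (auto simp: y_def)

sublocale U: universal_steinberg \<Phi> ip N Ac I JI y
proof
  have "\<forall>r\<in>steinberg_words I JI. weval (\<lambda>(\<beta>, f). y \<beta> f) r = 0" unfolding gn_y using G.gn_relator by blast
  then have *: "steinberg I y \<and> (\<forall>\<beta>\<in>\<Phi>. \<forall>j\<in>JI. y \<beta> j = 0)" by (rule steinberg_words_iff[THEN iffD1])
  then show "steinberg I y" "\<And>\<beta> j. \<beta> \<in> \<Phi> ==> j \<in> JI ==> y \<beta> j = 0" by blast+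
  fix y' assume "steinberg I y'" "\<And>\<beta> j. \<beta> \<in> \<Phi> ==> j \<in> JI ==> y' \<beta> j = 0"
  then have "\<forall>r\<in>steinberg_words I JI. weval (\<lambda>(\<beta>, f). y' \<beta> f) r = 0" unfolding steinberg_words_iff by blast
  then obtain h where "hom_on (subgrp (G.gn ` (\<Phi> \<times> I))) h" "\<forall>x\<in>\<Phi> \<times> I. h (G.gn x) = (\<lambda>(\<beta>, f). y' \<beta> f) x"
    using G.gn_universal by blast
  then show "\<exists>h. hom_on (subgrp {y \<beta> i |\<beta> i. \<beta> \<in> \<Phi> \<and> i \<in> I}) h \<and> (\<forall>\<beta>\<in>\<Phi>. \<forall>i\<in>I. h (y \<beta> i) = y' \<beta> i)"
    unfolding gn_image by (intro exI[of _ h] conjI) (auto simp: y_def)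
qed

definition K :: "'q set" where "K = {j / u |j u. j \<in> J \<and> u \<in> S}"

lemma K_closed:
  assumes "a \<in> K" shows "b \<in> K ==> a + b \<in> K" "b \<in> A ==> b * a \<in> K" "a \<in> A"
proof -
  obtain j u where a: "j \<in> J" "u \<in> S" "u \<noteq> 0" "a = j / u" using assms S_0 by (auto simp: K_def)
  show "a + b \<in> K" if bK: "b \<in> K"
  proof -
    obtain i v where b: "i \<in> J" "v \<in> S" "v \<noteq> 0" "b = i / v" using bK S_0 by (auto simp: K_def)
    have "a + b = (v * j + u * i) / (u * v)" using a b by (simp add: field_simps)
    moreover have "v * j + u * i \<in> J" using a b by (intro J_plus PJ S_P)
    moreover have "u * v \<in> S" using a b by (intro S_mult)
    ultimately show ?thesis unfolding K_def by (intro CollectI exI conjI)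
  qed
  show "b * a \<in> K" if bA: "b \<in> A"
  proof -
    obtain p v where b: "p \<in> P" "v \<in> S" "v \<noteq> 0" "b = p / v" using bA S_0 by (auto simp: A_def)
    have "b * a = (p * j) / (v * u)" using a b by simp
    moreover have "p * j \<in> J" "v * u \<in> S" using a b by (auto intro: PJ S_mult)
    ultimately show ?thesis unfolding K_def by (intro CollectI exI conjI)
  qed
  show "a \<in> A" unfolding a by (rule A_I[OF J_P[OF a(1)] a(2)])
qed

text \<open>The denominator is absorbed by \<open>I\<close> and the numerator, which lies in
  \<open>J\<close>, remains. As a is constant, its value at (1, 0) represents it.\<close>

lemma K_deep: assumes "a \<in> Ac" "a (1, 0) \<in> K" "f \<in> I" shows "a * f \<in> JI"
proof -
  obtain j u where a: "j \<in> J" "u \<in> S" "a = (\<lambda>_. j / u)" using assms by (auto simp: Ac_def K_def)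
  obtain j0 where "dp P j0 f" using assms by (auto simp: deep_def)
  have "dp J (Suc j0) ((\<lambda>_. j / u) * f)"
  proof (rule dp_scale[OF _ \<open>dp P j0 f\<close> a(1,2) HOL.refl])
    fix q p b assume "q \<in> P" "p \<in> J" "b \<in> P"
    then have "(q * b) * p \<in> J" by (intro PJ P_mult)
    then show "q * (p * b) \<in> J" by (simp add: mult_ac)
  qed
  then show ?thesis using a by (auto simp: deep_def)
qed

lemma tr_0: "U.tr 0 = 0" using U.tr_add[OF U.Y_0 U.Y_0] by (metis add.right_neutral add_left_imp_eq)

lemma tr_subgrp: "a \<in> U.Y ==> U.tr a \<in> subgrp {U.tr (y \<beta> i) |\<beta> i. \<beta> \<in> \<Phi> \<and> i \<in> I}"
proof -
  assume "a \<in> U.Y"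
  then have "a \<in> subgrp {y \<beta> i |\<beta> i. \<beta> \<in> \<Phi> \<and> i \<in> I}" by (simp add: U.Y_def)
  then have "a \<in> U.Y \<and> U.tr a \<in> subgrp {U.tr (y \<beta> i) |\<beta> i. \<beta> \<in> \<Phi> \<and> i \<in> I}"
  proof induction
    case (uminus a)
    then have "U.tr a + U.tr (- a) = 0" using U.tr_add[of a "- a"] U.Y_uminus[of a] tr_0 by simp
    then have "U.tr (- a) = - U.tr a" by (rule minus_unique[symmetric])
    then show ?case using uminus by (auto intro: subgrp.uminus U.Y_uminus)
  qed (auto simp: U.tr_add tr_0 intro: subgrp.intros U.Y_0 U.Y_add U.y_Y)
  then show ?thesis by blast
qed

text \<open>Evaluation at (1, 0) reads off the fraction behind a constant function; any other pair
  would give the same.\<close>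

sublocale L: local_step \<Phi> ip N D A K Ac I "\<lambda>f. f (1, 0)" U.\<theta> "\<lambda>\<beta> i. U.tr (y \<beta> i)" ht
proof
  show "1 \<in> A" by (rule P_A[OF P_1])
  fix a b assume "a \<in> A" "b \<in> A" then show "a + b \<in> A" "a * b \<in> A" "- a \<in> A" by (rule A_closed)+
next
  show "0 \<in> K" using J_zero S_1 unfolding K_def by (intro CollectI exI[of _ 0] exI[of _ 1]) simp
  fix a b assume aK: "a \<in> K"
  show "a \<in> A" by (rule K_closed(3)[OF aK])
  show "b \<in> K ==> a + b \<in> K" by (rule K_closed(1)[OF aK])
  show "b \<in> A ==> b * a \<in> K" by (rule K_closed(2)[OF aK])
next
  fix a assume "a \<in> Ac"
  then show "a (1, 0) \<in> A" by (auto simp: Ac_def)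
  show "(\<exists>u\<in>Ac. a * u = 1) \<or> (\<forall>b\<in>Ac. \<exists>u\<in>Ac. (1 + a * b) * u = 1)" by (rule Ac_local) fact
next
  show "module_family Ac U.\<theta> Ac U.\<theta>" using U.\<theta>_steinberg by (simp add: steinberg_module)
  show "module_family Ac U.\<theta> I (\<lambda>\<beta> i. U.tr (y \<beta> i))" by (rule U.tr_module)
next
  fix \<beta> \<gamma> i j assume "\<beta> \<in> \<Phi>" "\<gamma> \<in> \<Phi>" "ip \<beta> \<gamma> \<ge> 0" "i \<in> I" "j \<in> I"
  then show "commutes (U.tr (y \<beta> i)) (U.tr (y \<gamma> j))"
    using U.y_commutes[of \<beta> \<gamma> i j] by (simp flip: U.tr_add add: U.y_Y)
next
  fix \<beta> a assume *: "\<beta> \<in> \<Phi>" "a \<in> Ac" "a (1, 0) \<in> K"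
  then show "U.\<theta> \<beta> a = 0" using K_deep by (intro U.\<theta>_J) auto
  fix i assume "i \<in> I"
  then show "U.tr (y \<beta> (a * i)) = 0" using * K_deep U.y_J by (simp add: tr_0)
next
  fix \<alpha> a \<beta> i assume *: "\<alpha> \<in> \<Phi>" "a \<in> Ac" "\<beta> \<in> \<Phi>" "i \<in> I"
  then have "cjg (U.\<theta> \<alpha> a) (U.tr (y \<beta> i)) = U.tr (U.cj \<alpha> a (y \<beta> i))" by (intro conj_eqI U.\<theta>_tr U.y_Y)
  then show "cjg (U.\<theta> \<alpha> a) (U.tr (y \<beta> i)) \<in> subgrp {U.tr (y \<beta> i) |\<beta> i. \<beta> \<in> \<Phi> \<and> i \<in> I}"
    using tr_subgrp[OF U.cj_Y[OF *(1,2) U.y_Y[OF *(3,4)]]] by simp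
qed (use height in \<open>auto simp: Ac_1 Ac_closed closed\<close>)

definition act :: "('a \<times> 'q) list => ('a \<times> ('q \<times> nat => 'q)) group_word set sym sym" where
  "act ws = sum_list (map (\<lambda>(\<alpha>, p). U.\<theta> \<alpha> (\<lambda>_. p)) ws)"

lemma cst_P: "p \<in> P ==> (\<lambda>_. p) \<in> Ac" by (intro Ac_I P_A)

lemma act_fixes:
  assumes ws: "set ws \<subseteq> \<Phi> \<times> P" "\<And>i j. ent (prod_list (map (\<lambda>(\<alpha>, p). T \<alpha> p) ws) - 1) i j \<in> J"
    and b: "\<beta> \<in> \<Phi>" "f \<in> I"
  shows "cjg (act ws) (U.tr (y \<beta> f)) = U.tr (y \<beta> f)"
proof -
  define g where "g = sum_list (map (\<lambda>(\<alpha>, p). L.x \<alpha> (\<lambda>_. p)) ws)"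
  have *: "g \<in> L.L.Egrp \<and> fst g = act ws \<and> val (snd g) = prod_list (map (\<lambda>(\<alpha>, p). T \<alpha> p) ws)"
    using ws(1) unfolding g_def act_def L.L.Egrp_def
  proof (induction ws)
    case (Cons w ws)
    obtain \<alpha> p where w: "w = (\<alpha>, p)" "\<alpha> \<in> \<Phi>" "p \<in> P" using Cons(2) by (cases w) auto
    have "L.x \<alpha> (\<lambda>_. p) \<in> subgrp {L.x \<beta> a |\<beta> a. \<beta> \<in> \<Phi> \<and> a \<in> Ac}"
      using w cst_P by (intro subgrp.gen) blast
    then show ?case using Cons w by (auto simp: L.val_t intro: subgrp.add)
  qed (auto intro: subgrp.zero)
  have "j \<in> J ==> j \<in> K" for j unfolding K_def using S_1 by (intro CollectI exI[of _ j] exI[of _ 1]) simp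
  then have "L.entK (val (snd g) - 1)" using * ws(2) by (simp add: L.entK_def)
  then show ?thesis using L.kernel_acts_trivially[of g] * b by simp
qed

section \<open>Germs of elements of the Steinberg group of \<open>I\<close>\<close>

definition gv :: "('a \<times> ('q \<times> nat => 'q)) group_word => 'q \<times> nat => 'g" where
  "gv u x = weval (\<lambda>(\<beta>, f). X \<beta> (f x)) u"

lemma relator_germ: assumes "r \<in> steinberg_words I JI" shows "eventually (\<lambda>x. gv r x = 0) F"
proof -
  consider \<alpha> a b where "r = [(True, (\<alpha>, a)), (True, (\<alpha>, b)), (False, (\<alpha>, a + b))]" "\<alpha> \<in> \<Phi>" "a \<in> I" "b \<in> I"
    | \<alpha> \<beta> a b where "r = commutator_word (\<alpha>, a) (\<beta>, b)" "\<alpha> \<in> \<Phi>" "\<beta> \<in> \<Phi>" "ip \<alpha> \<beta> \<ge> 0" "a \<in> I" "b \<in> I"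
    | \<alpha> \<beta> a b where "r = commutator_word (\<alpha>, a) (\<beta>, b) @ [(False, (\<alpha> + \<beta>, of_int (N \<alpha> \<beta>) * a * b))]"
      "\<alpha> \<in> \<Phi>" "\<beta> \<in> \<Phi>" "ip \<alpha> \<beta> = -1" "a \<in> I" "b \<in> I"
    | \<beta> j where "r = [(True, (\<beta>, j))]" "\<beta> \<in> \<Phi>" "j \<in> JI"
    using assms unfolding steinberg_words_def by blast
  then show ?thesis
  proof cases
    case 1
    from deep_P[OF 1(3)] deep_P[OF 1(4)] show ?thesis unfolding gv_def 1 weval_steinberg_words
      by eventually_elim (use X_steinberg 1 in \<open>simp add: steinberg_def\<close>)
  next
    case 2
    from deep_P[OF 2(5)] deep_P[OF 2(6)] show ?thesis unfolding gv_def 2 weval_steinberg_words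
      by eventually_elim (use X_steinberg 2 in \<open>auto simp: steinberg_def\<close>)
  next
    case 3
    have i: "(of_int k :: 'q \<times> nat => 'q) x = of_int k" for k x
      by (cases k) (simp_all add: of_nat_fun del: of_nat_Suc)
    from deep_P[OF 3(5)] deep_P[OF 3(6)] show ?thesis unfolding gv_def 3 weval_steinberg_words
      by eventually_elim (use X_steinberg 3 in \<open>simp add: steinberg_def i\<close>)
  next
    case 4
    from deep_J[OF 4(3)] show ?thesis unfolding gv_def 4 by eventually_elim (use X_J 4 in simp)
  qed
qed

text \<open>A relation between elements of the abstract group and functions into the given group,
  the latter determined only up to eventual equality.\<close>

definition germ :: "('a \<times> ('q \<times> nat => 'q)) group_word set sym => ('q \<times> nat => 'g) => bool" where
  "germ a h \<longleftrightarrow> (\<exists>u\<in>lists (UNIV \<times> (\<Phi> \<times> I)). a = weval G.gn u \<and> eventually (\<lambda>x. h x = gv u x) F)"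

text \<open>Two words for the same element are linked by a derivation from relators, and each
  relator holds eventually for the values of \<open>X\<close>.\<close>

lemma germ_unique: assumes "germ a h" "germ a h'" shows "eventually (\<lambda>x. h x = h' x) F"
proof -
  obtain u v where u: "u \<in> lists (UNIV \<times> (\<Phi> \<times> I))" "a = weval G.gn u" "eventually (\<lambda>x. h x = gv u x) F"
    and v: "v \<in> lists (UNIV \<times> (\<Phi> \<times> I))" "a = weval G.gn v" "eventually (\<lambda>x. h' x = gv v x) F"
    using assms unfolding germ_def by blast
  have "(u, v) \<in> word_equiv (\<Phi> \<times> I) (steinberg_words I JI)"
    using G.weval_gn_eq[OF u(1) v(1)] u(2) v(2) by simp
  then have "eventually (\<lambda>x. gv u x = gv v x) F"
    unfolding gv_def by (rule word_equiv_eventually) (rule relator_germ[unfolded gv_def])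
  with u(3) v(3) show ?thesis by eventually_elim simp
qed

lemma germ_eventually: assumes "germ a h" "eventually (\<lambda>x. h' x = h x) F" shows "germ a h'"
proof -
  obtain u where u: "u \<in> lists (UNIV \<times> (\<Phi> \<times> I))" "a = weval G.gn u" "eventually (\<lambda>x. h x = gv u x) F"
    using assms(1) unfolding germ_def by blast
  from u(3) assms(2) have "eventually (\<lambda>x. h' x = gv u x) F" by eventually_elim simp
  then show ?thesis unfolding germ_def using u by blast
qed

lemma germ_gen: "\<beta> \<in> \<Phi> ==> f \<in> I ==> germ (y \<beta> f) (\<lambda>x. X \<beta> (f x))"
  unfolding germ_def by (intro bexI[of _ "[(True, (\<beta>, f))]"]) (auto simp: gv_def y_def)

lemma germ_0: "germ 0 (\<lambda>_. 0)" unfolding germ_def by (intro bexI[of _ "[]"]) (auto simp: gv_def)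

lemma germ_add: assumes "germ a h" "germ b k" shows "germ (a + b) (\<lambda>x. h x + k x)"
proof -
  obtain u v where u: "u \<in> lists (UNIV \<times> (\<Phi> \<times> I))" "a = weval G.gn u" "eventually (\<lambda>x. h x = gv u x) F"
    and v: "v \<in> lists (UNIV \<times> (\<Phi> \<times> I))" "b = weval G.gn v" "eventually (\<lambda>x. k x = gv v x) F"
    using assms unfolding germ_def by blast
  from u(3) v(3) have "eventually (\<lambda>x. h x + k x = gv (u @ v) x) F"
    by eventually_elim (simp add: gv_def weval_append)
  then show ?thesis unfolding germ_def using u v by (intro bexI[of _ "u @ v"]) (auto simp: weval_append)
qed

lemma germ_uminus: assumes "germ a h" shows "germ (- a) (\<lambda>x. - h x)"
proof -
  obtain u where u: "u \<in> lists (UNIV \<times> (\<Phi> \<times> I))" "a = weval G.gn u" "eventually (\<lambda>x. h x = gv u x) F"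
    using assms unfolding germ_def by blast
  from u(3) have "eventually (\<lambda>x. - h x = gv (word_inv u) x) F"
    by eventually_elim (simp add: gv_def weval_inv)
  then show ?thesis unfolding germ_def using u
    by (intro bexI[of _ "word_inv u"]) (auto simp: weval_inv in_lists_conv_set)
qed

lemma germ_Y: "germ a h ==> a \<in> U.Y"
  unfolding germ_def U.Y_def gn_image[symmetric] using weval_subgrp by blast

text \<open>The induction runs over generators away from -\<alpha>, where the abstract conjugation
  is explicit and agrees with conjugation by \<open>X \<alpha> p\<close>. It constructs one suitable
  h; by uniqueness any other germ of a may then be taken.\<close>

lemma germ_cj_ex:
  assumes \<alpha>: "\<alpha> \<in> \<Phi>" and p: "p \<in> P" and a: "a \<in> U.Y"
  shows "\<exists>h. germ a h \<and> germ (U.cj \<alpha> (\<lambda>_. p) a) (\<lambda>x. cjg (X \<alpha> p) (h x))"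
proof -
  have hom: "hom_on U.Y (U.cj \<alpha> (\<lambda>_. p))" by (intro U.cj_hom cst_P \<alpha> p)
  have "a \<in> subgrp (U.avoid {- \<alpha>})" using U.Y_avoid1[OF \<alpha>] a by simp
  then show ?thesis
  proof induction
    case zero
    have "U.cj \<alpha> (\<lambda>_. p) 0 = 0" using hom hom_on_0 unfolding U.Y_def by blast
    then show ?case using germ_0 by (intro exI[of _ "\<lambda>_. 0"]) simp
  next
    case (gen g)
    then obtain \<beta> f where b: "g = y \<beta> f" "\<beta> \<in> \<Phi>" "f \<in> I" "\<beta> \<noteq> - \<alpha>" by (auto simp: U.avoid_def)
    consider "ip \<alpha> \<beta> \<ge> 0" | "ip \<alpha> \<beta> = -1" using ip_vals[OF \<alpha> b(2)] ip_neg2[OF \<alpha> b(2)] b(4) by auto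
    then have "germ (U.cj \<alpha> (\<lambda>_. p) (y \<beta> f)) (\<lambda>x. cjg (X \<alpha> p) (X \<beta> (f x)))"
    proof cases
      case 1
      from deep_P[OF b(3)] have "eventually (\<lambda>x. cjg (X \<alpha> p) (X \<beta> (f x)) = X \<beta> (f x)) F"
        by eventually_elim (use X_steinberg \<alpha> b p 1 in \<open>auto simp: steinberg_def intro!: conj_eqI\<close>)
      then show ?thesis using germ_gen[OF b(2,3)] U.cj_y(1)[OF \<alpha> cst_P[OF p] b(2,3) 1]
        by (auto intro: germ_eventually)
    next
      case 2
      let ?f = "of_int (N \<alpha> \<beta>) * (\<lambda>_. p) * f"
      have i: "(of_int k :: 'q \<times> nat => 'q) x = of_int k" for k x
        by (cases k) (simp_all add: of_nat_fun del: of_nat_Suc)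
      have fI: "?f \<in> I" using cst_P[OF p] b by (intro closed)
      from deep_P[OF b(3)] have "eventually (\<lambda>x. cjg (X \<alpha> p) (X \<beta> (f x)) = X (\<alpha> + \<beta>) (?f x) + X \<beta> (f x)) F"
      proof eventually_elim
        case (elim x)
        then have "X \<alpha> p + X \<beta> (f x) = X (\<alpha> + \<beta>) (of_int (N \<alpha> \<beta>) * p * f x) + X \<beta> (f x) + X \<alpha> p"
          using X_steinberg \<alpha> b p 2 unfolding steinberg_def by blast
        then show ?case by (intro conj_eqI) (simp add: i)
      qed
      then show ?thesis using germ_add[OF germ_gen[OF add_root[OF \<alpha> b(2) 2] fI] germ_gen[OF b(2,3)]]
          U.cj_y(2)[OF \<alpha> cst_P[OF p] b(2,3) 2] by (auto intro: germ_eventually)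
    qed
    then show ?case using germ_gen[OF b(2,3)] b(1) by blast
  next
    case (add a b)
    then obtain h k where h: "germ a h" "germ (U.cj \<alpha> (\<lambda>_. p) a) (\<lambda>x. cjg (X \<alpha> p) (h x))"
      "germ b k" "germ (U.cj \<alpha> (\<lambda>_. p) b) (\<lambda>x. cjg (X \<alpha> p) (k x))" by blast
    have "U.cj \<alpha> (\<lambda>_. p) (a + b) = U.cj \<alpha> (\<lambda>_. p) a + U.cj \<alpha> (\<lambda>_. p) b"
      using hom germ_Y h unfolding hom_on_def by blast
    then show ?case using germ_add[OF h(1,3)] germ_add[OF h(2,4)]
      by (intro exI[of _ "\<lambda>x. h x + k x"]) (simp add: conj_add)
  next
    case (uminus a)
    then obtain h where h: "germ a h" "germ (U.cj \<alpha> (\<lambda>_. p) a) (\<lambda>x. cjg (X \<alpha> p) (h x))" by blast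
    have "U.cj \<alpha> (\<lambda>_. p) (- a) = - U.cj \<alpha> (\<lambda>_. p) a"
      using hom_on_uminus[OF hom[unfolded U.Y_def]] germ_Y[OF h(1)] unfolding U.Y_def by blast
    then show ?case using germ_uminus[OF h(1)] germ_uminus[OF h(2)]
      by (intro exI[of _ "\<lambda>x. - h x"]) (simp add: conj_uminus)
  qed
qed

lemma germ_cj:
  assumes "\<alpha> \<in> \<Phi>" "p \<in> P" "germ a h"
  shows "germ (U.cj \<alpha> (\<lambda>_. p) a) (\<lambda>x. cjg (X \<alpha> p) (h x))"
proof -
  obtain k where k: "germ a k" "germ (U.cj \<alpha> (\<lambda>_. p) a) (\<lambda>x. cjg (X \<alpha> p) (k x))"
    using germ_cj_ex assms germ_Y by blast
  show ?thesis
    by (rule germ_eventually[OF k(2)]) (use germ_unique[OF assms(3) k(1)] in \<open>auto elim: eventually_mono\<close>)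
qed

lemma germ_act:
  assumes "set ws \<subseteq> \<Phi> \<times> P" "germ a h"
  shows "germ (ap (act ws) a) (\<lambda>x. cjg (sum_list (map (\<lambda>(\<alpha>, p). X \<alpha> p) ws)) (h x))" using assms(1)
proof (induction ws)
  case (Cons w ws)
  obtain \<alpha> p where w: "w = (\<alpha>, p)" "\<alpha> \<in> \<Phi>" "p \<in> P" using Cons(2) by (cases w) auto
  have "ap (act (w # ws)) a = U.cj \<alpha> (\<lambda>_. p) (ap (act ws) a)"
    unfolding act_def using w by (simp add: U.ap_\<theta> cst_P)
  then show ?case using germ_cj[OF w(2,3) Cons.IH] Cons(2) w by (simp add: conj_conj)
qed (use assms(2) in \<open>simp add: act_def\<close>)

lemma ap_act_Y:
  assumes "set ws \<subseteq> \<Phi> \<times> P" "a \<in> U.Y"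
  shows "ap (act ws) a \<in> U.Y \<and> cjg (act ws) (U.tr a) = U.tr (ap (act ws) a)" using assms(1)
proof (induction ws)
  case (Cons w ws)
  obtain \<alpha> p where w: "w = (\<alpha>, p)" "\<alpha> \<in> \<Phi>" "p \<in> P" using Cons(2) by (cases w) auto
  have e: "act (w # ws) = U.\<theta> \<alpha> (\<lambda>_. p) + act ws" using w by (simp add: act_def)
  have Y: "ap (act ws) a \<in> U.Y" "cjg (act ws) (U.tr a) = U.tr (ap (act ws) a)" using Cons by auto
  then have "cjg (U.\<theta> \<alpha> (\<lambda>_. p)) (U.tr (ap (act ws) a)) = U.tr (U.cj \<alpha> (\<lambda>_. p) (ap (act ws) a))"
    using w cst_P by (intro conj_eqI U.\<theta>_tr)
  then show ?case unfolding e ap_plus conj_conj using Y w cst_P by (simp add: U.ap_\<theta> U.cj_Y)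
qed (use assms(2) in \<open>simp add: act_def\<close>)

lemma eventually_commutes:
  assumes ws: "set ws \<subseteq> \<Phi> \<times> P" "\<And>i j. ent (prod_list (map (\<lambda>(\<alpha>, p). T \<alpha> p) ws) - 1) i j \<in> J"
    and b: "\<beta> \<in> \<Phi>" "f \<in> I"
  shows "eventually (\<lambda>x. commutes (sum_list (map (\<lambda>(\<alpha>, p). X \<alpha> p) ws)) (X \<beta> (f x))) F"
proof -
  have Y: "y \<beta> f \<in> U.Y" by (rule U.y_Y[OF b])
  have "U.tr (ap (act ws) (y \<beta> f)) = U.tr (y \<beta> f)" using ap_act_Y[OF ws(1) Y] act_fixes[OF ws b] by simp
  then have "ap (act ws) (y \<beta> f) = y \<beta> f" using U.tr_inj ap_act_Y[OF ws(1) Y] Y by blast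
  then have "germ (y \<beta> f) (\<lambda>x. cjg (sum_list (map (\<lambda>(\<alpha>, p). X \<alpha> p) ws)) (X \<beta> (f x)))"
    using germ_act[OF ws(1) germ_gen[OF b]] by simp
  from germ_unique[OF this germ_gen[OF b]] show ?thesis
    by (rule eventually_mono) (simp add: cjg_def diff_eq_eq)
qed

text \<open>One function tests all coefficients: c picks a counterexample for s if there is one.
  Multiplied by the appropriate power of s it lies in \<open>I\<close>, so commutation holds at some
  pair (u, k), and for that power of u there is no counterexample.\<close>

lemma denominator_commutes:
  assumes ws: "set ws \<subseteq> \<Phi> \<times> P" "\<And>i j. ent (prod_list (map (\<lambda>(\<alpha>, p). T \<alpha> p) ws) - 1) i j \<in> J"
    and b: "\<beta> \<in> \<Phi>"
  shows "\<exists>s\<in>S. \<forall>p\<in>P. commutes (sum_list (map (\<lambda>(\<alpha>, p). X \<alpha> p) ws)) (X \<beta> (s * p))"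
proof -
  define g where "g = sum_list (map (\<lambda>(\<alpha>, p). X \<alpha> p) ws)"
  define c where "c s = (SOME p. p \<in> P \<and> ((\<exists>p\<in>P. \<not> commutes g (X \<beta> (s * p))) --> \<not> commutes g (X \<beta> (s * p))))" for s
  have c: "c s \<in> P \<and> ((\<exists>p\<in>P. \<not> commutes g (X \<beta> (s * p))) --> \<not> commutes g (X \<beta> (s * c s)))" for s
    unfolding c_def by (rule someI_ex) (use P_0 in blast)
  define f where "f z = fst z ^ 2 ^ snd z * c (fst z ^ 2 ^ snd z)" for z :: "'q \<times> nat"
  have "dp P 0 f" unfolding dp_def using c by (intro always_eventually allI) (auto simp: f_def)
  then have "f \<in> I" by (auto simp: deep_def)
  then obtain u k where u: "u \<in> S" "\<forall>s k'. dv u s \<and> k \<le> k' --> commutes g (X \<beta> (f (s, k')))"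
    using eventually_commutes[OF ws b] unfolding eventually_F g_def by blast
  have "dv u u" unfolding dv_def using S_1 by (intro bexI[of _ 1]) auto
  then have "commutes g (X \<beta> (u ^ 2 ^ k * c (u ^ 2 ^ k)))" using u(2) by (simp add: f_def)
  then have "\<forall>p\<in>P. commutes g (X \<beta> (u ^ 2 ^ k * p))" using c[of "u ^ 2 ^ k"] by blast
  then show ?thesis using S_power[OF u(1)] g_def by blast
qed

end

section \<open>From local to global\<close>

locale global_steinberg = lie_matrices \<Phi> ip N D + subring_ideal P J
  for \<Phi> :: "'a::ab_group_add set" and ip N and D :: "'a => nat => (int, 'n::finite) sqm"
    and P J :: "'q::field_char_0 set" +
  fixes X :: "'a => 'q => 'g::group_add" and ht :: "'a => real"
  assumes X_steinberg: "steinberg P X" and X_J: "\<beta> \<in> \<Phi> ==> j \<in> J ==> X \<beta> j = 0" and height: "height ht"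
begin

definition idl :: "'q set => bool" where
  "idl Q \<longleftrightarrow> Q \<subseteq> P \<and> 0 \<in> Q \<and> (\<forall>a\<in>Q. \<forall>b\<in>Q. a + b \<in> Q) \<and> (\<forall>p\<in>P. \<forall>a\<in>Q. p * a \<in> Q)"

lemma idl_diff: assumes "idl Q" "a \<in> Q" "b \<in> Q" shows "a - b \<in> Q"
proof -
  have "(- 1) * b \<in> Q" using assms P_uminus[OF P_1] unfolding idl_def by blast
  then have "a + (- 1) * b \<in> Q" using assms unfolding idl_def by blast
  then show ?thesis by simp
qed

lemma maximal_ideal:
  assumes a: "idl Q" "1 \<notin> Q"
  shows "\<exists>M. idl M \<and> Q \<subseteq> M \<and> 1 \<notin> M \<and> (\<forall>p\<in>P - M. \<exists>q\<in>P. 1 - p * q \<in> M)"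
proof -
  define I where "I = {M. idl M \<and> Q \<subseteq> M \<and> 1 \<notin> M}"
  have "\<exists>M\<in>I. \<forall>X\<in>I. M \<subseteq> X --> X = M"
  proof (rule subset_Zorn_nonempty)
    show "I \<noteq> {}" using a by (auto simp: I_def)
    fix C assume C: "C \<noteq> {}" "subset.chain I C"
    have CI: "M \<in> I" if "M \<in> C" for M using C(2) that by (auto simp: subset.chain_def)
    have add: "x + y \<in> \<Union>C" if "x \<in> \<Union>C" "y \<in> \<Union>C" for x y
    proof -
      obtain M M' where M: "M \<in> C" "x \<in> M" "M' \<in> C" "y \<in> M'" using \<open>x \<in> \<Union>C\<close> \<open>y \<in> \<Union>C\<close> by blast
      then have "M \<subseteq> M' \<or> M' \<subseteq> M" using C(2) unfolding subset_chain_def by blast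
      then obtain M'' where M'': "M'' \<in> C" "x \<in> M''" "y \<in> M''" using M by blast
      then have "x + y \<in> M''" using CI unfolding I_def idl_def by blast
      then show ?thesis using M''(1) by blast
    qed
    have "idl (\<Union>C)" unfolding idl_def
    proof (intro conjI ballI)
      show "\<Union>C \<subseteq> P" "0 \<in> \<Union>C" using CI C(1) unfolding I_def idl_def by blast+
      show "p * x \<in> \<Union>C" if "p \<in> P" "x \<in> \<Union>C" for p x using CI that unfolding I_def idl_def by blast
    qed (rule add)
    then show "\<Union>C \<in> I" using CI C(1) unfolding I_def by blast
  qed
  then obtain M where M: "M \<in> I" and max: "\<And>X. X \<in> I ==> M \<subseteq> X ==> X = M" by blast
  have iM: "idl M" "Q \<subseteq> M" "1 \<notin> M" using M by (auto simp: I_def)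
  have "\<exists>q\<in>P. 1 - p * q \<in> M" if p: "p \<in> P" "p \<notin> M" for p
  proof -
    \<comment> \<open>The ideal generated by M and p, which must contain 1 by maximality.\<close>
    define Z where "Z = {m + p * q |m q. m \<in> M \<and> q \<in> P}"
    have "idl Z" unfolding idl_def
    proof (intro conjI ballI subsetI)
      show "0 \<in> Z" unfolding Z_def using iM(1) P_0 by (intro CollectI exI[of _ 0]) (auto simp: idl_def)
    next
      fix x assume "x \<in> Z"
      then show "x \<in> P" using iM(1) p P_add P_mult unfolding Z_def idl_def by blast
      fix y assume "y \<in> Z"
      obtain m q where x: "m \<in> M" "q \<in> P" "x = m + p * q" using \<open>x \<in> Z\<close> by (auto simp: Z_def)
      obtain n r where y: "n \<in> M" "r \<in> P" "y = n + p * r" using \<open>y \<in> Z\<close> by (auto simp: Z_def)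
      have "x + y = (m + n) + p * (q + r)" by (simp add: x y algebra_simps)
      moreover have "m + n \<in> M" using iM(1) x y unfolding idl_def by blast
      ultimately show "x + y \<in> Z" using P_add x y unfolding Z_def by blast
    next
      fix c x assume c: "c \<in> P" and "x \<in> Z"
      obtain m q where x: "m \<in> M" "q \<in> P" "x = m + p * q" using \<open>x \<in> Z\<close> by (auto simp: Z_def)
      have "c * x = c * m + p * (c * q)" by (simp add: x algebra_simps)
      moreover have "c * m \<in> M" using iM(1) x c unfolding idl_def by blast
      ultimately show "c * x \<in> Z" using P_mult x c unfolding Z_def by blast
    qed
    moreover have MZ: "M \<subseteq> Z"
    proof
      fix m assume "m \<in> M"
      then show "m \<in> Z" unfolding Z_def using P_0 by (intro CollectI exI[of _ m] exI[of _ 0]) simp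
    qed
    moreover have "p \<in> Z" unfolding Z_def using iM(1) P_1 by (intro CollectI exI[of _ 0] exI[of _ 1]) (auto simp: idl_def)
    ultimately have "1 \<in> Z" using max[of Z] iM p unfolding I_def by blast
    then obtain m q where "m \<in> M" "q \<in> P" "1 = m + p * q" by (auto simp: Z_def)
    moreover from this have "m = 1 - p * q" by (simp add: algebra_simps)
    ultimately show ?thesis by blast
  qed
  then show ?thesis using iM by blast
qed

theorem word_commutes:
  assumes ws: "set ws \<subseteq> \<Phi> \<times> P" "\<And>i j. ent (prod_list (map (\<lambda>(\<alpha>, p). T \<alpha> p) ws) - 1) i j \<in> J"
    and b: "\<beta> \<in> \<Phi>" "p \<in> P"
  shows "commutes (sum_list (map (\<lambda>(\<alpha>, p). X \<alpha> p) ws)) (X \<beta> p)"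
proof -
  define g where "g = sum_list (map (\<lambda>(\<alpha>, p). X \<alpha> p) ws)"
  define Q where "Q = {s \<in> P. \<forall>p\<in>P. commutes g (X \<beta> (s * p))}"
  have X_add: "X \<beta> (p + q) = X \<beta> p + X \<beta> q" if "p \<in> P" "q \<in> P" for p q
    using X_steinberg b that unfolding steinberg_def by blast
  have "idl Q" unfolding idl_def
  proof (intro conjI ballI)
    show "Q \<subseteq> P" by (auto simp: Q_def)
    show "0 \<in> Q" using P_0 X_J[OF b(1) J_zero] by (simp add: Q_def)
    fix s t assume s: "s \<in> Q" and t: "t \<in> Q"
    then have "commutes g (X \<beta> (s * p + t * p))" if "p \<in> P" for p
      using that P_mult unfolding Q_def by (simp add: X_add commutes_add_right)
    then show "s + t \<in> Q" using s t P_add by (simp add: Q_def distrib_right)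
  next
    fix c s assume c: "c \<in> P" and s: "s \<in> Q"
    have "commutes g (X \<beta> (c * s * p))" if "p \<in> P" for p
    proof -
      have "c * s * p = s * (c * p)" by (simp add: mult_ac)
      moreover have "commutes g (X \<beta> (s * (c * p)))" using s P_mult[OF c that] unfolding Q_def by blast
      ultimately show ?thesis by (simp only:)
    qed
    then show "c * s \<in> Q" using s c P_mult by (simp add: Q_def)
  qed
  have "1 \<in> Q"
  proof (rule ccontr)
    assume "1 \<notin> Q"
    then obtain M where M: "idl M" "Q \<subseteq> M" "1 \<notin> M" "\<And>p. p \<in> P ==> p \<notin> M ==> \<exists>q\<in>P. 1 - p * q \<in> M"
      using maximal_ideal[OF \<open>idl Q\<close>] by blast
    \<comment> \<open>From 1 - sq in M one obtains u = u(1 - sq) + q(su) in M.\<close>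
    have prime: "s * u \<notin> M" if su: "s \<in> P" "s \<notin> M" "u \<in> P" "u \<notin> M" for s u
    proof
      assume m: "s * u \<in> M"
      obtain q where q: "q \<in> P" "1 - s * q \<in> M" using M(4) su by blast
      have "u * (1 - s * q) + q * (s * u) \<in> M" using M(1) m q su unfolding idl_def by blast
      then show False using su by (simp add: algebra_simps)
    qed
    interpret localized_steinberg \<Phi> ip N D P J "P - M" X ht
    proof
      fix p assume p: "p \<in> P"
      show "p \<in> P - M \<or> (\<forall>u\<in>P - M. \<forall>q\<in>P. u + p * q \<in> P - M)"
      proof (cases "p \<in> M")
        case True
        have "u + p * q \<in> P - M" if u: "u \<in> P - M" and q: "q \<in> P" for u q
        proof -
          have pq: "p * q \<in> M" using True q M(1) unfolding idl_def by (metis mult.commute)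
          have "u + p * q \<notin> M" using idl_diff[OF M(1) _ pq, of "u + p * q"] u by auto
          then show ?thesis using u p q P_add P_mult by blast
        qed
        then show ?thesis by blast
      qed (use p in blast)
    next
      fix s u assume "s \<in> P - M" "u \<in> P - M"
      then show "s * u \<in> P - M" using prime P_mult by blast
    next
      show "0 \<notin> P - M" using M(1) by (auto simp: idl_def)
    qed (use P_1 M(3) X_steinberg X_J height in auto)
    obtain s where "s \<in> P - M" "\<forall>p\<in>P. commutes g (X \<beta> (s * p))"
      using denominator_commutes[OF ws b(1)] unfolding g_def by blast
    then have "s \<in> Q" by (auto simp: Q_def)
    then show False using M(2) \<open>s \<in> P - M\<close> by blast
  qed
  then show ?thesis using b(2) by (simp add: Q_def g_def)
qed

end

section \<open>Homomorphisms from polynomial rings\<close>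

instance fract :: ("{idom, ring_char_0}") field_char_0
proof
  show "inj (of_nat :: nat => 'a fract)" by (rule injI) (simp add: of_nat_fract eq_fract)
qed

text \<open>The source is a ring given as a type, the target a ring given by its carrier; identities
  proved by type-class reasoning are transported along h.\<close>

locale typed_hom = cring R for R (structure) +
  fixes h :: "'c::comm_ring_1 => 'r"
  assumes h_closed [simp]: "h x \<in> carrier R" and h_add: "h (x + y) = h x \<oplus> h y"
    and h_mult: "h (x * y) = h x \<otimes> h y" and h_1: "h 1 = \<one>"
begin

lemma h_0: "h 0 = \<zero>"
proof -
  have "h 0 \<oplus> h 0 = h 0 \<oplus> \<zero>" by (simp flip: h_add)
  then show ?thesis by simp
qed

lemma h_uminus: "h (- x) = \<ominus> h x" using h_add[of "- x" x] h_0 by (simp add: minus_equality)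

lemma h_power: "h (x ^ k) = h x [^] k" by (induction k) (simp_all add: h_1 h_mult m_comm)

lemma h_sum: "h (\<Sum>x\<in>X. f x) = (\<Oplus>x\<in>X. h (f x))"
  by (induction X rule: infinite_finite_induct) (simp_all add: h_0 h_add)

lemma h_prod: "h (\<Prod>x\<in>X. f x) = (\<Otimes>x\<in>X. h (f x))"
  by (induction X rule: infinite_finite_induct) (simp_all add: h_1 h_mult)

lemma h_nat: "h (of_nat k * x) = [k] \<cdot> h x"
  by (induction k) (simp_all add: h_0 h_add distrib_right a_comm)

lemma h_int: "h (of_int k * x) = [k] \<cdot> h x"
proof (cases k)
  case (nonneg n) then show ?thesis by (simp add: h_nat add_pow_int_ge)
next
  case (neg n)
  have "h (of_int k * x) = h (- (of_nat (Suc n) * x))" by (simp add: neg algebra_simps)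
  also have "... = \<ominus> ([Suc n] \<cdot> h x)" by (simp only: h_uminus h_nat)
  also have "... = [k] \<cdot> h x" by (subst add_pow_int_lt) (simp_all add: neg nat_add_distrib)
  finally show ?thesis .
qed

definition mh :: "('c, 'n::finite) sqm => 'r ^ 'n ^ 'n" where "mh M = (\<chi> i j. h (ent M i j))"

lemma mh_mult: "mh (M * M') = mh M \<otimes>\<^bsub>matrix_monoid R\<^esub> mh M'"
  by (simp add: mh_def matrix_monoid_def ent_mult h_sum h_mult vec_eq_iff)

lemma mh_1: "mh 1 = \<one>\<^bsub>matrix_monoid R\<^esub>" by (simp add: mh_def matrix_monoid_def ent_1 h_1 h_0 vec_eq_iff)

lemma mh_closed: "mh M \<in> carrier (matrix_monoid R)" by (simp add: mh_def matrix_monoid_def)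

end

lemma typed_hom_comp:
  assumes "typed_hom R h" "\<And>x y. f (x + y) = f x + f y" "\<And>x y. f (x * y) = f x * f y" "f 1 = 1"
  shows "typed_hom R (\<lambda>x. h (f x))"
proof -
  interpret typed_hom R h by fact
  show ?thesis by unfold_locales (simp_all add: assms h_add h_mult h_1)
qed

context cring
begin

definition mon :: "('x => 'a) => ('x \<Rightarrow>\<^sub>0 nat) => 'a" where
  "mon a m = (\<Otimes>x\<in>Poly_Mapping.keys m. a x [^] Poly_Mapping.lookup m x)"

definition mev :: "('x => 'a) => (('x \<Rightarrow>\<^sub>0 nat) \<Rightarrow>\<^sub>0 int) => 'a" where
  "mev a p = (\<Oplus>m\<in>Poly_Mapping.keys p. [Poly_Mapping.lookup p m] \<cdot> mon a m)"

context
  fixes a :: "'x => 'a" assumes a: "\<And>x. a x \<in> carrier R"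
begin

lemma mon_closed: "mon a m \<in> carrier R" unfolding mon_def by (intro finprod_closed) (auto simp: a)

lemma mon_superset:
  assumes "finite V" "Poly_Mapping.keys m \<subseteq> V"
  shows "mon a m = (\<Otimes>x\<in>V. a x [^] Poly_Mapping.lookup m x)"
  unfolding mon_def by (rule finprod_mono_neutral_cong_left) (use assms a in \<open>auto simp: in_keys_iff\<close>)

lemma mon_add: "mon a (m + n) = mon a m \<otimes> mon a n"
proof -
  let ?V = "Poly_Mapping.keys m \<union> Poly_Mapping.keys n"
  have "mon a (m + n) = (\<Otimes>x\<in>?V. a x [^] Poly_Mapping.lookup m x \<otimes> a x [^] Poly_Mapping.lookup n x)"
    using mon_superset[of ?V "m + n"] Poly_Mapping.keys_add[of m n] a by (simp add: lookup_add nat_pow_mult)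
  also have "... = (\<Otimes>x\<in>?V. a x [^] Poly_Mapping.lookup m x) \<otimes> (\<Otimes>x\<in>?V. a x [^] Poly_Mapping.lookup n x)"
    by (rule finprod_multf) (auto simp: a)
  finally show ?thesis using mon_superset[of ?V m] mon_superset[of ?V n] by simp
qed

lemma mev_superset:
  assumes "finite V" "Poly_Mapping.keys p \<subseteq> V"
  shows "mev a p = (\<Oplus>m\<in>V. [Poly_Mapping.lookup p m] \<cdot> mon a m)"
proof -
  have "[(0::int)] \<cdot> x = \<zero>" for x by (simp add: add_pow_def)
  then show ?thesis unfolding mev_def
    by (intro add.finprod_mono_neutral_cong_left) (use assms mon_closed in \<open>auto simp: in_keys_iff\<close>)
qed

lemma mev_closed: "mev a p \<in> carrier R" unfolding mev_def by (intro finsum_closed) (auto simp: mon_closed)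

lemma mev_add: "mev a (p + q) = mev a p \<oplus> mev a q"
proof -
  let ?V = "Poly_Mapping.keys p \<union> Poly_Mapping.keys q"
  have "mev a (p + q) = (\<Oplus>m\<in>?V. [Poly_Mapping.lookup p m] \<cdot> mon a m \<oplus> [Poly_Mapping.lookup q m] \<cdot> mon a m)"
    using mev_superset[of ?V "p + q"] Poly_Mapping.keys_add[of p q] mon_closed
    by (simp add: lookup_add add.int_pow_mult)
  also have "... = (\<Oplus>m\<in>?V. [Poly_Mapping.lookup p m] \<cdot> mon a m) \<oplus> (\<Oplus>m\<in>?V. [Poly_Mapping.lookup q m] \<cdot> mon a m)"
    by (rule finsum_addf) (auto simp: mon_closed)
  finally show ?thesis using mev_superset[of ?V p] mev_superset[of ?V q] by simp
qed

lemma mev_single: "mev a (Poly_Mapping.single m k) = [k] \<cdot> mon a m"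
  using mev_superset[of "{m}" "Poly_Mapping.single m k"] mon_closed by (simp add: keys_single)

lemma mev_0: "mev a 0 = \<zero>" by (simp add: mev_def)

lemma update_add_single: "x \<notin> Poly_Mapping.keys p ==> Poly_Mapping.update x k p = Poly_Mapping.single x k + p"
  by (rule poly_mapping_eqI) (auto simp: lookup_update lookup_add lookup_single in_keys_iff)

lemma mev_single_mult: "mev a (Poly_Mapping.single m k * q) = ([k] \<cdot> mon a m) \<otimes> mev a q"
proof (induction q rule: update_induct)
  case const then show ?case by (simp add: mev_0 mon_closed)
next
  case (update f n l)
  have "([k] \<cdot> mon a m) \<otimes> ([l] \<cdot> mon a n) = [(k * l)] \<cdot> mon a (m + n)"
    by (simp add: add_pow_ldistr_int add_pow_rdistr_int mon_add mon_closed add.int_pow_pow mult.commute)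
  then show ?case using update mon_closed mev_closed
    by (simp add: update_add_single distrib_left mev_add mult_single mev_single r_distr)
qed

lemma mev_mult: "mev a (p * q) = mev a p \<otimes> mev a q"
proof (induction p rule: update_induct)
  case const then show ?case by (simp add: mev_0 mev_closed)
next
  case (update f n l)
  then show ?case using mon_closed mev_closed
    by (simp add: update_add_single distrib_right mev_add mev_single_mult mev_single l_distr)
qed

lemma mev_hom: "typed_hom R (mev a)"
proof
  have "mon a 0 = \<one>" by (simp add: mon_def)
  then show "mev a 1 = \<one>" using mev_single[of 0 1] by simp
qed (simp_all add: mev_closed mev_add mev_mult)

lemma mev_var: "mev a (Poly_Mapping.single (Poly_Mapping.single x 1) 1) = a x"
  using a by (simp add: mev_single mon_def)

end

end

text \<open>Substitution of y into an integer polynomial whose variable stands for the coefficient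
  of a root unipotent.\<close>

definition psub :: "'c::comm_ring_1 => int poly => 'c" where "psub y r = poly (map_poly of_int r) y"

lemma psub_pCons: "psub y (pCons k r) = of_int k + y * psub y r" by (simp add: psub_def map_poly_pCons)

lemma psub_0: "psub y 0 = 0" by (simp add: psub_def)

lemma psub_add: "psub y (p + q) = psub y p + psub y q"
  by (induction p q rule: poly_induct2) (simp_all add: psub_0 psub_pCons algebra_simps)

lemma psub_smult: "psub y (smult k p) = of_int k * psub y p"
  by (induction p) (simp_all add: psub_0 psub_pCons algebra_simps)

lemma psub_mult: "psub y (p * q) = psub y p * psub y q"
  by (induction p) (simp_all add: psub_0 psub_pCons psub_add psub_smult mult_pCons_left algebra_simps)

lemma psub_1: "psub y 1 = 1" by (simp add: one_pCons psub_pCons psub_0)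

lemma psub_X: "psub y [:0, 1:] = y" by (simp add: psub_pCons psub_0)

lemma psub_eq_0:
  assumes "\<And>y :: complex. psub y r = 0" shows "r = 0"
proof -
  have "map_poly of_int r = (0 :: complex poly)" using assms unfolding psub_def poly_all_0_iff_0 by (simp flip: poly_all_0_iff_0)
  then show ?thesis using map_poly_eq_0_iff[of "of_int :: int => complex" r] by auto
qed

lemma cring_complex: "cring complex_ring"
  by (unfold_locales) (auto simp: complex_ring_def algebra_simps Units_def intro!: exI[of _ "- _"] add.right_inverse add.left_inverse)

lemma psub_complex: "typed_hom complex_ring (psub y)"
proof -
  interpret cring complex_ring by (rule cring_complex)
  show ?thesis by unfold_locales (simp_all add: complex_ring_def psub_add psub_mult psub_1)
qed

context typed_hom
begin

lemma eval_poly_mh: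
  "eval_poly R p (mh M) = h (\<Sum>m\<in>Poly_Mapping.keys p. of_int (Poly_Mapping.lookup p m) *
     (\<Prod>x\<in>Poly_Mapping.keys m. ent M (fst x) (snd x) ^ Poly_Mapping.lookup m x))"
  by (simp add: eval_poly_def mh_def h_sum h_int h_prod h_power)

end

context cring
begin

lemma ex_psub: assumes "\<xi> \<in> carrier R" shows "\<exists>h :: int poly => 'a. typed_hom R h \<and> h [:0, 1:] = \<xi>"
proof -
  define v where "v = (Poly_Mapping.single (Poly_Mapping.single () 1) 1 :: (unit \<Rightarrow>\<^sub>0 nat) \<Rightarrow>\<^sub>0 int)"
  have "typed_hom R (mev (\<lambda>_ :: unit. \<xi>))" by (rule mev_hom) (rule assms)
  then have "typed_hom R (\<lambda>r. mev (\<lambda>_ :: unit. \<xi>) (psub v r))"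
    by (rule typed_hom_comp) (simp_all add: psub_add psub_mult psub_1)
  moreover have "mev (\<lambda>_ :: unit. \<xi>) (psub v [:0, 1:]) = \<xi>"
    unfolding psub_X v_def by (rule mev_var) (rule assms)
  ultimately show ?thesis by (intro exI[of _ "\<lambda>r. mev (\<lambda>_ :: unit. \<xi>) (psub v r)"]) simp
qed

text \<open>Identities between finitely many elements of \<open>R\<close> can be lifted to a polynomial ring, which is an
  integral domain of characteristic zero.\<close>

lemma ex_lift:
  assumes "finite X" "X \<subseteq> carrier R"
  shows "\<exists>h :: ((nat \<Rightarrow>\<^sub>0 nat) \<Rightarrow>\<^sub>0 int) => 'a. typed_hom R h \<and> X \<subseteq> range h"
proof -
  obtain f :: "nat => 'a" and n where f: "X = f ` {i. i < n}" using finite_imp_nat_seg_image_inj_on[OF assms(1)] by blast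
  define a where "a i = (if f i \<in> carrier R then f i else \<zero>)" for i
  have a: "a i \<in> carrier R" for i by (simp add: a_def)
  have "x \<in> range (mev a)" if x: "x \<in> X" for x
  proof -
    obtain i where i: "x = f i" using x f by blast
    then have "x = a i" using x assms(2) by (auto simp: a_def)
    then have "x = mev a (Poly_Mapping.single (Poly_Mapping.single i 1) 1)" using mev_var[of a i] a by simp
    then show ?thesis by blast
  qed
  then show ?thesis using mev_hom[of a] a by blast
qed

lemma matrix_lift:
  fixes B C D :: "'a ^ 'n ^ 'n"
  assumes "B \<in> carrier (matrix_monoid R)" "C \<in> carrier (matrix_monoid R)" "D \<in> carrier (matrix_monoid R)"
  shows "\<exists>h :: ((nat \<Rightarrow>\<^sub>0 nat) \<Rightarrow>\<^sub>0 int) => 'a. typed_hom R h \<and>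
    (\<exists>b c d. B = typed_hom.mh h b \<and> C = typed_hom.mh h c \<and> D = typed_hom.mh h d)"
proof -
  define ents where "ents M = (\<lambda>(i, j). M $ i $ j) ` (UNIV :: ('n \<times> 'n) set)" for M :: "'a ^ 'n ^ 'n"
  have ents: "ents M \<subseteq> carrier R" if "M \<in> carrier (matrix_monoid R)" for M
    using that by (auto simp: ents_def matrix_monoid_def)
  have fin: "finite (ents M)" for M by (simp add: ents_def)
  obtain h :: "((nat \<Rightarrow>\<^sub>0 nat) \<Rightarrow>\<^sub>0 int) => 'a" where h: "typed_hom R h" "ents B \<union> ents C \<union> ents D \<subseteq> range h"
    using ex_lift[of "ents B \<union> ents C \<union> ents D"] ents assms fin by blast
  interpret h: typed_hom R h by fact
  have *: "\<exists>m. M = h.mh m" if M: "ents M \<subseteq> range h" for M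
  proof (intro exI)
    have "h (inv_into UNIV h (M $ i $ j)) = M $ i $ j" for i j
      using M by (intro f_inv_into_f) (auto simp: ents_def)
    then show "M = h.mh (Sqm (\<lambda>i j. inv_into UNIV h (M $ i $ j)))" by (simp add: h.mh_def vec_eq_iff)
  qed
  obtain b c d where "B = h.mh b" "C = h.mh c" "D = h.mh d" using *[of B] *[of C] *[of D] h(2) by (metis Un_subset_iff)
  then show ?thesis using h(1) by metis
qed

text \<open>The monoid laws are lifted: three given matrices come from matrices over a polynomial
  ring, where square matrices form a ring.\<close>

lemma matrix_monoid: "monoid (matrix_monoid R :: ('a ^ 'n ^ 'n) monoid)" (is "monoid ?G")
proof
  fix B C D assume BCD: "B \<in> carrier ?G" "C \<in> carrier ?G" "D \<in> carrier ?G"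
  obtain h :: "((nat \<Rightarrow>\<^sub>0 nat) \<Rightarrow>\<^sub>0 int) => 'a" and b c d
    where h: "typed_hom R h" and l: "B = typed_hom.mh h b" "C = typed_hom.mh h c" "D = typed_hom.mh h d"
    using matrix_lift[OF BCD] by blast
  interpret h: typed_hom R h by fact
  show "B \<otimes>\<^bsub>?G\<^esub> C \<in> carrier ?G" "B \<otimes>\<^bsub>?G\<^esub> C \<otimes>\<^bsub>?G\<^esub> D = B \<otimes>\<^bsub>?G\<^esub> (C \<otimes>\<^bsub>?G\<^esub> D)"
    "\<one>\<^bsub>?G\<^esub> \<otimes>\<^bsub>?G\<^esub> B = B" "B \<otimes>\<^bsub>?G\<^esub> \<one>\<^bsub>?G\<^esub> = B"
    unfolding l h.mh_mult[symmetric] h.mh_1[symmetric] by (simp_all add: h.mh_closed mult.assoc)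
next
  show "\<one>\<^bsub>?G\<^esub> \<in> carrier ?G" by (simp add: matrix_monoid_def)
qed

end

section \<open>Root unipotents over a ring\<close>

text \<open>The passage to the fraction field, where the exponential form of the root elements is
  available in characteristic 0.\<close>

definition emb :: "'c::idom => 'c fract" where "emb x = Fraction_Field.Fract x 1"

lemma emb: "emb (x + y) = emb x + emb y" "emb (x * y) = emb x * emb y" "emb 1 = 1" "emb 0 = 0"
  by (simp_all add: emb_def One_fract_def Zero_fract_def)

lemma emb_uminus: "emb (- x) = - emb x"
  using emb(1)[of "- x" x] by (simp add: emb(4) eq_neg_iff_add_eq_0)

lemma emb_inj: "emb x = emb y \<longleftrightarrow> x = y" by (simp add: emb_def eq_fract)

lemma emb_of_int: "emb (of_int k) = of_int k"
proof -
  have "emb (of_nat n) = of_nat n" for n by (induction n) (simp_all add: emb)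
  then show ?thesis by (cases k) (simp_all add: emb emb_uminus flip: of_nat_Suc)
qed

lemma inv_emb: "inv_into UNIV emb (emb p) = p" by (rule inv_into_f_f) (auto simp: inj_def emb_inj)

context lie_matrices
begin

lemma ent_T: "ent (T \<alpha> a) i j = (\<Sum>k<CARD('n). a ^ k * of_int (ent (D \<alpha> k) i j))"
  by (simp add: T_def ent_sum)

lemma mmap_T:
  assumes f: "\<And>x y. f (x + y) = f x + f y" "\<And>x y. f (x * y) = f x * f y" "f 1 = 1" "f 0 = 0"
  shows "mmap f (T \<alpha> a) = T \<alpha> (f a)"
proof (rule sqm_eqI)
  fix i j
  have sum: "f (sum g X) = (\<Sum>x\<in>X. f (g x))" for g X
    by (induction X rule: infinite_finite_induct) (simp_all add: f)
  have pow: "f (x ^ k) = f x ^ k" for x k by (induction k) (simp_all add: f)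
  have nat: "f (of_nat k) = of_nat k" for k by (induction k) (simp_all add: f)
  have "f (- x) + f x = 0" for x using f(1)[of "- x" x] f(4) by simp
  then have neg: "f (- x) = - f x" for x by (simp add: eq_neg_iff_add_eq_0)
  have int: "f (of_int k) = of_int k" for k by (cases k) (simp_all add: nat neg f flip: of_nat_Suc)
  show "ent (mmap f (T \<alpha> a)) i j = ent (T \<alpha> (f a)) i j" by (simp add: ent_T sum f pow int)
qed

lemma emb_T: "mmap emb (T \<alpha> a) = T \<alpha> (emb a)" for a :: "'c::idom" by (rule mmap_T) (simp_all add: emb)

lemma emb_mult: "mmap emb (A * B) = mmap emb A * mmap emb B" for A :: "('c::idom, 'n) sqm"
  by (rule mmap_mult) (simp_all add: emb)

lemma mmap_emb_inj: "mmap emb A = mmap emb B ==> A = B" for A :: "('c::idom, 'n) sqm"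
  by (rule sqm_eqI) (metis ent_mmap emb_inj)

text \<open>The identities hold over the fraction field and descend along the injective
  embedding.\<close>

lemma T_domain:
  fixes a b :: "'c::{idom, ring_char_0}"
  assumes \<alpha>: "\<alpha> \<in> \<Phi>"
  shows "T \<alpha> (a + b) = T \<alpha> a * T \<alpha> b" "T \<alpha> 0 = (1 :: ('c, 'n) sqm)" "T \<alpha> a * T \<alpha> (- a) = 1" "T \<alpha> (- a) * T \<alpha> a = 1"
    and "\<beta> \<in> \<Phi> ==> ip \<alpha> \<beta> \<ge> 0 ==> T \<alpha> a * T \<beta> b = T \<beta> b * T \<alpha> a"
    and "\<beta> \<in> \<Phi> ==> ip \<alpha> \<beta> = -1 ==> T \<alpha> a * T \<beta> b = T (\<alpha> + \<beta>) (of_int (N \<alpha> \<beta>) * a * b) * T \<beta> b * T \<alpha> a"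
proof -
  show add: "T \<alpha> (a + b) = T \<alpha> a * T \<alpha> b" for a b :: 'c
    by (rule mmap_emb_inj) (simp add: emb_T emb_mult emb T_add \<alpha>)
  have one: "mmap emb 1 = (1 :: ('c fract, 'n) sqm)" by (rule mmap_1) (simp_all add: emb)
  show zero: "T \<alpha> 0 = (1 :: ('c, 'n) sqm)" by (rule mmap_emb_inj) (simp add: emb_T emb T_0 \<alpha> one)
  show "T \<alpha> a * T \<alpha> (- a) = 1" "T \<alpha> (- a) * T \<alpha> a = 1" using add[of a "- a"] add[of "- a" a] zero by simp_all
  assume \<beta>: "\<beta> \<in> \<Phi>"
  show "T \<alpha> a * T \<beta> b = T \<beta> b * T \<alpha> a" if "ip \<alpha> \<beta> \<ge> 0"
    by (rule mmap_emb_inj) (simp add: emb_T emb_mult T_commute[OF \<alpha> \<beta> that])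
  show "T \<alpha> a * T \<beta> b = T (\<alpha> + \<beta>) (of_int (N \<alpha> \<beta>) * a * b) * T \<beta> b * T \<alpha> a" if "ip \<alpha> \<beta> = -1"
    by (rule mmap_emb_inj) (simp only: emb_T emb_mult emb emb_of_int T_rel[OF \<alpha> \<beta> that])
qed

end

type_synonym mpoly = "(nat \<Rightarrow>\<^sub>0 nat) \<Rightarrow>\<^sub>0 int"

text \<open>\<open>H\<close> shares product and unit with the monoid \<open>M\<close>, so the
  evaluation of words in the Chevalley group can be computed by matrix multiplication, with only the
  inverses of letters taken in \<open>H\<close>.\<close>

lemma eval_word_append:
  assumes "monoid M" "mult H = mult M" "one H = one M"
    and f: "\<And>x. x \<in> S ==> f x \<in> carrier M \<and> inv\<^bsub>H\<^esub> f x \<in> carrier M"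
    and u: "u \<in> lists (UNIV \<times> S)" and v: "v \<in> lists (UNIV \<times> S)"
  shows "eval_word H f v \<in> carrier M \<and> eval_word H f (u @ v) = eval_word H f u \<otimes>\<^bsub>M\<^esub> eval_word H f v"
proof -
  interpret monoid M by fact
  have c: "eval_word H f w \<in> carrier M" if "w \<in> lists (UNIV \<times> S)" for w
    using that by (induction w) (auto simp: assms f)
  show ?thesis using u
  proof (induction u)
    case Nil then show ?case using c[OF v] by (simp add: assms)
  next
    case (Cons x u)
    obtain b z where x: "x = (b, z)" "z \<in> S" using Cons.hyps by auto
    show ?case using Cons.IH c[OF v] c[OF Cons.hyps(2)] f[OF x(2)] by (simp add: assms x m_assoc)
  qed
qed

context E_representation
begin

lemma neg_iff:
  assumes "\<alpha> \<in> \<Phi>" "\<beta> \<in> \<Phi>"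
  shows "\<alpha> + \<beta> \<in> \<Phi> \<longleftrightarrow> R.ip \<alpha> \<beta> = -1" "\<alpha> + \<beta> \<notin> \<Phi> \<union> {0} \<longleftrightarrow> R.ip \<alpha> \<beta> \<ge> 0"
proof -
  consider "R.ip \<alpha> \<beta> = -2" | "R.ip \<alpha> \<beta> = -1" | "R.ip \<alpha> \<beta> \<ge> 0" using ip_vals[OF assms] by auto
  then have "(\<alpha> + \<beta> \<in> \<Phi> \<longleftrightarrow> R.ip \<alpha> \<beta> = -1) \<and> (\<alpha> + \<beta> \<notin> \<Phi> \<union> {0} \<longleftrightarrow> R.ip \<alpha> \<beta> \<ge> 0)"
  proof cases
    case 1 then show ?thesis using ip_neg2[OF assms 1] R.zero_\<Phi> by simp
  next
    case 2 then show ?thesis using add_root[OF assms 2] by simp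
  next
    case 3 then show ?thesis using nonroot[OF assms 3] by auto
  qed
  then show "\<alpha> + \<beta> \<in> \<Phi> \<longleftrightarrow> R.ip \<alpha> \<beta> = -1" "\<alpha> + \<beta> \<notin> \<Phi> \<union> {0} \<longleftrightarrow> R.ip \<alpha> \<beta> \<ge> 0" by blast+
qed

lemma root_unipotent_mh:
  assumes "typed_hom K hm" shows "root_unipotent e \<pi> K \<alpha> (hm a) = typed_hom.mh hm (T \<alpha> a)"
proof -
  interpret typed_hom K hm by fact
  show ?thesis unfolding mh_def root_unipotent_def
    by (simp add: vec_eq_iff ent_T h_sum D_def h_int h_power mult.commute[of "_ ^ _"])
qed

section \<open>Words over a ring, their matrices and their polynomial lifts\<close>

context
  fixes K :: "('r, 'm) ring_scheme" assumes K: "cring K"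
begin

abbreviation rt :: "'a \<times> 'r => 'r ^ 'n ^ 'n" where "rt \<equiv> \<lambda>(\<alpha>, \<xi>). root_unipotent e \<pi> K \<alpha> \<xi>"
abbreviation chev :: "('r ^ 'n ^ 'n) monoid" where "chev \<equiv> chevalley_group \<Phi> e \<pi> K"
abbreviation mx :: "('r ^ 'n ^ 'n) monoid" where "mx \<equiv> matrix_monoid K"

lemma neg_closed: "\<xi> \<in> carrier K ==> \<ominus>\<^bsub>K\<^esub> \<xi> \<in> carrier K"
  by (rule abelian_group.a_inv_closed[OF ring.is_abelian_group[OF cring.axioms(1)[OF K]]])

lemma ex_lift2:
  assumes "\<xi> \<in> carrier K" "\<eta> \<in> carrier K"
  shows "\<exists>hm :: mpoly => 'r. typed_hom K hm \<and> (\<exists>x y. \<xi> = hm x \<and> \<eta> = hm y)"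
proof -
  obtain hm :: "mpoly => 'r" where "typed_hom K hm" "{\<xi>, \<eta>} \<subseteq> range hm"
    using cring.ex_lift[OF K, of "{\<xi>, \<eta>}"] assms by auto
  then show ?thesis by (intro exI[of _ hm]) auto
qed

lemma K_closed:
  fixes k :: int
  assumes "\<xi> \<in> carrier K" "\<eta> \<in> carrier K"
  shows "\<xi> \<oplus>\<^bsub>K\<^esub> \<eta> \<in> carrier K" "[k] \<cdot>\<^bsub>K\<^esub> (\<xi> \<otimes>\<^bsub>K\<^esub> \<eta>) \<in> carrier K"
proof -
  obtain hm :: "mpoly => 'r" and x y where h: "typed_hom K hm" "\<xi> = hm x" "\<eta> = hm y"
    using ex_lift2[OF assms] by blast
  interpret typed_hom K hm by (rule h(1))
  show "\<xi> \<oplus>\<^bsub>K\<^esub> \<eta> \<in> carrier K" "[k] \<cdot>\<^bsub>K\<^esub> (\<xi> \<otimes>\<^bsub>K\<^esub> \<eta>) \<in> carrier K" using h_closed h by auto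
qed

lemma chev_simps: "mult chev = mult mx" "one chev = one mx"
  by (simp_all add: chevalley_group_def GL_def units_of_def)

lemma rt_unit:
  assumes \<alpha>: "\<alpha> \<in> \<Phi>" and \<xi>: "\<xi> \<in> carrier K"
  shows "rt (\<alpha>, \<xi>) \<in> carrier mx" "rt (\<alpha>, \<xi>) \<otimes>\<^bsub>mx\<^esub> rt (\<alpha>, \<ominus>\<^bsub>K\<^esub> \<xi>) = \<one>\<^bsub>mx\<^esub>"
    "rt (\<alpha>, \<ominus>\<^bsub>K\<^esub> \<xi>) \<otimes>\<^bsub>mx\<^esub> rt (\<alpha>, \<xi>) = \<one>\<^bsub>mx\<^esub>"
proof -
  obtain hm :: "mpoly => 'r" where hm: "typed_hom K hm" "\<xi> \<in> range hm" using cring.ex_lift[OF K, of "{\<xi>}"] \<xi> by auto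
  interpret typed_hom K hm by fact
  obtain x where x: "\<xi> = hm x" using hm by blast
  show "rt (\<alpha>, \<xi>) \<in> carrier mx" "rt (\<alpha>, \<xi>) \<otimes>\<^bsub>mx\<^esub> rt (\<alpha>, \<ominus>\<^bsub>K\<^esub> \<xi>) = \<one>\<^bsub>mx\<^esub>"
    "rt (\<alpha>, \<ominus>\<^bsub>K\<^esub> \<xi>) \<otimes>\<^bsub>mx\<^esub> rt (\<alpha>, \<xi>) = \<one>\<^bsub>mx\<^esub>"
    unfolding x h_uminus[symmetric] prod.case root_unipotent_mh[OF hm(1)] mh_mult[symmetric] T_domain(3,4)[OF \<alpha>] mh_1
    by (rule mh_closed HOL.refl)+
qed

text \<open>Polynomial equations of the complex group hold for \<open>t\<^sub>\<alpha>(X)\<close> over \<open>\<int>[X]\<close>, hence over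
  every ring.\<close>

lemma rt_chev: assumes \<alpha>: "\<alpha> \<in> \<Phi>" and \<xi>: "\<xi> \<in> carrier K" shows "rt (\<alpha>, \<xi>) \<in> carrier chev"
proof -
  have neg: "\<ominus>\<^bsub>K\<^esub> \<xi> \<in> carrier K" using \<xi> by (rule neg_closed)
  have "eval_poly K p (root_unipotent e \<pi> K \<alpha> \<xi>) = \<zero>\<^bsub>K\<^esub>" if p: "p \<in> chevalley_ideal \<Phi> e \<pi>" for p
  proof -
    define q where "q = (\<Sum>m\<in>Poly_Mapping.keys p. of_int (Poly_Mapping.lookup p m) *
      (\<Prod>x\<in>Poly_Mapping.keys m. ent (T \<alpha> [:0, 1:] :: (int poly, 'n) sqm) (fst x) (snd x) ^ Poly_Mapping.lookup m x))"
    obtain hm :: "int poly => 'r" where hm: "typed_hom K hm" "hm [:0, 1:] = \<xi>" using cring.ex_psub[OF K \<xi>] by blast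
    have "psub y q = 0" for y :: complex
    proof -
      interpret typed_hom complex_ring "psub y" by (rule psub_complex)
      have "psub y q = eval_poly complex_ring p (root_unipotent e \<pi> complex_ring \<alpha> y)"
        using root_unipotent_mh[OF psub_complex, of \<alpha> y "[:0, 1:]"] by (simp only: psub_X q_def eval_poly_mh)
      moreover have "root_unipotent e \<pi> complex_ring \<alpha> y \<in> complex_chevalley_group \<Phi> e \<pi>"
        unfolding complex_chevalley_group_def using \<alpha> by (intro generate.incl) blast
      ultimately show ?thesis using p unfolding chevalley_ideal_def by simp
    qed
    then have "q = 0" by (rule psub_eq_0)
    interpret typed_hom K hm by (rule hm(1))
    have "eval_poly K p (root_unipotent e \<pi> K \<alpha> \<xi>) = hm q"
      using root_unipotent_mh[OF hm(1), of \<alpha> "[:0, 1:]"] by (simp only: hm(2) q_def eval_poly_mh)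
    then show ?thesis using \<open>q = 0\<close> h_0 by simp
  qed
  then show ?thesis using rt_unit[OF \<alpha> \<xi>] rt_unit(1)[OF \<alpha> neg]
    by (auto simp: chevalley_group_def GL_def units_of_def Units_def)
qed

text \<open>The inverse is a definite description over the carrier of the Chevalley group. Existence
  comes from membership of the root unipotent of -\<xi>, uniqueness from the matrix monoid.\<close>

lemma rt_inv: assumes \<alpha>: "\<alpha> \<in> \<Phi>" and \<xi>: "\<xi> \<in> carrier K" shows "inv\<^bsub>chev\<^esub> rt (\<alpha>, \<xi>) = rt (\<alpha>, \<ominus>\<^bsub>K\<^esub> \<xi>)"
  unfolding m_inv_def chev_simps
proof (rule the_equality)
  have neg: "\<ominus>\<^bsub>K\<^esub> \<xi> \<in> carrier K" using \<xi> by (rule neg_closed)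
  show "rt (\<alpha>, \<ominus>\<^bsub>K\<^esub> \<xi>) \<in> carrier chev \<and> rt (\<alpha>, \<xi>) \<otimes>\<^bsub>mx\<^esub> rt (\<alpha>, \<ominus>\<^bsub>K\<^esub> \<xi>) = \<one>\<^bsub>mx\<^esub> \<and>
    rt (\<alpha>, \<ominus>\<^bsub>K\<^esub> \<xi>) \<otimes>\<^bsub>mx\<^esub> rt (\<alpha>, \<xi>) = \<one>\<^bsub>mx\<^esub>" using rt_chev[OF \<alpha> neg] rt_unit[OF \<alpha> \<xi>] by blast
  fix y assume y: "y \<in> carrier chev \<and> rt (\<alpha>, \<xi>) \<otimes>\<^bsub>mx\<^esub> y = \<one>\<^bsub>mx\<^esub> \<and> y \<otimes>\<^bsub>mx\<^esub> rt (\<alpha>, \<xi>) = \<one>\<^bsub>mx\<^esub>"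
  then have "y \<in> carrier mx" by (auto simp: chevalley_group_def GL_def units_of_def Units_def)
  then show "y = rt (\<alpha>, \<ominus>\<^bsub>K\<^esub> \<xi>)"
    using monoid.inv_unique[OF cring.matrix_monoid[OF K], of y "rt (\<alpha>, \<xi>)" "rt (\<alpha>, \<ominus>\<^bsub>K\<^esub> \<xi>)"]
      y rt_unit[OF \<alpha> \<xi>] rt_unit(1)[OF \<alpha> neg] by blast
qed

text \<open>A letter \<open>(False, (\<alpha>, \<xi>))\<close> is lifted to \<open>(\<alpha>, p)\<close> with \<open>hm p = - \<xi>\<close>.\<close>

definition lift :: "(mpoly => 'r) => ('a \<times> mpoly) list => ('a \<times> 'r) group_word => bool" where
  "lift hm = list_all2 (\<lambda>(\<alpha>, p) (b, (\<beta>, \<xi>)). \<alpha> \<in> \<Phi> \<and> \<alpha> = \<beta> \<and> \<xi> = (if b then hm p else hm (- p)))"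

lemma eval_lift:
  assumes hm: "typed_hom K hm" and w: "lift hm ws w"
  shows "eval_word chev rt w = typed_hom.mh hm (prod_list (map (\<lambda>(\<alpha>, p). T \<alpha> p) ws))"
proof -
  interpret typed_hom K hm by fact
  show ?thesis using w unfolding lift_def
  proof (induction rule: list_all2_induct)
    case Nil then show ?case by (simp add: mh_1 chev_simps)
  next
    case (Cons x xs y ys)
    obtain \<alpha> p b \<xi> where e: "x = (\<alpha>, p)" "y = (b, (\<alpha>, \<xi>))" "\<alpha> \<in> \<Phi>" "\<xi> = (if b then hm p else hm (- p))"
      using Cons(1) by (cases x; cases y) auto
    have "(if b then rt (\<alpha>, \<xi>) else inv\<^bsub>chev\<^esub> rt (\<alpha>, \<xi>)) = mh (T \<alpha> p)"
    proof (cases b)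
      case True then show ?thesis using root_unipotent_mh[OF hm, of \<alpha> p] by (simp add: e)
    next
      case False
      then have "inv\<^bsub>chev\<^esub> rt (\<alpha>, \<xi>) = rt (\<alpha>, hm p)" using rt_inv[OF e(3), of \<xi>] h_uminus[of p] by (simp add: e)
      then show ?thesis using root_unipotent_mh[OF hm, of \<alpha> p] False by simp
    qed
    moreover have "eval_word chev rt (y # ys) =
        (if b then rt (\<alpha>, \<xi>) else inv\<^bsub>chev\<^esub> rt (\<alpha>, \<xi>)) \<otimes>\<^bsub>mx\<^esub> eval_word chev rt ys"
      by (simp only: e eval_word.simps chev_simps fst_conv snd_conv)
    ultimately show ?case using Cons(3) by (simp only: e mh_mult list.map prod_list.Cons prod.case)
  qed
qed

lemma ex_lift_word:
  assumes "w \<in> lists (UNIV \<times> (\<Phi> \<times> carrier K))" "(snd \<circ> snd) ` set w \<subseteq> range hm" "typed_hom K hm"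
  shows "\<exists>ws. lift hm ws w" using assms(1,2)
proof (induction w)
  case (Cons x w)
  obtain b \<alpha> \<xi> where x: "x = (b, (\<alpha>, \<xi>))" by (cases x) auto
  obtain ws where ws: "lift hm ws w" using Cons.IH Cons.prems by auto
  obtain p where p: "\<xi> = hm p" using Cons.prems x by auto
  have "lift hm ((\<alpha>, if b then p else - p) # ws) (x # w)" using ws Cons.hyps x p by (auto simp: lift_def)
  then show ?case by blast
qed (auto simp: lift_def)

text \<open>Each relator is lifted to polynomial coefficients, where its triviality follows from the
  identities in \<open>T_domain\<close>.\<close>

lemma eval_relator:
  assumes "r \<in> steinberg_relators \<Phi> N K" shows "eval_word chev rt r = \<one>\<^bsub>mx\<^esub>"
proof -
  have *: "eval_word chev rt r = \<one>\<^bsub>mx\<^esub>"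
    if "typed_hom K hm" "lift hm ws r" "prod_list (map (\<lambda>(\<alpha>, p). T \<alpha> p) ws) = 1" for hm ws
    using eval_lift[OF that(1,2)] that(3) typed_hom.mh_1[OF that(1)] by simp
  have TT: "T \<alpha> a * (T \<alpha> (- a) * M) = M" "T \<alpha> (- a) * (T \<alpha> a * M) = M" if "\<alpha> \<in> \<Phi>" for \<alpha> and a :: mpoly and M
    using T_domain(3,4)[OF that, of a] by (simp_all flip: mult.assoc)
  consider \<alpha> \<xi> \<eta> where "r = [(True, (\<alpha>, \<xi>)), (True, (\<alpha>, \<eta>)), (False, (\<alpha>, \<xi> \<oplus>\<^bsub>K\<^esub> \<eta>))]"
      "\<alpha> \<in> \<Phi>" "\<xi> \<in> carrier K" "\<eta> \<in> carrier K"
    | \<alpha> \<beta> \<xi> \<eta> where "r = commutator_word (\<alpha>, \<xi>) (\<beta>, \<eta>)"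
      "\<alpha> \<in> \<Phi>" "\<beta> \<in> \<Phi>" "R.ip \<alpha> \<beta> \<ge> 0" "\<xi> \<in> carrier K" "\<eta> \<in> carrier K"
    | \<alpha> \<beta> \<xi> \<eta> where "r = commutator_word (\<alpha>, \<xi>) (\<beta>, \<eta>) @ [(False, (\<alpha> + \<beta>, [N \<alpha> \<beta>] \<cdot>\<^bsub>K\<^esub> (\<xi> \<otimes>\<^bsub>K\<^esub> \<eta>)))]"
      "\<alpha> \<in> \<Phi>" "\<beta> \<in> \<Phi>" "R.ip \<alpha> \<beta> = -1" "\<xi> \<in> carrier K" "\<eta> \<in> carrier K"
    using assms neg_iff unfolding steinberg_relators_def by blast
  then show ?thesis
  proof cases
    case 1
    obtain hm x y where hm: "typed_hom K hm" "\<xi> = hm (x :: mpoly)" "\<eta> = hm y" using ex_lift2[OF 1(3,4)] by blast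
    show ?thesis
    proof (rule *[OF hm(1)])
      show "lift hm [(\<alpha>, x), (\<alpha>, y), (\<alpha>, - (x + y))] r"
        using 1 hm typed_hom.h_add[OF hm(1), of x y] by (simp add: lift_def del: minus_add_distrib minus_add)
      have "T \<alpha> x * T \<alpha> y * T \<alpha> (- (x + y)) = 1" using T_domain(1,3)[OF 1(2)] by metis
      then show "prod_list (map (\<lambda>(\<alpha>, p). T \<alpha> p) [(\<alpha>, x), (\<alpha>, y), (\<alpha>, - (x + y))]) = 1" by (simp add: mult.assoc)
    qed
  next
    case 2
    obtain hm x y where hm: "typed_hom K hm" "\<xi> = hm (x :: mpoly)" "\<eta> = hm y" using ex_lift2[OF 2(5,6)] by blast
    show ?thesis
    proof (rule *[OF hm(1)])
      show "lift hm [(\<alpha>, x), (\<beta>, y), (\<alpha>, - x), (\<beta>, - y)] r"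
        using 2 hm by (simp add: lift_def commutator_word_def)
      have "T \<alpha> x * T \<beta> y * T \<alpha> (- x) * T \<beta> (- y) = 1"
        unfolding T_domain(5)[OF 2(2-4)] using T_domain(3)[OF 2(3), of y] by (simp add: mult.assoc TT 2)
      then show "prod_list (map (\<lambda>(\<alpha>, p). T \<alpha> p) [(\<alpha>, x), (\<beta>, y), (\<alpha>, - x), (\<beta>, - y)]) = 1" by (simp add: mult.assoc)
    qed
  next
    case 3
    obtain hm x y where hm: "typed_hom K hm" "\<xi> = hm (x :: mpoly)" "\<eta> = hm y" using ex_lift2[OF 3(5,6)] by blast
    let ?z = "of_int (N \<alpha> \<beta>) * x * y"
    have s: "\<alpha> + \<beta> \<in> \<Phi>" by (rule add_root[OF 3(2-4)])
    show ?thesis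
    proof (rule *[OF hm(1)])
      show "lift hm [(\<alpha>, x), (\<beta>, y), (\<alpha>, - x), (\<beta>, - y), (\<alpha> + \<beta>, - ?z)] r"
      proof -
        have "hm ?z = [N \<alpha> \<beta>] \<cdot>\<^bsub>K\<^esub> (\<xi> \<otimes>\<^bsub>K\<^esub> \<eta>)"
          unfolding mult.assoc typed_hom.h_int[OF hm(1)] hm(2,3) unfolding typed_hom.h_mult[OF hm(1)] ..
        then show ?thesis using 3(1-3) hm(2,3) s by (simp add: lift_def commutator_word_def)
      qed
      have "T \<alpha> x * T \<beta> y * T \<alpha> (- x) * T \<beta> (- y) * T (\<alpha> + \<beta>) (- ?z) = 1"
        unfolding T_domain(6)[OF 3(2-4)] using T_domain(3)[OF s, of ?z] by (simp add: mult.assoc TT 3 s)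
      then show "prod_list (map (\<lambda>(\<alpha>, p). T \<alpha> p) [(\<alpha>, x), (\<beta>, y), (\<alpha>, - x), (\<beta>, - y), (\<alpha> + \<beta>, - ?z)]) = 1"
        by (simp add: mult.assoc)
    qed
  qed
qed

interpretation G: presentation "\<Phi> \<times> carrier K" "steinberg_relators \<Phi> N K"
proof
  fix r assume "r \<in> steinberg_relators \<Phi> N K"
  then show "r \<in> lists (UNIV \<times> (\<Phi> \<times> carrier K))"
    unfolding steinberg_relators_def commutator_word_def using K_closed by auto
qed

lemma eval_equiv:
  assumes "(u, v) \<in> word_equiv (\<Phi> \<times> carrier K) (steinberg_relators \<Phi> N K)"
  shows "eval_word chev rt u = eval_word chev rt v" using assms
proof induction
  case (append u u' v v')
  have M: "monoid mx" by (rule cring.matrix_monoid[OF K])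
  have f: "rt x \<in> carrier mx \<and> inv\<^bsub>chev\<^esub> rt x \<in> carrier mx" if xS: "x \<in> \<Phi> \<times> carrier K" for x
  proof -
    obtain \<alpha> \<xi> where x: "x = (\<alpha>, \<xi>)" "\<alpha> \<in> \<Phi>" "\<xi> \<in> carrier K" using xS by (cases x) auto
    show ?thesis unfolding x(1) rt_inv[OF x(2,3)] using rt_unit(1) neg_closed x by blast
  qed
  show ?case using eval_word_append[OF M chev_simps, of "\<Phi> \<times> carrier K" rt, OF f] append G.eqv_W by simp
next
  case (cancel x b)
  obtain \<alpha> \<xi> where x: "x = (\<alpha>, \<xi>)" "\<alpha> \<in> \<Phi>" "\<xi> \<in> carrier K" using cancel by (cases x) auto
  have "rt (\<alpha>, \<ominus>\<^bsub>K\<^esub> \<xi>) \<in> carrier mx" by (rule rt_unit(1)[OF x(2) neg_closed[OF x(3)]])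
  then show ?case
    using rt_unit[OF x(2,3)] rt_inv[OF x(2,3)] rt_unit(1)[OF x(2)] monoid.r_one[OF cring.matrix_monoid[OF K], where x = "rt (\<alpha>, \<xi>)"]
      monoid.r_one[OF cring.matrix_monoid[OF K], where x = "rt (\<alpha>, \<ominus>\<^bsub>K\<^esub> \<xi>)"] by (simp add: x chev_simps)
next
  case (relator r) then show ?case by (simp add: eval_relator chev_simps)
qed simp_all

text \<open>An element of the group is a class of words with one common matrix, so the induced
  homomorphism can be evaluated at any representative.\<close>

lemma K2_eval:
  assumes "A \<in> K2 smul br \<Phi> e \<pi> K"
  shows "\<exists>w\<in>lists (UNIV \<times> (\<Phi> \<times> carrier K)). A = G.cls w \<and> eval_word chev rt w = \<one>\<^bsub>mx\<^esub>"
proof -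
  have A: "A \<in> carrier (steinberg_group \<Phi> N K)" "steinberg_map \<Phi> e \<pi> K A = \<one>\<^bsub>chev\<^esub>"
    using assms unfolding K2_def kernel_def by auto
  then obtain w where w: "w \<in> lists (UNIV \<times> (\<Phi> \<times> carrier K))" "A = G.cls w"
    unfolding steinberg_group_def G.carrier_cls by blast
  have "eval_word chev rt ` A = {eval_word chev rt w}"
    using eval_equiv w word_equiv.refl[OF w(1)] unfolding w(2) G.cls_def by (force simp del: eval_word.simps)
  then have "steinberg_map \<Phi> e \<pi> K A = eval_word chev rt w"
    unfolding steinberg_map_def induced_hom_def by simp
  then show ?thesis using w A(2) chev_simps by metis
qed

text \<open>Coefficients lie in the copy of the polynomial ring inside its fraction field and are
  mapped to the base ring by undoing the embedding; each relation comes from a relator.\<close>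

lemma gn_steinberg:
  fixes hm :: "mpoly => 'r"
  assumes hm: "typed_hom K hm"
  shows "steinberg (range emb) (\<lambda>\<alpha> q. G.gn (\<alpha>, hm (inv_into UNIV emb q)))" (is "steinberg ?P ?X")
proof -
  interpret hm: typed_hom K hm by fact
  show ?thesis unfolding steinberg_def
  proof (intro conjI ballI impI)
    fix \<alpha> a b assume "\<alpha> \<in> \<Phi>" "a \<in> ?P" "b \<in> ?P"
    then obtain x y where e: "a = emb x" "b = emb y" by blast
    have "[(True, (\<alpha>, hm x)), (True, (\<alpha>, hm y)), (False, (\<alpha>, hm x \<oplus>\<^bsub>K\<^esub> hm y))] \<in> steinberg_relators \<Phi> N K"
      unfolding steinberg_relators_def using \<open>\<alpha> \<in> \<Phi>\<close> hm.h_closed by blast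
    from G.gn_relator[OF this] show "?X \<alpha> (a + b) = ?X \<alpha> a + ?X \<alpha> b"
      unfolding weval_steinberg_words e emb(1)[symmetric] inv_emb hm.h_add .
  next
    fix \<alpha> \<beta> a b assume *: "\<alpha> \<in> \<Phi>" "\<beta> \<in> \<Phi>" "a \<in> ?P" "b \<in> ?P" "R.ip \<alpha> \<beta> \<ge> 0"
    then obtain x y where e: "a = emb x" "b = emb y" by blast
    have "commutator_word (\<alpha>, hm x) (\<beta>, hm y) \<in> steinberg_relators \<Phi> N K"
      unfolding steinberg_relators_def using * neg_iff(2) hm.h_closed by blast
    from G.gn_relator[OF this] show "commutes (?X \<alpha> a) (?X \<beta> b)"
      unfolding weval_steinberg_words e inv_emb .
  next
    fix \<alpha> \<beta> a b assume *: "\<alpha> \<in> \<Phi>" "\<beta> \<in> \<Phi>" "a \<in> ?P" "b \<in> ?P" "R.ip \<alpha> \<beta> = -1"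
    then obtain x y where e: "a = emb x" "b = emb y" by blast
    have "commutator_word (\<alpha>, hm x) (\<beta>, hm y) @ [(False, (\<alpha> + \<beta>, [N \<alpha> \<beta>] \<cdot>\<^bsub>K\<^esub> (hm x \<otimes>\<^bsub>K\<^esub> hm y)))] \<in> steinberg_relators \<Phi> N K"
      unfolding steinberg_relators_def using * add_root[OF *(1,2,5)] hm.h_closed by blast
    from G.gn_relator[OF this]
    show "?X \<alpha> a + ?X \<beta> b = ?X (\<alpha> + \<beta>) (of_int (N \<alpha> \<beta>) * a * b) + ?X \<beta> b + ?X \<alpha> a"
      unfolding weval_steinberg_words e emb_of_int[symmetric] emb(2)[symmetric] inv_emb mult.assoc
      unfolding hm.h_int unfolding hm.h_mult .
  qed
qed

lemma ex_height: "\<exists>ht. height ht"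
proof -
  obtain ht :: "'a => real" where ht: "\<forall>v w. ht (v + w) = ht v + ht w" "\<forall>\<delta>\<in>\<Delta>'. ht \<delta> > 0" "inj_on ht \<Phi>"
    using R.height_exists by blast
  have simple: "simple ht \<epsilon>" if "\<epsilon> \<in> \<Delta>'" for \<epsilon>
    unfolding simple_def using that ht R.\<Delta>_\<Phi> R.simple_root[OF ht(1,2)] by blast
  have "\<exists>\<alpha>. simple ht \<alpha> \<and> \<beta> - \<alpha> \<in> \<Phi> \<and> R.ip \<alpha> (\<beta> - \<alpha>) = -1"
    if "\<beta> \<in> \<Phi>" "ht \<beta> > 0" "\<not> simple ht \<beta>" for \<beta>
    using R.height_base[OF ht(1,2) that(1,2)] simple that(3) by blast
  then show ?thesis unfolding height_def using ht R.height_pos_iff(2)[OF ht(1,2)] by blast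
qed

lemma K2_commutes:
  assumes w: "w \<in> lists (UNIV \<times> (\<Phi> \<times> carrier K))" "eval_word chev rt w = \<one>\<^bsub>mx\<^esub>"
    and b: "\<beta> \<in> \<Phi>" "\<xi> \<in> carrier K"
  shows "commutes (weval G.gn w) (G.gn (\<beta>, \<xi>))"
proof -
  \<comment> \<open>The coefficient of the generator under test is lifted together with those of the
    word.\<close>
  have "insert \<xi> ((snd \<circ> snd) ` set w) \<subseteq> carrier K" using w(1) b(2) by fastforce
  then obtain hm :: "mpoly => 'r" where hm: "typed_hom K hm" "insert \<xi> ((snd \<circ> snd) ` set w) \<subseteq> range hm"
    using cring.ex_lift[OF K, of "insert \<xi> ((snd \<circ> snd) ` set w)"] by auto
  interpret hm: typed_hom K hm by (rule hm(1))
  obtain ws where ws: "lift hm ws w" using ex_lift_word[OF w(1) _ hm(1)] hm(2) by blast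
  obtain x where x: "\<xi> = hm x" using hm(2) by blast
  obtain ht :: "'a => real" where ht: "height ht" using ex_height by blast
  define X where "X = (\<lambda>\<alpha> q. G.gn (\<alpha>, hm (inv_into UNIV emb q)))"
  \<comment> \<open>The kernel of the lift, moved into the fraction field; \<open>X\<close> is
    trivial on it because such coefficients are mapped to zero.\<close>
  define J where "J = emb ` {p. hm p = \<zero>\<^bsub>K\<^esub>}"
  have XP: "steinberg (range emb) X" unfolding X_def by (rule gn_steinberg[OF hm(1)])
  have X0: "X \<alpha> 0 = 0" if "\<alpha> \<in> \<Phi>" for \<alpha>
  proof -
    have "X \<alpha> (emb 0 + emb 0) = X \<alpha> (emb 0) + X \<alpha> (emb 0)" using XP that unfolding steinberg_def by blast
    then show ?thesis by (simp add: emb) (metis add.right_neutral add_left_imp_eq)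
  qed
  have Xe: "X \<alpha> (emb p) = G.gn (\<alpha>, hm p)" for \<alpha> p by (simp add: X_def inv_emb)
  interpret global_steinberg \<Phi> R.ip N D "range emb" J X ht
  proof
    show "1 \<in> range emb" using emb(3) by (metis rangeI)
    fix p q :: "mpoly fract" assume pq: "p \<in> range emb" "q \<in> range emb"
    then obtain x y where "p = emb x" "q = emb y" by blast
    then have "p + q = emb (x + y)" "p * q = emb (x * y)" "- p = emb (- x)" by (simp_all add: emb emb_uminus)
    then show "p + q \<in> range emb" "p * q \<in> range emb" "- p \<in> range emb" by simp_all
  next
    fix j assume j: "j \<in> J"
    then show "j \<in> range emb" by (auto simp: J_def)
    obtain p where p: "j = emb p" "hm p = \<zero>\<^bsub>K\<^esub>" using j by (auto simp: J_def)
    show "j + i \<in> J" if i: "i \<in> J" for i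
    proof -
      obtain q where q: "i = emb q" "hm q = \<zero>\<^bsub>K\<^esub>" using i by (auto simp: J_def)
      then have "j + i = emb (p + q)" "hm (p + q) = \<zero>\<^bsub>K\<^esub>" using p by (simp_all add: emb hm.h_add)
      then show ?thesis by (simp add: J_def)
    qed
    show "c * j \<in> J" if c: "c \<in> range emb" for c
    proof -
      obtain q where q: "c = emb q" using c by blast
      then have "c * j = emb (q * p)" "hm (q * p) = \<zero>\<^bsub>K\<^esub>" using p by (simp_all add: emb hm.h_mult)
      then show ?thesis by (simp add: J_def)
    qed
    show "X \<alpha> j = 0" if "\<alpha> \<in> \<Phi>" for \<alpha> using X0[OF that] Xe[of \<alpha> p] Xe[of \<alpha> 0] p hm.h_0 by (simp add: emb)
  next
    show "0 \<in> J" unfolding J_def using emb(4) hm.h_0 by (intro image_eqI[of _ _ 0]) auto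
  qed (use XP ht in auto)
  define vs where "vs = map (\<lambda>(\<alpha>, p). (\<alpha>, emb p)) ws"
  have "set ws \<subseteq> \<Phi> \<times> UNIV" using ws unfolding lift_def
    by (auto simp: list_all2_conv_all_nth in_set_conv_nth split: prod.splits) (metis prod.exhaust)+
  then have vs: "set vs \<subseteq> \<Phi> \<times> range emb" by (auto simp: vs_def)
  have prod: "prod_list (map (\<lambda>(\<alpha>, p). T \<alpha> p) vs) = mmap emb (prod_list (map (\<lambda>(\<alpha>, p). T \<alpha> p) ws))"
    unfolding vs_def by (induction ws) (auto simp: emb_mult emb_T mmap_1 emb)
  have "hm.mh (prod_list (map (\<lambda>(\<alpha>, p). T \<alpha> p) ws)) = hm.mh 1"
    using eval_lift[OF hm(1) ws] w(2) unfolding hm.mh_1 by simp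
  then have "hm (ent (prod_list (map (\<lambda>(\<alpha>, p). T \<alpha> p) ws)) i j) = hm (ent 1 i j)" for i j
    unfolding hm.mh_def vec_eq_iff by simp
  then have z: "hm (ent (prod_list (map (\<lambda>(\<alpha>, p). T \<alpha> p) ws)) i j - ent 1 i j) = \<zero>\<^bsub>K\<^esub>" for i j
    using hm.h_add[of _ "- _"] hm.h_uminus by (simp add: hm.r_neg flip: add_uminus_conv_diff)
  have "ent (prod_list (map (\<lambda>(\<alpha>, p). T \<alpha> p) vs) - 1) i j \<in> J" for i j
  proof -
    have "ent (prod_list (map (\<lambda>(\<alpha>, p). T \<alpha> p) vs) - 1) i j =
      emb (ent (prod_list (map (\<lambda>(\<alpha>, p). T \<alpha> p) ws)) i j - ent 1 i j)"
      unfolding prod by (simp add: ent_1 emb emb_uminus emb_uminus[of 1, unfolded emb(3)] flip: add_uminus_conv_diff)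
    then show ?thesis using z unfolding J_def by blast
  qed
  then have "commutes (sum_list (map (\<lambda>(\<alpha>, p). X \<alpha> p) vs)) (X \<beta> (emb x))"
    using vs b(1) by (intro word_commutes) auto
  moreover have "sum_list (map (\<lambda>(\<alpha>, p). X \<alpha> p) vs) = weval G.gn w" using ws unfolding lift_def vs_def
  proof (induction rule: list_all2_induct)
    case (Cons u us v vs)
    obtain \<alpha> p c \<eta> where e: "u = (\<alpha>, p)" "v = (c, (\<alpha>, \<eta>))" "\<alpha> \<in> \<Phi>" "\<eta> = (if c then hm p else hm (- p))"
      using Cons(1) by (cases u; cases v) auto
    \<comment> \<open>A letter for an inverse was lifted with the negated coefficient, so its value
      must be identified with the inverse of a generator.\<close>
    have "X \<alpha> (emb p) + X \<alpha> (emb (- p)) = X \<alpha> (emb p + emb (- p))"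
      using XP e(3) unfolding steinberg_def by simp
    then have "X \<alpha> (emb p) + X \<alpha> (emb (- p)) = 0" using X0[OF e(3)] by (simp add: emb_uminus)
    then have "X \<alpha> (emb p) = - X \<alpha> (emb (- p))" by (simp add: eq_neg_iff_add_eq_0)
    then show ?case using Cons(3) e by (simp add: Xe)
  qed simp
  ultimately show ?thesis by (simp add: Xe x)
qed

theorem K2_central: "K2 smul br \<Phi> e \<pi> K \<subseteq> center (steinberg_group \<Phi> N K)"
proof
  fix A assume "A \<in> K2 smul br \<Phi> e \<pi> K"
  then obtain w where w: "w \<in> lists (UNIV \<times> (\<Phi> \<times> carrier K))" "A = G.cls w" "eval_word chev rt w = \<one>\<^bsub>mx\<^esub>"
    using K2_eval by blast
  have c: "commutes (weval G.gn w) (weval G.gn v)" if "v \<in> lists (UNIV \<times> (\<Phi> \<times> carrier K))" for v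
    using that
  proof (induction v)
    case (Cons x v)
    obtain b \<beta> \<xi> where x: "x = (b, (\<beta>, \<xi>))" "\<beta> \<in> \<Phi>" "\<xi> \<in> carrier K" using Cons(1) by (cases x) auto
    have "commutes (weval G.gn w) (G.gn (\<beta>, \<xi>))" by (rule K2_commutes[OF w(1,3) x(2,3)])
    then have "commutes (weval G.gn w) (if b then G.gn (\<beta>, \<xi>) else - G.gn (\<beta>, \<xi>))"
      by (cases b) (simp_all only: if_True if_False commutes_minus_right)
    then show ?case using Cons(3) x(1) by (simp add: commutes_add_right)
  qed simp
  have "A \<otimes>\<^bsub>steinberg_group \<Phi> N K\<^esub> B = B \<otimes>\<^bsub>steinberg_group \<Phi> N K\<^esub> A"
    if B: "B \<in> carrier (steinberg_group \<Phi> N K)" for B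
  proof -
    obtain v where v: "v \<in> lists (UNIV \<times> (\<Phi> \<times> carrier K))" "B = G.cls v"
      using B unfolding steinberg_group_def G.carrier_cls by blast
    have "weval G.gn (w @ v) = weval G.gn (v @ w)" using c[OF v(1)] by (simp add: weval_append)
    then have "G.cls (w @ v) = G.cls (v @ w)" using w v by (subst G.cls_eq) (auto simp flip: G.weval_gn_eq)
    then show ?thesis using w v by (simp add: steinberg_group_def G.mult_cls)
  qed
  moreover have "A \<in> carrier (steinberg_group \<Phi> N K)" using w unfolding steinberg_group_def G.carrier_cls by blast
  ultimately show "A \<in> center (steinberg_group \<Phi> N K)" unfolding center_def by blast
qed

end

end

theorem theorem1:
  fixes \<Phi> \<Delta> :: "'a::euclidean_space set"
    and smul :: "complex \<Rightarrow> 'g::ab_group_add \<Rightarrow> 'g"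
    and br :: "'g \<Rightarrow> 'g \<Rightarrow> 'g"
    and e :: "'a \<Rightarrow> 'g"
    and \<pi> :: "'g \<Rightarrow> complex ^ 'n \<Rightarrow> complex ^ 'n"
    and R :: "('r, 'm) ring_scheme"
    and l :: nat
  assumes "l \<in> {6, 7, 8}"
    and "root_system_type_E l \<Phi>"
    and "simply_connected_representation smul br \<Phi> \<Delta> e \<pi>"
    and "cring R"
  shows "K2 smul br \<Phi> e \<pi> R
    \<subseteq> center (steinberg_group \<Phi> (structure_constant smul br e) R)"
proof -
  obtain \<Delta>' s where E: "root_system \<Phi>" "root_base \<Phi> \<Delta>'" "bij_betw s {1..l} \<Delta>'"
    "\<forall>i\<in>{1..l}. \<forall>j\<in>{1..l}. pairing (s i) (s j) = of_int (cartan_matrix_E i j)"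
    using assms(2) unfolding root_system_type_E_def by blast
  interpret simply_connected_representation smul br \<Phi> \<Delta> e \<pi> by (rule assms(3))
  interpret E_representation smul br \<Phi> \<Delta> e \<pi> l \<Delta>' s
    by unfold_locales (use assms(1) E in auto)
  show ?thesis by (rule K2_central[OF assms(4)])
qed

end
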